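(* Let $\tau\in\mathfrak M_{1,c}(\mathrm{Rat})$. Suppose that $J_{\ker}(G_\tau)=\emptyset$ and $J(G_\tau)\neq\emptyset$. Then all of the following hold. (1) There is a direct sum decomposition $C(\hat{\mathbb C})=U_\tau\oplus\mathcal B_{0,\tau}$; moreover $\dim_{\mathbb C}U_\tau<\infty$ and $\mathcal B_{0,\tau}$ is a closed subspace of $C(\hat{\mathbb C})$. Moreover, there exists a non-empty $M_\tau^*$-invariant compact subset $A$ of $\mathfrak M_1(\hat{\mathbb C})$ with finite topological dimension such that for each $\mu\in\mathfrak M_1(\hat{\mathbb C})$, the distance from $(M_\tau^* )^n(\mu)$ to $A$ in $\mathfrak M_1(\hat{\mathbb C})$ tends to $0$ as $n\to\infty$. Furthermore, each element of $U_\tau$ is locally constant on $F(G_\tau)$. (Therefore each element of $U_\tau$ is a continuous function on $\hat{\mathbb C}$ which varies only on $J(G_\tau)$.) (2) For each $z\in\hat{\mathbb C}$ there exists a Borel subset $\mathcal A_z$ of $(\mathrm{Rat})^{\mathbb N}$ with $\tilde\tau(\mathcal A_z)=1$ such that for each $\gamma=(\gamma_1,\gamma_2,\dots)\in\mathcal A_z$ there exists a number $\delta=\delta(z,\gamma)>0$ with $\operatorname{diam}(\gamma_n\circ\cdots\circ\gamma_1(B(z,\delta)))\to0$ as $n\to\infty$, where $\operatorname{diam}$ is the diameter and $B(z,\delta)$ the ball of center $z$ and radius $\delta$ with respect to the spherical distance. (3) There exist at least one and at most finitely many minimal sets for $(G_\tau,\hat{\mathbb C})$. (4) Let $S_\tau$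 be the union of the minimal sets for $(G_\tau,\hat{\mathbb C})$. Then for each $z\in\hat{\mathbb C}$ there exists a Borel subset $\mathcal C_z$ of $(\mathrm{Rat})^{\mathbb N}$ with $\tilde\tau(\mathcal C_z)=1$ such that for each $\gamma=(\gamma_1,\gamma_2,\dots)\in\mathcal C_z$, $d(\gamma_n\circ\cdots\circ\gamma_1(z),S_\tau)\to0$ as $n\to\infty$.
   Context: $\hat{\mathbb C}$ is the Riemann sphere with spherical distance $d$. $\mathrm{Rat}$ is the set of all non-constant rational maps $\hat{\mathbb C}\to\hat{\mathbb C}$ with the metric $\kappa(f,g)=\sup_{z}d(f(z),g(z))$. For a semigroup $G$ (under composition) of non-constant rational maps, the Fatou set $F(G)$ is the set of $z\in\hat{\mathbb C}$ having a neighborhood $U$ such that $\{g|_U\}_{g\in G}$ is equicontinuous on $U$ with respect to $d$; $J(G)=\hat{\mathbb C}\setminus F(G)$ is the Julia set; $J_{\ker}(G)=\bigcap_{g\in G}g^{-1}(J(G))$ is the kernel Julia set. A minimal set for $(G,\hat{\mathbb C})$ is a non-empty compact $L\subset\hat{\mathbb C}$ that is minimal with respect to inclusion among non-empty compact sets $C$ with $g(C)\subset C$ for all $g\in G$. For a topological space $X$, $\mathfrak M_1(X)$ is the space of Borel probability measures on $X$ with the topology of weak convergence, and $\mathfrak M_{1,c}(X)$ is the set of those with compact topological support; $\mathfrak M_1(\hat{\mathbb C})$ is compact metrizable and is equipped with a metric inducing its topology. For $\tau\in\mathfrak M_{1,c}(\mathrm{Rat})$, $G_\tau$ is the semigroup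 generated under composition by $\operatorname{supp}\tau$, and $\tilde\tau=\otimes_{j=1}^\infty\tau$ is the product measure on $(\mathrm{Rat})^{\mathbb N}$. $C(\hat{\mathbb C})$ is the Banach space of complex-valued continuous functions on $\hat{\mathbb C}$ with the sup norm; $M_\tau:C(\hat{\mathbb C})\to C(\hat{\mathbb C})$ is $M_\tau(\varphi)(z)=\int\varphi(g(z))\,d\tau(g)$, and $M_\tau^*:\mathfrak M_1(\hat{\mathbb C})\to\mathfrak M_1(\hat{\mathbb C})$ is its dual. $U_\tau$ is the space of all finite linear combinations of unitary eigenvectors of $M_\tau$ on $C(\hat{\mathbb C})$, i.e. of non-zero $\varphi$ with $M_\tau\varphi=a\varphi$ for some $a\in\mathbb C$, $|a|=1$. $\mathcal B_{0,\tau}=\{\varphi\in C(\hat{\mathbb C}): M_\tau^n(\varphi)\to0 \text{ in } C(\hat{\mathbb C})\text{ as }n\to\infty\}$. *)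

theory Defs
  imports "HOL-Probability.Probability" "HOL-Computational_Algebra.Polynomial"
begin

section \<open>The Riemann sphere with the spherical distance\<close>

datatype rsphere = Cplx complex | Infty

text \<open>Inverse stereographic projection onto the unit sphere of \<open>\<complex> \<times> \<real>\<close>; the spherical
  distance is the length of the shorter great-circle arc, i.e. the geodesic distance of the
  metric \<open>2 |dz| / (1 + |z|\<^sup>2)\<close>.\<close>

fun sph :: "rsphere \<Rightarrow> complex \<times> real" where
  "sph (Cplx z) = ((2 / (1 + (norm z)\<^sup>2)) *\<^sub>R z, ((norm z)\<^sup>2 - 1) / ((norm z)\<^sup>2 + 1))"
| "sph Infty = (0, 1)"

lemma norm_sph [simp]: "norm (sph x) = 1"
proof (cases x)
  case (Cplx z)
  define r where "r = (norm z)\<^sup>2"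
  have r: "r \<ge> 0" by (simp add: r_def)
  have *: "(2 * norm z / (1 + r))\<^sup>2 = 4 * r / (1 + r)\<^sup>2"
    by (simp add: r_def power_divide power_mult_distrib)
  have "(norm (sph x))\<^sup>2 = (2 * norm z / (1 + r))\<^sup>2 + ((r - 1) / (r + 1))\<^sup>2"
    using r by (simp add: Cplx norm_prod_def r_def[symmetric] power_divide)
  also have "\<dots> = (4 * r + (r - 1)\<^sup>2) / (1 + r)\<^sup>2"
    unfolding * by (simp add: power_divide add_divide_distrib add.commute)
  also have "4 * r + (r - 1)\<^sup>2 = (1 + r)\<^sup>2"
    by (simp add: power2_eq_square algebra_simps)
  finally have "(norm (sph x))\<^sup>2 = 1" using r by simp
  then show ?thesis
    by (metis norm_ge_zero one_power2 power2_eq_iff_nonneg zero_le_one)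
qed (simp add: norm_prod_def)

lemma inner_sph_self [simp]: "sph x \<bullet> sph x = 1"
  by (metis norm_sph power2_norm_eq_inner one_power2)

lemma inner_sph_bounds: "\<bar>sph x \<bullet> sph y\<bar> \<le> 1"
  using Cauchy_Schwarz_ineq2[of "sph x" "sph y"] by simp

lemma inner_sph_ge [simp]: "- 1 \<le> sph x \<bullet> sph y" and inner_sph_le [simp]: "sph x \<bullet> sph y \<le> 1"
  using inner_sph_bounds[of x y] by auto

definition unsph :: "complex \<times> real \<Rightarrow> rsphere" where
  "unsph p = (if snd p = 1 then Infty else Cplx ((1 / (1 - snd p)) *\<^sub>R fst p))"

lemma snd_sph_Cplx: "1 - snd (sph (Cplx z)) = 2 / (1 + (norm z)\<^sup>2)"
  by (simp add: divide_simps) (smt (verit) zero_le_power2)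

lemma snd_sph_Cplx_neq: "snd (sph (Cplx z)) \<noteq> 1"
proof -
  have "2 / (1 + (norm z)\<^sup>2) > 0" by (smt (verit) zero_less_divide_iff zero_le_power2)
  then show ?thesis using snd_sph_Cplx[of z] by linarith
qed

lemma unsph_sph [simp]: "unsph (sph x) = x"
proof (cases x)
  case (Cplx z)
  have inv: "(1 / c) *\<^sub>R c *\<^sub>R z = z" if "c \<noteq> 0" for c :: real
    using that by simp
  have "1 + (norm z)\<^sup>2 \<noteq> 0" by (smt (verit) zero_le_power2)
  then have "(1 / (2 / (1 + (norm z)\<^sup>2))) *\<^sub>R (2 / (1 + (norm z)\<^sup>2)) *\<^sub>R z = z"
    by (intro inv) simp
  then have "(1 / (1 - snd (sph (Cplx z)))) *\<^sub>R fst (sph (Cplx z)) = z"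
    unfolding snd_sph_Cplx by (simp only: sph.simps fst_conv)
  then show ?thesis
    unfolding Cplx unsph_def using snd_sph_Cplx_neq[of z] by (simp only: if_False)
qed (simp add: unsph_def)

lemma inj_sph: "inj sph"
  by (metis injI unsph_sph)

lemma sph_unsph [simp]:
  assumes "norm p = 1"
  shows "sph (unsph p) = p"
proof -
  obtain w t where p: "p = (w, t)" by (cases p)
  have wt: "(norm w)\<^sup>2 + t\<^sup>2 = 1"
    using assms by (simp add: p norm_prod_def)
  show ?thesis
  proof (cases "t = 1")
    case True
    then show ?thesis using wt by (simp add: p unsph_def)
  next
    case False
    have w: "(norm w)\<^sup>2 = (1 - t) * (1 + t)" using wt by (simp add: power2_eq_square algebra_simps)
    have n: "(norm ((1 / (1 - t)) *\<^sub>R w))\<^sup>2 = (1 + t) / (1 - t)"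
    proof -
      have "(norm ((1 / (1 - t)) *\<^sub>R w))\<^sup>2 = (norm w)\<^sup>2 / (1 - t)\<^sup>2"
        by (simp add: power_divide power_mult_distrib)
      also have "\<dots> = (1 + t) / (1 - t)"
        unfolding w using False by (simp add: power2_eq_square)
      finally show ?thesis .
    qed
    have s: "1 + (1 + t) / (1 - t) = 2 / (1 - t)" "(1 + t) / (1 - t) - 1 = 2 * t / (1 - t)"
      using False by (simp_all add: field_simps)
    have "sph (unsph p) = ((2 / (1 + (1 + t) / (1 - t))) *\<^sub>R ((1 / (1 - t)) *\<^sub>R w),
        ((1 + t) / (1 - t) - 1) / ((1 + t) / (1 - t) + 1))"
      using False by (simp only: p unsph_def sph.simps n fst_conv snd_conv if_False)
    also have "\<dots> = (w, t)"
      using False unfolding add.commute[of "(1 + t) / (1 - t)" 1] s by simp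
    finally show ?thesis by (simp add: p)
  qed
qed

lemma arccos_inner_triangle:
  fixes x y z :: "'a :: real_inner"
  assumes "norm x = 1" "norm y = 1" "norm z = 1"
  shows "arccos (x \<bullet> z) \<le> arccos (x \<bullet> y) + arccos (y \<bullet> z)"
proof -
  have b: "\<bar>u \<bullet> v\<bar> \<le> 1" if "norm u = 1" "norm v = 1" for u v :: 'a
    using Cauchy_Schwarz_ineq2[of u v] that by simp
  define a where "a = arccos (x \<bullet> y)"
  define c where "c = arccos (y \<bullet> z)"
  have xy: "-1 \<le> x \<bullet> y" "x \<bullet> y \<le> 1" and yz: "-1 \<le> y \<bullet> z" "y \<bullet> z \<le> 1" and xz: "-1 \<le> x \<bullet> z" "x \<bullet> z \<le> 1"
    using b[of x y] b[of y z] b[of x z] assms by auto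
  have a: "0 \<le> a" "a \<le> pi" "cos a = x \<bullet> y" and c: "0 \<le> c" "c \<le> pi" "cos c = y \<bullet> z"
    unfolding a_def c_def using xy yz by (auto intro: arccos_lbound arccos_ubound)
  show ?thesis
  proof (cases "a + c \<le> pi")
    case False
    then show ?thesis using arccos_ubound[of "x \<bullet> z"] xz by (simp add: a_def c_def)
  next
    case True
    have sq: "x \<bullet> x = 1" "y \<bullet> y = 1" "z \<bullet> z = 1"
      using assms by (simp_all add: norm_eq_1)
    define u where "u = x - (x \<bullet> y) *\<^sub>R y"
    define v where "v = z - (y \<bullet> z) *\<^sub>R y"
    have uu: "u \<bullet> u = 1 - (cos a)\<^sup>2"
      unfolding u_def a by (simp add: inner_simps sq inner_commute power2_eq_square)
    have vv: "v \<bullet> v = 1 - (cos c)\<^sup>2"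
      unfolding v_def c by (simp add: inner_simps sq inner_commute power2_eq_square)
    have uv: "u \<bullet> v = x \<bullet> z - cos a * cos c"
      unfolding u_def v_def a c by (simp add: inner_simps sq inner_commute)
    have "norm u = sin a" "norm v = sin c"
      unfolding norm_eq_sqrt_inner uu vv sin_squared_eq[symmetric] using a c
      by (simp_all add: sin_ge_zero)
    then have "\<bar>u \<bullet> v\<bar> \<le> sin a * sin c"
      using Cauchy_Schwarz_ineq2[of u v] by simp
    then have "cos (a + c) \<le> x \<bullet> z"
      unfolding uv cos_add by linarith
    then have "arccos (x \<bullet> z) \<le> arccos (cos (a + c))"
      using xz by (intro arccos_le_arccos) auto
    then show ?thesis
      using True a c by (simp add: arccos_cos a_def[symmetric] c_def[symmetric])
  qed
qed

instantiation rsphere :: metric_space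
begin

definition dist_rsphere :: "rsphere \<Rightarrow> rsphere \<Rightarrow> real" where
  "dist_rsphere x y = arccos (sph x \<bullet> sph y)"

definition uniformity_rsphere :: "(rsphere \<times> rsphere) filter" where
  "uniformity_rsphere = (INF e\<in>{0 <..}. principal {(x, y). dist x y < e})"

definition open_rsphere :: "rsphere set \<Rightarrow> bool" where
  "open_rsphere S = (\<forall>x\<in>S. \<forall>\<^sub>F (x', y) in uniformity. x' = x \<longrightarrow> y \<in> S)"

instance
proof
  fix x y z :: rsphere
  show "dist x y = 0 \<longleftrightarrow> x = y"
  proof
    assume "dist x y = 0"
    then have "sph x \<bullet> sph y = 1"
      unfolding dist_rsphere_def by (metis arccos_cos_eq_abs cos_arccos inner_sph_ge inner_sph_le cos_zero)
    then have "(norm (sph x - sph y))\<^sup>2 = 0"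
      by (simp add: power2_norm_eq_inner inner_simps inner_commute)
    then show "x = y" using inj_sph by (simp add: inj_eq)
  qed (simp add: dist_rsphere_def)
  show "dist x y \<le> dist x z + dist y z"
    unfolding dist_rsphere_def
    using arccos_inner_triangle[of "sph x" "sph z" "sph y"] by (simp add: inner_commute)
qed (rule open_rsphere_def uniformity_rsphere_def)+

end

lemma dist_rsphere_le_pi: "dist (x :: rsphere) y \<le> pi"
  by (simp add: dist_rsphere_def arccos_ubound)

lemma bounded_rsphere [simp]: "bounded (S :: rsphere set)"
  by (meson bounded_any_center dist_rsphere_le_pi bounded_def)

lemma cos_dist_rsphere: "cos (dist x y) = 1 - (dist (sph x) (sph y))\<^sup>2 / 2"
  unfolding dist_rsphere_def dist_norm power2_norm_eq_inner
  by (simp add: inner_simps inner_commute[of "sph y" "sph x"] diff_divide_distrib)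

lemma tendsto_sph_iff: "((\<lambda>i. sph (f i)) \<longlongrightarrow> sph x) F \<longleftrightarrow> (f \<longlongrightarrow> x) F"
proof
  assume "((\<lambda>i. sph (f i)) \<longlongrightarrow> sph x) F"
  then have "((\<lambda>i. sph (f i) \<bullet> sph x) \<longlongrightarrow> sph x \<bullet> sph x) F"
    by (intro tendsto_intros)
  then have "((\<lambda>i. arccos (sph (f i) \<bullet> sph x)) \<longlongrightarrow> arccos (sph x \<bullet> sph x)) F"
    by (rule continuous_on_tendsto_compose[OF continuous_on_arccos']) (simp_all add: always_eventually)
  then show "(f \<longlongrightarrow> x) F"
    by (subst tendsto_dist_iff) (simp add: dist_rsphere_def)
next
  assume "(f \<longlongrightarrow> x) F"
  then have "((\<lambda>i. dist (f i) x) \<longlongrightarrow> 0) F"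
    by (rule tendsto_dist_iff[THEN iffD1])
  then have "((\<lambda>i. cos (dist (f i) x)) \<longlongrightarrow> cos 0) F"
    by (rule isCont_tendsto_compose[OF isCont_cos])
  then have "((\<lambda>i. 2 - 2 * cos (dist (f i) x)) \<longlongrightarrow> 2 - 2 * cos 0) F"
    by (intro tendsto_diff tendsto_mult tendsto_const)
  then have "((\<lambda>i. (dist (sph (f i)) (sph x))\<^sup>2) \<longlongrightarrow> 0) F"
    by (simp add: cos_dist_rsphere)
  then have "((\<lambda>i. dist (sph (f i)) (sph x)) \<longlongrightarrow> 0) F"
    using tendsto_real_sqrt[of "\<lambda>i. (dist (sph (f i)) (sph x))\<^sup>2" 0 F] by simp
  then show "((\<lambda>i. sph (f i)) \<longlongrightarrow> sph x) F"
    by (rule tendsto_dist_iff[THEN iffD2])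
qed

lemma continuous_on_sph_iff: "continuous_on S (\<lambda>x. sph (f x)) \<longleftrightarrow> continuous_on S f"
  by (simp add: continuous_on_def tendsto_sph_iff)

lemma continuous_on_sph: "continuous_on S sph"
  using continuous_on_sph_iff[of S "\<lambda>x. x"] by simp

lemma compact_rsphere: "compact (UNIV :: rsphere set)"
proof -
  have "continuous_on (sphere 0 1) unsph"
    by (subst continuous_on_sph_iff[symmetric], subst continuous_on_cong[OF refl, of _ _ "\<lambda>x. x"]) auto
  moreover have "x \<in> unsph ` sphere 0 1" for x
    by (rule image_eqI[of _ _ "sph x"]) simp_all
  then have "unsph ` sphere 0 1 = UNIV" by blast
  ultimately show ?thesis
    by (metis compact_continuous_image compact_sphere)
qed

lemma bcontfun_rsphere_iff:
  fixes f :: "rsphere \<Rightarrow> 'b :: metric_space"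
  shows "f \<in> bcontfun \<longleftrightarrow> continuous_on UNIV f"
  using compact_imp_bounded[OF compact_continuous_image[OF _ compact_rsphere]]
  by (auto simp: bcontfun_def)


section \<open>Rational maps\<close>

text \<open>The point with homogeneous coordinates \<open>[a : b]\<close>, for \<open>(a, b) \<noteq> (0, 0)\<close>.\<close>

definition hpoint :: "complex \<Rightarrow> complex \<Rightarrow> rsphere" where
  "hpoint a b = (if b = 0 then Infty else Cplx (a / b))"

text \<open>At \<open>\<infinity>\<close> the quotient \<open>p / q\<close> is evaluated by comparing the coefficients of degree
  \<open>max (deg p) (deg q)\<close>.\<close>

fun rat_eval :: "complex poly \<Rightarrow> complex poly \<Rightarrow> rsphere \<Rightarrow> rsphere" where
  "rat_eval p q (Cplx z) = hpoint (poly p z) (poly q z)"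
| "rat_eval p q Infty =
     (let d = max (degree p) (degree q) in hpoint (coeff p d) (coeff q d))"

definition nonconst_rational :: "(rsphere \<Rightarrow> rsphere) \<Rightarrow> bool" where
  "nonconst_rational f \<longleftrightarrow>
     (\<exists>p q. coprime p q \<and> q \<noteq> 0 \<and> f = rat_eval p q) \<and> \<not> f constant_on UNIV"

typedef rat_map = "{f. nonconst_rational f}"
  morphisms apply_rat Abs_rat_map
proof -
  have "nonconst_rational (rat_eval [:0, 1:] 1)"
    unfolding nonconst_rational_def
  proof
    show "\<exists>p q. coprime p q \<and> q \<noteq> 0 \<and> rat_eval [:0, 1:] 1 = rat_eval p q"
      by (rule exI[of _ "[:0, 1:]"], rule exI[of _ 1]) auto
    have "rat_eval [:0, 1:] 1 (Cplx 0) \<noteq> rat_eval [:0, 1:] 1 (Cplx 1)"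
      by (simp add: hpoint_def)
    then show "\<not> rat_eval [:0, 1:] 1 constant_on UNIV"
      by (metis UNIV_I constant_on_def)
  qed
  then show ?thesis by blast
qed

instantiation rat_map :: metric_space
begin

definition dist_rat_map :: "rat_map \<Rightarrow> rat_map \<Rightarrow> real" where
  "dist_rat_map f g = (SUP z. dist (apply_rat f z) (apply_rat g z))"

definition uniformity_rat_map :: "(rat_map \<times> rat_map) filter" where
  "uniformity_rat_map = (INF e\<in>{0 <..}. principal {(x, y). dist x y < e})"

definition open_rat_map :: "rat_map set \<Rightarrow> bool" where
  "open_rat_map S = (\<forall>x\<in>S. \<forall>\<^sub>F (x', y) in uniformity. x' = x \<longrightarrow> y \<in> S)"

lemma dist_apply_rat_le: "dist (apply_rat f z) (apply_rat g z) \<le> dist f g"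
  unfolding dist_rat_map_def
  by (rule cSUP_upper) (auto intro!: bdd_aboveI[of _ pi] dist_rsphere_le_pi)

instance
proof
  fix f g h :: rat_map
  show "dist f g = 0 \<longleftrightarrow> f = g"
  proof
    assume "dist f g = 0"
    then have "apply_rat f z = apply_rat g z" for z
      using dist_apply_rat_le[of f z g] by simp
    then show "f = g" by (metis apply_rat_inject ext)
  qed (simp add: dist_rat_map_def)
  show "dist f g \<le> dist f h + dist g h"
    unfolding dist_rat_map_def[of f g]
  proof (rule cSUP_least)
    fix z
    show "dist (apply_rat f z) (apply_rat g z) \<le> dist f h + dist g h"
      using dist_triangle2[of "apply_rat f z" "apply_rat g z" "apply_rat h z"]
        dist_apply_rat_le[of f z h] dist_apply_rat_le[of g z h] by linarith
  qed simp
qed (rule open_rat_map_def uniformity_rat_map_def)+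

end


lemma sph_hpoint:
  assumes "a \<noteq> 0 \<or> b \<noteq> 0"
  shows "sph (hpoint a b) =
    ((2 / ((norm a)\<^sup>2 + (norm b)\<^sup>2)) *\<^sub>R (a * cnj b),
     ((norm a)\<^sup>2 - (norm b)\<^sup>2) / ((norm a)\<^sup>2 + (norm b)\<^sup>2))"
proof (cases "b = 0")
  case True
  then show ?thesis using assms by (simp add: hpoint_def)
next
  case False
  define A where "A = (norm a)\<^sup>2"
  define B where "B = (norm b)\<^sup>2"
  have B: "B > 0" and A: "A \<ge> 0" using False by (simp_all add: A_def B_def)
  have n: "(norm (a / b))\<^sup>2 = A / B" by (simp add: norm_divide power_divide A_def B_def)
  have ab: "a / b = (1 / B) *\<^sub>R (a * cnj b)"
    using complex_div_cnj[of a b] by (simp add: B_def scaleR_conv_of_real)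
  have 1: "2 / (1 + A / B) * (1 / B) = 2 / (A + B)" using A B by (simp add: field_simps)
  have "A / B - 1 = (A - B) / B" "A / B + 1 = (A + B) / B" using B by (simp_all add: field_simps)
  then have 2: "(A / B - 1) / (A / B + 1) = (A - B) / (A + B)" using B by simp
  have "(2 / (1 + A / B)) *\<^sub>R (a / b) = (2 / (A + B)) *\<^sub>R (a * cnj b)"
    unfolding ab scaleR_scaleR 1 ..
  then show ?thesis
    using False unfolding hpoint_def by (simp only: if_False sph.simps n 2 A_def[symmetric] B_def[symmetric])
qed

lemma continuous_on_hpoint:
  fixes P Q :: "'a :: topological_space \<Rightarrow> complex"
  assumes "continuous_on S P" "continuous_on S Q" "\<And>x. x \<in> S \<Longrightarrow> P x \<noteq> 0 \<or> Q x \<noteq> 0"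
  shows "continuous_on S (\<lambda>x. hpoint (P x) (Q x))"
proof -
  have nz: "(norm (P x))\<^sup>2 + (norm (Q x))\<^sup>2 \<noteq> 0" if "x \<in> S" for x
    using assms(3)[OF that] by (simp add: add_nonneg_eq_0_iff)
  have "continuous_on S (\<lambda>x. ((2 / ((norm (P x))\<^sup>2 + (norm (Q x))\<^sup>2)) *\<^sub>R (P x * cnj (Q x)),
     ((norm (P x))\<^sup>2 - (norm (Q x))\<^sup>2) / ((norm (P x))\<^sup>2 + (norm (Q x))\<^sup>2)))"
    by (intro continuous_intros assms(1,2)) (use nz in auto)
  then have "continuous_on S (\<lambda>x. sph (hpoint (P x) (Q x)))"
    by (rule continuous_on_cong[THEN iffD1, OF refl, rotated]) (simp only: sph_hpoint[OF assms(3)])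
  then show ?thesis by (simp add: continuous_on_sph_iff)
qed

lemma Cplx_chart:
  assumes "snd (sph x) \<noteq> 1"
  shows "x = Cplx ((1 / (1 - snd (sph x))) *\<^sub>R fst (sph x))"
  using assms unsph_sph[of x] by (metis unsph_def)

lemma hpoint_chart:
  assumes "snd (sph x) \<noteq> -1"
  shows "x = hpoint 1 ((1 / (1 + snd (sph x))) *\<^sub>R cnj (fst (sph x)))"
proof (cases x)
  case (Cplx z)
  define r where "r = (norm z)\<^sup>2"
  have r: "r \<ge> 0" by (simp add: r_def)
  have z: "z \<noteq> 0" using assms by (auto simp: Cplx)
  then have r0: "r > 0" by (simp add: r_def)
  have "1 + (r - 1) / (r + 1) = 2 * r / (1 + r)" using r by (simp add: field_simps)
  moreover have "1 / (2 * r / (1 + r)) * (2 / (1 + r)) = 1 / r"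
  proof -
    have "1 / (r * c) * c = 1 / r" if "c \<noteq> 0" for c using that r0 by simp
    from this[of "2 / (1 + r)"] show ?thesis using r by (simp add: mult.commute)
  qed
  ultimately have "(1 / (1 + snd (sph x))) *\<^sub>R cnj (fst (sph x)) = (1 / r) *\<^sub>R cnj z"
    by (simp only: Cplx sph.simps fst_conv snd_conv r_def[symmetric] complex_cnj_scaleR scaleR_scaleR)
  also have "\<dots> = 1 / z"
    using complex_div_cnj[of 1 z] by (simp add: r_def scaleR_conv_of_real)
  finally show ?thesis using z by (simp add: Cplx hpoint_def)
qed (simp add: hpoint_def)

lemma continuous_on_rat_eval:
  assumes cop: "coprime p q"
  shows "continuous_on UNIV (rat_eval p q)"
proof -
  let ?f = "rat_eval p q"
  have pq: "poly p z \<noteq> 0 \<or> poly q z \<noteq> 0" for z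
    using coprime_poly_0[OF cop] by blast
  have pq0: "p \<noteq> 0 \<or> q \<noteq> 0" using cop by auto
  define d where "d = max (degree p) (degree q)"
  define R where "R s w = w ^ (d - degree s) * poly (reflect_poly s) w" for s :: "complex poly" and w
  have R: "R s w = w ^ d * poly s (inverse w)" if "w \<noteq> 0" "s = p \<or> s = q" for s w
  proof -
    have "degree s \<le> d" using that by (auto simp: d_def)
    then show ?thesis
      using that by (simp add: R_def poly_reflect_poly_nz power_add[symmetric] mult.assoc[symmetric])
  qed
  have R0: "R s 0 = coeff s d" if "s = p \<or> s = q" for s
  proof (cases "d = degree s")
    case False
    then have "degree s < d" using that by (auto simp: d_def)
    then show ?thesis by (simp add: R_def coeff_eq_0)
  qed (simp add: R_def)
  have Rnz: "R p w \<noteq> 0 \<or> R q w \<noteq> 0" for w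
  proof (cases "w = 0")
    case True
    have "coeff p d \<noteq> 0 \<or> coeff q d \<noteq> 0"
    proof (cases "q \<noteq> 0 \<and> degree p \<le> degree q")
      case True
      then have "coeff q d \<noteq> 0" unfolding d_def by (simp add: max_absorb2)
      then show ?thesis ..
    next
      case False
      then have "d = degree p" and "p \<noteq> 0" using pq0 unfolding d_def by auto
      then show ?thesis by simp
    qed
    then show ?thesis by (simp add: True R0)
  next
    case False
    then show ?thesis using pq[of "inverse w"] by (simp add: R)
  qed
  have Rf: "?f (hpoint 1 w) = hpoint (R p w) (R q w)" for w
  proof (cases "w = 0")
    case True
    then show ?thesis by (simp add: R0 hpoint_def d_def[symmetric])
  next
    case False
    then show ?thesis by (simp add: R hpoint_def divide_inverse)
  qed
  have cR: "continuous_on S (\<lambda>x. R s (h x))" if "continuous_on S h" for S :: "rsphere set" and s h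
    unfolding R_def by (intro continuous_intros that)
  let ?S = "{x. snd (sph x) \<noteq> 1}" and ?T = "{x. snd (sph x) \<noteq> -1}"
  have cs: "continuous_on S (\<lambda>x. fst (sph x))" "continuous_on S (\<lambda>x. snd (sph x))" for S
    by (intro continuous_intros continuous_on_sph)+
  let ?s = "\<lambda>x. (1 / (1 - snd (sph x))) *\<^sub>R fst (sph x)"
  let ?t = "\<lambda>x. (1 / (1 + snd (sph x))) *\<^sub>R cnj (fst (sph x))"
  have t0: "1 + y \<noteq> 0" if "y \<noteq> -1" for y :: real using that by linarith
  have cS: "continuous_on ?S ?s" and cT: "continuous_on ?T ?t"
    by (intro continuous_on_scaleR continuous_on_divide continuous_on_const continuous_on_diff
        continuous_on_add continuous_on_cnj cs; simp add: t0)+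
  have "continuous_on ?S (\<lambda>x. hpoint (poly p (?s x)) (poly q (?s x)))"
    by (rule continuous_on_hpoint[OF continuous_on_poly[OF cS] continuous_on_poly[OF cS]]) (rule pq)
  moreover have "hpoint (poly p (?s x)) (poly q (?s x)) = ?f x" if "x \<in> ?S" for x
  proof -
    have "?f x = ?f (Cplx (?s x))" using Cplx_chart[of x] that by simp
    then show ?thesis by simp
  qed
  ultimately have S: "continuous_on ?S ?f"
    by (rule continuous_on_eq)
  have "continuous_on ?T (\<lambda>x. hpoint (R p (?t x)) (R q (?t x)))"
    by (rule continuous_on_hpoint[OF cR[OF cT] cR[OF cT]]) (rule Rnz)
  moreover have "hpoint (R p (?t x)) (R q (?t x)) = ?f x" if "x \<in> ?T" for x
  proof -
    have "?f x = ?f (hpoint 1 (?t x))" using hpoint_chart[of x] that by simp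
    then show ?thesis by (simp only: Rf)
  qed
  ultimately have T: "continuous_on ?T ?f"
    by (rule continuous_on_eq)
  have "open ?S" "open ?T"
    by (intro open_Collect_neq continuous_intros cs)+
  then have "continuous_on (?S \<union> ?T) ?f"
    using S T by (rule continuous_on_open_Un)
  moreover have "?S \<union> ?T = UNIV" by auto
  ultimately show ?thesis by simp
qed

lemma continuous_on_apply_rat: "continuous_on S (apply_rat g)"
  using apply_rat[of g] continuous_on_rat_eval continuous_on_subset
  by (metis mem_Collect_eq nonconst_rational_def top_greatest)

lemma continuous_on_eval_rat: "continuous_on S (\<lambda>g. apply_rat g z)"
  unfolding continuous_on_iff by (metis dist_apply_rat_le order_le_less_trans)



section \<open>Borel probability measures\<close>

definition borel_probs :: "'a :: topological_space measure set" where
  "borel_probs = {\<mu>. prob_space \<mu> \<and> sets \<mu> = sets borel}"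

definition topological_support :: "'a :: topological_space measure \<Rightarrow> 'a set" where
  "topological_support \<mu> = {x. \<forall>U. open U \<longrightarrow> x \<in> U \<longrightarrow> emeasure \<mu> U > 0}"

definition compact_borel_probs :: "'a :: topological_space measure set" where
  "compact_borel_probs = {\<mu> \<in> borel_probs. compact (topological_support \<mu>)}"

text \<open>The topology of weak convergence: the coarsest one for which \<open>\<mu> \<mapsto> \<integral> \<phi> d\<mu>\<close> is continuous
  for every bounded continuous \<open>\<phi>\<close>.\<close>

definition weak_topology :: "'a :: topological_space measure topology" where
  "weak_topology = topology_generated_by
     {{\<mu> \<in> borel_probs. (\<integral>x. apply_bcontfun \<phi> x \<partial>\<mu>) \<in> V} | (\<phi> :: 'a \<Rightarrow>\<^sub>C real) V. open V}"

lemma topspace_weak_topology [simp]: "topspace weak_topology = (borel_probs :: 'a :: topological_space measure set)"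
proof -
  have "(borel_probs :: 'a measure set) \<in> {{\<mu> \<in> borel_probs. (\<integral>x. apply_bcontfun \<phi> x \<partial>\<mu>) \<in> V} |
      (\<phi> :: 'a \<Rightarrow>\<^sub>C real) V. open V}"
    by (rule CollectI, rule exI[of _ 0], rule exI[of _ UNIV]) auto
  then show ?thesis
    unfolding weak_topology_def topology_generated_by_topspace by blast
qed

lemma integrable_bcontfun:
  fixes \<phi> :: "'a :: topological_space \<Rightarrow>\<^sub>C 'b :: {banach, second_countable_topology}"
  assumes "\<mu> \<in> borel_probs"
  shows "integrable \<mu> (apply_bcontfun \<phi>)"
proof -
  from assms interpret prob_space \<mu> by (simp add: borel_probs_def)
  have [measurable_cong]: "sets \<mu> = sets borel" using assms by (simp add: borel_probs_def)
  have [measurable]: "apply_bcontfun \<phi> \<in> borel_measurable borel"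
    by (intro borel_measurable_continuous_onI) simp
  show ?thesis
    by (rule integrable_const_bound[where B = "norm \<phi>"]) (auto simp: norm_bounded)
qed

lemma closed_indicator_approx:
  fixes C :: "'a :: metric_space set"
  assumes "closed C"
  obtains \<phi> :: "nat \<Rightarrow> ('a \<Rightarrow>\<^sub>C complex)"
  where "\<And>n x. norm (apply_bcontfun (\<phi> n) x) \<le> 1" "\<And>x. (\<lambda>n. apply_bcontfun (\<phi> n) x) \<longlonglongrightarrow> indicator C x"
proof (cases "C = {}")
  case True
  show ?thesis by (rule that[of "\<lambda>_. 0"]) (auto simp: True)
next
  case False
  define f where "f n x = complex_of_real (max 0 (1 - real n * infdist x C))" for n x
  have f1: "norm (f n x) \<le> 1" for n x
    by (simp add: f_def infdist_nonneg)
  have "f n \<in> bcontfun" for n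
    unfolding bcontfun_def f_def
    by (auto intro!: continuous_intros boundedI[of _ 1] simp: infdist_nonneg)
  then have f: "apply_bcontfun (Bcontfun (f n)) = f n" for n
    by (rule Bcontfun_inverse)
  have "(\<lambda>n. f n x) \<longlonglongrightarrow> indicator C x" for x
  proof (cases "x \<in> C")
    case True
    then show ?thesis by (simp add: f_def)
  next
    case False
    with \<open>C \<noteq> {}\<close> assms have pos: "infdist x C > 0"
      by (metis in_closed_iff_infdist_zero infdist_nonneg less_eq_real_def)
    then obtain N where N: "1 < real N * infdist x C"
      using reals_Archimedean3 by blast
    have "\<forall>\<^sub>F n in sequentially. f n x = 0"
      using eventually_ge_at_top[of N]
    proof eventually_elim
      case (elim n)
      then have "real N * infdist x C \<le> real n * infdist x C"
        by (intro mult_right_mono) (auto simp: infdist_nonneg)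
      with N show ?case by (simp add: f_def)
    qed
    then show ?thesis using False by (simp add: tendsto_eventually)
  qed
  then show ?thesis
    by (intro that[of "\<lambda>n. Bcontfun (f n)"]) (simp_all add: f f1)
qed

lemma integral_indicator_complex:
  assumes "C \<in> sets M"
  shows "(\<integral>x. indicator C x \<partial>M) = complex_of_real (measure M C)"
proof -
  have "(\<integral>x. indicator C x \<partial>M) = (\<integral>x. complex_of_real (indicator C x) \<partial>M)"
    by (rule Bochner_Integration.integral_cong) (auto simp: indicator_def)
  also have "\<dots> = complex_of_real (measure M C)"
    using sets.sets_into_space[OF assms] by (simp add: Int_absorb2)
  finally show ?thesis .
qed

lemma borel_probs_eqI:
  fixes \<mu> \<nu> :: "'a :: metric_space measure"
  assumes \<mu>: "\<mu> \<in> borel_probs" and \<nu>: "\<nu> \<in> borel_probs"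
    and eq: "\<And>\<phi> :: 'a \<Rightarrow>\<^sub>C complex. (\<integral>x. apply_bcontfun \<phi> x \<partial>\<mu>) = (\<integral>x. apply_bcontfun \<phi> x \<partial>\<nu>)"
  shows "\<mu> = \<nu>"
proof -
  have conv: "(\<lambda>n. \<integral>x. apply_bcontfun (\<phi> n) x \<partial>\<mu>) \<longlonglongrightarrow> complex_of_real (measure \<mu> C)"
    if "closed C" and b: "\<And>n x. norm (apply_bcontfun (\<phi> n) x) \<le> 1" and l: "\<And>x. (\<lambda>n. apply_bcontfun (\<phi> n) x) \<longlonglongrightarrow> indicator C x"
      and \<mu>: "\<mu> \<in> borel_probs"
    for C and \<phi> :: "nat \<Rightarrow> ('a \<Rightarrow>\<^sub>C complex)" and \<mu> :: "'a measure"
  proof -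
    from \<mu> interpret prob_space \<mu> by (simp add: borel_probs_def)
    have s [measurable_cong]: "sets \<mu> = sets borel" using \<mu> by (simp add: borel_probs_def)
    have C: "C \<in> sets \<mu>" using \<open>closed C\<close> by (simp add: s)
    have m: "apply_bcontfun (\<phi> n) \<in> borel_measurable \<mu>" for n
      using integrable_bcontfun[OF \<mu>, of "\<phi> n"] by (rule borel_measurable_integrable)
    have "(\<lambda>n. \<integral>x. apply_bcontfun (\<phi> n) x \<partial>\<mu>) \<longlonglongrightarrow> (\<integral>x. indicator C x \<partial>\<mu>)"
      by (rule integral_dominated_convergence[where w = "\<lambda>_. 1"])
         (use C b l m in \<open>auto intro: borel_measurable_indicator\<close>)
    also have "(\<integral>x. indicator C x \<partial>\<mu>) = complex_of_real (measure \<mu> C)"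
      by (rule integral_indicator_complex[OF C])
    finally show ?thesis .
  qed
  interpret M: prob_space \<mu> using \<mu> by (simp add: borel_probs_def)
  interpret N: prob_space \<nu> using \<nu> by (simp add: borel_probs_def)
  have s: "sets \<mu> = sets borel" "sets \<nu> = sets borel" using \<mu> \<nu> by (simp_all add: borel_probs_def)
  have C: "emeasure \<mu> C = emeasure \<nu> C" if cl: "closed C" for C
  proof -
    from closed_indicator_approx[OF cl] obtain \<phi> :: "nat \<Rightarrow> ('a \<Rightarrow>\<^sub>C complex)"
      where "\<And>n x. norm (apply_bcontfun (\<phi> n) x) \<le> 1" "\<And>x. (\<lambda>n. apply_bcontfun (\<phi> n) x) \<longlonglongrightarrow> indicator C x" by metis
    note c = conv[OF cl this]
    have "complex_of_real (measure \<mu> C) = complex_of_real (measure \<nu> C)"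
      using c[OF \<mu>] c[OF \<nu>] unfolding eq by (rule LIMSEQ_unique)
    then show ?thesis by (simp add: M.emeasure_eq_measure N.emeasure_eq_measure)
  qed
  show ?thesis
  proof (rule measure_eqI_generator_eq[where E = "Collect closed" and \<Omega> = UNIV and A = "\<lambda>_. UNIV"])
    show "Int_stable (Collect closed :: 'a set set)" by (auto simp: Int_stable_def)
    show "sets \<mu> = sigma_sets UNIV (Collect closed)" "sets \<nu> = sigma_sets UNIV (Collect closed)"
      unfolding s borel_eq_closed by simp_all
  qed (use C in auto)
qed


section \<open>The transition operator and its dual\<close>

text \<open>The Banach space of continuous functions on the sphere is \<open>rsphere \<Rightarrow>\<^sub>C complex\<close> with its sup norm, where boundedness is automatic;
  the library provides only the real scalar multiplication on it.\<close>

definition cscale :: "complex \<Rightarrow> ('a :: topological_space \<Rightarrow>\<^sub>C complex) \<Rightarrow> ('a \<Rightarrow>\<^sub>C complex)" where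
  "cscale c f = Bcontfun (\<lambda>x. c * apply_bcontfun f x)"

lemma apply_cscale [simp]: "apply_bcontfun (cscale c f) x = c * apply_bcontfun f x"
proof -
  have "norm (c * apply_bcontfun f x) \<le> norm c * norm f" for x
    by (simp add: norm_mult mult_left_mono norm_bounded)
  then have "(\<lambda>x. c * apply_bcontfun f x) \<in> bcontfun"
    unfolding bcontfun_def by (auto intro!: continuous_intros boundedI)
  then show ?thesis by (simp add: cscale_def Bcontfun_inverse)
qed

global_interpretation cfun: vector_space cscale
  by standard (auto intro!: bcontfun_eqI simp: algebra_simps)

definition transition_op :: "rat_map measure \<Rightarrow> (rsphere \<Rightarrow>\<^sub>C complex) \<Rightarrow> (rsphere \<Rightarrow>\<^sub>C complex)" where
  "transition_op \<tau> \<phi> = Bcontfun (\<lambda>z. \<integral>g. apply_bcontfun \<phi> (apply_rat g z) \<partial>\<tau>)"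

lemma measurable_eval_rat:
  assumes "\<tau> \<in> borel_probs"
  shows "(\<lambda>g. apply_rat g z) \<in> measurable \<tau> borel"
  using borel_measurable_continuous_onI[OF continuous_on_eval_rat, of z] assms
  by (simp add: borel_probs_def cong: measurable_cong_sets)

lemma apply_transition_op:
  assumes "\<tau> \<in> borel_probs"
  shows "apply_bcontfun (transition_op \<tau> \<phi>) z = (\<integral>g. apply_bcontfun \<phi> (apply_rat g z) \<partial>\<tau>)"
proof -
  from assms interpret prob_space \<tau> by (simp add: borel_probs_def)
  have m: "apply_bcontfun \<phi> \<in> borel_measurable borel"
    by (intro borel_measurable_continuous_onI) simp
  note meas = measurable_compose[OF measurable_eval_rat[OF assms] m]
  have "continuous_on UNIV (\<lambda>z. \<integral>g. apply_bcontfun \<phi> (apply_rat g z) \<partial>\<tau>)"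
  proof (rule continuous_on_sequentiallyI)
    fix u :: "nat \<Rightarrow> rsphere" and a assume u: "u \<longlonglongrightarrow> a"
    show "(\<lambda>n. \<integral>g. apply_bcontfun \<phi> (apply_rat g (u n)) \<partial>\<tau>) \<longlonglongrightarrow> (\<integral>g. apply_bcontfun \<phi> (apply_rat g a) \<partial>\<tau>)"
    proof (rule integral_dominated_convergence[where w = "\<lambda>_. norm \<phi>"])
      have "(\<lambda>n. apply_bcontfun \<phi> (apply_rat g (u n))) \<longlonglongrightarrow> apply_bcontfun \<phi> (apply_rat g a)" for g
        using continuous_on_tendsto_compose[OF continuous_on_compose2[OF
              continuous_on_apply_bcontfun[of UNIV \<phi>] continuous_on_apply_rat[of UNIV g]] u]
        by simp
      then show "AE g in \<tau>. (\<lambda>n. apply_bcontfun \<phi> (apply_rat g (u n))) \<longlonglongrightarrow> apply_bcontfun \<phi> (apply_rat g a)"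
        by simp
    qed (use meas norm_bounded in auto)
  qed
  then show ?thesis
    unfolding transition_op_def by (simp add: Bcontfun_inverse bcontfun_rsphere_iff)
qed

text \<open>\<open>M\<^sub>\<tau>\<^sup>*\<mu>\<close> is the Borel probability measure representing the functional
  \<open>\<phi> \<mapsto> \<integral> M\<^sub>\<tau>\<phi> d\<mu>\<close>; existence and uniqueness are proved below.\<close>

definition dual_op :: "rat_map measure \<Rightarrow> rsphere measure \<Rightarrow> rsphere measure" where
  "dual_op \<tau> \<mu> = (THE \<nu>. \<nu> \<in> borel_probs \<and>
     (\<forall>\<phi> :: rsphere \<Rightarrow>\<^sub>C complex. (\<integral>x. apply_bcontfun \<phi> x \<partial>\<nu>) = (\<integral>x. apply_bcontfun (transition_op \<tau> \<phi>) x \<partial>\<mu>)))"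

lemma dual_op_ex1:
  assumes \<tau>: "\<tau> \<in> borel_probs" and \<mu>: "\<mu> \<in> borel_probs"
  shows "\<exists>!\<nu>. \<nu> \<in> borel_probs \<and>
     (\<forall>\<phi> :: rsphere \<Rightarrow>\<^sub>C complex. (\<integral>x. apply_bcontfun \<phi> x \<partial>\<nu>) = (\<integral>x. apply_bcontfun (transition_op \<tau> \<phi>) x \<partial>\<mu>))"
proof (rule ex_ex1I)
  interpret T: prob_space \<tau> using \<tau> by (simp add: borel_probs_def)
  interpret M: prob_space \<mu> using \<mu> by (simp add: borel_probs_def)
  have s\<mu>: "sets \<mu> = sets borel" using \<mu> by (simp add: borel_probs_def)
  define K where "K z = distr \<tau> borel (\<lambda>g. apply_rat g z)" for z
  have K: "prob_space (K z)" "sets (K z) = sets borel" for z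
    unfolding K_def by (simp_all add: T.prob_space_distr measurable_eval_rat[OF \<tau>])
  then have Kb: "K z \<in> borel_probs" for z by (simp add: borel_probs_def)
  have intK: "(\<integral>x. apply_bcontfun \<phi> x \<partial>K z) = apply_bcontfun (transition_op \<tau> \<phi>) z" for \<phi> :: "rsphere \<Rightarrow>\<^sub>C complex" and z
    unfolding K_def apply_transition_op[OF \<tau>]
    by (intro integral_distr measurable_eval_rat[OF \<tau>] borel_measurable_continuous_onI) simp
  have closedK: "(\<lambda>z. emeasure (K z) C) \<in> borel_measurable borel" if "closed C" for C
  proof -
    from closed_indicator_approx[OF that] obtain \<phi> :: "nat \<Rightarrow> (rsphere \<Rightarrow>\<^sub>C complex)"
      where \<phi>: "\<And>n x. norm (apply_bcontfun (\<phi> n) x) \<le> 1" "\<And>x. (\<lambda>n. apply_bcontfun (\<phi> n) x) \<longlonglongrightarrow> indicator C x" by metis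
    have "(\<lambda>n. apply_bcontfun (transition_op \<tau> (\<phi> n)) z) \<longlonglongrightarrow> complex_of_real (measure (K z) C)" for z
    proof -
      interpret K: prob_space "K z" by (rule K)
      have C: "C \<in> sets (K z)" using that by (simp add: K)
      have m: "apply_bcontfun (\<phi> n) \<in> borel_measurable (K z)" for n
        using integrable_bcontfun[OF Kb[of z], of "\<phi> n"] by (rule borel_measurable_integrable)
      have "(\<lambda>n. \<integral>x. apply_bcontfun (\<phi> n) x \<partial>K z) \<longlonglongrightarrow> (\<integral>x. indicator C x \<partial>K z)"
        by (rule integral_dominated_convergence[where w = "\<lambda>_. 1"])
           (use C \<phi> m in \<open>auto intro: borel_measurable_indicator\<close>)
      also have "(\<integral>x. indicator C x \<partial>K z) = complex_of_real (measure (K z) C)"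
        by (rule integral_indicator_complex[OF C])
      finally show ?thesis by (simp add: intK)
    qed
    then have "(\<lambda>z. complex_of_real (measure (K z) C)) \<in> borel_measurable borel"
      by (rule borel_measurable_LIMSEQ_metric[rotated]) (intro borel_measurable_continuous_onI; simp)
    then have "(\<lambda>z. Re (complex_of_real (measure (K z) C))) \<in> borel_measurable borel"
      by measurable
    then have "(\<lambda>z. ennreal (measure (K z) C)) \<in> borel_measurable borel"
      by simp
    moreover have "ennreal (measure (K z) C) = emeasure (K z) C" for z
      using finite_measure.emeasure_eq_measure[OF prob_space.finite_measure[OF K(1)[of z]]] by simp
    ultimately show ?thesis by simp
  qed
  have K_meas: "K \<in> measurable \<mu> (subprob_algebra borel)"
  proof -
    have "K \<in> measurable borel (subprob_algebra borel)"
    proof (rule measurable_subprob_algebra_generated[where G = "Collect closed" and \<Omega> = UNIV])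
      show "sets borel = sigma_sets UNIV (Collect closed :: rsphere set set)"
        unfolding borel_eq_closed by simp
      show "Int_stable (Collect closed :: rsphere set set)" by (auto simp: Int_stable_def)
      show "(\<lambda>a. emeasure (K a) UNIV) \<in> borel_measurable borel"
        by (rule closedK) simp
    qed (use K closedK in \<open>auto intro: prob_space_imp_subprob_space\<close>)
    then show ?thesis by (simp add: s\<mu> cong: measurable_cong_sets)
  qed
  have bind: "bind \<mu> K \<in> borel_probs"
    unfolding borel_probs_def
  proof (intro CollectI conjI)
    show "prob_space (bind \<mu> K)"
      by (rule M.prob_space_bind[OF _ K_meas]) (simp add: K)
    show "sets (bind \<mu> K) = sets borel"
      by (rule sets_bind) (simp_all add: K M.not_empty)
  qed
  show "\<exists>\<nu>. \<nu> \<in> borel_probs \<and>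
     (\<forall>\<phi> :: rsphere \<Rightarrow>\<^sub>C complex. (\<integral>x. apply_bcontfun \<phi> x \<partial>\<nu>) = (\<integral>x. apply_bcontfun (transition_op \<tau> \<phi>) x \<partial>\<mu>))"
  proof (rule exI[of _ "bind \<mu> K"], intro conjI bind allI)
    fix \<phi> :: "rsphere \<Rightarrow>\<^sub>C complex"
    have bd: "(\<integral>x. h x \<partial>bind \<mu> K) = (\<integral>z. (\<integral>x. h x \<partial>K z) \<partial>\<mu>)"
      if "continuous_on UNIV h" "\<And>x. \<bar>h x\<bar> \<le> norm \<phi>" for h :: "rsphere \<Rightarrow> real"
      by (rule integral_bind[OF _ _ K_meas, where B = "norm \<phi>" and B' = 1])
         (use that in \<open>auto intro!: borel_measurable_continuous_onI M.finite_measure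
            simp: prob_space.emeasure_space_1 K\<close>)
    have "\<bar>Re (apply_bcontfun \<phi> x)\<bar> \<le> norm \<phi>" "\<bar>Im (apply_bcontfun \<phi> x)\<bar> \<le> norm \<phi>" for x
      using abs_Re_le_cmod abs_Im_le_cmod norm_bounded order_trans by blast+
    then have "(\<integral>x. Re (apply_bcontfun \<phi> x) \<partial>bind \<mu> K) = (\<integral>z. (\<integral>x. Re (apply_bcontfun \<phi> x) \<partial>K z) \<partial>\<mu>)"
      "(\<integral>x. Im (apply_bcontfun \<phi> x) \<partial>bind \<mu> K) = (\<integral>z. (\<integral>x. Im (apply_bcontfun \<phi> x) \<partial>K z) \<partial>\<mu>)"
      by (intro bd continuous_intros; simp)+
    then show "(\<integral>x. apply_bcontfun \<phi> x \<partial>bind \<mu> K) = (\<integral>x. apply_bcontfun (transition_op \<tau> \<phi>) x \<partial>\<mu>)"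
      using integrable_bcontfun[OF bind, of \<phi>] integrable_bcontfun[OF Kb, where \<phi> = \<phi>]
        integrable_bcontfun[OF \<mu>, of "transition_op \<tau> \<phi>"]
      by (simp add: intK complex_eq_iff)
  qed
next
  fix \<nu> \<nu>'
  assume "\<nu> \<in> borel_probs \<and> (\<forall>\<phi> :: rsphere \<Rightarrow>\<^sub>C complex. (\<integral>x. apply_bcontfun \<phi> x \<partial>\<nu>) = (\<integral>x. apply_bcontfun (transition_op \<tau> \<phi>) x \<partial>\<mu>))"
    "\<nu>' \<in> borel_probs \<and> (\<forall>\<phi> :: rsphere \<Rightarrow>\<^sub>C complex. (\<integral>x. apply_bcontfun \<phi> x \<partial>\<nu>') = (\<integral>x. apply_bcontfun (transition_op \<tau> \<phi>) x \<partial>\<mu>))"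
  then show "\<nu> = \<nu>'" by (intro borel_probs_eqI) auto
qed

lemma
  assumes "\<tau> \<in> borel_probs" "\<mu> \<in> borel_probs"
  shows dual_op_in_borel_probs: "dual_op \<tau> \<mu> \<in> borel_probs"
    and integral_dual_op:
      "(\<integral>x. apply_bcontfun \<phi> x \<partial>dual_op \<tau> \<mu>) = (\<integral>x. apply_bcontfun (transition_op \<tau> \<phi>) x \<partial>\<mu>)"
  using theI'[OF dual_op_ex1[OF assms]] unfolding dual_op_def by blast+

definition unitary_eigenvectors :: "rat_map measure \<Rightarrow> (rsphere \<Rightarrow>\<^sub>C complex) set" where
  "unitary_eigenvectors \<tau> =
     {\<phi>. \<phi> \<noteq> 0 \<and> (\<exists>a. norm a = 1 \<and> transition_op \<tau> \<phi> = cscale a \<phi>)}"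

definition unitary_space :: "rat_map measure \<Rightarrow> (rsphere \<Rightarrow>\<^sub>C complex) set" where
  "unitary_space \<tau> = cfun.span (unitary_eigenvectors \<tau>)"

definition vanishing_space :: "rat_map measure \<Rightarrow> (rsphere \<Rightarrow>\<^sub>C complex) set" where
  "vanishing_space \<tau> = {\<phi>. (\<lambda>n. (transition_op \<tau> ^^ n) \<phi>) \<longlonglongrightarrow> 0}"


section \<open>Rational semigroups and random compositions\<close>

inductive_set gen_semigroup :: "('a \<Rightarrow> 'a) set \<Rightarrow> ('a \<Rightarrow> 'a) set" for \<Gamma> where
  generator: "g \<in> \<Gamma> \<Longrightarrow> g \<in> gen_semigroup \<Gamma>"
| comp: "g \<in> gen_semigroup \<Gamma> \<Longrightarrow> h \<in> gen_semigroup \<Gamma> \<Longrightarrow> g \<circ> h \<in> gen_semigroup \<Gamma>"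

definition semigroup_of :: "rat_map measure \<Rightarrow> (rsphere \<Rightarrow> rsphere) set" where
  "semigroup_of \<tau> = gen_semigroup (apply_rat ` topological_support \<tau>)"

definition equicontinuous_on :: "'a :: metric_space set \<Rightarrow> ('a \<Rightarrow> 'b :: metric_space) set \<Rightarrow> bool" where
  "equicontinuous_on U G \<longleftrightarrow>
     (\<forall>x\<in>U. \<forall>\<epsilon>>0. \<exists>\<delta>>0. \<forall>g\<in>G. \<forall>y\<in>U. dist y x < \<delta> \<longrightarrow> dist (g y) (g x) < \<epsilon>)"

definition fatou_set :: "(rsphere \<Rightarrow> rsphere) set \<Rightarrow> rsphere set" where
  "fatou_set G = {z. \<exists>U. open U \<and> z \<in> U \<and> equicontinuous_on U G}"

definition julia_set :: "(rsphere \<Rightarrow> rsphere) set \<Rightarrow> rsphere set" where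
  "julia_set G = - fatou_set G"

definition kernel_julia_set :: "(rsphere \<Rightarrow> rsphere) set \<Rightarrow> rsphere set" where
  "kernel_julia_set G = (\<Inter>g\<in>G. g -` julia_set G)"

definition forward_invariant_compact :: "('a \<Rightarrow> 'a) set \<Rightarrow> 'a :: topological_space set \<Rightarrow> bool" where
  "forward_invariant_compact G C \<longleftrightarrow> C \<noteq> {} \<and> compact C \<and> (\<forall>g\<in>G. g ` C \<subseteq> C)"

definition minimal_sets :: "('a \<Rightarrow> 'a) set \<Rightarrow> 'a :: topological_space set set" where
  "minimal_sets G = {L. forward_invariant_compact G L \<and>
     (\<forall>C. forward_invariant_compact G C \<longrightarrow> C \<subseteq> L \<longrightarrow> C = L)}"

text \<open>Sequences are indexed from \<open>0\<close>, so \<open>random_comp \<gamma> n = \<gamma>\<^sub>n \<circ> \<dots> \<circ> \<gamma>\<^sub>1\<close> with \<open>\<gamma>\<^sub>k = \<gamma> (k - 1)\<close>.\<close>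

fun random_comp :: "(nat \<Rightarrow> rat_map) \<Rightarrow> nat \<Rightarrow> rsphere \<Rightarrow> rsphere" where
  "random_comp \<gamma> 0 = id"
| "random_comp \<gamma> (Suc n) = apply_rat (\<gamma> n) \<circ> random_comp \<gamma> n"

text \<open>This measure lives on the product \<open>\<sigma>\<close>-algebra; since the space of rational maps is
  separable, that is the Borel \<open>\<sigma>\<close>-algebra of the product topology.\<close>

definition path_measure :: "rat_map measure \<Rightarrow> (nat \<Rightarrow> rat_map) measure" where
  "path_measure \<tau> = PiM UNIV (\<lambda>_. \<tau>)"

end

theory Submission
  imports Defs "HOL-Complex_Analysis.Complex_Analysis" "HOL-Computational_Algebra.Fundamental_Theorem_Algebra"
begin

text \<open>Since \<open>J\<^sub>k\<^sub>e\<^sub>r(G\<^sub>\<tau>) = \<emptyset>\<close>, every point is mapped into the Fatou set by some element of \<open>G\<^sub>\<tau>\<close>.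
  On a disc of the Fatou set, limits of elements of \<open>G\<^sub>\<tau>\<close> are holomorphic; a limit \<open>q\<close> in a minimal
  left ideal of the closure must be constant, for otherwise limits that are the identity on an open
  set would spread equicontinuity over the whole sphere. So each disc can be contracted to
  arbitrarily small size by an element of \<open>G\<^sub>\<tau>\<close>, uniformly on compact families. A zero-one argument
  turns this into almost sure contraction along random orbits, and with compactness of the sphere
  (finitely many discs suffice as targets) this gives (2), (3) and (4).

  For (1), the same hitting argument makes \<open>{M\<^sub>\<tau>\<^sup>n \<phi>}\<close> equicontinuous, so all orbits of \<open>M\<^sub>\<tau>\<close> are
  relatively compact. This splits \<open>C\<close> into the vanishing part and the reversible part, the
  functions with a relatively compact backward orbit, on which \<open>M\<^sub>\<tau>\<close> is a recurrent isometry.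
  Contraction forces reversible functions to be constant on Fatou discs and to oscillate by at most
  half their norm on the members of a finite cover of the sphere. Hence they are determined by finitely many
  values: the reversible part has finite dimension and is spanned by unitary eigenvectors. The attractor
  consists of the probability measures annihilating the vanishing part; integration of a basis of the
  reversible part gives it finitely many real coordinates.\<close>

section \<open>Equicontinuity and pointwise limits\<close>

text \<open>Limits of the semigroup are taken in the product topology on all self-maps of the
  sphere. Compactness then comes from Tychonoff, but the space is not first countable, so
  approximation runs through filters instead of sequences; over the Fatou set, equicontinuity
  upgrades pointwise to locally uniform convergence. Composition is continuous on the right with any
  map, on the left only with a continuous one. Limits may be discontinuous off the Fatou set, so
  they can be followed by elements of \<open>G\<close> but not by other limits; this is why left
  ideals appear.

  The same compactness yields the uniform lower bound on hitting probabilities that the zero-one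
  argument requires: a bound depending on the element already reached would not do.

  The reversible part is described by backward orbits and not by a spectrum. A function far back on
  such an orbit is averaged over long random paths to give the present one, so contraction of the
  paths acts on the present function directly. Finite dimension follows first, and only then does
  linear algebra produce the unitary eigenvectors.\<close>

definition equi_at :: "('a::topological_space \<Rightarrow> 'b::metric_space) set \<Rightarrow> 'a \<Rightarrow> bool" where
  "equi_at FF x \<longleftrightarrow> (\<forall>e>0. \<exists>U. open U \<and> x \<in> U \<and> (\<forall>f\<in>FF. \<forall>y\<in>U. dist (f y) (f x) < e))"

lemma equi_atD:
  assumes "equi_at FF x" "e > 0"
  obtains U where "open U" "x \<in> U" "\<forall>f\<in>FF. \<forall>y\<in>U. dist (f y) (f x) < e"
proof -
  obtain U where "open U \<and> x \<in> U \<and> (\<forall>f\<in>FF. \<forall>y\<in>U. dist (f y) (f x) < e)"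
    using assms(1)[unfolded equi_at_def, rule_format, OF assms(2)] by (rule exE)
  then show ?thesis using that[of U] by simp
qed

lemma equi_at_mono:
  assumes "equi_at FF x" "GG \<subseteq> FF" shows "equi_at GG x"
  unfolding equi_at_def
proof (intro allI impI)
  fix e :: real assume "e > 0"
  obtain U where "open U" "x \<in> U" "\<forall>f\<in>FF. \<forall>y\<in>U. dist (f y) (f x) < e"
    by (rule equi_atD[OF assms(1) \<open>e > 0\<close>])
  then show "\<exists>U. open U \<and> x \<in> U \<and> (\<forall>f\<in>GG. \<forall>y\<in>U. dist (f y) (f x) < e)"
    using assms(2) by (intro exI[of _ U]) auto
qed

lemma equi_at_Un:
  assumes "equi_at FF x" "equi_at GG x" shows "equi_at (FF \<union> GG) x"
  unfolding equi_at_def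
proof (intro allI impI)
  fix e :: real assume "e > 0"
  obtain U where U: "open U" "x \<in> U" "\<forall>f\<in>FF. \<forall>y\<in>U. dist (f y) (f x) < e"
    by (rule equi_atD[OF assms(1) \<open>e > 0\<close>])
  obtain V where V: "open V" "x \<in> V" "\<forall>f\<in>GG. \<forall>y\<in>V. dist (f y) (f x) < e"
    by (rule equi_atD[OF assms(2) \<open>e > 0\<close>])
  show "\<exists>W. open W \<and> x \<in> W \<and> (\<forall>f\<in>FF \<union> GG. \<forall>y\<in>W. dist (f y) (f x) < e)"
    using U V by (intro exI[of _ "U \<inter> V"]) auto
qed

lemma equi_at_continuous:
  assumes "continuous_on UNIV f" shows "equi_at {f} x"
  unfolding equi_at_def
proof (intro allI impI)
  fix e :: real assume "e > 0"
  have "open (f -` ball (f x) e)" using assms by (simp add: open_vimage)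
  then show "\<exists>U. open U \<and> x \<in> U \<and> (\<forall>f\<in>{f}. \<forall>y\<in>U. dist (f y) (f x) < e)"
    using \<open>e > 0\<close> by (intro exI[of _ "f -` ball (f x) e"]) (auto simp: dist_commute)
qed

lemma equi_at_compose:
  assumes "equi_at FF (h x)" "continuous_on UNIV h"
  shows "equi_at ((\<lambda>f. f \<circ> h) ` FF) x"
  unfolding equi_at_def
proof (intro allI impI)
  fix e :: real assume "e > 0"
  obtain U where U: "open U" "h x \<in> U" "\<forall>f\<in>FF. \<forall>y\<in>U. dist (f y) (f (h x)) < e"
    by (rule equi_atD[OF assms(1) \<open>e > 0\<close>])
  show "\<exists>W. open W \<and> x \<in> W \<and> (\<forall>f\<in>(\<lambda>f. f \<circ> h) ` FF. \<forall>y\<in>W. dist (f y) (f x) < e)"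
    using U assms(2) by (intro exI[of _ "h -` U"]) (auto simp: open_vimage)
qed

lemma equi_at_imp_isCont:
  assumes "equi_at FF x" "f \<in> FF" shows "isCont f x"
  unfolding isCont_def tendsto_iff
proof (intro allI impI)
  fix e :: real assume "e > 0"
  obtain U where U: "open U" "x \<in> U" "\<forall>f\<in>FF. \<forall>y\<in>U. dist (f y) (f x) < e"
    by (rule equi_atD[OF assms(1) \<open>e > 0\<close>])
  then show "\<forall>\<^sub>F y in at x. dist (f y) (f x) < e"
    unfolding eventually_at_topological using U(3) assms(2) by (intro exI[of _ U]) simp
qed

lemma continuous_on_eval: "continuous_on S (\<lambda>f. f a :: 'b::topological_space)"
  by (rule continuous_on_subset[OF continuous_on_product_coordinates subset_UNIV])

lemma eventually_nhds_eval:
  fixes f :: "'a \<Rightarrow> 'b::metric_space"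
  assumes "e > 0" shows "\<forall>\<^sub>F g in nhds f. dist (g a) (f a) < e"
proof -
  have "open ((\<lambda>g. g a) -` ball (f a) e)"
    by (rule open_vimage) (auto simp: continuous_on_eval)
  then show ?thesis
    using assms unfolding eventually_nhds
    by (intro exI[of _ "(\<lambda>g. g a) -` ball (f a) e"]) (auto simp: dist_commute)
qed

text \<open>The trace of the neighbourhood filter on \<open>FF\<close> replaces a sequence
  converging to \<open>f\<close>: in an uncountable product, points of the closure need not be
  limits of sequences. Properness turns an eventual property into an actual member of
  \<open>FF\<close>.\<close>

lemma closure_filter_nontrivial:
  assumes "f \<in> closure FF" shows "inf (nhds f) (principal FF) \<noteq> bot"
proof
  assume "inf (nhds f) (principal FF) = bot"
  then have "\<forall>\<^sub>F g in nhds f. g \<notin> FF"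
    using eventually_inf_principal[of "\<lambda>_. False" "nhds f" FF] by simp
  then obtain S where S: "open S \<and> f \<in> S \<and> (\<forall>g\<in>S. g \<notin> FF)" unfolding eventually_nhds by (rule exE)
  then have "FF \<subseteq> - S" "closed (- S)" by auto
  then have "closure FF \<subseteq> - S" by (rule closure_minimal)
  then show False using assms S by auto
qed

lemma closure_approx:
  fixes f :: "'a \<Rightarrow> 'b::metric_space"
  assumes "f \<in> closure FF" "finite A" "e > 0"
  obtains g where "g \<in> FF" "\<forall>a\<in>A. dist (g a) (f a) < e"
proof -
  have "\<forall>\<^sub>F g in inf (nhds f) (principal FF). (\<forall>a\<in>A. dist (g a) (f a) < e) \<and> g \<in> FF"
    using eventually_ball_finite[OF assms(2), of "\<lambda>g a. dist (g a) (f a) < e" "nhds f"]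
      eventually_nhds_eval[OF assms(3), of _ f] unfolding eventually_inf_principal
    by (auto elim: eventually_mono)
  then have "\<exists>g. (\<forall>a\<in>A. dist (g a) (f a) < e) \<and> g \<in> FF"
    by (rule eventually_happens'[OF closure_filter_nontrivial[OF assms(1)]])
  then show ?thesis using that by blast
qed

lemma closure_approxI:
  fixes f :: "'a \<Rightarrow> 'b::metric_space"
  assumes "f \<in> closure FF" "\<And>g. g \<in> FF \<Longrightarrow> dist (g a) (g b) \<le> e"
  shows "dist (f a) (f b) \<le> e"
proof (rule field_le_epsilon)
  fix d :: real assume "d > 0"
  then have "d/2 > 0" by simp
  obtain g where g: "g \<in> FF" "\<forall>c\<in>{a,b}. dist (g c) (f c) < d/2"
    by (rule closure_approx[OF assms(1) _ \<open>d/2>0\<close>, of "{a,b}"]) auto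
  have "dist (f a) (f b) \<le> dist (g a) (f a) + dist (g a) (g b) + dist (g b) (f b)"
    by metric
  then show "dist (f a) (f b) \<le> e + d" using g(2) assms(2)[OF g(1)] by simp
qed

lemma equi_at_closure:
  assumes "equi_at FF x" shows "equi_at (closure FF) x"
  unfolding equi_at_def
proof (intro allI impI)
  fix e :: real assume e: "e > 0"
  \<comment> \<open>Strict bounds become non-strict in the closure; starting from \<open>e/2\<close>
    restores strictness.\<close>
  then have "e/2 > 0" by simp
  obtain U where U: "open U" "x \<in> U" "\<forall>f\<in>FF. \<forall>y\<in>U. dist (f y) (f x) < e/2"
    by (rule equi_atD[OF assms(1) \<open>e/2 > 0\<close>])
  have "dist (f y) (f x) < e" if "f \<in> closure FF" "y \<in> U" for f y
  proof -
    have "dist (f y) (f x) \<le> e/2"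
      using U(3) that(2) that(1) e by (intro closure_approxI[of f FF]) (auto intro: less_imp_le)
    then show ?thesis using e by simp
  qed
  then show "\<exists>U. open U \<and> x \<in> U \<and> (\<forall>f\<in>closure FF. \<forall>y\<in>U. dist (f y) (f x) < e)"
    using U(1,2) by (intro exI[of _ U]) simp
qed

text \<open>Neighbourhoods of finitely many points cover \<open>K\<close>. Closeness of
  \<open>g\<close> to \<open>f\<close> at these points is an open condition in the product topology,
  and equicontinuity, which \<open>f\<close> inherits, spreads it over \<open>K\<close>.\<close>

lemma eventually_uniformly_close:
  fixes f :: "'a::topological_space \<Rightarrow> 'b::metric_space"
  assumes f: "f \<in> closure FF" and K: "compact K" and eq: "\<And>x. x \<in> K \<Longrightarrow> equi_at FF x" and e: "e > 0"
  shows "\<forall>\<^sub>F g in inf (nhds f) (principal FF). \<forall>x\<in>K. dist (g x) (f x) < e"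
proof -
  have "e/3 > 0" using e by simp
  have "\<exists>U. open U \<and> x \<in> U \<and> (\<forall>h\<in>closure FF. \<forall>y\<in>U. dist (h y) (h x) < e/3)" if "x \<in> K" for x
    using equi_at_closure[OF eq[OF that]] \<open>e/3 > 0\<close> unfolding equi_at_def by blast
  then obtain U where U: "\<And>x. x \<in> K \<Longrightarrow> open (U x)" "\<And>x. x \<in> K \<Longrightarrow> x \<in> U x"
     "\<And>x h y. x \<in> K \<Longrightarrow> h \<in> closure FF \<Longrightarrow> y \<in> U x \<Longrightarrow> dist (h y) (h x) < e/3" by metis
  have "K \<subseteq> \<Union>(U ` K)" using U by auto
  with compactE_image[OF K, of K U] U(1) obtain C where C: "C \<subseteq> K" "finite C" "K \<subseteq> \<Union>(U ` C)" by blast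
  have "\<forall>\<^sub>F g in inf (nhds f) (principal FF). (\<forall>c\<in>C. dist (g c) (f c) < e/3) \<and> g \<in> FF"
    using eventually_ball_finite[OF C(2), of "\<lambda>g a. dist (g a) (f a) < e/3" "nhds f"]
      eventually_nhds_eval[OF \<open>e/3>0\<close>, of _ f] unfolding eventually_inf_principal
    by (auto elim: eventually_mono)
  then show ?thesis
  proof eventually_elim
    case (elim g)
    show ?case
    proof
      fix x assume "x \<in> K"
      then obtain c where c: "c \<in> C" "x \<in> U c" using C by auto
      have "g \<in> closure FF" using elim closure_subset by blast
      then have "dist (g x) (g c) < e/3" "dist (f x) (f c) < e/3" "dist (g c) (f c) < e/3"
        using U(3)[of c _ x] c C elim f by auto
      then show "dist (g x) (f x) < e" by metric
    qed
  qed
qed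

lemma closure_approx_uniform:
  fixes f :: "'a::topological_space \<Rightarrow> 'b::metric_space"
  assumes "f \<in> closure FF" "compact K" "\<And>x. x \<in> K \<Longrightarrow> equi_at FF x" "e > 0"
  obtains g where "g \<in> FF" "\<forall>x\<in>K. dist (g x) (f x) < e"
proof -
  have "\<forall>\<^sub>F g in inf (nhds f) (principal FF). (\<forall>x\<in>K. dist (g x) (f x) < e) \<and> g \<in> FF"
    using eventually_uniformly_close[OF assms] by (simp add: eventually_inf_principal eventually_conj_iff)
  then have "\<exists>g. (\<forall>x\<in>K. dist (g x) (f x) < e) \<and> g \<in> FF"
    by (rule eventually_happens'[OF closure_filter_nontrivial[OF assms(1)]])
  then obtain g where "(\<forall>x\<in>K. dist (g x) (f x) < e) \<and> g \<in> FF" by (rule exE)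
  then show ?thesis using that[of g] by simp
qed

lemma continuous_on_compose_right: "continuous_on S (\<lambda>f. f \<circ> h :: _ \<Rightarrow> 'b::topological_space)"
  unfolding comp_def by (intro continuous_on_coordinatewise_then_product continuous_on_eval)

text \<open>Unlike composition on the right, this depends on continuity of the fixed map; elements
  of \<open>G\<close> qualify, their pointwise limits in general do not.\<close>

lemma continuous_on_compose_left:
  fixes g :: "'b::topological_space \<Rightarrow> 'c::topological_space"
  assumes "continuous_on UNIV g"
  shows "continuous_on S (\<lambda>f. g \<circ> f)"
  unfolding comp_def
  by (intro continuous_on_coordinatewise_then_product continuous_on_compose2[OF assms] continuous_on_eval) auto

section \<open>Holomorphic maps into the sphere\<close>

text \<open>\<open>chart False\<close> is the coordinate 1/w at infinity, with 0 sent to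
  \<open>Infty\<close>. Each chart misses exactly one point, \<open>pole b\<close>, which is the
  centre of the other chart.\<close>

definition chart :: "bool \<Rightarrow> complex \<Rightarrow> rsphere" where
  "chart b w = (if b then Cplx w else hpoint 1 w)"

text \<open>Stereographic projection from \<open>pole b\<close>, conjugated in the second case so
  that the change of charts is holomorphic. At \<open>pole b\<close> itself the division yields the
  default value 0.\<close>

definition coord :: "bool \<Rightarrow> rsphere \<Rightarrow> complex" where
  "coord b x = (if b then (1 / (1 - snd (sph x))) *\<^sub>R fst (sph x)
     else (1 / (1 + snd (sph x))) *\<^sub>R cnj (fst (sph x)))"

definition pole :: "bool \<Rightarrow> rsphere" where
  "pole b = (if b then Infty else Cplx 0)"

lemma snd_sph_eq_1: "snd (sph x) = 1 \<longleftrightarrow> x = Infty"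
  using snd_sph_Cplx_neq by (cases x) (auto simp del: sph.simps(1))

lemma snd_sph_eq_m1: "snd (sph x) = -1 \<longleftrightarrow> x = Cplx 0"
proof (cases x)
  case (Cplx z)
  have p: "(norm z)\<^sup>2 + 1 > 0" by (simp add: add_nonneg_pos)
  have "((norm z)\<^sup>2 - 1) / ((norm z)\<^sup>2 + 1) = -1 \<longleftrightarrow> (norm z)\<^sup>2 - 1 = -1 * ((norm z)\<^sup>2 + 1)"
    using p by (subst divide_eq_eq) auto
  also have "\<dots> \<longleftrightarrow> z = 0" by auto
  finally show ?thesis by (simp add: Cplx)
qed simp

lemma chart_coord: "x \<noteq> pole b \<Longrightarrow> chart b (coord b x) = x"
  using Cplx_chart[of x] hpoint_chart[of x]
  by (auto simp: chart_def coord_def pole_def snd_sph_eq_1 snd_sph_eq_m1)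

lemma chart_neq_pole: "chart b w \<noteq> pole b"
  by (auto simp: chart_def pole_def hpoint_def)

lemma inj_chart: "inj (chart b)"
  by (auto simp: inj_def chart_def hpoint_def divide_simps split: if_splits)

lemma coord_chart: "coord b (chart b w) = w"
  using chart_coord[OF chart_neq_pole] inj_chart by (metis injD)

lemma chart_zero: "chart (\<not> b) 0 = pole b"
  by (auto simp: chart_def pole_def hpoint_def)

lemma chart_change: "w \<noteq> 0 \<Longrightarrow> chart (\<not> b) w = chart b (1 / w)"
  by (auto simp: chart_def hpoint_def)

lemma ex_chart: "\<exists>b w. x = chart b w"
proof -
  have "\<exists>b. x \<noteq> pole b" by (metis (full_types) pole_def rsphere.distinct(1))
  then show ?thesis by (metis chart_coord)
qed

lemma continuous_on_chart: "continuous_on S (chart b)"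
proof -
  have "continuous_on S (\<lambda>w. hpoint w 1)" "continuous_on S (\<lambda>w. hpoint 1 w)"
    by (intro continuous_on_hpoint continuous_intros; simp)+
  then show ?thesis by (cases b) (simp_all add: chart_def[abs_def] hpoint_def[of _ 1])
qed

lemma continuous_on_coord: "continuous_on (- {pole b}) (coord b)"
proof -
  have cs: "continuous_on S (\<lambda>x. fst (sph x))" "continuous_on S (\<lambda>x. snd (sph x))" for S
    by (intro continuous_intros continuous_on_sph)+
  have "1 + snd (sph x) \<noteq> 0" if "x \<noteq> Cplx 0" for x
    using snd_sph_eq_m1[of x] that by linarith
  moreover have "1 - snd (sph x) \<noteq> 0" if "x \<noteq> Infty" for x
    using snd_sph_eq_1[of x] that by linarith
  ultimately show ?thesis
    by (cases b; simp add: coord_def[abs_def] pole_def)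
      (intro continuous_on_scaleR continuous_on_divide continuous_on_const continuous_on_diff
        continuous_on_add continuous_on_cnj cs; simp)+
qed

lemma open_chart_image: "open S \<Longrightarrow> open (chart b ` S)"
proof -
  assume S: "open S"
  have "chart b ` S = coord b -` S \<inter> (- {pole b})"
    using chart_coord[of _ b] coord_chart[of b] chart_neq_pole[of b] by (auto simp: image_iff) metis
  then show ?thesis
    using continuous_on_open_vimage[of "- {pole b}" "coord b"] continuous_on_coord[of b] S by (simp add: open_Compl)
qed

text \<open>Holomorphy of a sphere-valued map, with one chart per small disc, so that poles are no
  exception. Maps defined on the sphere are tested after composition with both charts.\<close>

definition sholo :: "(complex \<Rightarrow> rsphere) \<Rightarrow> complex set \<Rightarrow> bool" where
  "sholo f S \<longleftrightarrow> (\<forall>w\<in>S. \<exists>r>0. \<exists>b F. F holomorphic_on ball w r \<and> (\<forall>u\<in>ball w r. f u = chart b (F u)))"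

lemma sholo_subset: "sholo f S \<Longrightarrow> T \<subseteq> S \<Longrightarrow> sholo f T"
  unfolding sholo_def by blast

lemma sholo_chart: "F holomorphic_on UNIV \<Longrightarrow> sholo (\<lambda>w. chart b (F w)) S"
  unfolding sholo_def
  by (intro ballI exI[of _ 1] conjI exI[of _ b] exI[of _ F]) (auto elim: holomorphic_on_subset)

lemma sholo_const: "sholo (\<lambda>_. c) S"
proof -
  obtain b w where "c = chart b w" using ex_chart by blast
  then show ?thesis using sholo_chart[of "\<lambda>_. w"] by simp
qed

text \<open>The chart in \<open>sholo\<close> is only known to exist; here it is prescribed, as long
  as the value avoids its pole. If the other chart was given, \<open>F w\<close> is non-zero,
  because 0 is sent to the forbidden pole, and \<open>1 / F\<close> is the coordinate
  function.\<close>

lemma sholo_in_chart: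
  assumes "sholo f S" "w \<in> S" "f w \<noteq> pole b"
  obtains r F where "r > 0" "F holomorphic_on ball w r" "\<And>u. u \<in> ball w r \<Longrightarrow> f u = chart b (F u)"
proof -
  obtain r c F where r: "r > 0" and F: "F holomorphic_on ball w r" "\<And>u. u \<in> ball w r \<Longrightarrow> f u = chart c (F u)"
    using assms(1,2) unfolding sholo_def by meson
  show ?thesis
  proof (cases "c = b")
    case True then show ?thesis using that r F by blast
  next
    case False
    then have c: "c = (\<not> b)" by simp
    have "F w \<noteq> 0"
      using F(2)[of w] r assms(3) chart_zero[of b] by (auto simp: c)
    moreover have "continuous (at w) F"
      using holomorphic_on_imp_continuous_on[OF F(1)] r by (simp add: continuous_on_eq_continuous_at)
    ultimately obtain d where d: "d > 0" "\<And>u. dist w u < d \<Longrightarrow> F u \<noteq> 0"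
      by (metis continuous_at_avoid)
    show ?thesis
    proof (rule that[of "min d r" "\<lambda>u. 1 / F u"])
      show "(\<lambda>u. 1 / F u) holomorphic_on ball w (min d r)"
        by (intro holomorphic_intros holomorphic_on_subset[OF F(1)]) (use d in auto)
      show "f u = chart b (1 / F u)" if "u \<in> ball w (min d r)" for u
        using that F(2)[of u] d(2)[of u] chart_change[of "F u" b] by (simp add: c)
    qed (use d r in auto)
  qed
qed

lemma sholo_imp_isCont: "sholo f S \<Longrightarrow> w \<in> S \<Longrightarrow> isCont f w"
proof -
  assume "sholo f S" "w \<in> S"
  then obtain r b F where r: "r > 0" and F: "F holomorphic_on ball w r" "\<And>u. u \<in> ball w r \<Longrightarrow> f u = chart b (F u)"
    unfolding sholo_def by meson
  have "continuous_on (ball w r) (\<lambda>u. chart b (F u))"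
    by (intro continuous_on_compose2[OF continuous_on_chart[of UNIV]] holomorphic_on_imp_continuous_on F) auto
  then have "continuous_on (ball w r) f" by (rule continuous_on_eq) (simp add: F(2))
  then show ?thesis using r by (simp add: continuous_on_eq_continuous_at)
qed

lemma sholo_compose:
  assumes "sholo (\<lambda>u. g u) S" "\<And>b. sholo (\<lambda>u. f (chart b u)) UNIV"
  shows "sholo (\<lambda>u. f (g u)) S"
  unfolding sholo_def
proof
  fix w assume "w \<in> S"
  then obtain r b F where r: "r > 0" and F: "F holomorphic_on ball w r" "\<And>u. u \<in> ball w r \<Longrightarrow> g u = chart b (F u)"
    using assms(1) unfolding sholo_def by meson
  obtain s c H where s: "s > 0" and H: "H holomorphic_on ball (F w) s" "\<And>u. u \<in> ball (F w) s \<Longrightarrow> f (chart b u) = chart c (H u)"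
    using assms(2)[of b] unfolding sholo_def by (meson UNIV_I)
  have "isCont F w"
    using holomorphic_on_imp_continuous_on[OF F(1)] r by (simp add: continuous_on_eq_continuous_at)
  then obtain d where d: "d > 0" "\<And>u. dist u w < d \<Longrightarrow> dist (F u) (F w) < s"
    using s unfolding continuous_at_eps_delta by meson
  show "\<exists>r>0. \<exists>b Fa. Fa holomorphic_on ball w r \<and> (\<forall>u\<in>ball w r. f (g u) = chart b (Fa u))"
  proof (intro exI conjI ballI)
    show "min d r > 0" using d r by simp
    have "H \<circ> F holomorphic_on ball w (min d r)"
      by (rule holomorphic_on_compose_gen[OF holomorphic_on_subset[OF F(1)] H(1)])
         (use d in \<open>auto simp: dist_commute\<close>)
    then show "(\<lambda>u. H (F u)) holomorphic_on ball w (min d r)" by (simp add: comp_def)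
    show "f (g u) = chart c (H (F u))" if "u \<in> ball w (min d r)" for u
      using that F(2)[of u] H(2)[of "F u"] d(2)[of u] by (simp add: dist_commute)
  qed
qed

lemma sholo_hpoint:
  assumes "P holomorphic_on UNIV" "Q holomorphic_on UNIV" "\<And>w. P w \<noteq> 0 \<or> Q w \<noteq> 0"
  shows "sholo (\<lambda>w. hpoint (P w) (Q w)) UNIV"
  unfolding sholo_def
proof
  fix w :: complex
  have cont: "continuous (at w) P" "continuous (at w) Q"
    using assms(1,2) holomorphic_on_imp_continuous_on continuous_on_eq_continuous_at[of UNIV] by auto
  show "\<exists>r>0. \<exists>b F. F holomorphic_on ball w r \<and> (\<forall>u\<in>ball w r. hpoint (P u) (Q u) = chart b (F u))"
  proof (cases "Q w = 0")
    case False
    then obtain d where d: "d > 0" "\<And>u. dist w u < d \<Longrightarrow> Q u \<noteq> 0" using cont by (metis continuous_at_avoid)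
    have "(\<lambda>u. P u / Q u) holomorphic_on ball w d"
      using d by (intro holomorphic_intros holomorphic_on_subset[OF assms(1)] holomorphic_on_subset[OF assms(2)]) auto
    moreover have "\<forall>u\<in>ball w d. hpoint (P u) (Q u) = chart True (P u / Q u)"
      using d by (auto simp: hpoint_def chart_def)
    ultimately show ?thesis using d(1) by blast
  next
    case True
    then have "P w \<noteq> 0" using assms(3) by blast
    then obtain d where d: "d > 0" "\<And>u. dist w u < d \<Longrightarrow> P u \<noteq> 0" using cont by (metis continuous_at_avoid)
    have "(\<lambda>u. Q u / P u) holomorphic_on ball w d"
      using d by (intro holomorphic_intros holomorphic_on_subset[OF assms(1)] holomorphic_on_subset[OF assms(2)]) auto
    moreover have "\<forall>u\<in>ball w d. hpoint (P u) (Q u) = chart False (Q u / P u)"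
      using d by (auto simp: hpoint_def chart_def)
    ultimately show ?thesis using d(1) by blast
  qed
qed

lemma sholo_rat_eval:
  assumes cop: "coprime p q" shows "sholo (\<lambda>w. rat_eval p q (chart b w)) UNIV"
proof (cases b)
  case True
  have "poly p z \<noteq> 0 \<or> poly q z \<noteq> 0" for z using coprime_poly_0[OF cop] by blast
  then have "sholo (\<lambda>w. hpoint (poly p w) (poly q w)) UNIV"
    by (intro sholo_hpoint) (auto intro!: holomorphic_intros)
  then show ?thesis using True by (simp add: chart_def)
next
  case False
  have pq: "poly p z \<noteq> 0 \<or> poly q z \<noteq> 0" for z using coprime_poly_0[OF cop] by blast
  have pq0: "p \<noteq> 0 \<or> q \<noteq> 0" using cop by auto
  define d where "d = max (degree p) (degree q)"
  \<comment> \<open>Homogenisation: for non-zero \<open>w\<close> this is the polynomial at 1/w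
    times \<open>w ^ d\<close>. The reflected polynomial extends it to 0, where it gives the
    coefficient of degree \<open>d\<close>, in agreement with \<open>rat_eval\<close> at
    infinity.\<close>
  define R where "R s w = w ^ (d - degree s) * poly (reflect_poly s) w" for s :: "complex poly" and w
  have R: "R s w = w ^ d * poly s (inverse w)" if "w \<noteq> 0" "s = p \<or> s = q" for s w
  proof -
    have "degree s \<le> d" using that by (auto simp: d_def)
    then show ?thesis
      using that by (simp add: R_def poly_reflect_poly_nz power_add[symmetric] mult.assoc[symmetric])
  qed
  have R0: "R s 0 = coeff s d" if "s = p \<or> s = q" for s
  proof (cases "d = degree s")
    case False
    then have "degree s < d" using that by (auto simp: d_def)
    then show ?thesis by (simp add: R_def coeff_eq_0)
  qed (simp add: R_def)
  have "coeff p d \<noteq> 0 \<or> coeff q d \<noteq> 0"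
  proof (cases "q \<noteq> 0 \<and> degree p \<le> degree q")
    case True
    then have "coeff q d \<noteq> 0" unfolding d_def by (simp add: max_absorb2)
    then show ?thesis ..
  next
    case False
    then have "d = degree p" and "p \<noteq> 0" using pq0 unfolding d_def by auto
    then show ?thesis by simp
  qed
  then have Rnz: "R p w \<noteq> 0 \<or> R q w \<noteq> 0" for w
    using pq[of "inverse w"] by (cases "w = 0") (simp_all add: R R0)
  have Rf: "rat_eval p q (hpoint 1 w) = hpoint (R p w) (R q w)" for w
    by (cases "w = 0") (simp_all add: R R0 hpoint_def d_def[symmetric] divide_inverse)
  have "sholo (\<lambda>w. hpoint (R p w) (R q w)) UNIV"
    by (rule sholo_hpoint[OF _ _ Rnz]) (auto simp: R_def[abs_def] intro!: holomorphic_intros)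
  then show ?thesis using False by (simp add: chart_def Rf)
qed

lemma sholo_apply_rat: "sholo (\<lambda>w. apply_rat g (chart b w)) UNIV"
  using apply_rat[of g] sholo_rat_eval unfolding nonconst_rational_def by auto

text \<open>In a chart whose pole is not \<open>f w\<close>, equicontinuity keeps all members close
  to \<open>f\<close> inside one compact part \<open>C\<close> of the chart over a whole disc. There
  the coordinates converge uniformly, and the theorem on uniform limits of holomorphic functions
  applies.\<close>

lemma sholo_pointwise_limit:
  fixes FF :: "(complex \<Rightarrow> rsphere) set"
  assumes S: "open S" and hol: "\<And>f. f \<in> FF \<Longrightarrow> sholo f S" and eq: "\<And>w. w \<in> S \<Longrightarrow> equi_at FF w"
    and f: "f \<in> closure FF"
  shows "sholo f S"
  unfolding sholo_def
proof
  fix w assume w: "w \<in> S"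
  have "\<exists>b. f w \<noteq> pole b" by (metis (full_types) pole_def rsphere.distinct(1))
  then obtain b where b: "f w \<noteq> pole b" by blast
  define c where "c = coord b (f w)"
  define C where "C = chart b ` cball c 1"
  have C: "compact C" "C \<subseteq> - {pole b}"
    unfolding C_def using chart_neq_pole[of b]
    by (auto intro!: compact_continuous_image continuous_on_chart simp: eq_commute[of "pole b"])
  have "f w \<in> chart b ` ball c 1"
    by (rule image_eqI[of _ _ c]) (simp_all add: c_def chart_coord[OF b])
  then obtain e where e: "e > 0" "ball (f w) e \<subseteq> chart b ` ball c 1"
    using open_chart_image[of "ball c 1" b] by (meson open_ball open_contains_ball)
  then have eC: "ball (f w) e \<subseteq> C" by (auto simp: C_def)
  have e2: "e/2 > 0" using e by simp
  obtain U where U: "open U" "w \<in> U" "\<forall>g\<in>closure FF. \<forall>y\<in>U. dist (g y) (g w) < e/2"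
    by (rule equi_atD[OF equi_at_closure[OF eq[OF w]] e2])
  have "open (U \<inter> S)" "w \<in> U \<inter> S" using U S w by auto
  then obtain r where r: "r > 0" "cball w r \<subseteq> U \<inter> S" by (meson open_contains_cball)
  have in_C: "g u \<in> C" if "g \<in> closure FF" "dist (g w) (f w) < e/2" "u \<in> cball w r" for g u
  proof -
    have "dist (g u) (g w) < e/2" using U(3) that r by blast
    with that(2) have "dist (f w) (g u) < e" by metric
    then show ?thesis using eC by auto
  qed
  let ?F = "inf (nhds f) (principal FF)"
  have uc: "uniformly_continuous_on C (coord b)"
    by (rule compact_uniformly_continuous[OF continuous_on_subset[OF continuous_on_coord C(2)] C(1)])
  have ev: "\<forall>\<^sub>F g in ?F. g \<in> FF \<and> dist (g w) (f w) < e/2"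
    using eventually_nhds_eval[OF e2, of w f] unfolding eventually_inf_principal by (auto elim: eventually_mono)
  have fC: "f u \<in> C" if "u \<in> cball w r" for u using in_C[OF f _ that] e by simp
  have ul: "uniform_limit (cball w r) (\<lambda>g u. coord b (g u)) (\<lambda>u. coord b (f u)) ?F"
    unfolding uniform_limit_iff
  proof (intro allI impI)
    fix \<epsilon> :: real assume "\<epsilon> > 0"
    then obtain d where d: "d > 0" "\<And>x y. x \<in> C \<Longrightarrow> y \<in> C \<Longrightarrow> dist y x < d \<Longrightarrow> dist (coord b y) (coord b x) < \<epsilon>"
      using uc unfolding uniformly_continuous_on_def by meson
    have "\<forall>\<^sub>F g in ?F. \<forall>u\<in>cball w r. dist (g u) (f u) < d"
      by (rule eventually_uniformly_close[OF f compact_cball _ d(1)]) (use eq r in blast)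
    with ev show "\<forall>\<^sub>F g in ?F. \<forall>u\<in>cball w r. dist (coord b (g u)) (coord b (f u)) < \<epsilon>"
    proof eventually_elim
      case (elim g)
      then have "g \<in> closure FF" using closure_subset by blast
      then show ?case using d(2)[OF fC in_C[of g]] elim by auto
    qed
  qed
  \<comment> \<open>The limit theorem asks for continuity up to the boundary circle, hence
    differentiability is obtained at every point of the closed disc, which still lies in
    \<open>S\<close>.\<close>
  have ev2: "\<forall>\<^sub>F g in ?F. continuous_on (cball w r) (\<lambda>u. coord b (g u)) \<and> (\<lambda>u. coord b (g u)) holomorphic_on ball w r"
    using ev
  proof eventually_elim
    case (elim g)
    then have gC: "g u \<in> C" if "u \<in> cball w r" for u using in_C[of g u] that closure_subset by blast
    have hg: "sholo g S" using hol elim by blast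
    have *: "\<exists>s>0. \<exists>H. H holomorphic_on ball u s \<and> (\<forall>v\<in>ball u s. coord b (g v) = H v)" if "u \<in> cball w r" for u
    proof -
      have "g u \<noteq> pole b" using gC[OF that] C(2) by auto
      moreover have "u \<in> S" using that r by blast
      ultimately obtain s H where "s > 0" "H holomorphic_on ball u s" "\<And>v. v \<in> ball u s \<Longrightarrow> g v = chart b (H v)"
        using sholo_in_chart[OF hg, of u b] by auto
      then show ?thesis by (intro exI[of _ s] conjI exI[of _ H]) (auto simp: coord_chart)
    qed
    have fd: "(\<lambda>u. coord b (g u)) field_differentiable (at u)" if u: "u \<in> cball w r" for u
    proof -
      obtain s H where s: "s > 0" "H holomorphic_on ball u s" "\<forall>v\<in>ball u s. coord b (g v) = H v"
        using *[OF u] by blast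
      then have "(\<lambda>v. coord b (g v)) holomorphic_on ball u s"
        by (intro holomorphic_transform[OF s(2)]) (use s(3) in auto)
      from holomorphic_on_imp_differentiable_at[OF this open_ball, of u] show ?thesis using s(1) by simp
    qed
    show ?case
    proof
      show "continuous_on (cball w r) (\<lambda>u. coord b (g u))"
        by (intro continuous_at_imp_continuous_on ballI field_differentiable_imp_continuous_at fd)
      show "(\<lambda>u. coord b (g u)) holomorphic_on ball w r"
        unfolding holomorphic_on_def by (rule ballI, rule field_differentiable_at_within, rule fd) simp
    qed
  qed
  have "(\<lambda>u. coord b (f u)) holomorphic_on ball w r"
    by (rule holomorphic_uniform_limit[OF ev2 ul closure_filter_nontrivial[OF f]])
  moreover have "f u = chart b (coord b (f u))" if "u \<in> ball w r" for u
  proof -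
    have "f u \<noteq> pole b" using fC[of u] that C(2) by auto
    then show ?thesis by (simp add: chart_coord)
  qed
  ultimately show "\<exists>r>0. \<exists>b F. F holomorphic_on ball w r \<and> (\<forall>u\<in>ball w r. f u = chart b (F u))"
    using r(1) by blast
qed

text \<open>\<open>Z\<close>, the set of points near which the maps agree, is open and closed in
  \<open>S\<close>. At a point outside \<open>Z\<close>, either the values differ and continuity
  separates them nearby, or they coincide, one chart serves both maps, and the identity theorem in
  that chart excludes points of \<open>Z\<close> nearby.\<close>

lemma sholo_identity:
  assumes f: "sholo f S" and g: "sholo g S" and S: "open S" "connected S"
    and N: "open N" "N \<noteq> {}" "N \<subseteq> S" "\<And>u. u \<in> N \<Longrightarrow> f u = g u" and w: "w \<in> S"
  shows "f w = g w"
proof -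
  define Z where "Z = {w \<in> S. \<exists>r>0. \<forall>u\<in>ball w r. f u = g u}"
  have ZN: "N \<subseteq> Z"
  proof
    fix u assume u: "u \<in> N"
    obtain r where "r > 0" "ball u r \<subseteq> N" using N(1) u unfolding open_contains_ball by auto
    then show "u \<in> Z" using N(3,4) u unfolding Z_def by auto
  qed
  have "open Z" unfolding open_contains_ball
  proof
    fix w assume "w \<in> Z"
    then obtain r where r: "r > 0" "\<forall>u\<in>ball w r. f u = g u" "w \<in> S" unfolding Z_def by blast
    obtain s where s: "s > 0" "ball w s \<subseteq> S" using S r by (meson open_contains_ball)
    have "ball w (min r s) \<subseteq> Z"
    proof
      fix v assume v: "v \<in> ball w (min r s)"
      then have "v \<in> ball w r" by simp
      then obtain t where "t > 0" "ball v t \<subseteq> ball w r" using open_ball unfolding open_contains_ball by metis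
      then show "v \<in> Z" unfolding Z_def using v s r(2) by auto
    qed
    then show "\<exists>e>0. ball w e \<subseteq> Z" using r s by (intro exI[of _ "min r s"]) auto
  qed
  moreover have "open (S - Z)" unfolding open_contains_ball
  proof
    fix w assume w: "w \<in> S - Z"
    obtain s where s: "s > 0" "ball w s \<subseteq> S" using S w by (meson DiffD1 open_contains_ball)
    show "\<exists>e>0. ball w e \<subseteq> S - Z"
    proof (cases "f w = g w")
      case False
      have c: "isCont (\<lambda>u. dist (f u) (g u)) w"
        using w f g sholo_imp_isCont by (intro continuous_intros) auto
      have n: "dist (f w) (g w) \<noteq> 0" using False by simp
      obtain d where "d > 0 \<and> (\<forall>u. dist w u < d \<longrightarrow> dist (f u) (g u) \<noteq> 0)"
        using continuous_at_avoid[OF c n] by (rule exE)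
      then have d: "d > 0" "\<And>u. dist w u < d \<Longrightarrow> dist (f u) (g u) \<noteq> 0" by simp_all
      have "ball w (min d s) \<subseteq> S - Z"
      proof
        fix u assume u: "u \<in> ball w (min d s)"
        then have "f u \<noteq> g u" using d(2)[of u] by auto
        then show "u \<in> S - Z" using u s by (auto simp: Z_def)
      qed
      then show ?thesis using d s by (intro exI[of _ "min d s"]) auto
    next
      case True
      have "\<exists>b. f w \<noteq> pole b" by (metis (full_types) pole_def rsphere.distinct(1))
      then obtain b where b: "f w \<noteq> pole b" by blast
      obtain r1 F where F: "r1 > 0" "F holomorphic_on ball w r1" "\<And>u. u \<in> ball w r1 \<Longrightarrow> f u = chart b (F u)"
        using sholo_in_chart[OF f _ b] w by blast
      obtain r2 G where G: "r2 > 0" "G holomorphic_on ball w r2" "\<And>u. u \<in> ball w r2 \<Longrightarrow> g u = chart b (G u)"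
        using sholo_in_chart[OF g _ b[unfolded True]] w by blast
      define r where "r = Min {r1, r2, s}"
      have r: "r > 0" "r \<le> r1" "r \<le> r2" "r \<le> s" using F G s by (auto simp: r_def)
      have "u \<notin> Z" if u: "u \<in> ball w r" for u
      proof
        assume "u \<in> Z"
        then obtain t where t: "t > 0" "\<forall>v\<in>ball u t. f v = g v" unfolding Z_def by blast
        have "F v = G v" if "v \<in> ball w r" for v
        proof (rule analytic_continuation_open[of "ball u t \<inter> ball w r" "ball w r" F G])
          show "ball u t \<inter> ball w r \<noteq> {}" using t u by (metis IntI centre_in_ball empty_iff)
          show "F holomorphic_on ball w r" "G holomorphic_on ball w r"
            using F G r by (auto elim!: holomorphic_on_subset)
          fix z assume "z \<in> ball u t \<inter> ball w r"
          then show "F z = G z" using t F(3)[of z] G(3)[of z] r inj_chart[of b] by (auto simp: inj_eq)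
        qed (use that in auto)
        then have "\<forall>v\<in>ball w r. f v = g v" using F(3) G(3) r by auto
        then show False using w r unfolding Z_def by blast
      qed
      then have "ball w r \<subseteq> S - Z" using r s by auto
      then show ?thesis using r by blast
    qed
  qed
  ultimately have "Z = {} \<or> S - Z = {}"
    using connectedD[OF S(2), of Z "S - Z"] by (auto simp: Z_def)
  moreover have "Z \<noteq> {}" using ZN N by blast
  ultimately have "w \<in> Z" using w by blast
  then show ?thesis unfolding Z_def by auto
qed

text \<open>If some coordinate function is non-constant on its disc, the open mapping theorem in
  that chart suffices. Otherwise \<open>f\<close> is constant on one disc, and
  \<open>sholo_identity\<close> against a constant map makes it constant on
  \<open>S\<close>.\<close>

lemma sholo_image_interior:
  assumes f: "sholo f S" and S: "open S" "connected S" and nc: "\<not> f constant_on S"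
  obtains O' where "open O'" "O' \<noteq> {}" "O' \<subseteq> f ` S"
proof (cases "\<exists>w\<in>S. \<exists>r>0. \<exists>b F. ball w r \<subseteq> S \<and> F holomorphic_on ball w r \<and> (\<forall>u\<in>ball w r. f u = chart b (F u)) \<and>
     \<not> F constant_on ball w r")
  case True
  then obtain w r b F where *: "w \<in> S" "r > 0" "ball w r \<subseteq> S" "F holomorphic_on ball w r"
     "\<forall>u\<in>ball w r. f u = chart b (F u)" "\<not> F constant_on ball w r" by blast
  have "open (F ` ball w r)"
    using open_mapping_thm[OF *(4) _ _ _ _ *(6), of "ball w r"] by auto
  then have "open (chart b ` F ` ball w r)" by (rule open_chart_image)
  moreover have "chart b ` F ` ball w r = f ` ball w r" using *(5) by (force simp: image_image)
  moreover have "f ` ball w r \<subseteq> f ` S" "f ` ball w r \<noteq> {}" using *(2,3) by auto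
  ultimately show ?thesis by (intro that[of "f ` ball w r"]) simp_all
next
  case False
  have "S \<noteq> {}" using nc by (auto simp: constant_on_def)
  then obtain w where w: "w \<in> S" by blast
  obtain r b F where r: "r > 0" and F: "F holomorphic_on ball w r" "\<And>u. u \<in> ball w r \<Longrightarrow> f u = chart b (F u)"
    using f w unfolding sholo_def by meson
  obtain s where s: "s > 0" "ball w s \<subseteq> S" using S w by (meson open_contains_ball)
  have "F holomorphic_on ball w (min r s)" using F(1) by (rule holomorphic_on_subset) auto
  moreover have "ball w (min r s) \<subseteq> S" "min r s > 0" "\<forall>u\<in>ball w (min r s). f u = chart b (F u)"
    using r s F(2) by auto
  ultimately have "F constant_on ball w (min r s)" using False w by blast
  then obtain c where c: "\<And>u. u \<in> ball w (min r s) \<Longrightarrow> F u = c" by (auto simp: constant_on_def)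
  have "f v = chart b c" if "v \<in> S" for v
    by (rule sholo_identity[OF f sholo_const S, of "ball w (min r s)"]) (use r s F(2) c that in auto)
  then show ?thesis using nc by (auto simp: constant_on_def)
qed

lemma connected_rsphere: "connected (UNIV :: rsphere set)"
proof -
  have "continuous_on (sphere 0 1) unsph"
    by (subst continuous_on_sph_iff[symmetric], subst continuous_on_cong[OF refl, of _ _ "\<lambda>x. x"]) auto
  moreover have "x \<in> unsph ` sphere 0 1" for x
    by (rule image_eqI[of _ _ "sph x"]) simp_all
  then have "unsph ` sphere 0 1 = UNIV" by blast
  moreover have "connected (sphere (0 :: complex \<times> real) 1)" by (rule connected_sphere) simp
  ultimately show ?thesis by (metis connected_continuous_image)
qed

section \<open>Minimal sets and the fibres of pointwise limits\<close>

lemma compact_imp_closed_fun: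
  fixes S :: "('a \<Rightarrow> 'b::metric_space) set"
  assumes "compact S" shows "closed S"
proof -
  have "Hausdorff_space (product_topology (\<lambda>_::'a. euclidean :: 'b topology) UNIV)"
    by (simp add: Hausdorff_space_product_topology)
  then have "closedin (product_topology (\<lambda>_::'a. euclidean :: 'b topology) UNIV) S"
    by (rule compactin_imp_closedin) (simp add: euclidean_product_topology assms)
  then show ?thesis by (simp add: euclidean_product_topology)
qed

lemma compact_UNIV_fun:
  assumes "compact (UNIV :: 'b::topological_space set)" shows "compact (UNIV :: ('a \<Rightarrow> 'b) set)"
proof -
  have "compact_space (euclidean :: 'b topology)" using assms by (simp add: compact_space_def)
  then have "compact_space (product_topology (\<lambda>_::'a. euclidean :: 'b topology) UNIV)"
    by (simp add: compact_space_product_topology)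
  then show ?thesis by (simp add: euclidean_product_topology compact_space_def)
qed

lemma finite_chain_Inter:
  assumes "finite CC" "CC \<noteq> {}" "\<And>A B. A \<in> CC \<Longrightarrow> B \<in> CC \<Longrightarrow> A \<subseteq> B \<or> B \<subseteq> A"
  shows "\<Inter>CC \<in> CC"
  using assms
proof (induction CC rule: finite_ne_induct)
  case (insert A CC)
  then have "\<Inter>CC \<in> CC" by blast
  then have "A \<subseteq> \<Inter>CC \<or> \<Inter>CC \<subseteq> A" using insert.prems by blast
  then have "A \<inter> \<Inter>CC = A \<or> A \<inter> \<Inter>CC = \<Inter>CC" by blast
  then show ?case using \<open>\<Inter>CC \<in> CC\<close> by auto
qed simp

text \<open>Zorn's lemma is applied to complements, so that minimal becomes maximal; a chain has a
  bound because its intersection is non-empty by compactness. The topological setting covers both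
  the sphere and the space of its self-maps; \<open>closed\<close> stands in for the Hausdorff
  property.\<close>

lemma minimal_set_exists:
  fixes G :: "('a::topological_space \<Rightarrow> 'a) set"
  assumes C: "forward_invariant_compact G C" and closed: "\<And>K :: 'a set. compact K \<Longrightarrow> closed K"
  obtains L where "L \<in> minimal_sets G" "L \<subseteq> C"
proof -
  define AA where "AA = {- K | K. K \<subseteq> C \<and> forward_invariant_compact G K}"
  have "\<exists>M\<in>AA. \<forall>X\<in>AA. M \<subseteq> X \<longrightarrow> X = M"
  proof (rule subset_Zorn_nonempty)
    show "AA \<noteq> {}" using C unfolding AA_def by blast
    fix CC assume ne: "CC \<noteq> {}" and ch: "subset.chain AA CC"
    define KK where "KK = uminus ` CC"
    have CA: "CC \<subseteq> AA" and CC: "\<And>A B. A \<in> CC \<Longrightarrow> B \<in> CC \<Longrightarrow> A \<subseteq> B \<or> B \<subseteq> A"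
      using ch unfolding subset_chain_def by simp_all
    have KK: "K \<subseteq> C" "forward_invariant_compact G K" if K: "K \<in> KK" for K
    proof -
      have "- K \<in> AA" using K CA by (auto simp: KK_def)
      then show "K \<subseteq> C" "forward_invariant_compact G K" unfolding AA_def by auto
    qed
    have chK: "A \<subseteq> B \<or> B \<subseteq> A" if "A \<in> KK" "B \<in> KK" for A B
    proof -
      have "- A \<in> CC" "- B \<in> CC" using that by (auto simp: KK_def)
      from CC[OF this] show ?thesis by auto
    qed
    have ne': "KK \<noteq> {}" using ne by (simp add: KK_def)
    have cl: "closed K" if "K \<in> KK" for K
      using KK(2)[OF that] by (simp add: forward_invariant_compact_def closed)
    obtain K0 where K0: "K0 \<in> KK" using ne' by blast
    have cK0: "compact K0" using KK(2)[OF K0] by (simp add: forward_invariant_compact_def)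
    have "K0 \<inter> \<Inter>KK \<noteq> {}"
    proof (rule compact_imp_fip[OF cK0 cl])
      fix F' assume F': "finite F'" "F' \<subseteq> KK"
      have sub: "insert K0 F' \<subseteq> KK" using F' K0 by simp
      have "\<Inter>(insert K0 F') \<in> insert K0 F'"
      proof (rule finite_chain_Inter)
        fix A B assume "A \<in> insert K0 F'" "B \<in> insert K0 F'"
        then have "A \<in> KK" "B \<in> KK" using sub by (meson subsetD)+
        then show "A \<subseteq> B \<or> B \<subseteq> A" by (rule chK)
      qed (use F' in simp_all)
      with sub have "\<Inter>(insert K0 F') \<in> KK" by (rule subsetD)
      from KK(2)[OF this] show "K0 \<inter> \<Inter>F' \<noteq> {}" by (simp add: forward_invariant_compact_def)
    qed
    then have "\<Inter>KK \<noteq> {}" by blast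
    moreover have "compact (\<Inter>KK)"
      using compact_Int_closed[OF cK0 closed_Inter[of KK]] cl K0 by (simp add: Inf_lower inf_absorb2)
    moreover have "\<forall>g\<in>G. g ` \<Inter>KK \<subseteq> \<Inter>KK"
    proof (intro ballI subsetI InterI)
      fix g x K assume "g \<in> G" "x \<in> g ` \<Inter>KK" "K \<in> KK"
      then show "x \<in> K" using KK(2)[of K] by (auto simp: forward_invariant_compact_def)
    qed
    ultimately have "forward_invariant_compact G (\<Inter>KK)" by (simp add: forward_invariant_compact_def)
    moreover have "\<Inter>KK \<subseteq> C" using K0 KK(1) by blast
    moreover have "\<Union>CC = - \<Inter>KK" by (auto simp: KK_def)
    ultimately show "\<Union>CC \<in> AA" unfolding AA_def by blast
  qed
  then obtain M where M: "M \<in> AA" "\<And>X. X \<in> AA \<Longrightarrow> M \<subseteq> X \<Longrightarrow> X = M" by blast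
  have "- M \<in> minimal_sets G" unfolding minimal_sets_def
  proof (intro CollectI conjI allI impI)
    show "forward_invariant_compact G (- M)" using M(1) unfolding AA_def by auto
    fix K assume "forward_invariant_compact G K" "K \<subseteq> - M"
    then have "- K \<in> AA" "M \<subseteq> - K" using M(1) unfolding AA_def by auto
    then show "K = - M" using M(2) by blast
  qed
  moreover have "- M \<subseteq> C" using M(1) unfolding AA_def by auto
  ultimately show ?thesis using that by blast
qed

section \<open>The Fatou set and the limits of a holomorphic semigroup\<close>

lemma fatou_iff: "z \<in> fatou_set G \<longleftrightarrow> (\<exists>U. open U \<and> z \<in> U \<and> (\<forall>x\<in>U. equi_at G x))"
proof -
  have "equicontinuous_on U G \<longleftrightarrow> (\<forall>x\<in>U. equi_at G x)" if U: "open U" for U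
  proof
    assume eq: "equicontinuous_on U G"
    show "\<forall>x\<in>U. equi_at G x" unfolding equi_at_def
    proof (intro ballI allI impI)
      fix x e assume x: "x \<in> U" and e: "(0::real) < e"
      obtain d where d: "d > 0 \<and> (\<forall>g\<in>G. \<forall>y\<in>U. dist y x < d \<longrightarrow> dist (g y) (g x) < e)"
        using eq[unfolded equicontinuous_on_def, THEN bspec, OF x, THEN spec, THEN mp, OF e] by (rule exE)
      show "\<exists>W. open W \<and> x \<in> W \<and> (\<forall>f\<in>G. \<forall>y\<in>W. dist (f y) (f x) < e)"
        using d x U by (intro exI[of _ "U \<inter> ball x d"]) (auto simp: dist_commute)
    qed
  next
    assume eq: "\<forall>x\<in>U. equi_at G x"
    show "equicontinuous_on U G" unfolding equicontinuous_on_def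
    proof (intro ballI allI impI)
      fix x e assume x: "x \<in> U" and e: "(0::real) < e"
      obtain W where W: "open W" "x \<in> W" "\<forall>f\<in>G. \<forall>y\<in>W. dist (f y) (f x) < e"
        by (rule equi_atD[OF eq[THEN bspec, OF x] e])
      obtain d where "d > 0" "ball x d \<subseteq> W" using W unfolding open_contains_ball by auto
      then show "\<exists>d>0. \<forall>g\<in>G. \<forall>y\<in>U. dist y x < d \<longrightarrow> dist (g y) (g x) < e"
        using W by (intro exI[of _ d]) (auto simp: subset_iff dist_commute)
    qed
  qed
  then show ?thesis unfolding fatou_set_def by auto
qed

lemma open_fatou: "open (fatou_set G)"
proof (subst open_subopen, intro ballI)
  fix z assume "z \<in> fatou_set G"
  then obtain U where "open U" "z \<in> U" "\<forall>x\<in>U. equi_at G x" unfolding fatou_iff by blast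
  then show "\<exists>T. open T \<and> z \<in> T \<and> T \<subseteq> fatou_set G"
    by (intro exI[of _ U]) (auto simp: fatou_iff)
qed

lemma fatou_equi_at: "z \<in> fatou_set G \<Longrightarrow> equi_at G z"
  unfolding fatou_iff by auto

locale holomorphic_semigroup =
  fixes G :: "(rsphere \<Rightarrow> rsphere) set"
  assumes comp_closed: "g \<in> G \<Longrightarrow> h \<in> G \<Longrightarrow> g \<circ> h \<in> G"
    and cont: "g \<in> G \<Longrightarrow> continuous_on UNIV g"
    and hol: "g \<in> G \<Longrightarrow> sholo (\<lambda>w. g (chart b w)) UNIV"
    and kernel: "kernel_julia_set G = {}"
    and julia: "julia_set G \<noteq> {}"
begin

abbreviation "F \<equiv> fatou_set G"

text \<open>The identity is adjoined so that a disc not yet moved is the case \<open>p = id\<close>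
  of the statements about limits.\<close>

abbreviation "E \<equiv> closure (insert id G)"

lemma to_fatou: obtains g where "g \<in> G" "g z \<in> F"
  using kernel unfolding kernel_julia_set_def julia_set_def by blast

lemma equi_id: "x \<in> F \<Longrightarrow> equi_at (insert id G) x"
  using equi_at_Un[OF equi_at_continuous fatou_equi_at, of id x G] by simp

lemma left_closed:
  assumes g: "g \<in> G" and FF: "\<And>k. k \<in> FF \<Longrightarrow> g \<circ> k \<in> FF'" and p: "p \<in> closure FF"
  shows "g \<circ> p \<in> closure FF'"
proof -
  have "(\<lambda>p. g \<circ> p) ` closure FF \<subseteq> closure FF'"
    by (rule image_closure_subset[OF continuous_on_compose_left[OF cont[OF g]]])
       (auto intro!: FF closure_subset[THEN subsetD])
  then show ?thesis using p by blast
qed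

lemma E_left: "g \<in> G \<Longrightarrow> p \<in> E \<Longrightarrow> g \<circ> p \<in> E"
  by (rule left_closed) (auto intro: comp_closed)

lemma sholo_limit:
  assumes FF: "FF \<subseteq> insert id G" and eq: "\<And>x. x \<in> chart b ` ball w r \<Longrightarrow> equi_at FF x" and p: "p \<in> closure FF"
  shows "sholo (\<lambda>u. p (chart b u)) (ball w r)"
proof -
  define HH where "HH = (\<lambda>f. f \<circ> chart b) ` FF"
  have "sholo (p \<circ> chart b) (ball w r)"
  proof (rule sholo_pointwise_limit[where FF = HH])
    fix f assume "f \<in> HH"
    then obtain g where "g \<in> insert id G" "f = g \<circ> chart b" using FF by (auto simp: HH_def)
    moreover have "sholo (chart b) (ball w r)" using sholo_chart[of "\<lambda>x. x" b] by (simp add: holomorphic_on_ident)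
    ultimately show "sholo f (ball w r)" using sholo_subset[OF hol[of g b]] by (auto simp: comp_def)
  next
    fix u assume "u \<in> ball w r"
    then show "equi_at HH u" unfolding HH_def using eq by (intro equi_at_compose continuous_on_chart) auto
  next
    show "p \<circ> chart b \<in> closure HH"
    proof -
      have "(\<lambda>p. p \<circ> chart b) ` closure FF \<subseteq> closure HH"
        by (rule image_closure_subset[OF continuous_on_compose_right]) (auto simp: HH_def intro!: closure_subset[THEN subsetD] imageI)
      then show ?thesis using p by blast
    qed
  qed simp
  then show ?thesis by (simp add: comp_def)
qed

lemma disc_in_open:
  assumes "open U" "x \<in> U"
  obtains b w r where "r > 0" "x = chart b w" "chart b ` ball w r \<subseteq> U"
proof -
  obtain b w where x: "x = chart b w" using ex_chart by blast
  have "open (chart b -` U)" "w \<in> chart b -` U"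
    using assms continuous_on_chart[of UNIV b] by (auto simp: x intro: open_vimage)
  then obtain r where "r > 0" "ball w r \<subseteq> chart b -` U" unfolding open_contains_ball by blast
  then show ?thesis using that x by blast
qed

text \<open>On the disc \<open>p\<close> is holomorphic as a limit of an equicontinuous family, so
  agreement with the inclusion propagates from \<open>N\<close>. Equicontinuity is asked of
  \<open>FF\<close> and not of \<open>G\<close>: this lets the identity reach discs not yet known to
  lie in the Fatou set.\<close>

lemma identity_extends:
  assumes eq: "\<And>x. x \<in> chart b ` ball w r \<Longrightarrow> equi_at FF x" and FF: "FF \<subseteq> insert id G"
    and p: "p \<in> closure FF" and N: "open N" "N \<inter> chart b ` ball w r \<noteq> {}" "\<And>a. a \<in> N \<Longrightarrow> p a = a"
    and a: "a \<in> chart b ` ball w r"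
  shows "p a = a"
proof -
  have h: "sholo (\<lambda>u. chart b u) (ball w r)" using sholo_chart[of "\<lambda>x. x" b] by (simp add: holomorphic_on_ident)
  obtain u where u: "u \<in> ball w r" "a = chart b u" using a by blast
  have "p (chart b u) = chart b u"
  proof (rule sholo_identity[OF sholo_limit[OF FF eq p] h _ _ _ _ _ _ u(1)])
    show "open (chart b -` N \<inter> ball w r)"
      using N(1) continuous_on_chart[of UNIV b] by (auto intro: open_vimage)
    show "chart b -` N \<inter> ball w r \<noteq> {}" using N(2) by blast
  qed (use N(3) in auto)
  then show ?thesis using u by simp
qed

text \<open>A limit \<open>q\<close> in a minimal left ideal satisfies \<open>p \<circ> q = q\<close> for limits \<open>p\<close> of maps \<open>k \<circ> g\<close>; if
  \<open>q\<close> were open somewhere, these \<open>p\<close> would be the identity on an open set. The set \<open>Z\<close> of points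
  near which this happens consists of Fatou points and is clopen, contradicting \<open>J \<noteq> {}\<close>.\<close>

lemma minimal_limit_constant:
  assumes M: "M \<in> minimal_sets ((\<lambda>g p. g \<circ> p) ` G)" "M \<subseteq> E" and q: "q \<in> M"
    and D: "chart b ` ball w r \<subseteq> F"
  shows "q constant_on (chart b ` ball w r)"
proof (rule ccontr)
  assume nc: "\<not> q constant_on (chart b ` ball w r)"
  have Minv: "compact M" "\<And>g p. g \<in> G \<Longrightarrow> p \<in> M \<Longrightarrow> g \<circ> p \<in> M"
    and Mmin: "\<And>C. forward_invariant_compact ((\<lambda>g p. g \<circ> p) ` G) C \<Longrightarrow> C \<subseteq> M \<Longrightarrow> C = M"
    using M(1) unfolding minimal_sets_def forward_invariant_compact_def by blast+
  \<comment> \<open>Near a point that \<open>g\<close> sends into the Fatou set, the right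
    translates \<open>k o g\<close> are equicontinuous even where this is not known for
    \<open>G\<close>.\<close>
  define cl where "cl g = closure ((\<lambda>k. k \<circ> g) ` G)" for g :: "rsphere \<Rightarrow> rsphere"
  have compact_cl: "compact (closure FF)" for FF :: "(rsphere \<Rightarrow> rsphere) set"
    using compact_Int_closed[OF compact_UNIV_fun[OF compact_rsphere] closed_closure] by simp
  \<comment> \<open>The orbit closure of \<open>g o q\<close> is an invariant compact subset of
    \<open>M\<close>, hence equals \<open>M\<close> and contains \<open>q\<close>. As
    \<open>cl g\<close> is compact, composing its members with \<open>q\<close> gives a closed set,
    so \<open>q\<close> has exactly the form \<open>p o q\<close>.\<close>
  have id_on_range: "\<exists>p\<in>cl g. p \<circ> q = q" if g: "g \<in> G" for g
  proof -
    define N where "N = closure ((\<lambda>k. k \<circ> g \<circ> q) ` G)"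
    have NM: "N \<subseteq> M" unfolding N_def
      by (rule closure_minimal) (use Minv g q compact_imp_closed_fun in \<open>auto simp: comp_assoc\<close>)
    have "N = M"
    proof (rule Mmin)
      have "h \<circ> p \<in> N" if "h \<in> G" "p \<in> N" for h p
        using that unfolding N_def
        by (elim left_closed[rotated 2]) (auto simp: comp_assoc[symmetric] intro!: imageI intro: comp_closed)
      moreover have "G \<noteq> {}" using g by blast
      ultimately show "forward_invariant_compact ((\<lambda>g p. g \<circ> p) ` G) N"
        unfolding forward_invariant_compact_def using compact_cl by (auto simp: N_def)
    qed (rule NM)
    moreover have "N \<subseteq> (\<lambda>p. p \<circ> q) ` cl g" unfolding N_def cl_def
    proof (rule closure_minimal)
      show "closed ((\<lambda>p. p \<circ> q) ` closure ((\<lambda>k. k \<circ> g) ` G))"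
        by (intro compact_imp_closed_fun compact_continuous_image continuous_on_compose_right compact_cl)
      show "(\<lambda>k. k \<circ> g \<circ> q) ` G \<subseteq> (\<lambda>p. p \<circ> q) ` closure ((\<lambda>k. k \<circ> g) ` G)"
        using closure_subset[of "(\<lambda>k. k \<circ> g) ` G"] by auto
    qed
    ultimately have "q \<in> (\<lambda>p. p \<circ> q) ` cl g" using q by (metis subsetD)
    then obtain p where "p \<in> cl g" "q = p \<circ> q" by (rule imageE)
    then show ?thesis by (intro bexI[of _ p]) simp_all
  qed
  \<comment> \<open>One neighbourhood \<open>N\<close> has to serve every \<open>g\<close>: the map
    that will bring a given boundary point into the Fatou set is not known in advance.\<close>
  define Z where "Z = {y. \<exists>N. open N \<and> y \<in> N \<and> (\<forall>g\<in>G. \<exists>p\<in>cl g. \<forall>a\<in>N. p a = a)}"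
  have openZ: "open Z"
  proof (subst open_subopen, intro ballI)
    fix y assume "y \<in> Z"
    then obtain N where "open N" "y \<in> N" "\<forall>g\<in>G. \<exists>p\<in>cl g. \<forall>a\<in>N. p a = a" unfolding Z_def by blast
    then show "\<exists>T. open T \<and> y \<in> T \<and> T \<subseteq> Z" unfolding Z_def by (intro exI[of _ N]) blast
  qed
  have "\<exists>O'. open O' \<and> O' \<noteq> {} \<and> O' \<subseteq> range q"
  proof -
    have h: "sholo (\<lambda>u. q (chart b u)) (ball w r)"
      by (rule sholo_limit[of "insert id G"]) (use M q D equi_id in auto)
    have "\<not> (\<lambda>u. q (chart b u)) constant_on (ball w r)"
      using nc unfolding constant_on_def by auto
    then obtain O' where "open O'" "O' \<noteq> {}" "O' \<subseteq> (\<lambda>u. q (chart b u)) ` ball w r"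
      by (rule sholo_image_interior[OF h open_ball connected_ball])
    then show ?thesis by (intro exI[of _ O']) auto
  qed
  then obtain O' where O': "open O'" "O' \<noteq> {}" "O' \<subseteq> range q" by blast
  have "\<exists>p\<in>cl g. \<forall>a\<in>O'. p a = a" if g: "g \<in> G" for g
  proof -
    obtain p where p: "p \<in> cl g" "p \<circ> q = q" using id_on_range[OF g] by blast
    have "p a = a" if "a \<in> O'" for a
      using that O'(3) fun_cong[OF p(2)] by (auto simp: comp_def)
    then show ?thesis using p(1) by blast
  qed
  then have Zne: "Z \<noteq> {}" using O' unfolding Z_def by blast
  \<comment> \<open>At a boundary point \<open>y\<close>, some \<open>g0\<close> leads into the
    Fatou set, so \<open>cl g0\<close> is equicontinuous on a disc \<open>D\<close> around
    \<open>y\<close>. This disc meets \<open>Z\<close>, and the identity on the common open piece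
    extends to all of \<open>D\<close>.\<close>
  have clZ: "y \<in> F \<and> y \<in> Z" if y: "y \<in> closure Z" for y
  proof -
    obtain g0 where g0: "g0 \<in> G" "g0 y \<in> F" by (rule to_fatou)
    have "open (g0 -` F)" using open_fatou cont[OF g0(1)] by (intro open_vimage)
    then obtain b w r where r: "r > 0" "y = chart b w" "chart b ` ball w r \<subseteq> g0 -` F"
      using disc_in_open g0(2) by (metis vimageI)
    define D where "D = chart b ` ball w r"
    have D: "open D" "y \<in> D" "D \<subseteq> g0 -` F" unfolding D_def using r by (auto intro: open_chart_image)
    then obtain y' where y': "y' \<in> D" "y' \<in> Z" using y closure_iff_nhds_not_empty[of y Z] by blast
    then obtain N where N: "open N" "y' \<in> N" "\<forall>g\<in>G. \<exists>p\<in>cl g. \<forall>a\<in>N. p a = a" unfolding Z_def by blast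
    have key: "\<exists>p\<in>cl g. \<forall>a\<in>D. p a = a"
      if g: "g \<in> G" and eq: "\<And>x. x \<in> D \<Longrightarrow> equi_at ((\<lambda>k. k \<circ> g) ` G) x" for g
    proof -
      obtain p where p: "p \<in> cl g" "\<forall>a\<in>N. p a = a" using N(3) g by blast
      have "p a = a" if "a \<in> D" for a
        by (rule identity_extends[of b w r "(\<lambda>k. k \<circ> g) ` G" p N])
           (use p eq N(1,2) y'(1) g comp_closed that in \<open>auto simp: D_def cl_def\<close>)
      then show ?thesis using p(1) by blast
    qed
    have eq0: "equi_at ((\<lambda>k. k \<circ> g0) ` G) x" if "x \<in> D" for x
      using that D(3) by (intro equi_at_compose fatou_equi_at cont g0(1)) auto
    obtain p0 where p0: "p0 \<in> cl g0" "\<forall>a\<in>D. p0 a = a" using key[OF g0(1) eq0] by blast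
    \<comment> \<open>On \<open>D\<close>, each \<open>k\<close> in \<open>G\<close> coincides with
      \<open>k o p0\<close>, a member of \<open>cl g0\<close>. So the equicontinuity of that family
      passes to \<open>G\<close> itself, and \<open>D\<close> turns out to lie in the Fatou
      set.\<close>
    have eqD: "equi_at G x" if x: "x \<in> D" for x unfolding equi_at_def
    proof (intro allI impI)
      fix e :: real assume e: "e > 0"
      obtain U where U: "open U" "x \<in> U" "\<forall>f\<in>cl g0. \<forall>y\<in>U. dist (f y) (f x) < e"
        unfolding cl_def by (rule equi_atD[OF equi_at_closure[OF eq0[OF x]] e])
      have "dist (k y) (k x) < e" if k: "k \<in> G" and y: "y \<in> U \<inter> D" for k y
      proof -
        have "k \<circ> p0 \<in> cl g0" unfolding cl_def
        proof (rule left_closed[OF k _ p0(1)[unfolded cl_def]])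
          fix k' assume "k' \<in> (\<lambda>k. k \<circ> g0) ` G"
          then obtain h where h: "h \<in> G" "k' = h \<circ> g0" by blast
          have "k \<circ> k' = (k \<circ> h) \<circ> g0" by (simp add: h comp_assoc)
          then show "k \<circ> k' \<in> (\<lambda>k. k \<circ> g0) ` G" using comp_closed[OF k h(1)] by (rule image_eqI)
        qed
        then have "dist ((k \<circ> p0) y) ((k \<circ> p0) x) < e" using U(3) y by blast
        then show ?thesis using p0(2) x y by simp
      qed
      then show "\<exists>U. open U \<and> x \<in> U \<and> (\<forall>f\<in>G. \<forall>y\<in>U. dist (f y) (f x) < e)"
        using U D x by (intro exI[of _ "U \<inter> D"]) auto
    qed
    have "y \<in> F" unfolding fatou_iff using D eqD by blast
    \<comment> \<open>With \<open>G\<close> equicontinuous on \<open>D\<close>, so is each subfamily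
      of right translates, and \<open>key\<close> becomes available for every \<open>g\<close>
      instead of \<open>g0\<close> alone.\<close>
    moreover have "\<exists>p\<in>cl g. \<forall>a\<in>D. p a = a" if g: "g \<in> G" for g
    proof (rule key[OF g])
      fix x assume x: "x \<in> D"
      show "equi_at ((\<lambda>k. k \<circ> g) ` G) x"
        by (rule equi_at_mono[OF eqD[OF x]]) (use comp_closed g in auto)
    qed
    then have "y \<in> Z" unfolding Z_def using D by blast
    ultimately show ?thesis by blast
  qed
  then have "closed Z" by (metis closure_subset closure_eq subsetI subset_antisym)
  then have "Z = UNIV" using connectedD[OF connected_rsphere openZ, of "- Z"] Zne by auto
  then show False using clZ julia unfolding julia_set_def by auto
qed

text \<open>The orbit closure of \<open>p\<close> contains a minimal left ideal, whose members are
  constant on the disc. \<open>g1\<close> moves the constant \<open>c\<close> into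
  \<open>O'\<close>, and \<open>g1 o q\<close> is approximated by actual maps \<open>g o p\<close>,
  uniformly on the closed disc, which the slack \<open>r < s\<close> makes a compact subset of the
  open one.\<close>

lemma contraction:
  assumes p: "p \<in> E" and D: "chart b ` ball w s \<subseteq> F" and r: "r < s" and O': "\<And>c. \<exists>g\<in>G. g c \<in> O'" and d: "d > 0"
  obtains g y where "g \<in> G" "y \<in> O'" "g ` p ` chart b ` cball w r \<subseteq> ball y d"
proof -
  define V where "V = chart b ` cball w r"
  have Gp: "(\<lambda>g. g \<circ> p) ` G \<subseteq> E" using E_left[OF _ p] by auto
  define C where "C = closure ((\<lambda>g. g \<circ> p) ` G)"
  have CE: "C \<subseteq> E" unfolding C_def by (rule closure_minimal[OF Gp]) simp
  have "compact C" unfolding C_def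
    using compact_Int_closed[OF compact_UNIV_fun[OF compact_rsphere] closed_closure] by simp
  moreover have "G \<noteq> {}" using O' by blast
  moreover have "h \<circ> k \<in> C" if "h \<in> G" "k \<in> C" for h k
    using that unfolding C_def
    by (elim left_closed[rotated 2]) (auto simp: comp_assoc[symmetric] intro!: imageI intro: comp_closed)
  ultimately have "forward_invariant_compact ((\<lambda>g p. g \<circ> p) ` G) C"
    unfolding forward_invariant_compact_def by (auto simp: C_def)
  then obtain M where M: "M \<in> minimal_sets ((\<lambda>g p. g \<circ> p) ` G)" "M \<subseteq> C" by (rule minimal_set_exists) (rule compact_imp_closed_fun)
  then obtain q where q: "q \<in> M" unfolding minimal_sets_def forward_invariant_compact_def by blast
  have "q constant_on (chart b ` ball w s)"
    using minimal_limit_constant[OF M(1) _ q D] M(2) CE by blast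
  then obtain c where c: "\<And>x. x \<in> chart b ` ball w s \<Longrightarrow> q x = c" unfolding constant_on_def by blast
  have VD: "V \<subseteq> chart b ` ball w s" unfolding V_def using r by auto
  obtain g1 where g1: "g1 \<in> G" "g1 c \<in> O'" using O' by blast
  have "g1 \<circ> q \<in> closure ((\<lambda>g. g \<circ> p) ` G)"
    using M q g1(1) unfolding minimal_sets_def forward_invariant_compact_def C_def by auto
  moreover have "compact V" unfolding V_def by (intro compact_continuous_image continuous_on_chart compact_cball)
  moreover have "equi_at ((\<lambda>g. g \<circ> p) ` G) x" if "x \<in> V" for x
    using equi_at_mono[OF equi_at_closure[OF equi_id] Gp] that VD D by blast
  ultimately obtain f where f: "f \<in> (\<lambda>g. g \<circ> p) ` G" "\<forall>x\<in>V. dist (f x) ((g1 \<circ> q) x) < d"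
    using d by (rule closure_approx_uniform)
  then obtain g where g: "g \<in> G" "f = g \<circ> p" by blast
  have "g ` p ` V \<subseteq> ball (g1 c) d"
  proof -
    have "dist (g1 c) (g (p x)) < d" if "x \<in> V" for x
      using f(2) that c[of x] VD that g(2) by (auto simp: dist_commute)
    then show ?thesis by auto
  qed
  then show ?thesis using that[OF g(1) g1(2)] unfolding V_def by simp
qed

end

section \<open>The Riesz representation theorem on compact metric spaces\<close>

text \<open>\<open>L\<close> is total but constrained only on continuous functions. It will be a
  limit of integrals, and the representing measure will be the weak limit of the measures.\<close>

locale positive_functional =
  fixes L :: "('a::metric_space \<Rightarrow> real) \<Rightarrow> real"
  assumes compact_space: "compact (UNIV :: 'a set)"
    and add: "continuous_on UNIV f \<Longrightarrow> continuous_on UNIV g \<Longrightarrow> L (\<lambda>x. f x + g x) = L f + L g"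
    and scale: "continuous_on UNIV f \<Longrightarrow> L (\<lambda>x. c * f x) = c * L f"
    and pos: "continuous_on UNIV f \<Longrightarrow> (\<And>x. 0 \<le> f x) \<Longrightarrow> 0 \<le> L f"
    and one: "L (\<lambda>_. 1) = 1"
begin

lemma const: "L (\<lambda>_. c) = c"
  using scale[of "\<lambda>_. 1" c] by (simp add: one)

lemma mono:
  assumes "continuous_on UNIV f" "continuous_on UNIV g" "\<And>x. f x \<le> g x" shows "L f \<le> L g"
proof -
  have c: "continuous_on UNIV (\<lambda>x. g x + (-1) * f x)" by (intro continuous_intros assms)
  have "L (\<lambda>x. g x + (-1) * f x) = L g + L (\<lambda>x. (-1) * f x)"
    by (rule add) (intro continuous_intros assms)+
  also have "L (\<lambda>x. (-1) * f x) = - L f" by (subst scale[OF assms(1)]) simp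
  finally show ?thesis using pos[OF c] assms(3) by simp
qed

lemma L_sum:
  assumes "finite I" "\<And>i. i \<in> I \<Longrightarrow> continuous_on UNIV (f i)"
  shows "L (\<lambda>x. \<Sum>i\<in>I. f i x) = (\<Sum>i\<in>I. L (f i))"
  using assms
proof (induction I rule: finite_induct)
  case (insert i I)
  have "L (\<lambda>x. f i x + (\<Sum>i\<in>I. f i x)) = L (f i) + L (\<lambda>x. \<Sum>i\<in>I. f i x)"
    by (rule add) (intro continuous_intros insert.prems; simp)+
  then show ?case using insert by simp
qed (simp add: const)

section \<open>The outer measure induced by a positive functional\<close>

definition below :: "'a set \<Rightarrow> ('a \<Rightarrow> real) set" where
  "below U = {f. continuous_on UNIV f \<and> (\<forall>x. 0 \<le> f x \<and> f x \<le> indicator U x)}"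

definition open_size :: "'a set \<Rightarrow> real" where "open_size U = Sup (L ` below U)"

definition outer :: "'a set \<Rightarrow> real" where "outer A = Inf (open_size ` {U. open U \<and> A \<subseteq> U})"

lemma below_iff:
  "f \<in> below U \<longleftrightarrow> continuous_on UNIV f \<and> (\<forall>x. 0 \<le> f x) \<and> (\<forall>x. f x \<le> 1) \<and> (\<forall>x. x \<notin> U \<longrightarrow> f x = 0)"
proof -
  have "0 \<le> f x \<and> f x \<le> indicator U x \<longleftrightarrow> 0 \<le> f x \<and> f x \<le> 1 \<and> (x \<notin> U \<longrightarrow> f x = 0)" for x
    by (cases "x \<in> U") auto
  then show ?thesis unfolding below_def by auto
qed

lemma below_bounds: "f \<in> below U \<Longrightarrow> 0 \<le> L f \<and> L f \<le> 1"
proof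
  assume f: "f \<in> below U"
  show "0 \<le> L f" using f by (intro pos) (auto simp: below_def)
  have "f x \<le> 1" for x using f by (simp add: below_iff)
  then have "L f \<le> L (\<lambda>_. 1)" using f by (intro mono) (auto simp: below_def)
  then show "L f \<le> 1" by (simp add: one)
qed

lemma zero_below: "(\<lambda>_. 0) \<in> below U" by (simp add: below_def)

lemma bdd_below_image: "bdd_above (L ` below U)"
  using below_bounds by (intro bdd_aboveI[of _ 1]) auto

lemma below_le: "f \<in> below U \<Longrightarrow> L f \<le> open_size U"
  unfolding open_size_def by (rule cSUP_upper[OF _ bdd_below_image])

lemma open_size_least: "(\<And>f. f \<in> below U \<Longrightarrow> L f \<le> c) \<Longrightarrow> open_size U \<le> c"
  unfolding open_size_def using zero_below by (intro cSUP_least) auto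

lemma open_size_nonneg: "0 \<le> open_size U"
  using below_le[OF zero_below] const[of 0] by simp

lemma open_size_le_1: "open_size U \<le> 1"
  using below_bounds by (intro open_size_least) auto

lemma open_size_mono: "U \<subseteq> V \<Longrightarrow> open_size U \<le> open_size V"
proof (rule open_size_least)
  fix f assume "U \<subseteq> V" "f \<in> below U"
  then have "f \<in> below V" unfolding below_iff by auto
  then show "L f \<le> open_size V" by (rule below_le)
qed

lemma open_size_UNIV: "open_size UNIV = 1"
  using below_le[of "\<lambda>_. 1" UNIV] open_size_le_1[of UNIV] by (simp add: below_def one)

lemma bdd_outer: "bdd_below (open_size ` {U. open U \<and> A \<subseteq> U})"
  using open_size_nonneg by (intro bdd_belowI[of _ 0]) auto

lemma outer_le: "open U \<Longrightarrow> A \<subseteq> U \<Longrightarrow> outer A \<le> open_size U"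
  unfolding outer_def by (intro cINF_lower[OF bdd_outer]) simp

lemma outer_greatest: "(\<And>U. open U \<Longrightarrow> A \<subseteq> U \<Longrightarrow> c \<le> open_size U) \<Longrightarrow> c \<le> outer A"
  unfolding outer_def by (intro cINF_greatest) auto

lemma outer_open: "open U \<Longrightarrow> outer U = open_size U"
  by (intro antisym outer_le outer_greatest open_size_mono) auto

lemma outer_nonneg: "0 \<le> outer A" by (intro outer_greatest open_size_nonneg)

lemma outer_mono: "A \<subseteq> B \<Longrightarrow> outer A \<le> outer B"
  by (intro outer_greatest outer_le) auto

lemma outer_approx:
  assumes "e > 0" shows "\<exists>U. open U \<and> A \<subseteq> U \<and> open_size U < outer A + e"
proof (rule ccontr)
  assume "\<not> ?thesis"
  then have "outer A + e \<le> outer A" by (intro outer_greatest) (auto simp: not_less)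
  then show False using assms by simp
qed

text \<open>A Lipschitz cut-off that reaches 1 at depth \<open>d\<close> inside \<open>U\<close>.
  The full space is treated apart because \<open>infdist\<close> to the empty set has the default
  value 0.\<close>

definition bump :: "'a set \<Rightarrow> real \<Rightarrow> 'a \<Rightarrow> real" where
  "bump U d x = (if U = UNIV then 1 else min 1 (infdist x (- U) / d))"

lemma bump_below: "open U \<Longrightarrow> d > 0 \<Longrightarrow> bump U d \<in> below U"
  unfolding below_def bump_def
  by (cases "U = UNIV") (auto intro!: continuous_intros simp: indicator_def infdist_nonneg)

lemma bump_eq_1:
  assumes "ball x d \<subseteq> U" "d > 0" shows "bump U d x = 1"
proof (cases "U = UNIV")
  case False
  then have ne: "- U \<noteq> {}" by auto
  have "d \<le> dist x a" if "a \<in> - U" for a using assms that by (force simp: not_less[symmetric])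
  then have "d \<le> infdist x (- U)"
    unfolding infdist_notempty[OF ne] using ne by (intro cINF_greatest) auto
  then show ?thesis using assms False by (simp add: bump_def)
qed (simp add: bump_def)

text \<open>The set where \<open>f\<close> is at least \<open>e\<close> is compact, hence covered by
  finitely many \<open>U i\<close>. A Lebesgue number \<open>d\<close> makes some
  \<open>bump (U i) d\<close> equal to 1 at each of its points, so \<open>f\<close> is at most
  \<open>e\<close> plus a finite sum of functions below the \<open>U i\<close>.\<close>

lemma open_size_Union:
  fixes U :: "nat \<Rightarrow> 'a set"
  assumes op: "\<And>i. open (U i)"
  shows "ennreal (open_size (\<Union>i. U i)) \<le> (\<Sum>i. ennreal (open_size (U i)))"
proof (cases "(\<Sum>i. ennreal (open_size (U i))) = top")
  case False
  have sm: "summable (\<lambda>i. open_size (U i))"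
    by (rule summable_suminf_not_top[OF open_size_nonneg False])
  have "open_size (\<Union>i. U i) \<le> (\<Sum>i. open_size (U i))"
  proof (rule open_size_least, rule field_le_epsilon)
    fix f and e :: real assume f: "f \<in> below (\<Union>i. U i)" and e: "e > 0"
    have cf: "continuous_on UNIV f" and f01: "\<And>x. 0 \<le> f x" "\<And>x. f x \<le> 1" and fU: "\<And>x. x \<notin> (\<Union>i. U i) \<Longrightarrow> f x \<le> 0"
      using f unfolding below_iff by auto
    define C where "C = f -` {e..}"
    have "closed C" unfolding C_def by (rule closed_vimage[OF _ cf]) simp
    then have C: "compact C" using compact_Int_closed[OF compact_space] by simp
    have "C \<subseteq> (\<Union>i. U i)" using fU e unfolding C_def by force
    with compactE_image[OF C, of UNIV U] op obtain I where I: "finite I" "C \<subseteq> (\<Union>i\<in>I. U i)" by metis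
    obtain d where d: "d > 0" "\<And>x. x \<in> C \<Longrightarrow> \<exists>G\<in>U ` I. ball x d \<subseteq> G"
      using Heine_Borel_lemma[OF C I(2)] op by blast
    define h where "h i x = min (f x) (bump (U i) d x)" for i x
    have h: "h i \<in> below (U i)" for i
    proof -
      have b: "bump (U i) d \<in> below (U i)" by (rule bump_below[OF op d(1)])
      have "continuous_on UNIV (h i)"
        unfolding h_def[abs_def] using b by (intro continuous_intros cf) (simp add: below_def)
      moreover have "0 \<le> h i x" "h i x \<le> indicator (U i) x" for x
        using b f01[of x] unfolding below_def h_def by (auto simp: min_le_iff_disj)
      ultimately show ?thesis by (simp add: below_def)
    qed
    have le: "f x \<le> e + (\<Sum>i\<in>I. h i x)" for x
    proof -
      have hn: "0 \<le> h i x" for i using h[of i] by (simp add: below_def)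
      show ?thesis
      proof (cases "x \<in> C")
        case True
        then obtain i where i: "i \<in> I" "ball x d \<subseteq> U i" using d(2) by blast
        then have "h i x = f x" using f01(2)[of x] d(1) by (simp add: h_def bump_eq_1)
        moreover have "h i x \<le> (\<Sum>i\<in>I. h i x)" by (rule member_le_sum[OF i(1) hn I(1)])
        ultimately show ?thesis using e by simp
      next
        case False
        then have "f x < e" by (simp add: C_def)
        then show ?thesis using sum_nonneg[of I "\<lambda>i. h i x"] hn by (simp add: add_increasing2 less_imp_le)
      qed
    qed
    have ch: "continuous_on UNIV (h i)" for i using h[of i] by (simp add: below_def)
    have "L f \<le> L (\<lambda>x. e + (\<Sum>i\<in>I. h i x))"
      by (rule mono[OF cf _ le]) (intro continuous_intros ch)
    also have "\<dots> = e + (\<Sum>i\<in>I. L (h i))"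
      by (subst add) (auto intro!: continuous_intros ch simp: const L_sum[OF I(1) ch])
    also have "(\<Sum>i\<in>I. L (h i)) \<le> (\<Sum>i\<in>I. open_size (U i))" by (intro sum_mono below_le h)
    also have "\<dots> \<le> (\<Sum>i. open_size (U i))" by (intro sum_le_suminf sm I ballI open_size_nonneg)
    finally show "L f \<le> (\<Sum>i. open_size (U i)) + e" by simp
  qed
  then show ?thesis by (simp add: suminf_ennreal2[OF open_size_nonneg sm] ennreal_leI)
qed simp

lemma outer_measure_space_outer: "outer_measure_space UNIV (\<lambda>A. ennreal (outer A))"
  unfolding outer_measure_space_def
proof (intro conjI)
  have "open_size {} \<le> 0"
  proof (rule open_size_least)
    fix f assume "f \<in> below {}"
    then have "f = (\<lambda>_. 0)" by (auto simp: below_def fun_eq_iff intro!: antisym)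
    then show "L f \<le> 0" by (simp add: const)
  qed
  then have "outer {} = 0" using outer_open[of "{}"] open_size_nonneg[of "{}"] by simp
  then show "positive UNIV (\<lambda>A. ennreal (outer A))" by (simp add: positive_def)
  show "increasing UNIV (\<lambda>A. ennreal (outer A))"
    by (auto simp: increasing_def intro!: ennreal_leI outer_mono)
  show "countably_subadditive UNIV (\<lambda>A. ennreal (outer A))"
    unfolding countably_subadditive_def
  proof (intro allI impI)
    fix A :: "nat \<Rightarrow> 'a set"
    show "ennreal (outer (\<Union>i. A i)) \<le> (\<Sum>i. ennreal (outer (A i)))"
    proof (rule ennreal_le_epsilon)
      fix e :: real assume e: "e > 0"
      have "\<exists>U. open U \<and> A i \<subseteq> U \<and> open_size U < outer (A i) + e * (1/2) ^ Suc i" for i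
        using e by (intro outer_approx) simp
      then obtain U where U: "\<And>i. open (U i)" "\<And>i. A i \<subseteq> U i" "\<And>i. open_size (U i) < outer (A i) + e * (1/2) ^ Suc i"
        by metis
      have "ennreal (outer (\<Union>i. A i)) \<le> ennreal (open_size (\<Union>i. U i))"
        using U by (intro ennreal_leI outer_le open_UN) blast+
      also have "\<dots> \<le> (\<Sum>i. ennreal (open_size (U i)))" by (rule open_size_Union[OF U(1)])
      also have "\<dots> \<le> (\<Sum>i. ennreal (outer (A i)) + ennreal (e * (1/2) ^ Suc i))"
        using U(3) outer_nonneg e by (intro suminf_le) (auto simp: ennreal_plus[symmetric] less_imp_le intro!: ennreal_leI simp del: ennreal_plus)
      also have "\<dots> = (\<Sum>i. ennreal (outer (A i))) + (\<Sum>i. ennreal (e * (1/2) ^ Suc i))"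
        by (intro suminf_add[symmetric]) auto
      also have "(\<Sum>i. ennreal (e * (1/2) ^ Suc i)) = ennreal e"
      proof (rule suminf_ennreal_eq)
        show "(\<lambda>i. e * (1/2) ^ Suc i) sums e"
          using sums_mult[OF power_half_series, of e] by simp
      qed (use e in simp)
      finally show "ennreal (outer (\<Union>i. A i)) \<le> (\<Sum>i. ennreal (outer (A i))) + ennreal e" .
    qed
  qed
qed

text \<open>Lowering \<open>f\<close> by \<open>e\<close> confines it to a closed set
  \<open>C\<close> inside \<open>U \<inter> V\<close>. Such a function can be added to any
  \<open>g\<close> below \<open>V - C\<close> without exceeding the indicator of \<open>V\<close>.
  So \<open>L f\<close>, up to \<open>e\<close>, and the size of \<open>V - C\<close>, which
  contains \<open>V - U\<close>, share the size of \<open>V\<close>.\<close>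

lemma open_in_lambda_system:
  assumes U: "open U" shows "U \<in> lambda_system UNIV UNIV (\<lambda>A. ennreal (outer A))"
  unfolding lambda_system_def
proof (intro CollectI conjI ballI)
  fix A :: "'a set"
  have *: "outer (U \<inter> A) + outer ((UNIV - U) \<inter> A) \<le> outer A"
  proof (rule outer_greatest)
    fix V assume V: "open V" "A \<subseteq> V"
    have "open_size (U \<inter> V) \<le> open_size V - outer (V - U)"
    proof (rule open_size_least, rule field_le_epsilon)
      fix f and e :: real assume f: "f \<in> below (U \<inter> V)" and e: "e > 0"
      have cf: "continuous_on UNIV f" and f01: "\<And>x. 0 \<le> f x" and fUV: "\<And>x. f x \<le> indicator (U \<inter> V) x"
        using f unfolding below_def by auto
      define C where "C = f -` {e..}"
      have "closed C" unfolding C_def by (rule closed_vimage[OF _ cf]) simp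
      then have W: "open (V - C)" using V by blast
      have CU: "x \<in> U \<inter> V" if "x \<in> C" for x using fUV[of x] that e unfolding C_def by (cases "x \<in> U \<inter> V") auto
      define f' where "f' x = max (f x - e) 0" for x
      have cf': "continuous_on UNIV f'" unfolding f'_def by (intro continuous_intros cf)
      have "open_size (V - C) \<le> open_size V - L f'"
      proof (rule open_size_least)
        fix g assume g: "g \<in> below (V - C)"
        have cg: "continuous_on UNIV g" using g by (simp add: below_def)
        have "(\<lambda>x. f' x + g x) \<in> below V" unfolding below_def
        proof (intro CollectI conjI allI)
          show "continuous_on UNIV (\<lambda>x. f' x + g x)" by (intro continuous_intros cf' cg)
          fix x
          have gx: "0 \<le> g x" "g x \<le> indicator (V - C) x" using g by (auto simp: below_def)
          show "0 \<le> f' x + g x" using gx by (simp add: f'_def)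
          show "f' x + g x \<le> indicator V x"
          proof (cases "x \<in> C")
            case True
            then have "g x = 0" "x \<in> V" using gx CU by (auto simp: indicator_def)
            moreover have "f x \<le> 1" using fUV[of x] by (metis indicator_le_1 order_trans)
            ultimately show ?thesis using e by (simp add: f'_def)
          next
            case False
            then have "f' x = 0" by (simp add: f'_def C_def)
            then show ?thesis using gx(2) False by (simp add: indicator_def)
          qed
        qed
        from below_le[OF this] show "L g \<le> open_size V - L f'" by (simp add: add[OF cf' cg])
      qed
      moreover have "L f \<le> L f' + e"
      proof -
        have "L f \<le> L (\<lambda>x. f' x + e)" by (rule mono[OF cf]) (auto simp: f'_def intro!: continuous_intros cf)
        also have "\<dots> = L f' + e" by (subst add[OF cf']) (auto simp: const)
        finally show ?thesis .
      qed
      moreover have "outer (V - U) \<le> open_size (V - C)"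
        using CU by (intro outer_le W) auto
      ultimately show "L f \<le> open_size V - outer (V - U) + e" by simp
    qed
    moreover have "outer (U \<inter> A) \<le> open_size (U \<inter> V)" using U V by (intro outer_le) auto
    moreover have "outer ((UNIV - U) \<inter> A) \<le> outer (V - U)" using V by (intro outer_mono) auto
    ultimately show "outer (U \<inter> A) + outer ((UNIV - U) \<inter> A) \<le> open_size V" by simp
  qed
  have "outer A \<le> outer (U \<inter> A) + outer ((UNIV - U) \<inter> A)"
  proof (rule field_le_epsilon)
    fix e :: real assume "e > 0"
    then have e2: "e/2 > 0" by simp
    obtain V where V: "open V" "U \<inter> A \<subseteq> V" "open_size V < outer (U \<inter> A) + e/2" using outer_approx[OF e2] by blast
    obtain W where W: "open W" "(UNIV - U) \<inter> A \<subseteq> W" "open_size W < outer ((UNIV - U) \<inter> A) + e/2" using outer_approx[OF e2] by blast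
    \<comment> \<open>Padding the pair with empty sets derives finite subadditivity from the
      countable one.\<close>
    define X where "X i = (if i = 0 then V else if i = Suc 0 then W else {})" for i :: nat
    have "(\<Union>i. X i) = V \<union> W" by (auto simp: X_def split: if_splits)
    moreover have "(\<Sum>i. ennreal (open_size (X i))) = ennreal (open_size V) + ennreal (open_size W)"
    proof -
      have "outer {} = 0" using outer_measure_space_outer outer_nonneg[of "{}"]
        by (simp add: outer_measure_space_def positive_def ennreal_eq_0_iff)
      then have "open_size {} = 0" using outer_open[of "{}"] by simp
      then have "(\<Sum>i. ennreal (open_size (X i))) = (\<Sum>i<2. ennreal (open_size (X i)))"
        by (intro suminf_finite) (auto simp: X_def)
      then show ?thesis by (simp add: X_def numeral_2_eq_2)
    qed
    ultimately have "ennreal (open_size (V \<union> W)) \<le> ennreal (open_size V) + ennreal (open_size W)"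
      using open_size_Union[of X] V W by (simp add: X_def)
    then have "open_size (V \<union> W) \<le> open_size V + open_size W"
      using open_size_nonneg by (simp add: ennreal_plus[symmetric] del: ennreal_plus)
    moreover have "outer A \<le> open_size (V \<union> W)" using V W by (intro outer_le) auto
    ultimately show "outer A \<le> outer (U \<inter> A) + outer ((UNIV - U) \<inter> A) + e" using V W by simp
  qed
  with * show "ennreal (outer (U \<inter> A)) + ennreal (outer ((UNIV - U) \<inter> A)) = ennreal (outer A)"
    using outer_nonneg by (simp add: ennreal_plus[symmetric] del: ennreal_plus)
qed simp

section \<open>The representing measure and its integral\<close>

definition rep :: "'a measure" where "rep = measure_of UNIV (sets borel) (\<lambda>A. ennreal (outer A))"

lemma rep_emeasure: "A \<in> sets borel \<Longrightarrow> emeasure rep A = ennreal (outer A)"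
  and sets_rep: "sets rep = sets borel"
proof -
  interpret sigma_algebra UNIV "UNIV :: 'a set set" by (metis Pow_UNIV sigma_algebra_Pow)
  let ?L = "lambda_system UNIV UNIV (\<lambda>A. ennreal (outer A))"
  have ms: "measure_space UNIV ?L (\<lambda>A. ennreal (outer A))" by (rule caratheodory_lemma[OF outer_measure_space_outer])
  have "sigma_sets UNIV (Collect open) \<subseteq> ?L"
    using ms open_in_lambda_system by (intro sigma_algebra.sigma_sets_subset) (auto simp: measure_space_def)
  then have sub: "sets borel \<subseteq> ?L" by (simp add: sets_borel)
  show s: "sets rep = sets borel" unfolding rep_def
    by (simp add: sets_measure_of_conv) (metis sets.sigma_sets_eq space_borel)
  have ca: "countably_additive (sets borel) (\<lambda>A. ennreal (outer A))"
    using ms sub unfolding measure_space_def countably_additive_def by (meson order_trans subsetD)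
  have "positive (sets borel) (\<lambda>A. ennreal (outer A))"
    using ms by (simp add: measure_space_def positive_def)
  then show "emeasure rep A = ennreal (outer A)" if "A \<in> sets borel"
    by (intro emeasure_measure_of[OF rep_def]) (use ca that s in auto)
qed

lemma rep_prob: "rep \<in> borel_probs"
proof -
  have "space rep = UNIV" using sets_eq_imp_space_eq[OF sets_rep] by simp
  then have "prob_space rep"
    using rep_emeasure[of UNIV] by (intro prob_spaceI) (simp add: outer_open open_size_UNIV)
  then show ?thesis by (simp add: borel_probs_def sets_rep)
qed

text \<open>\<open>f\<close> is cut into \<open>n\<close> horizontal layers \<open>g j\<close> of
  height 1/n. As \<open>n * g j\<close> lies below the superlevel set \<open>U j\<close>,
  \<open>L f\<close> is at most the mean of the measures of the \<open>U j\<close>. A point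
  \<open>x\<close> belongs to at most \<open>n * f x + 1\<close> of these sets, which costs an error
  of 1/n.\<close>

lemma L_le_integral:
  assumes cf: "continuous_on UNIV f" and f01: "\<And>x. 0 \<le> f x" "\<And>x. f x \<le> 1"
  shows "L f \<le> (\<integral>x. f x \<partial>rep)"
proof -
  interpret prob_space rep using rep_prob by (simp add: borel_probs_def)
  have fm: "f \<in> borel_measurable rep"
    using borel_measurable_continuous_onI[OF cf] by (simp add: sets_rep cong: measurable_cong_sets)
  have fi: "integrable rep f"
    by (rule integrable_const_bound[where B = 1]) (use f01 fm in auto)
  have "L f \<le> (\<integral>x. f x \<partial>rep) + 1 / real n" if n: "n > 0" for n
  proof -
    define g where "g j x = min (max (f x - real j / n) 0) (1 / n)" for j x
    define U where "U j = f -` {real j / n <..}" for j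
    have U: "open (U j)" for j unfolding U_def by (intro open_vimage cf) simp
    have iU: "integrable rep (\<lambda>x. indicator (U j) x / real n)" for j
    proof (rule integrable_divide)
      have "U j \<in> sets rep" using U by (simp add: sets_rep)
      then show "integrable rep (indicat_real (U j))"
        by (intro integrable_real_indicator) (simp_all add: less_top[symmetric])
    qed
    have cg: "continuous_on UNIV (g j)" for j unfolding g_def[abs_def] by (intro continuous_intros cf)
    have partial: "(\<Sum>j<m. g j x) = min (f x) (real m / n)" for m x
    proof (induction m)
      case 0 then show ?case using f01(1)[of x] by simp
    next
      case (Suc m)
      have "real (Suc m) / n = real m / n + 1 / n" by (simp add: add_divide_distrib add.commute)
      moreover have "min t s + min (max (t - s) 0) c = min t (s + c)" if "0 \<le> c" for t s c :: real
        using that by (auto simp: min_def max_def)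
      ultimately show ?case using Suc unfolding g_def by simp
    qed
    have "L f = L (\<lambda>x. \<Sum>j<n. g j x)" using n f01 by (simp add: partial min_absorb1)
    also have "\<dots> = (\<Sum>j<n. L (g j))" by (rule L_sum) (auto intro: cg)
    also have "\<dots> \<le> (\<Sum>j<n. measure rep (U j) / n)"
    proof (rule sum_mono)
      fix j
      have "(\<lambda>x. real n * g j x) \<in> below (U j)" unfolding below_def
      proof (intro CollectI conjI allI)
        show "continuous_on UNIV (\<lambda>x. real n * g j x)" by (intro continuous_intros cg)
        show "0 \<le> real n * g j x" for x by (simp add: g_def)
        fix x
        show "real n * g j x \<le> indicator (U j) x"
        proof (cases "x \<in> U j")
          case True
          have "g j x \<le> 1 / n" by (simp add: g_def)
          then show ?thesis using True n by (simp add: field_simps)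
        next
          case False
          then have "g j x = 0" by (simp add: g_def U_def not_less)
          then show ?thesis by simp
        qed
      qed
      from below_le[OF this] have "real n * L (g j) \<le> open_size (U j)" by (simp add: scale[OF cg])
      also have "open_size (U j) = measure rep (U j)"
        using rep_emeasure[of "U j"] U[of j] outer_nonneg[of "U j"] by (simp add: outer_open measure_def)
      finally show "L (g j) \<le> measure rep (U j) / n" using n by (simp add: field_simps)
    qed
    also have "\<dots> = (\<integral>x. (\<Sum>j<n. indicator (U j) x / n) \<partial>rep)"
      by (subst Bochner_Integration.integral_sum[OF iU]) (simp add: sets_eq_imp_space_eq[OF sets_rep])
    also have "\<dots> \<le> (\<integral>x. f x + 1 / n \<partial>rep)"
    proof (rule integral_mono)
      show "integrable rep (\<lambda>x. \<Sum>j<n. indicator (U j) x / real n)"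
        by (intro Bochner_Integration.integrable_sum iU)
      show "integrable rep (\<lambda>x. f x + 1 / n)" using fi by simp
      fix x
      have "(\<Sum>j<m. indicator (U j) x) \<le> min (real m) (n * f x + 1)" for m
      proof (induction m)
        case 0 then show ?case using f01(1)[of x] by simp
      next
        case (Suc m)
        show ?case
        proof (cases "x \<in> U m")
          case True
          then have "real m < n * f x" using n by (simp add: U_def field_simps)
          then show ?thesis using Suc True by simp
        qed (use Suc in simp)
      qed
      from this[of n] have "(\<Sum>j<n. indicator (U j) x) / n \<le> (n * f x + 1) / n"
        by (intro divide_right_mono) auto
      then show "(\<Sum>j<n. indicator (U j) x / n) \<le> f x + 1 / n"
        using n by (simp add: sum_divide_distrib add_divide_distrib)
    qed
    also have "\<dots> = (\<integral>x. f x \<partial>rep) + 1 / n" using fi by (simp add: prob_space)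
    finally show ?thesis .
  qed
  then have "\<forall>n>0. L f - (\<integral>x. f x \<partial>rep) \<le> 1 / real n" by (auto simp: algebra_simps)
  moreover have "\<exists>n>0. 1 / real n < L f - (\<integral>x. f x \<partial>rep)" if "L f - (\<integral>x. f x \<partial>rep) > 0"
    using real_arch_inverse[of "L f - (\<integral>x. f x \<partial>rep)"] that by (auto simp: inverse_eq_divide)
  ultimately show ?thesis by (force simp: not_less[symmetric])
qed

text \<open>For values in [0, 1], the missing inequality is \<open>L_le_integral\<close> for
  \<open>1 - g\<close>; an affine rescaling reduces the general case to this one.\<close>

lemma integral_rep:
  assumes cf: "continuous_on UNIV f" shows "(\<integral>x. f x \<partial>rep) = L f"
proof -
  interpret prob_space rep using rep_prob by (simp add: borel_probs_def)
  have eq01: "(\<integral>x. g x \<partial>rep) = L g" if cg: "continuous_on UNIV g" and g: "\<And>x. 0 \<le> g x" "\<And>x. g x \<le> 1" for g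
  proof (rule antisym)
    have gi: "integrable rep g"
    proof (rule integrable_const_bound[where B = 1])
      show "g \<in> borel_measurable rep"
        using borel_measurable_continuous_onI[OF cg] by (simp add: sets_rep cong: measurable_cong_sets)
    qed (use g in auto)
    have "L (\<lambda>x. 1 + (-1) * g x) \<le> (\<integral>x. 1 + (-1) * g x \<partial>rep)"
      by (rule L_le_integral) (use g in \<open>auto intro!: continuous_intros cg\<close>)
    moreover have "L (\<lambda>x. 1 + (-1) * g x) = 1 + L (\<lambda>x. (-1) * g x)"
      by (subst add) (auto intro!: continuous_intros cg simp: one)
    moreover have "L (\<lambda>x. (-1) * g x) = - L g" by (subst scale[OF cg]) simp
    moreover have "(\<integral>x. 1 + (-1) * g x \<partial>rep) = 1 - (\<integral>x. g x \<partial>rep)" using gi by (simp add: prob_space)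
    ultimately show "(\<integral>x. g x \<partial>rep) \<le> L g" by simp
  qed (rule L_le_integral[OF that])
  have "bounded (range f)" by (rule compact_imp_bounded[OF compact_continuous_image[OF cf compact_space]])
  then obtain B where B: "B > 0" "\<And>x. \<bar>f x\<bar> \<le> B" unfolding bounded_pos by auto
  define g where "g x = (f x + B) / (2 * B)" for x
  have cg: "continuous_on UNIV g" unfolding g_def by (intro continuous_intros cf) (use B in auto)
  have g01: "0 \<le> g x" "g x \<le> 1" for x
    using B(1) B(2)[of x] unfolding g_def by (auto simp: field_simps abs_le_iff)
  have gi: "integrable rep g"
  proof (rule integrable_const_bound[where B = 1])
    show "g \<in> borel_measurable rep"
      using borel_measurable_continuous_onI[OF cg] by (simp add: sets_rep cong: measurable_cong_sets)
  qed (use g01 in auto)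
  have fg: "f = (\<lambda>x. 2 * B * g x + (- B))" using B by (auto simp: g_def field_simps)
  have "(\<integral>x. f x \<partial>rep) = 2 * B * (\<integral>x. g x \<partial>rep) - B" using gi by (subst fg) (simp add: prob_space)
  also have "\<dots> = 2 * B * L g - B" by (simp add: eq01[OF cg g01])
  also have "\<dots> = L (\<lambda>x. 2 * B * g x + (- B))"
  proof -
    have "L (\<lambda>x. 2 * B * g x + (- B)) = L (\<lambda>x. 2 * B * g x) + L (\<lambda>_. - B)"
      by (rule add) (auto intro!: continuous_intros cg)
    then show ?thesis using scale[OF cg, of "2 * B"] const[of "- B"] by simp
  qed
  also have "\<dots> = L f" by (rule arg_cong[OF fg[symmetric]])
  finally show ?thesis .
qed

end

section \<open>Dimension of spaces with finitely many real coordinates\<close>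

text \<open>Together the clauses say that \<open>X\<close> carries the topology pulled back along
  the coordinates. No embedding into a Euclidean space is chosen, so that subspaces and smaller
  index sets keep the same functions \<open>f\<close>.\<close>

definition real_coords :: "'a topology \<Rightarrow> 'i set \<Rightarrow> ('i \<Rightarrow> 'a \<Rightarrow> real) \<Rightarrow> bool" where
  "real_coords X I f \<longleftrightarrow> (\<forall>i\<in>I. continuous_map X euclideanreal (f i)) \<and>
     (\<forall>V a. openin X V \<longrightarrow> a \<in> V \<longrightarrow> (\<exists>e>0. \<forall>y\<in>topspace X. (\<forall>i\<in>I. \<bar>f i y - f i a\<bar> < e) \<longrightarrow> y \<in> V))"

lemma real_coords_cont: "real_coords X I f \<Longrightarrow> i \<in> I \<Longrightarrow> continuous_map X euclideanreal (f i)"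
  by (simp add: real_coords_def)

lemma real_coords_nhd:
  assumes "real_coords X I f" "openin X V" "a \<in> V"
  obtains e where "e > 0" "\<forall>y\<in>topspace X. (\<forall>i\<in>I. \<bar>f i y - f i a\<bar> < e) \<longrightarrow> y \<in> V"
  using assms unfolding real_coords_def by meson

lemma real_coords_subtopology:
  assumes "real_coords X I f" shows "real_coords (subtopology X S) I f"
  unfolding real_coords_def
proof (intro conjI ballI allI impI)
  show "continuous_map (subtopology X S) euclideanreal (f i)" if "i \<in> I" for i
    using real_coords_cont[OF assms that] by (rule continuous_map_from_subtopology)
  fix V a assume "openin (subtopology X S) V" "a \<in> V"
  then obtain T where T: "openin X T" "V = T \<inter> S" "a \<in> T" by (auto simp: openin_subtopology)
  obtain e where "e > 0" "\<forall>y\<in>topspace X. (\<forall>i\<in>I. \<bar>f i y - f i a\<bar> < e) \<longrightarrow> y \<in> T"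
    by (rule real_coords_nhd[OF assms T(1,3)])
  then show "\<exists>e>0. \<forall>y\<in>topspace (subtopology X S). (\<forall>i\<in>I. \<bar>f i y - f i a\<bar> < e) \<longrightarrow> y \<in> V"
    using T by (intro exI[of _ e]) auto
qed

text \<open>Frontiers are formed in different spaces, \<open>O'\<close> and \<open>X\<close>.
  Shrinking to the sublevel set \<open>W\<close>, whose closed version \<open>C\<close> lies inside
  \<open>O'\<close>, keeps the closure of \<open>U\<close> inside \<open>O'\<close>, and then both
  frontiers of \<open>U\<close> coincide.\<close>

lemma real_coords_local_dim:
  assumes X: "real_coords X I f" and fin: "finite I" and n: "-1 \<le> n"
    and loc: "\<And>a. a \<in> topspace X \<Longrightarrow> \<exists>U. openin X U \<and> a \<in> U \<and> subtopology X U dim_le n"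
  shows "X dim_le n"
proof (rule dimension_le.intros[OF n])
  fix V a assume V: "openin X V" "a \<in> V"
  then have a: "a \<in> topspace X" using openin_subset by blast
  then obtain O' where O': "openin X O'" "a \<in> O'" "subtopology X O' dim_le n" using loc by blast
  have "openin X (V \<inter> O')" "a \<in> V \<inter> O'" using V O' by auto
  then obtain e where e: "e > 0" "\<forall>y\<in>topspace X. (\<forall>i\<in>I. \<bar>f i y - f i a\<bar> < e) \<longrightarrow> y \<in> V \<inter> O'"
    by (rule real_coords_nhd[OF X])
  define s where "s y = (\<Sum>i\<in>I. \<bar>f i y - f i a\<bar>)" for y
  have s: "continuous_map X euclideanreal s"
    unfolding s_def[abs_def] by (intro continuous_intros fin real_coords_cont[OF X]) simp
  define W where "W = {y \<in> topspace X. s y \<in> {..<e/2}}"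
  define C where "C = {y \<in> topspace X. s y \<in> {..e/2}}"
  have W: "openin X W" unfolding W_def by (rule openin_continuous_map_preimage[OF s]) simp
  have aW: "a \<in> W" using e a by (simp add: W_def s_def)
  have C: "closedin X C" unfolding C_def by (rule closedin_continuous_map_preimage[OF s]) simp
  have CV: "C \<subseteq> V \<inter> O'"
  proof
    fix y assume y: "y \<in> C"
    have "\<bar>f i y - f i a\<bar> \<le> s y" if "i \<in> I" for i
      unfolding s_def by (rule member_le_sum[OF that _ fin]) simp
    then have "\<forall>i\<in>I. \<bar>f i y - f i a\<bar> < e" using y e(1) unfolding C_def by force
    then show "y \<in> V \<inter> O'" using y e(2) unfolding C_def by blast
  qed
  have WC: "W \<subseteq> C" unfolding W_def C_def by auto
  have "openin (subtopology X O') W" using W WC CV by (intro openin_subset_topspace_eq[THEN iffD2] openin_open_subtopology[THEN iffD2] O' conjI) auto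
  then obtain U where U: "a \<in> U" "U \<subseteq> W" "openin (subtopology X O') U"
     "subtopology (subtopology X O') ((subtopology X O') frontier_of U) dim_le (n - 1)"
    using O'(3) aW by (metis dimension_le.cases)
  have UX: "openin X U" using U(3) O'(1) by (simp add: openin_open_subtopology)
  have "X closure_of U \<subseteq> C" using U(2) WC C by (intro closure_of_minimal) auto
  then have "X closure_of U \<subseteq> O'" using CV by blast
  then have "(subtopology X O') frontier_of U = X frontier_of U"
    using U(3) UX O'(1) by (simp add: frontier_of_openin closure_of_subtopology_open inf_absorb2)
  moreover have "X frontier_of U \<subseteq> O'"
    using \<open>X closure_of U \<subseteq> O'\<close> by (auto simp: frontier_of_openin[OF UX])
  ultimately have "subtopology X (X frontier_of U) dim_le (n - 1)"
    using U(4) by (simp add: subtopology_subtopology inf_absorb2)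
  then show "\<exists>U. a \<in> U \<and> U \<subseteq> V \<and> openin X U \<and> subtopology X (X frontier_of U) dim_le n - 1"
    using U UX WC CV by (intro exI[of _ U]) auto
qed

lemma real_coords_drop_sphere:
  assumes X: "real_coords X I f" and fin: "finite I" and j: "j \<in> I" and \<sigma>: "\<sigma> = 1 \<or> \<sigma> = (-1::real)"
    and sph: "\<And>y. y \<in> topspace X \<Longrightarrow> (\<Sum>i\<in>I. (f i y - c i)\<^sup>2) = r"
    and side: "\<And>y. y \<in> topspace X \<Longrightarrow> 0 < \<sigma> * (f j y - c j)"
  shows "real_coords X (I - {j}) f"
  unfolding real_coords_def
proof (intro conjI ballI allI impI)
  show "continuous_map X euclideanreal (f i)" if "i \<in> I - {j}" for i
    using real_coords_cont[OF X] that by blast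
  fix V a assume V: "openin X V" "a \<in> V"
  then have a: "a \<in> topspace X" using openin_subset by blast
  obtain e where e: "e > 0" "\<forall>y\<in>topspace X. (\<forall>i\<in>I. \<bar>f i y - f i a\<bar> < e) \<longrightarrow> y \<in> V"
    by (rule real_coords_nhd[OF X V])
  define t where "t y = \<sigma> * (f j y - c j)" for y
  have tp: "0 < t y" if "y \<in> topspace X" for y using side[OF that] by (simp add: t_def)
  define M where "M = (\<Sum>i\<in>I - {j}. 2 * \<bar>f i a - c i\<bar> + 1)"
  have M: "M \<ge> 0" unfolding M_def by (intro sum_nonneg) simp
  \<comment> \<open>\<open>d * M\<close> bounds the change of the square of \<open>t\<close>;
    dividing by \<open>t a\<close> bounds the change of \<open>t\<close>, and the third bound makes
    this less than \<open>e\<close>. The cap 1 accounts for the summand 1 in \<open>M\<close>, the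
    cap \<open>e\<close> serves the remaining coordinates.\<close>
  define d where "d = min (min 1 e) (e * t a / (M + 1))"
  have d: "d > 0" "d \<le> 1" "d \<le> e" "d * (M + 1) \<le> e * t a"
  proof -
    have "d \<le> e * t a / (M + 1)" by (simp add: d_def)
    then show "d * (M + 1) \<le> e * t a" using M by (simp add: field_simps)
  qed (use e tp[OF a] M in \<open>auto simp: d_def\<close>)
  have "y \<in> V" if y: "y \<in> topspace X" "\<forall>i\<in>I - {j}. \<bar>f i y - f i a\<bar> < d" for y
  proof -
    have sq: "(t z)\<^sup>2 = r - (\<Sum>i\<in>I - {j}. (f i z - c i)\<^sup>2)" if "z \<in> topspace X" for z
      using sph[OF that] sum.remove[OF fin j, of "\<lambda>i. (f i z - c i)\<^sup>2"] \<sigma>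
      by (auto simp: t_def power_mult_distrib)
    have "\<bar>(t y)\<^sup>2 - (t a)\<^sup>2\<bar> = \<bar>\<Sum>i\<in>I - {j}. (f i a - c i)\<^sup>2 - (f i y - c i)\<^sup>2\<bar>"
      by (simp add: sq[OF y(1)] sq[OF a] sum_subtractf)
    also have "\<dots> \<le> (\<Sum>i\<in>I - {j}. \<bar>(f i a - c i)\<^sup>2 - (f i y - c i)\<^sup>2\<bar>)" by (rule sum_abs)
    also have "\<dots> \<le> (\<Sum>i\<in>I - {j}. d * (2 * \<bar>f i a - c i\<bar> + 1))"
    proof (rule sum_mono)
      fix i assume i: "i \<in> I - {j}"
      have "(f i a - c i)\<^sup>2 - (f i y - c i)\<^sup>2 = (f i a - f i y) * (2 * (f i a - c i) + (f i y - f i a))"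
        by (simp add: power2_eq_square algebra_simps)
      then have "\<bar>(f i a - c i)\<^sup>2 - (f i y - c i)\<^sup>2\<bar> = \<bar>f i y - f i a\<bar> * \<bar>2 * (f i a - c i) + (f i y - f i a)\<bar>"
        by (simp add: abs_mult abs_minus_commute)
      also have "\<dots> \<le> d * (2 * \<bar>f i a - c i\<bar> + 1)"
      proof (rule mult_mono)
        show "\<bar>f i y - f i a\<bar> \<le> d" using y(2) i by (simp add: less_imp_le)
        then show "\<bar>2 * (f i a - c i) + (f i y - f i a)\<bar> \<le> 2 * \<bar>f i a - c i\<bar> + 1"
          using d(2) abs_triangle_ineq[of "2 * (f i a - c i)" "f i y - f i a"] abs_mult[of 2 "f i a - c i"] by simp
      qed (use d in auto)
      finally show "\<bar>(f i a - c i)\<^sup>2 - (f i y - c i)\<^sup>2\<bar> \<le> d * (2 * \<bar>f i a - c i\<bar> + 1)" .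
    qed
    also have "\<dots> = d * M" by (simp add: M_def sum_distrib_left)
    also have "\<dots> < d * (M + 1)" using d(1) by simp
    also have "\<dots> \<le> e * t a" by (rule d)
    finally have "\<bar>(t y)\<^sup>2 - (t a)\<^sup>2\<bar> < e * t a" .
    moreover have "(t y)\<^sup>2 - (t a)\<^sup>2 = (t y - t a) * (t y + t a)" by (simp add: power2_eq_square algebra_simps)
    moreover have "\<bar>t y - t a\<bar> * t a \<le> \<bar>t y - t a\<bar> * (t y + t a)" using tp[OF y(1)] by (intro mult_left_mono) auto
    moreover have "\<bar>t y + t a\<bar> = t y + t a" using tp[OF a] tp[OF y(1)] by simp
    ultimately have "\<bar>t y - t a\<bar> * t a < e * t a" by (simp only: abs_mult)
    then have "\<bar>t y - t a\<bar> < e" using tp[OF a] by simp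
    moreover have "\<bar>t y - t a\<bar> = \<bar>f j y - f j a\<bar>" using \<sigma> by (auto simp: t_def)
    ultimately have "\<forall>i\<in>I. \<bar>f i y - f i a\<bar> < e" using y(2) d(3) by force
    then show ?thesis using e(2) y(1) by blast
  qed
  then show "\<exists>e>0. \<forall>y\<in>topspace X. (\<forall>i\<in>I - {j}. \<bar>f i y - f i a\<bar> < e) \<longrightarrow> y \<in> V"
    using d(1) by blast
qed

text \<open>Since the coordinates separate points, the sum of coordinate differences is a metric. It
  induces the topology of \<open>X\<close>, so compactness can be tested by sequences.\<close>

lemma real_coords_compact:
  assumes X: "real_coords X I f" and fin: "finite I"
    and inj: "\<And>x y. x \<in> topspace X \<Longrightarrow> y \<in> topspace X \<Longrightarrow> \<forall>i\<in>I. f i x = f i y \<Longrightarrow> x = y"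
    and seq: "\<And>\<sigma>. (\<And>n. \<sigma> n \<in> topspace X) \<Longrightarrow>
       \<exists>l\<in>topspace X. \<exists>r :: nat \<Rightarrow> nat. strict_mono r \<and> (\<forall>i\<in>I. (\<lambda>k. f i (\<sigma> (r k))) \<longlonglongrightarrow> f i l)"
  shows "compact_space X"
proof -
  define d where "d x y = (\<Sum>i\<in>I. \<bar>f i x - f i y\<bar>)" for x y
  interpret Metric_space "topspace X" d
  proof
    show "0 \<le> d x y" for x y unfolding d_def by (simp add: sum_nonneg)
    show "d x y = d y x" for x y unfolding d_def by (simp add: abs_minus_commute)
    show "d x y = 0 \<longleftrightarrow> x = y" if "x \<in> topspace X" "y \<in> topspace X" for x y
      using inj[OF that] fin unfolding d_def by (auto simp: sum_nonneg_eq_0_iff)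
    show "d x z \<le> d x y + d y z" for x y z
      unfolding d_def sum.distrib[symmetric] by (rule sum_mono) simp
  qed
  have d_ge: "\<bar>f i x - f i y\<bar> \<le> d x y" if "i \<in> I" for i x y
    unfolding d_def by (rule member_le_sum[OF that _ fin]) simp
  have "mtopology = X"
  proof (rule topology_eq[THEN iffD2], intro allI iffI)
    fix U assume U: "openin mtopology U"
    show "openin X U"
    proof (subst openin_subopen, intro ballI)
      fix x assume x: "x \<in> U"
      have xX: "x \<in> topspace X" using U x openin_subset by fastforce
      obtain r where r: "r > 0" "mball x r \<subseteq> U" using U x unfolding openin_mtopology by blast
      define B where "B = {y \<in> topspace X. d x y \<in> {..<r}}"
      have "continuous_map X euclideanreal (\<lambda>y. d x y)"
        unfolding d_def by (intro continuous_intros fin real_coords_cont[OF X]) simp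
      then have "openin X B" unfolding B_def by (rule openin_continuous_map_preimage) simp
      moreover have "x \<in> B" using xX r(1) mdist_zero[OF xX] by (simp add: B_def)
      moreover have "B \<subseteq> U" using r(2) xX by (auto simp: B_def subset_iff)
      ultimately show "\<exists>T. openin X T \<and> x \<in> T \<and> T \<subseteq> U" by blast
    qed
  next
    fix U assume U: "openin X U"
    show "openin mtopology U" unfolding openin_mtopology
    proof (intro conjI allI impI)
      show "U \<subseteq> topspace X" by (rule openin_subset[OF U])
      fix x assume x: "x \<in> U"
      obtain e where e: "e > 0" "\<forall>y\<in>topspace X. (\<forall>i\<in>I. \<bar>f i y - f i x\<bar> < e) \<longrightarrow> y \<in> U"
        by (rule real_coords_nhd[OF X U x])
      have "mball x e \<subseteq> U"
      proof
        fix y assume y: "y \<in> mball x e"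
        then have "\<bar>f i y - f i x\<bar> < e" if "i \<in> I" for i
          using d_ge[OF that, of x y] by (simp add: abs_minus_commute)
        then show "y \<in> U" using e(2) y by simp
      qed
      then show "\<exists>r>0. mball x r \<subseteq> U" using e(1) by blast
    qed
  qed
  moreover have "compact_space mtopology"
    unfolding compact_space_sequentially
  proof (intro allI impI)
    fix \<sigma> :: "nat \<Rightarrow> 'a" assume \<sigma>: "range \<sigma> \<subseteq> topspace X"
    then obtain l r where l: "l \<in> topspace X" "strict_mono (r :: nat \<Rightarrow> nat)"
      "\<forall>i\<in>I. (\<lambda>k. f i (\<sigma> (r k))) \<longlonglongrightarrow> f i l" using seq[of \<sigma>] by blast
    have "(\<lambda>k. d (\<sigma> (r k)) l) \<longlonglongrightarrow> (\<Sum>i\<in>I. \<bar>f i l - f i l\<bar>)"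
      unfolding d_def using l(3) by (intro tendsto_intros) auto
    moreover have "\<sigma> (r k) \<in> topspace X" for k using \<sigma> by auto
    ultimately have "limitin mtopology (\<sigma> \<circ> r) l sequentially"
      using l(1) by (simp add: limitin_metric_dist_null comp_def)
    then show "\<exists>l r. l \<in> topspace X \<and> strict_mono r \<and> limitin mtopology (\<sigma> \<circ> r) l sequentially"
      using l by blast
  qed
  ultimately show ?thesis by simp
qed

text \<open>Spheres around a point have small dimension: near each of their points the sphere equation
  expresses one coordinate through the others.\<close>

lemma real_coords_dim_le:
  assumes "finite I" "real_coords X I f" shows "X dim_le int (card I)"
  using assms
proof (induction "card I" arbitrary: I X)
  case 0
  then have I: "I = {}" by simp
  show ?case
  proof (rule dimension_le.intros)
    fix V a assume V: "openin X V" "a \<in> V"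
    obtain e where "e > 0" "\<forall>y\<in>topspace X. (\<forall>i\<in>I. \<bar>f i y - f i a\<bar> < e) \<longrightarrow> y \<in> V"
      by (rule real_coords_nhd[OF 0(3) V])
    \<comment> \<open>Without coordinates every non-empty open set is the whole space, whose
      frontier is empty and so has dimension -1.\<close>
    then have "topspace X \<subseteq> V" by (auto simp: I)
    then show "\<exists>U. a \<in> U \<and> U \<subseteq> V \<and> openin X U \<and> subtopology X (X frontier_of U) dim_le int (card I) - 1"
      using V openin_subset[OF V(1)]
      by (intro exI[of _ "topspace X"]) (auto simp: I frontier_of_openin closure_of_topspace)
  qed simp
next
  case (Suc n)
  note X = Suc(4) and fin = Suc(3)
  show ?case
  proof (rule dimension_le.intros)
    fix V a assume V: "openin X V" "a \<in> V"
    then have a: "a \<in> topspace X" using openin_subset by blast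
    obtain e where e: "e > 0" "\<forall>y\<in>topspace X. (\<forall>i\<in>I. \<bar>f i y - f i a\<bar> < e) \<longrightarrow> y \<in> V"
      by (rule real_coords_nhd[OF X V])
    define s where "s y = (\<Sum>i\<in>I. (f i y - f i a)\<^sup>2)" for y
    have s: "continuous_map X euclideanreal s"
      unfolding s_def[abs_def] by (intro continuous_intros fin real_coords_cont[OF X]) simp
    define U where "U = {y \<in> topspace X. s y \<in> {..<e\<^sup>2}}"
    define S where "S = {y \<in> topspace X. s y = e\<^sup>2}"
    have U: "openin X U" unfolding U_def by (rule openin_continuous_map_preimage[OF s]) simp
    have aU: "a \<in> U" using a e by (simp add: U_def s_def)
    have UV: "U \<subseteq> V"
    proof
      fix y assume y: "y \<in> U"
      have "\<bar>f i y - f i a\<bar> < e" if "i \<in> I" for i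
      proof -
        have "(f i y - f i a)\<^sup>2 \<le> s y" unfolding s_def by (rule member_le_sum[OF that _ fin]) simp
        then have "\<bar>f i y - f i a\<bar>\<^sup>2 < e\<^sup>2" using y by (simp add: U_def)
        then show ?thesis using e(1) power2_less_imp_less[of "\<bar>f i y - f i a\<bar>" e] by simp
      qed
      then show "y \<in> V" using e(2) y by (auto simp: U_def)
    qed
    have "closedin X {y \<in> topspace X. s y \<in> {..e\<^sup>2}}" by (rule closedin_continuous_map_preimage[OF s]) simp
    then have "X closure_of U \<subseteq> {y \<in> topspace X. s y \<in> {..e\<^sup>2}}"
      by (intro closure_of_minimal) (auto simp: U_def)
    then have fr: "X frontier_of U \<subseteq> S"
      unfolding frontier_of_openin[OF U] by (auto simp: U_def S_def not_less dest!: subsetD intro: antisym)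
    have S: "real_coords (subtopology X S) I f" by (rule real_coords_subtopology[OF X])
    have "subtopology X S dim_le int n"
    proof (rule real_coords_local_dim[OF S fin])
      fix b assume "b \<in> topspace (subtopology X S)"
      then have b: "b \<in> S" by simp
      \<comment> \<open>The radius is positive, so some coordinate of \<open>b\<close> differs from
        that of the centre; on the part of the sphere on the same side as \<open>b\<close>, this
        coordinate is redundant.\<close>
      have "\<exists>j\<in>I. f j b \<noteq> f j a"
      proof (rule ccontr)
        assume "\<not> ?thesis"
        then have "s b = 0" unfolding s_def by simp
        then show False using b e(1) by (simp add: S_def)
      qed
      then obtain j where j: "j \<in> I" "f j b \<noteq> f j a" by blast
      define \<sigma> :: real where "\<sigma> = (if f j b > f j a then 1 else -1)"
      define T where "T = {y \<in> topspace (subtopology X S). \<sigma> * (f j y - f j a) \<in> {0<..}}"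
      have "continuous_map (subtopology X S) euclideanreal (\<lambda>y. \<sigma> * (f j y - f j a))"
        by (intro continuous_map_real_mult continuous_map_diff real_coords_cont[OF S j(1)]) simp_all
      then have T: "openin (subtopology X S) T" unfolding T_def
        by (rule openin_continuous_map_preimage) simp
      have bT: "b \<in> T" using b j(2) by (auto simp: T_def \<sigma>_def S_def)
      have "real_coords (subtopology (subtopology X S) T) (I - {j}) f"
      proof (rule real_coords_drop_sphere[OF real_coords_subtopology[OF S] fin j(1), where \<sigma> = \<sigma> and c = "\<lambda>i. f i a" and r = "e\<^sup>2"])
        show "\<sigma> = 1 \<or> \<sigma> = -1" by (simp add: \<sigma>_def)
      qed (auto simp: T_def S_def s_def)
      moreover have cn: "n = card (I - {j})" using Suc(2) card_Suc_Diff1[OF fin j(1)] by simp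
      ultimately have "subtopology (subtopology X S) T dim_le int n"
        unfolding cn using fin by (intro Suc(1)[OF cn]) auto
      then show "\<exists>U. openin (subtopology X S) U \<and> b \<in> U \<and> subtopology (subtopology X S) U dim_le int n"
        using T bT by blast
    qed simp
    then have "subtopology X (X frontier_of U) dim_le int n" by (rule dimension_le_subtopologies[OF _ fr])
    then show "\<exists>U. a \<in> U \<and> U \<subseteq> V \<and> openin X U \<and> subtopology X (X frontier_of U) dim_le int (card I) - 1"
      using U UV aU Suc(2) by (intro exI[of _ U]) (simp add: Suc(2)[symmetric])
  qed simp
qed

section \<open>Contractions with relatively compact orbits\<close>

lemma norm_cscale: "norm (cscale c \<phi>) = norm c * norm \<phi>"
proof (rule antisym)
  have le: "norm (cscale c \<phi>) \<le> norm c * norm \<phi>" for c and \<phi> :: "'a \<Rightarrow>\<^sub>C complex"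
    by (rule norm_bound) (simp add: norm_mult mult_left_mono norm_bounded)
  show "norm (cscale c \<phi>) \<le> norm c * norm \<phi>" by (rule le)
  show "norm c * norm \<phi> \<le> norm (cscale c \<phi>)"
  proof (cases "c = 0")
    case False
    have "norm \<phi> = norm (cscale (1 / c) (cscale c \<phi>))" using False by simp
    also have "\<dots> \<le> norm (1 / c) * norm (cscale c \<phi>)" by (rule le)
    finally show ?thesis using False by (simp add: norm_divide field_simps)
  qed simp
qed

lemma cscale_diff: "cscale c (\<phi> - \<psi>) = cscale c \<phi> - cscale c \<psi>"
  by (rule cfun.scale_right_diff_distrib)

lemma continuous_cscale: "continuous_on S (cscale c)"
  unfolding continuous_on_iff dist_norm cscale_diff[symmetric] norm_cscale
proof (intro ballI allI impI)
  fix x :: "'a \<Rightarrow>\<^sub>C complex" and e :: real assume e: "e > 0"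
  have "norm c * norm (y - x) < e" if "norm (y - x) < e / (norm c + 1)" for y
  proof -
    have "norm (y - x) * (norm c + 1) < e" using that by (simp add: field_simps add_pos_nonneg)
    moreover have "norm c * norm (y - x) \<le> norm (y - x) * (norm c + 1)" by (simp add: algebra_simps)
    ultimately show ?thesis by linarith
  qed
  then show "\<exists>d>0. \<forall>x'\<in>S. norm (x' - x) < d \<longrightarrow> norm c * norm (x' - x) < e"
    using e by (intro exI[of _ "e / (norm c + 1)"]) (auto simp: add_nonneg_pos)
qed

lemma continuous_cscale_left: "continuous_on S (\<lambda>c. cscale c \<phi>)"
proof -
  have d: "dist (cscale c \<phi>) (cscale c' \<phi>) = dist c c' * norm \<phi>" for c c'
    unfolding dist_norm norm_cscale[symmetric] by (simp add: cfun.scale_left_diff_distrib)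
  show ?thesis unfolding continuous_on_iff d
  proof (intro ballI allI impI)
    fix x :: complex and e :: real assume e: "e > 0"
    have "dist y x * norm \<phi> < e" if "dist y x < e / (norm \<phi> + 1)" for y
    proof -
      have "dist y x * (norm \<phi> + 1) < e" using that by (simp add: field_simps add_pos_nonneg)
      moreover have "dist y x * norm \<phi> \<le> dist y x * (norm \<phi> + 1)" by (simp add: algebra_simps)
      ultimately show ?thesis by linarith
    qed
    then show "\<exists>d>0. \<forall>x'\<in>S. dist x' x < d \<longrightarrow> dist x' x * norm \<phi> < e"
      using e by (intro exI[of _ "e / (norm \<phi> + 1)"]) (auto simp: add_nonneg_pos)
  qed
qed

lemma strict_mono_nat_add:
  assumes "strict_mono (r :: nat \<Rightarrow> nat)" shows "r k + n \<le> r (k + n)"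
proof (induction n)
  case (Suc n)
  have "r (k + n) < r (k + Suc n)" using assms by (simp add: strict_mono_def)
  then show ?case using Suc by simp
qed simp

text \<open>The operator-theoretic side: the splitting rests on linearity, contraction and relative
  compactness of forward orbits; rational maps enter only when these are verified.\<close>

locale almost_periodic =
  fixes T :: "('a::topological_space \<Rightarrow>\<^sub>C complex) \<Rightarrow> ('a \<Rightarrow>\<^sub>C complex)"
  assumes T_add: "T (\<phi> + \<psi>) = T \<phi> + T \<psi>"
    and T_scale: "T (cscale c \<phi>) = cscale c (T \<phi>)"
    and T_contraction: "norm (T \<phi>) \<le> norm \<phi>"
    and compact_orbits: "\<exists>Q. compact Q \<and> (\<forall>n. (T ^^ n) \<phi> \<in> Q)"
begin

lemma T_0: "T 0 = 0" using T_add[of 0 0] by simp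

lemma T_diff: "T (\<phi> - \<psi>) = T \<phi> - T \<psi>"
  using T_add[of "\<phi> - \<psi>" \<psi>] by simp

lemma Tn_add: "(T ^^ n) (\<phi> + \<psi>) = (T ^^ n) \<phi> + (T ^^ n) \<psi>"
  by (induction n) (simp_all add: T_add)

lemma Tn_diff: "(T ^^ n) (\<phi> - \<psi>) = (T ^^ n) \<phi> - (T ^^ n) \<psi>"
  by (induction n) (simp_all add: T_diff)

lemma Tn_scale: "(T ^^ n) (cscale c \<phi>) = cscale c ((T ^^ n) \<phi>)"
  by (induction n) (simp_all add: T_scale)

lemma Tn_0: "(T ^^ n) 0 = 0"
  by (induction n) (simp_all add: T_0)

lemma Tn_le: "norm ((T ^^ n) \<phi>) \<le> norm \<phi>"
  by (induction n) (auto intro: order_trans[OF T_contraction])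

lemma Tn_mono: "m \<le> n \<Longrightarrow> norm ((T ^^ n) \<phi>) \<le> norm ((T ^^ m) \<phi>)"
  using Tn_le[of "n - m" "(T ^^ m) \<phi>"] by (simp add: funpow_add[symmetric, THEN fun_cong, unfolded comp_def])

lemma Tn_dist: "dist ((T ^^ n) \<phi>) ((T ^^ n) \<psi>) \<le> dist \<phi> \<psi>"
  unfolding dist_norm Tn_diff[symmetric] by (rule Tn_le)

text \<open>The backward orbit \<open>s\<close> is part of the data because \<open>T\<close> need
  not be injective. Once a finite spanning set is known, this set is the span of the eigenvectors
  with eigenvalue of modulus one.\<close>

definition reversible :: "('a \<Rightarrow>\<^sub>C complex) set" where
  "reversible = {\<psi>. \<exists>Q s. compact Q \<and> s 0 = \<psi> \<and> (\<forall>n. s n \<in> Q) \<and> (\<forall>n. T (s (Suc n)) = s n)}"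

lemma reversibleI:
  "compact Q \<Longrightarrow> s 0 = \<psi> \<Longrightarrow> (\<And>n. s n \<in> Q) \<Longrightarrow> (\<And>n. T (s (Suc n)) = s n) \<Longrightarrow> \<psi> \<in> reversible"
  unfolding reversible_def by blast

lemma reversibleE:
  assumes "\<psi> \<in> reversible"
  obtains Q s where "compact Q" "s 0 = \<psi>" "\<forall>n. s n \<in> Q" "\<forall>n. T (s (Suc n)) = s n"
  using assms unfolding reversible_def by blast

lemma back_steps:
  assumes "\<And>n. T (s (Suc n)) = s n" shows "(T ^^ n) (s (m + n)) = s m"
  using assms by (induction n) (simp_all add: funpow_swap1 del: funpow.simps add: funpow_Suc_right)

lemma reversible_subspace: "cfun.subspace reversible"
  unfolding cfun.subspace_def
proof (intro conjI ballI allI)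
  show "0 \<in> reversible" by (rule reversibleI[of "{0}" "\<lambda>_. 0"]) (simp_all add: T_0)
next
  fix x y assume "x \<in> reversible" "y \<in> reversible"
  obtain Q s where Q: "compact Q" "s 0 = x" "\<forall>n. s n \<in> Q" "\<forall>n. T (s (Suc n)) = s n"
    using \<open>x \<in> reversible\<close> by (rule reversibleE)
  obtain R t where R: "compact R" "t 0 = y" "\<forall>n. t n \<in> R" "\<forall>n. T (t (Suc n)) = t n"
    using \<open>y \<in> reversible\<close> by (rule reversibleE)
  show "x + y \<in> reversible"
  proof (rule reversibleI[of "{a + b | a b. a \<in> Q \<and> b \<in> R}" "\<lambda>n. s n + t n"])
    show "compact {a + b | a b. a \<in> Q \<and> b \<in> R}" by (rule compact_sums[OF Q(1) R(1)])
    show "s n + t n \<in> {a + b | a b. a \<in> Q \<and> b \<in> R}" for n using Q(3) R(3) by auto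
  qed (simp_all add: Q R T_add)
next
  fix c x assume "x \<in> reversible"
  obtain Q s where Q: "compact Q" "s 0 = x" "\<forall>n. s n \<in> Q" "\<forall>n. T (s (Suc n)) = s n"
    using \<open>x \<in> reversible\<close> by (rule reversibleE)
  show "cscale c x \<in> reversible"
    by (rule reversibleI[of "cscale c ` Q" "\<lambda>n. cscale c (s n)"])
       (use Q in \<open>auto simp: T_scale intro: compact_continuous_image continuous_cscale\<close>)
qed

lemma reversible_shift:
  assumes "compact Q" "\<And>n. s n \<in> Q" "\<And>n. T (s (Suc n)) = s n"
  shows "s m \<in> reversible"
  by (rule reversibleI[of Q "\<lambda>n. s (n + m)"]) (use assms in auto)

text \<open>By compactness, two members \<open>s k\<close> and \<open>s l'\<close> with distant
  indices are close. The power \<open>T ^^ m\<close> carries \<open>s l'\<close> to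
  \<open>s k\<close> and therefore moves \<open>s k\<close> by less than \<open>e\<close>; applying
  \<open>T ^^ k\<close> transfers this to \<open>\<psi>\<close>.\<close>

lemma reversible_recurrent:
  assumes "\<psi> \<in> reversible" "e > 0"
  obtains m where "m \<ge> n" "norm ((T ^^ m) \<psi> - \<psi>) < e"
proof -
  obtain Q s where Q: "compact Q" "s 0 = \<psi>" "\<forall>n. s n \<in> Q" "\<forall>n. T (s (Suc n)) = s n"
    using assms(1) by (rule reversibleE)
  obtain l r where r: "strict_mono (r :: nat \<Rightarrow> nat)" "(s \<circ> r) \<longlonglongrightarrow> l"
    using Q(1,3) unfolding compact_def by metis
  then have "Cauchy (s \<circ> r)" by (simp add: LIMSEQ_imp_Cauchy)
  then obtain N where N: "\<And>i j. i \<ge> N \<Longrightarrow> j \<ge> N \<Longrightarrow> dist ((s \<circ> r) i) ((s \<circ> r) j) < e"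
    using assms(2) unfolding Cauchy_def by meson
  define k where "k = r N"
  define l' where "l' = r (N + n)"
  have ln: "l' \<ge> k + n" unfolding k_def l'_def by (rule strict_mono_nat_add[OF r(1)])
  define m where "m = l' - k"
  have m: "l' = k + m" "m \<ge> n" using ln by (auto simp: m_def)
  have "(T ^^ m) (s l') = s k" using back_steps[of s m k] Q(4) m by simp
  then have "dist ((T ^^ m) (s k)) (s k) \<le> dist (s k) (s l')" using Tn_dist[of m "s k" "s l'"] by simp
  also have "\<dots> < e" using N[of N "N + n"] by (simp add: k_def l'_def)
  finally have *: "dist ((T ^^ m) (s k)) (s k) < e" .
  have "\<psi> = (T ^^ k) (s k)" using back_steps[of s k 0] Q by simp
  moreover have "(T ^^ m) ((T ^^ k) (s k)) = (T ^^ k) ((T ^^ m) (s k))"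
    using funpow_add[of m k T] funpow_add[of k m T] by (simp add: add.commute fun_eq_iff)
  ultimately have "dist ((T ^^ m) \<psi>) \<psi> = dist ((T ^^ k) ((T ^^ m) (s k))) ((T ^^ k) (s k))" by simp
  also have "\<dots> < e" using Tn_dist[of k "(T ^^ m) (s k)" "s k"] * by simp
  finally show ?thesis using that[OF m(2)] by (simp add: dist_norm)
qed

text \<open>Norms of iterates never increase, yet recurrence brings them back near the initial value
  at arbitrarily late times.\<close>

lemma reversible_isometry:
  assumes "\<psi> \<in> reversible" shows "norm ((T ^^ n) \<psi>) = norm \<psi>"
proof (rule antisym[OF Tn_le], rule field_le_epsilon)
  fix e :: real assume "e > 0"
  then obtain m where m: "m \<ge> n" "norm ((T ^^ m) \<psi> - \<psi>) < e" by (rule reversible_recurrent[OF assms])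
  have "norm \<psi> \<le> norm ((T ^^ m) \<psi>) + norm ((T ^^ m) \<psi> - \<psi>)" by norm
  then show "norm \<psi> \<le> norm ((T ^^ n) \<psi>) + e" using m Tn_mono[OF m(1), of \<psi>] by linarith
qed

lemma reversible_T: "\<psi> \<in> reversible \<Longrightarrow> T \<psi> \<in> reversible"
proof -
  assume "\<psi> \<in> reversible"
  then obtain Q s where Q: "compact Q" "s 0 = \<psi>" "\<forall>n. s n \<in> Q" "\<forall>n. T (s (Suc n)) = s n"
    by (rule reversibleE)
  show ?thesis
  proof (rule reversibleI[of "insert (T \<psi>) Q" "case_nat (T \<psi>) s"])
    show "case_nat (T \<psi>) s n \<in> insert (T \<psi>) Q" for n using Q by (cases n) auto
    show "T (case_nat (T \<psi>) s (Suc n)) = case_nat (T \<psi>) s n" for n using Q by (cases n) auto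
  qed (use Q in auto)
qed

section \<open>Eigenvectors with eigenvalue of modulus one and their span\<close>

definition eigenvectors :: "('a \<Rightarrow>\<^sub>C complex) set" where
  "eigenvectors = {\<phi>. \<phi> \<noteq> 0 \<and> (\<exists>a. norm a = 1 \<and> T \<phi> = cscale a \<phi>)}"

text \<open>Dividing by powers of the eigenvalue gives a backward orbit, and modulus one keeps it in
  a compact set of multiples.\<close>

lemma eigenvectors_reversible: "eigenvectors \<subseteq> reversible"
proof
  fix \<phi> assume "\<phi> \<in> eigenvectors"
  then obtain a where a: "norm a = 1" "T \<phi> = cscale a \<phi>" unfolding eigenvectors_def by blast
  have a0: "a \<noteq> 0" using a by auto
  show "\<phi> \<in> reversible"
  proof (rule reversibleI[of "(\<lambda>c. cscale c \<phi>) ` cball 0 1" "\<lambda>n. cscale ((1 / a) ^ n) \<phi>"])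
    show "compact ((\<lambda>c. cscale c \<phi>) ` cball 0 1)" by (intro compact_continuous_image continuous_cscale_left) simp
    show "cscale ((1 / a) ^ n) \<phi> \<in> (\<lambda>c. cscale c \<phi>) ` cball 0 1" for n
      using a by (intro imageI) (simp add: norm_power norm_divide power_divide)
    show "T (cscale ((1 / a) ^ Suc n) \<phi>) = cscale ((1 / a) ^ n) \<phi>" for n
      using a0 by (simp add: T_scale a(2))
  qed simp
qed

lemma span_eigenvectors_reversible: "cfun.span eigenvectors \<subseteq> reversible"
  by (rule cfun.span_minimal[OF eigenvectors_reversible reversible_subspace])

text \<open>An eigenvector with eigenvalue \<open>b \<noteq> a\<close> is in the range of
  \<open>T - a\<close>, by division by \<open>b - a\<close>; the components with eigenvalue
  \<open>a\<close> are collected in \<open>\<eta>\<close>.\<close>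

lemma resolvent_splitting:
  assumes "u \<in> cfun.span eigenvectors"
  shows "\<exists>u'\<in>cfun.span eigenvectors. \<exists>\<eta>. u = T u' - cscale a u' + \<eta> \<and> T \<eta> = cscale a \<eta> \<and> (norm a = 1 \<or> \<eta> = 0)"
  using assms
proof (induction rule: cfun.span_induct_alt)
  case base
  show ?case by (rule bexI[of _ 0], rule exI[of _ 0]) (simp_all add: T_0 cfun.span_zero)
next
  case (step c x y)
  obtain u' \<eta> where u': "u' \<in> cfun.span eigenvectors" "y = T u' - cscale a u' + \<eta>" "T \<eta> = cscale a \<eta>" "norm a = 1 \<or> \<eta> = 0"
    using step by blast
  obtain b where b: "norm b = 1" "T x = cscale b x" using step(1) unfolding eigenvectors_def by blast
  show ?case
  proof (cases "b = a")
    case True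
    then show ?thesis using u' b
      by (intro bexI[of _ u'] exI[of _ "cscale c x + \<eta>"]) (simp_all add: T_add T_scale cfun.scale_right_distrib ac_simps)
  next
    case False
    have "T (cscale (c / (b - a)) x) - cscale a (cscale (c / (b - a)) x) = cscale c x"
      using False by (simp add: T_scale b cfun.scale_left_diff_distrib[symmetric] algebra_simps flip: diff_divide_distrib)
         (metis (no_types, opaque_lifting) False cfun.scale_left_diff_distrib eq_iff_diff_eq_0 mult.commute nonzero_mult_div_cancel_left right_diff_distrib times_divide_eq_right)
    moreover have "cscale (c / (b - a)) x + u' \<in> cfun.span eigenvectors"
      using u' step(1) by (auto intro: cfun.span_add cfun.span_scale cfun.span_base)
    ultimately show ?thesis using u'
      by (intro bexI[of _ "cscale (c / (b - a)) x + u'"] exI[of _ \<eta>])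
         (simp_all add: T_add cfun.scale_right_distrib algebra_simps)
  qed
qed

text \<open>After subtraction of \<open>u'\<close>, the rest satisfies
  \<open>T \<psi>' = a \<psi>' + \<eta>\<close> with \<open>T \<eta> = a \<eta>\<close>. A non-zero
  \<open>\<eta>\<close> would be a Jordan block, whose powers grow linearly, against contraction.
  For \<open>\<eta> = 0\<close>, isometry forces \<open>a\<close> to have modulus one unless
  \<open>\<psi>' = 0\<close>.\<close>

lemma resolvent_step:
  assumes \<psi>: "\<psi> \<in> reversible" and u: "T \<psi> - cscale a \<psi> \<in> cfun.span eigenvectors"
  shows "\<psi> \<in> cfun.span eigenvectors"
proof -
  obtain u' \<eta> where u': "u' \<in> cfun.span eigenvectors" "T \<psi> - cscale a \<psi> = T u' - cscale a u' + \<eta>"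
    "T \<eta> = cscale a \<eta>" "norm a = 1 \<or> \<eta> = 0"
    using resolvent_splitting[OF u, of a] by blast
  define \<psi>' where "\<psi>' = \<psi> - u'"
  have T': "T \<psi>' = cscale a \<psi>' + \<eta>"
  proof -
    have "T \<psi>' - cscale a \<psi>' = (T \<psi> - cscale a \<psi>) - (T u' - cscale a u')"
      by (simp add: \<psi>'_def T_diff cscale_diff)
    then have "T \<psi>' - cscale a \<psi>' = \<eta>" using u'(2) by simp
    then show ?thesis by (simp add: diff_eq_eq add.commute)
  qed
  have r: "\<psi>' \<in> reversible" unfolding \<psi>'_def
    using \<psi> u' span_eigenvectors_reversible reversible_subspace by (intro cfun.subspace_diff) auto
  have "\<psi>' \<in> cfun.span eigenvectors"
  proof (cases "\<eta> = 0")
    case True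
    show ?thesis
    proof (cases "\<psi>' = 0")
      case False
      have "norm a * norm \<psi>' = norm \<psi>'"
        using reversible_isometry[OF r, of 1] T' True by (simp add: norm_cscale)
      then have "norm a = 1" using False by simp
      then show ?thesis using T' True False by (intro cfun.span_base) (auto simp: eigenvectors_def)
    qed (simp add: cfun.span_zero)
  next
    case False
    then have a: "norm a = 1" "a \<noteq> 0" using u'(4) by auto
    have *: "(T ^^ n) \<psi>' = cscale (a ^ n) (\<psi>' + cscale (of_nat n / a) \<eta>)" for n
    proof (induction n)
      case (Suc n)
      have "T (\<psi>' + cscale (of_nat n / a) \<eta>) = cscale a (\<psi>' + cscale (of_nat (Suc n) / a) \<eta>)"
        using a(2) by (simp add: T_add T_scale T' u'(3) cfun.scale_right_distrib add_divide_distrib cfun.scale_left_distrib ac_simps)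
      then show ?case by (simp add: Suc T_scale)
    qed simp
    have bound: "real n * norm \<eta> \<le> 2 * norm \<psi>'" for n
    proof -
      have "real n * norm \<eta> = norm (cscale (of_nat n / a) \<eta>)" using a by (simp add: norm_cscale norm_divide)
      also have "\<dots> \<le> norm (\<psi>' + cscale (of_nat n / a) \<eta>) + norm \<psi>'" by norm
      also have "norm (\<psi>' + cscale (of_nat n / a) \<eta>) = norm ((T ^^ n) \<psi>')"
        using a by (simp add: * norm_cscale norm_power)
      also have "\<dots> \<le> norm \<psi>'" by (rule Tn_le)
      finally show ?thesis by simp
    qed
    obtain n where "2 * norm \<psi>' < real n * norm \<eta>" using reals_Archimedean3 False by (metis zero_less_norm_iff)
    then show ?thesis using bound[of n] by simp
  qed
  then show ?thesis using u'(1) cfun.span_add[of \<psi>' eigenvectors u'] by (simp add: \<psi>'_def)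
qed

definition poly_T :: "complex poly \<Rightarrow> ('a \<Rightarrow>\<^sub>C complex) \<Rightarrow> ('a \<Rightarrow>\<^sub>C complex)" where
  "poly_T p \<psi> = (\<Sum>i\<le>degree p. cscale (coeff p i) ((T ^^ i) \<psi>))"

lemma poly_T_bound: "degree p \<le> n \<Longrightarrow> poly_T p \<psi> = (\<Sum>i\<le>n. cscale (coeff p i) ((T ^^ i) \<psi>))"
  unfolding poly_T_def by (rule sum.mono_neutral_left) (auto simp: coeff_eq_0)

lemma poly_T_diff: "poly_T p (\<phi> - \<psi>) = poly_T p \<phi> - poly_T p \<psi>"
  by (simp add: poly_T_def Tn_diff cscale_diff sum_subtractf)

lemma poly_T_scale: "poly_T p (cscale c \<psi>) = cscale c (poly_T p \<psi>)"
  by (simp add: poly_T_def Tn_scale cfun.scale_sum_right mult.commute)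

lemma poly_T_linear_factor: "poly_T ([:- a, 1:] * q) \<psi> = poly_T q (T \<psi> - cscale a \<psi>)"
proof -
  define n where "n = Suc (degree q)"
  have "degree ([:- a, 1:] * q) \<le> degree [:- a, 1:] + degree q" by (rule degree_mult_le)
  then have dn: "degree ([:- a, 1:] * q) \<le> n" by (simp add: n_def)
  have "poly_T ([:- a, 1:] * q) \<psi> = (\<Sum>i\<le>n. cscale (coeff ([:- a, 1:] * q) i) ((T ^^ i) \<psi>))"
    by (rule poly_T_bound[OF dn])
  also have "\<dots> = (\<Sum>i\<le>n. cscale (coeff (pCons 0 q) i) ((T ^^ i) \<psi>)) - (\<Sum>i\<le>n. cscale (a * coeff q i) ((T ^^ i) \<psi>))"
    by (simp add: sum_subtractf[symmetric] cfun.scale_left_diff_distrib[symmetric])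
  also have "(\<Sum>i\<le>n. cscale (coeff (pCons 0 q) i) ((T ^^ i) \<psi>)) = poly_T q (T \<psi>)"
    unfolding n_def by (subst sum.atMost_Suc_shift) (simp add: poly_T_def funpow_swap1)
  also have "(\<Sum>i\<le>n. cscale (a * coeff q i) ((T ^^ i) \<psi>)) = cscale a (poly_T q \<psi>)"
    using poly_T_bound[of q n \<psi>] by (simp only: cfun.scale_sum_right cfun.scale_scale n_def lessI less_imp_le)
  finally show ?thesis by (simp add: poly_T_diff poly_T_scale)
qed

text \<open>A complex root \<open>a\<close> of \<open>p\<close> splits off; the induction hypothesis
  treats \<open>T \<psi> - a \<psi>\<close>, and \<open>resolvent_step\<close> returns from it to
  \<open>\<psi>\<close>.\<close>

lemma annihilated_in_span:
  assumes "p \<noteq> 0" "poly_T p \<psi> = 0" "\<psi> \<in> reversible"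
  shows "\<psi> \<in> cfun.span eigenvectors"
  using assms
proof (induction "degree p" arbitrary: p \<psi>)
  case 0
  then obtain c where c: "p = [:c:]" "c \<noteq> 0" by (metis degree_eq_zeroE pCons_0_0)
  then have "\<psi> = 0" using 0 by (simp add: poly_T_def)
  then show ?case by (simp add: cfun.span_zero)
next
  case (Suc n)
  then have "\<not> constant (poly p)" by (simp add: constant_degree)
  then obtain a where "poly p a = 0" using fundamental_theorem_of_algebra by blast
  then obtain q where q: "p = [:- a, 1:] * q" by (auto simp: poly_eq_0_iff_dvd dvd_def)
  then have q0: "q \<noteq> 0" using Suc by auto
  have "degree p = degree [:- a, 1:] + degree q" unfolding q by (rule degree_mult_eq) (use q0 in auto)
  then have n: "n = degree q" using Suc by simp
  have r: "T \<psi> - cscale a \<psi> \<in> reversible"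
    using Suc(5) reversible_T reversible_subspace by (intro cfun.subspace_diff cfun.subspace_scale) auto
  have "poly_T q (T \<psi> - cscale a \<psi>) = 0" using Suc(4) unfolding q poly_T_linear_factor .
  then have "T \<psi> - cscale a \<psi> \<in> cfun.span eigenvectors" using Suc(1)[OF n q0 _ r] by blast
  then show ?case by (rule resolvent_step[OF Suc(5)])
qed

lemma reversible_eq_span:
  assumes S: "finite S" "reversible \<subseteq> cfun.span S"
  shows "reversible = cfun.span eigenvectors"
proof
  show "cfun.span eigenvectors \<subseteq> reversible" by (rule span_eigenvectors_reversible)
  show "reversible \<subseteq> cfun.span eigenvectors"
  proof
    fix \<psi> assume \<psi>: "\<psi> \<in> reversible"
    define n where "n = card S"
    define v where "v i = (T ^^ i) \<psi>" for i
    have vS: "v i \<in> cfun.span S" for i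
    proof -
      have "v i \<in> reversible" unfolding v_def using \<psi> reversible_T by (induction i) auto
      then show ?thesis using S by blast
    qed
    \<comment> \<open>The iterates up to \<open>n\<close> are one more than the spanning set has
      members, so a relation exists; it becomes a polynomial annihilating \<open>\<psi>\<close>.
      Linear dependence concerns the set of iterates, so a repetition is treated apart, with
      coefficients 1 and -1.\<close>
    have "\<exists>u :: nat \<Rightarrow> complex. (\<exists>i\<le>n. u i \<noteq> 0) \<and> (\<Sum>i\<le>n. cscale (u i) (v i)) = 0"
    proof (cases "inj_on v {..n}")
      case True
      have "cfun.dependent (v ` {..n})"
      proof (rule ccontr)
        assume "\<not> ?thesis"
        then have "cfun.independent (v ` {..n})" by simp
        then have "card (v ` {..n}) \<le> card S" using cfun.independent_span_bound[OF S(1)] vS by blast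
        then show False using card_image[OF True] by (simp add: n_def)
      qed
      then obtain u where u: "\<exists>w\<in>v ` {..n}. u w \<noteq> 0" "(\<Sum>w\<in>v ` {..n}. cscale (u w) w) = 0"
        using cfun.dependent_finite[of "v ` {..n}"] by auto
      then show ?thesis
        using sum.reindex[OF True, of "\<lambda>w. cscale (u w) w"] by (intro exI[of _ "\<lambda>i. u (v i)"]) auto
    next
      case False
      then obtain i j where ij: "i \<le> n" "j \<le> n" "i \<noteq> j" "v i = v j" unfolding inj_on_def by auto
      define u where "u k = (if k = i then 1 else if k = j then -1 else 0 :: complex)" for k
      have "(\<Sum>k\<le>n. cscale (u k) (v k)) = (\<Sum>k\<in>{i, j}. cscale (u k) (v k))"
        by (rule sum.mono_neutral_right) (use ij in \<open>auto simp: u_def\<close>)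
      also have "\<dots> = 0" using ij by (simp add: u_def)
      finally show ?thesis using ij by (intro exI[of _ u]) (auto simp: u_def)
    qed
    then obtain u :: "nat \<Rightarrow> complex" and i where u: "i \<le> n" "u i \<noteq> 0" "(\<Sum>i\<le>n. cscale (u i) (v i)) = 0" by blast
    define p where "p = (\<Sum>i\<le>n. monom (u i) i)"
    have cp: "coeff p k = (if k \<le> n then u k else 0)" for k
      by (simp add: p_def coeff_sum if_distrib cong: if_cong)
    have "degree p \<le> n" by (rule degree_le) (simp add: cp)
    then have "poly_T p \<psi> = (\<Sum>i\<le>n. cscale (u i) (v i))" by (simp add: poly_T_bound cp v_def)
    then have "poly_T p \<psi> = 0" using u by simp
    moreover have "p \<noteq> 0" using cp[of i] u by auto
    ultimately show "\<psi> \<in> cfun.span eigenvectors" using annihilated_in_span \<psi> by blast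
  qed
qed

text \<open>\<open>T\<close> maps the omega-limit set \<open>\<Omega>\<close> of
  \<open>\<phi>\<close> onto itself, so its points have backward orbits in \<open>Q\<close>. The
  part sought is a point of \<open>\<Omega>\<close> whose forward orbit shadows that of
  \<open>\<phi>\<close>: a limit of \<open>r0 k\<close>-fold preimages of \<open>x\<close>, where
  \<open>x\<close> is the limit of the orbit at times \<open>r0 k\<close>.\<close>

lemma reversible_part:
  obtains u where "u \<in> reversible" "(\<lambda>n. (T ^^ n) (\<phi> - u)) \<longlonglongrightarrow> 0"
proof -
  obtain Q where Q: "compact Q" "\<And>n. (T ^^ n) \<phi> \<in> Q" using compact_orbits by blast
  define \<Omega> where "\<Omega> = {x. \<forall>e>0. \<forall>N. \<exists>n\<ge>N. dist ((T ^^ n) \<phi>) x < e}"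
  have lim: "\<exists>y r. strict_mono (r :: nat \<Rightarrow> nat) \<and> (x \<circ> r) \<longlonglongrightarrow> y" if "\<And>k. x k \<in> Q" for x :: "nat \<Rightarrow> ('a \<Rightarrow>\<^sub>C complex)"
    using Q(1) that unfolding compact_def by blast
  have \<Omega>I: "y \<in> \<Omega>" if y: "(\<lambda>k. (T ^^ (m k)) \<phi>) \<longlonglongrightarrow> y" and m: "\<And>k. m k \<ge> k" for y m
    unfolding \<Omega>_def
  proof (intro CollectI allI impI)
    fix e :: real and N assume "e > 0"
    then obtain K where "\<And>k. k \<ge> K \<Longrightarrow> dist ((T ^^ (m k)) \<phi>) y < e" using y unfolding lim_sequentially by meson
    then show "\<exists>n\<ge>N. dist ((T ^^ n) \<phi>) y < e" using m[of "max K N"] by (intro exI[of _ "m (max K N)"]) auto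
  qed
  have approx: "\<exists>m. (\<forall>k. m k \<ge> Suc k) \<and> (\<lambda>k. (T ^^ (m k)) \<phi>) \<longlonglongrightarrow> x" if x: "x \<in> \<Omega>" for x
  proof -
    have "\<forall>k. \<exists>n\<ge>Suc k. dist ((T ^^ n) \<phi>) x < 1 / Suc k" using x by (simp add: \<Omega>_def)
    then obtain m where m: "\<And>k. m k \<ge> Suc k" "\<And>k. dist ((T ^^ (m k)) \<phi>) x < 1 / Suc k" by metis
    have "(\<lambda>k. dist ((T ^^ (m k)) \<phi>) x) \<longlonglongrightarrow> 0"
    proof (rule tendsto_sandwich[OF _ _ tendsto_const LIMSEQ_inverse_real_of_nat])
      show "\<forall>\<^sub>F k in sequentially. dist ((T ^^ (m k)) \<phi>) x \<le> inverse (real (Suc k))"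
        using m(2) by (auto simp: inverse_eq_divide less_imp_le)
    qed auto
    then show ?thesis using m(1) tendsto_dist_iff by blast
  qed
  have "closed \<Omega>" unfolding closed_sequential_limits
  proof (intro allI impI)
    fix x l assume xl: "(\<forall>n. x n \<in> \<Omega>) \<and> x \<longlonglongrightarrow> l"
    show "l \<in> \<Omega>" unfolding \<Omega>_def
    proof (intro CollectI allI impI)
      fix e :: real and N assume "e > 0"
      then have e2: "e/2 > 0" by simp
      obtain K where "dist (x K) l < e/2" using xl e2 unfolding lim_sequentially by blast
      moreover obtain n where "n \<ge> N" "dist ((T ^^ n) \<phi>) (x K) < e/2" using xl e2 unfolding \<Omega>_def by blast
      ultimately show "\<exists>n\<ge>N. dist ((T ^^ n) \<phi>) l < e"
        using dist_triangle[of "(T ^^ n) \<phi>" l "x K"] by (intro exI[of _ n]) auto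
    qed
  qed
  have \<Omega>Q: "\<Omega> \<subseteq> Q"
  proof
    fix x assume "x \<in> \<Omega>"
    then obtain m where "(\<lambda>k. (T ^^ (m k)) \<phi>) \<longlonglongrightarrow> x" using approx by blast
    then show "x \<in> Q"
      using closed_sequentially[OF compact_imp_closed[OF Q(1)], of "\<lambda>k. (T ^^ (m k)) \<phi>" x] Q(2) by simp
  qed
  \<comment> \<open>A preimage is a cluster point of the iterates one step earlier; therefore
    \<open>approx\<close> supplies times at least \<open>Suc k\<close>.\<close>
  have "\<exists>y\<in>\<Omega>. T y = x" if x: "x \<in> \<Omega>" for x
  proof -
    obtain m where m: "\<And>k. m k \<ge> Suc k" "(\<lambda>k. (T ^^ (m k)) \<phi>) \<longlonglongrightarrow> x" using approx[OF x] by blast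
    obtain y r where r: "strict_mono (r :: nat \<Rightarrow> nat)" "((\<lambda>k. (T ^^ (m k - 1)) \<phi>) \<circ> r) \<longlonglongrightarrow> y"
      using lim[of "\<lambda>k. (T ^^ (m k - 1)) \<phi>"] Q(2) by blast
    have "m (r k) - 1 \<ge> k" for k using m(1)[of "r k"] seq_suble[OF r(1), of k] by linarith
    then have "y \<in> \<Omega>" using r(2) by (intro \<Omega>I[of "\<lambda>k. m (r k) - 1"]) (simp_all add: comp_def)
    moreover have "T y = x"
    proof -
      have "(\<lambda>k. T ((T ^^ (m (r k) - 1)) \<phi>)) \<longlonglongrightarrow> T y"
      proof (rule metric_tendsto_imp_tendsto[OF r(2)], rule always_eventually, rule allI)
        show "dist (T ((T ^^ (m (r k) - 1)) \<phi>)) (T y) \<le> dist (((\<lambda>k. (T ^^ (m k - 1)) \<phi>) \<circ> r) k) y" for k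
          using Tn_dist[of 1] by simp
      qed
      moreover have "T ((T ^^ (m (r k) - 1)) \<phi>) = (T ^^ (m (r k))) \<phi>" for k
        using m(1)[of "r k"] by (cases "m (r k)") auto
      moreover have "(\<lambda>k. (T ^^ (m (r k))) \<phi>) \<longlonglongrightarrow> x"
        using LIMSEQ_subseq_LIMSEQ[OF m(2) r(1)] by (simp add: comp_def)
      ultimately show ?thesis using LIMSEQ_unique by auto
    qed
    ultimately show ?thesis by blast
  qed
  then obtain f where f: "\<And>x. x \<in> \<Omega> \<Longrightarrow> f x \<in> \<Omega>" "\<And>x. x \<in> \<Omega> \<Longrightarrow> T (f x) = x" by metis
  have fn: "(f ^^ n) x \<in> \<Omega>" if "x \<in> \<Omega>" for n x using that f(1) by (induction n) auto
  have Tf: "(T ^^ n) ((f ^^ n) x) = x" if x: "x \<in> \<Omega>" for n x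
  proof (induction n)
    case (Suc n)
    have "(T ^^ Suc n) ((f ^^ Suc n) x) = (T ^^ n) (T (f ((f ^^ n) x)))"
      by (simp only: funpow_Suc_right[of n T] funpow.simps(2)[of n f] comp_apply)
    then show ?case using Suc f(2)[OF fn[OF x]] by simp
  qed simp
  have \<Omega>rev: "\<Omega> \<subseteq> reversible"
  proof
    fix x assume x: "x \<in> \<Omega>"
    show "x \<in> reversible"
      by (rule reversibleI[OF Q(1), of "\<lambda>n. (f ^^ n) x"]) (use fn[OF x] \<Omega>Q f(2) in auto)
  qed
  obtain x r0 where r0: "strict_mono (r0 :: nat \<Rightarrow> nat)" "((\<lambda>k. (T ^^ k) \<phi>) \<circ> r0) \<longlonglongrightarrow> x"
    using lim[of "\<lambda>k. (T ^^ k) \<phi>"] Q(2) by blast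
  have x: "x \<in> \<Omega>" using r0 seq_suble[OF r0(1)] by (intro \<Omega>I[of r0]) (simp_all add: comp_def)
  define u where "u k = (f ^^ (r0 k)) x" for k
  have u\<Omega>: "u k \<in> \<Omega>" for k unfolding u_def by (rule fn[OF x])
  obtain w r where r: "strict_mono (r :: nat \<Rightarrow> nat)" "(u \<circ> r) \<longlonglongrightarrow> w"
    using lim[of u] u\<Omega> \<Omega>Q by blast
  have w: "w \<in> \<Omega>" using closed_sequentially[OF \<open>closed \<Omega>\<close>, of "u \<circ> r" w] r(2) u\<Omega> by simp
  have "(\<lambda>n. (T ^^ n) (\<phi> - w)) \<longlonglongrightarrow> 0" unfolding LIMSEQ_iff
  proof (intro allI impI)
    fix e :: real assume "e > 0"
    then have e2: "e/2 > 0" by simp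
    have "(\<lambda>k. (T ^^ (r0 (r k))) \<phi>) \<longlonglongrightarrow> x" using LIMSEQ_subseq_LIMSEQ[OF r0(2) r(1)] by (simp add: comp_def)
    then obtain K1 where K1: "\<And>k. k \<ge> K1 \<Longrightarrow> dist ((T ^^ (r0 (r k))) \<phi>) x < e/2"
      using e2 unfolding lim_sequentially by blast
    obtain K2 where K2: "\<And>k. k \<ge> K2 \<Longrightarrow> dist ((u \<circ> r) k) w < e/2" using r(2) e2 unfolding lim_sequentially by blast
    define k where "k = max K1 K2"
    \<comment> \<open>At this single time the orbits of \<open>\<phi>\<close> and \<open>w\<close>
      are both within \<open>e/2\<close> of \<open>x\<close>; contraction extends the estimate to
      all later times.\<close>
    define N where "N = r0 (r k)"
    have "dist ((T ^^ N) (u (r k))) ((T ^^ N) w) < e/2"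
      using Tn_dist[of N "u (r k)" w] K2[of k] by (simp add: k_def)
    moreover have "(T ^^ N) (u (r k)) = x" unfolding N_def u_def by (rule Tf[OF x])
    moreover have "dist ((T ^^ N) \<phi>) x < e/2" using K1[of k] by (simp add: N_def k_def)
    ultimately have "dist ((T ^^ N) \<phi>) ((T ^^ N) w) < e"
      using dist_triangle[of "(T ^^ N) \<phi>" "(T ^^ N) w" x] by simp
    then have "norm ((T ^^ N) (\<phi> - w)) < e" by (simp add: Tn_diff dist_norm)
    then have "\<forall>n\<ge>N. norm ((T ^^ n) (\<phi> - w) - 0) < e" using Tn_mono[of N _ "\<phi> - w"] by fastforce
    then show "\<exists>N. \<forall>n\<ge>N. norm ((T ^^ n) (\<phi> - w) - 0) < e" by blast
  qed
  then show ?thesis using that w \<Omega>rev by blast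
qed

section \<open>The vanishing subspace and simultaneous recurrence\<close>

definition vanishing :: "('a \<Rightarrow>\<^sub>C complex) set" where
  "vanishing = {\<phi>. (\<lambda>n. (T ^^ n) \<phi>) \<longlonglongrightarrow> 0}"

lemma vanishing_subspace: "cfun.subspace vanishing"
  unfolding cfun.subspace_def vanishing_def
proof (intro conjI ballI allI)
  fix x y assume "x \<in> {\<phi>. (\<lambda>n. (T ^^ n) \<phi>) \<longlonglongrightarrow> 0}" "y \<in> {\<phi>. (\<lambda>n. (T ^^ n) \<phi>) \<longlonglongrightarrow> 0}"
  then show "x + y \<in> {\<phi>. (\<lambda>n. (T ^^ n) \<phi>) \<longlonglongrightarrow> 0}"
    using tendsto_add[of "\<lambda>n. (T ^^ n) x" 0 sequentially "\<lambda>n. (T ^^ n) y" 0] by (simp add: Tn_add)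
next
  fix c x assume x: "x \<in> {\<phi>. (\<lambda>n. (T ^^ n) \<phi>) \<longlonglongrightarrow> 0}"
  have "(\<lambda>n. cscale c ((T ^^ n) x)) \<longlonglongrightarrow> cscale c 0"
    using x continuous_on_tendsto_compose[OF continuous_cscale[of UNIV c], of "\<lambda>n. (T ^^ n) x" 0] by simp
  then show "cscale c x \<in> {\<phi>. (\<lambda>n. (T ^^ n) \<phi>) \<longlonglongrightarrow> 0}" by (simp add: Tn_scale)
qed (simp add: Tn_0)

lemma closed_vanishing: "closed vanishing"
  unfolding closed_sequential_limits
proof (intro allI impI)
  fix x l assume xl: "(\<forall>n. x n \<in> vanishing) \<and> x \<longlonglongrightarrow> l"
  show "l \<in> vanishing" unfolding vanishing_def
  proof (intro CollectI, unfold LIMSEQ_iff, intro allI impI)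
    fix e :: real assume "e > 0"
    then have e2: "e/2 > 0" by simp
    obtain K where K: "dist (x K) l < e/2" using xl e2 unfolding lim_sequentially by blast
    have "(\<lambda>n. (T ^^ n) (x K)) \<longlonglongrightarrow> 0" using xl unfolding vanishing_def by blast
    then obtain N where N: "\<forall>n\<ge>N. norm ((T ^^ n) (x K) - 0) < e/2" using e2 unfolding LIMSEQ_iff by blast
    have "norm ((T ^^ n) l) < e" if "n \<ge> N" for n
    proof -
      have "norm ((T ^^ n) l) \<le> norm ((T ^^ n) (x K)) + dist ((T ^^ n) (x K)) ((T ^^ n) l)"
        unfolding dist_norm by norm
      also have "\<dots> < e/2 + e/2" using N that Tn_dist[of n "x K" l] K by fastforce
      finally show ?thesis by simp
    qed
    then show "\<exists>N. \<forall>n\<ge>N. norm ((T ^^ n) l - 0) < e" by auto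
  qed
qed

lemma reversible_Int_vanishing: "reversible \<inter> vanishing = {0}"
proof
  show "reversible \<inter> vanishing \<subseteq> {0}"
  proof
    fix \<psi> assume \<psi>: "\<psi> \<in> reversible \<inter> vanishing"
    then have "(\<lambda>n. norm ((T ^^ n) \<psi>)) \<longlonglongrightarrow> norm (0 :: 'a \<Rightarrow>\<^sub>C complex)"
      unfolding vanishing_def by (intro tendsto_norm) simp
    then have "(\<lambda>n. norm \<psi>) \<longlonglongrightarrow> 0" using reversible_isometry \<psi> by simp
    then show "\<psi> \<in> {0}" by (simp add: LIMSEQ_const_iff)
  qed
  show "{0} \<subseteq> reversible \<inter> vanishing"
    using cfun.subspace_0[OF reversible_subspace] cfun.subspace_0[OF vanishing_subspace] by simp
qed

text \<open>The times \<open>r0\<close> are thinned once for each member of the finite set.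
  Prescribing \<open>r0\<close> allows starting from times at which an orbit is supposed to stay
  away from the attractor.\<close>

lemma orbit_subsequences:
  fixes S :: "('a \<Rightarrow>\<^sub>C complex) set"
  assumes "finite S" "strict_mono (r0 :: nat \<Rightarrow> nat)"
  shows "\<exists>r :: nat \<Rightarrow> nat. strict_mono r \<and> (\<forall>\<phi>\<in>S. convergent (\<lambda>k. (T ^^ (r0 (r k))) \<phi>))"
  using assms(1)
proof (induction S rule: finite_induct)
  case empty
  show ?case by (rule exI[of _ "\<lambda>x. x"]) (simp add: strict_mono_def)
next
  case (insert \<phi> S)
  then obtain r :: "nat \<Rightarrow> nat" where r: "strict_mono r" "\<forall>\<phi>\<in>S. convergent (\<lambda>k. (T ^^ (r0 (r k))) \<phi>)" by blast
  obtain Q where Q: "compact Q" "\<And>n. (T ^^ n) \<phi> \<in> Q" using compact_orbits by blast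
  obtain l q where q: "strict_mono (q :: nat \<Rightarrow> nat)" "((\<lambda>k. (T ^^ (r0 (r k))) \<phi>) \<circ> q) \<longlonglongrightarrow> l"
    using Q unfolding compact_def by metis
  show ?case
  proof (intro exI[of _ "r \<circ> q"] conjI ballI)
    show "strict_mono (r \<circ> q)" using r(1) q(1) by (rule strict_mono_o)
    fix \<psi> assume "\<psi> \<in> insert \<phi> S"
    then show "convergent (\<lambda>k. (T ^^ (r0 ((r \<circ> q) k))) \<psi>)"
    proof
      assume "\<psi> = \<phi>" then show ?thesis using q(2) unfolding convergent_def comp_def by blast
    next
      assume "\<psi> \<in> S"
      then show ?thesis using convergent_subseq_convergent[OF _ q(1)] r(2) by (fastforce simp: comp_def)
    qed
  qed
qed

lemma convergent_span:
  assumes "\<And>\<phi>. \<phi> \<in> S \<Longrightarrow> convergent (\<lambda>k. (T ^^ (r k)) \<phi>)" "u \<in> cfun.span S"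
  shows "convergent (\<lambda>k. (T ^^ (r k)) u)"
  using assms(2)
proof (induction rule: cfun.span_induct_alt)
  case base
  show ?case by (simp add: Tn_0 convergent_const)
next
  case (step c x y)
  obtain l where l: "(\<lambda>k. (T ^^ (r k)) x) \<longlonglongrightarrow> l" using assms(1)[OF step(1)] unfolding convergent_def by blast
  have "(\<lambda>k. cscale c ((T ^^ (r k)) x)) \<longlonglongrightarrow> cscale c l"
    using continuous_on_tendsto_compose[OF continuous_cscale[of UNIV c] l] by simp
  then have "convergent (\<lambda>k. cscale c ((T ^^ (r k)) x))" unfolding convergent_def by blast
  then show ?case using step(2) by (simp add: Tn_add Tn_scale convergent_add)
qed

text \<open>Along times \<open>r\<close> at which the iterates converge, differences of iterates
  tend to 0; by isometry on the reversible part, differences of such times are return times.\<close>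

lemma simultaneous_recurrence:
  assumes "finite S" "cfun.span S \<subseteq> reversible"
  obtains m where "\<And>k. m k \<ge> Suc k" "\<And>u. u \<in> cfun.span S \<Longrightarrow> (\<lambda>k. (T ^^ (m k)) u) \<longlonglongrightarrow> u"
proof -
  obtain r :: "nat \<Rightarrow> nat" where r: "strict_mono r" "\<forall>\<phi>\<in>S. convergent (\<lambda>k. (T ^^ (r k)) \<phi>)"
    using orbit_subsequences[OF assms(1), of "\<lambda>x. x"] by (auto simp: strict_mono_def)
  \<comment> \<open>The index \<open>2 * k + 1\<close> exceeds \<open>k\<close> by
    \<open>Suc k\<close>, which forces the gap to grow, while both indices run along the convergent
    sequence.\<close>
  define m where "m k = r (2 * k + 1) - r k" for k
  have m: "m k \<ge> Suc k" "r (2 * k + 1) = r k + m k" for k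
  proof -
    have "r k + Suc k \<le> r (k + Suc k)" by (rule strict_mono_nat_add[OF r(1)])
    then show "m k \<ge> Suc k" "r (2 * k + 1) = r k + m k" unfolding m_def by (simp_all add: mult_2)
  qed
  have "(\<lambda>k. (T ^^ (m k)) u) \<longlonglongrightarrow> u" if u: "u \<in> cfun.span S" for u
  proof -
    have "convergent (\<lambda>k. (T ^^ (r k)) u)" by (rule convergent_span[OF _ u]) (use r(2) in blast)
    then obtain l where l: "(\<lambda>k. (T ^^ (r k)) u) \<longlonglongrightarrow> l" unfolding convergent_def by blast
    have "strict_mono (\<lambda>k::nat. 2 * k + 1)" by (simp add: strict_mono_def)
    from LIMSEQ_subseq_LIMSEQ[OF l this] have "(\<lambda>k. (T ^^ (r (2 * k + 1))) u) \<longlonglongrightarrow> l" by (simp add: comp_def)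
    then have "(\<lambda>k. dist ((T ^^ (r (2 * k + 1))) u) ((T ^^ (r k)) u)) \<longlonglongrightarrow> dist l l" by (intro tendsto_dist l)
    moreover have "dist ((T ^^ (r (2 * k + 1))) u) ((T ^^ (r k)) u) = dist ((T ^^ (m k)) u) u" for k
    proof -
      have ur: "u \<in> reversible" using u assms(2) by blast
      have "(T ^^ n) u \<in> reversible" for n using ur reversible_T by (induction n) auto
      then have "(T ^^ (m k)) u - u \<in> reversible" using ur reversible_subspace by (intro cfun.subspace_diff) auto
      from reversible_isometry[OF this, of "r k"] show ?thesis
        unfolding m(2) dist_norm by (simp add: Tn_diff funpow_add)
    qed
    ultimately show ?thesis by (subst tendsto_dist_iff) simp
  qed
  then show ?thesis using that m(1) by blast
qed

end

section \<open>Nets of equicontinuous families\<close>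

text \<open>Each \<open>f\<close> is coded by nearby net points at finitely many centres. Two
  functions with the same code differ by less than \<open>4 * e\<close>: two uses of equicontinuity
  and two of rounding. The representatives are taken from \<open>FF\<close> itself, which keeps them
  rational maps in the separability proof.\<close>

lemma equicontinuous_finite_net:
  fixes FF :: "('a::topological_space \<Rightarrow> 'b::metric_space) set"
  assumes K: "compact K"
    and eq: "\<And>x. x \<in> K \<Longrightarrow> \<exists>U. open U \<and> x \<in> U \<and> (\<forall>f\<in>FF. \<forall>y\<in>U. dist (f y) (f x) < e)"
    and N: "finite N" "\<And>f x. f \<in> FF \<Longrightarrow> x \<in> K \<Longrightarrow> \<exists>y\<in>N. dist (f x) y < e"
  shows "\<exists>F0\<subseteq>FF. finite F0 \<and> (\<forall>f\<in>FF. \<exists>g\<in>F0. \<forall>x\<in>K. dist (f x) (g x) < 4 * e)"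
proof -
  obtain U where U: "\<And>x. x \<in> K \<Longrightarrow> open (U x)" "\<And>x. x \<in> K \<Longrightarrow> x \<in> U x"
     "\<forall>x\<in>K. \<forall>f\<in>FF. \<forall>y\<in>U x. dist (f y) (f x) < e"
    using eq by metis
  have "K \<subseteq> \<Union>(U ` K)" using U by auto
  with compactE_image[OF K, of K U] U(1) obtain C where C: "C \<subseteq> K" "finite C" "K \<subseteq> \<Union>(U ` C)" by blast
  define code where "code f = restrict (\<lambda>c. SOME y. y \<in> N \<and> dist (f c) y < e) C" for f
  have code: "code f c \<in> N \<and> dist (f c) (code f c) < e" if "f \<in> FF" "c \<in> C" for f c
  proof -
    have "\<exists>y. y \<in> N \<and> dist (f c) y < e" using N(2)[of f c] that C(1) by blast
    from someI_ex[OF this] show ?thesis using that(2) by (simp add: code_def)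
  qed
  have "code ` FF \<subseteq> C \<rightarrow>\<^sub>E N" using code by (auto simp: code_def)
  then have fin: "finite (code ` FF)" using finite_PiE[OF C(2), of "\<lambda>_. N"] N(1) finite_subset by blast
  define F0 where "F0 = inv_into FF code ` (code ` FF)"
  show ?thesis
  proof (intro exI[of _ F0] conjI ballI)
    show "F0 \<subseteq> FF" unfolding F0_def by (rule image_subsetI) (rule inv_into_into)
    show "finite F0" unfolding F0_def using fin by simp
    fix f assume f: "f \<in> FF"
    define g where "g = inv_into FF code (code f)"
    have "code f \<in> code ` FF" using f by simp
    then have g: "g \<in> FF" "code g = code f" unfolding g_def by (simp_all add: inv_into_into f_inv_into_f)
    have "g \<in> F0" unfolding F0_def g_def using f by blast
    moreover have "dist (f x) (g x) < 4 * e" if x: "x \<in> K" for x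
    proof -
      obtain c where c: "c \<in> C" "x \<in> U c" using C x by auto
      have "dist (f x) (f c) < e" "dist (g x) (g c) < e" using U(3) c C(1) f g by auto
      moreover have "dist (f c) (code f c) < e" "dist (g c) (code f c) < e"
        using code[OF f c(1)] code[OF g(1) c(1)] g(2) by auto
      ultimately show ?thesis by metric
    qed
    ultimately show "\<exists>g\<in>F0. \<forall>x\<in>K. dist (f x) (g x) < 4 * e" by blast
  qed
qed

text \<open>Ascoli's theorem by total boundedness: a net at scale \<open>e/8\<close> approximates
  \<open>FF\<close> up to \<open>e/2\<close>, and the remaining room absorbs the passage to the
  closure.\<close>

lemma compact_closure_bcontfun:
  fixes FF :: "('a::metric_space \<Rightarrow>\<^sub>C complex) set"
  assumes K: "compact (UNIV :: 'a set)" and eq: "\<And>x. equi_at (apply_bcontfun ` FF) x"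
    and B: "\<And>\<phi>. \<phi> \<in> FF \<Longrightarrow> norm \<phi> \<le> B"
  shows "compact (closure FF)"
  unfolding compact_eq_totally_bounded complete_eq_closed
proof (intro conjI allI impI)
  show "closed (closure FF)" by simp
  fix e :: real assume e: "e > 0"
  then have e8: "e/8 > 0" by simp
  have "compact (cball (0::complex) B)" by simp
  then obtain N where N: "finite N" "cball (0::complex) B \<subseteq> (\<Union>x\<in>N. ball x (e/8))"
    unfolding compact_eq_totally_bounded using e8 by blast
  have "\<exists>F0\<subseteq>apply_bcontfun ` FF. finite F0 \<and> (\<forall>f\<in>apply_bcontfun ` FF. \<exists>g\<in>F0. \<forall>x\<in>UNIV. dist (f x) (g x) < 4 * (e/8))"
  proof (rule equicontinuous_finite_net[OF K _ N(1)])
    fix x :: 'a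
    obtain U where "open U" "x \<in> U" "\<forall>f\<in>apply_bcontfun ` FF. \<forall>y\<in>U. dist (f y) (f x) < e/8"
      by (rule equi_atD[OF eq e8])
    then show "\<exists>U. open U \<and> x \<in> U \<and> (\<forall>f\<in>apply_bcontfun ` FF. \<forall>y\<in>U. dist (f y) (f x) < e/8)"
      by (intro exI[of _ U]) simp
  next
    fix f and x :: 'a assume "f \<in> apply_bcontfun ` FF"
    then obtain \<phi> where "\<phi> \<in> FF" "f = apply_bcontfun \<phi>" by blast
    then have "f x \<in> cball 0 B" using norm_bounded[of \<phi> x] B[of \<phi>] by simp
    then obtain y where "y \<in> N" "f x \<in> ball y (e/8)" using N(2) by blast
    then show "\<exists>y\<in>N. dist (f x) y < e/8" by (intro bexI[of _ y]) (auto simp: dist_commute)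
  qed
  then obtain F0 where F0: "F0 \<subseteq> apply_bcontfun ` FF" "finite F0"
     "\<forall>f\<in>apply_bcontfun ` FF. \<exists>g\<in>F0. \<forall>x\<in>UNIV. dist (f x) (g x) < 4 * (e/8)" by blast
  obtain C where C: "finite C" "F0 = apply_bcontfun ` C" using finite_subset_image[OF F0(2,1)] by blast
  have "closure FF \<subseteq> (\<Union>x\<in>C. ball x e)"
  proof
    fix \<psi> assume "\<psi> \<in> closure FF"
    then obtain \<phi> where \<phi>: "\<phi> \<in> FF" "dist \<phi> \<psi> < e/4" using e unfolding closure_approachable by (meson divide_pos_pos zero_less_numeral)
    then obtain g where g: "g \<in> C" "\<forall>x. dist (apply_bcontfun \<phi> x) (apply_bcontfun g x) < e/2" using F0(3) C(2) by auto
    have "dist \<phi> g \<le> e/2" using g(2) by (intro dist_bound) (auto intro: less_imp_le)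
    then have "dist g \<psi> < e" using \<phi>(2) e dist_triangle[of g \<psi> \<phi>] by (simp add: dist_commute)
    then show "\<psi> \<in> (\<Union>x\<in>C. ball x e)" using g(1) by auto
  qed
  then show "\<exists>k. finite k \<and> closure FF \<subseteq> (\<Union>x\<in>k. ball x e)" using C(1) by blast
qed

section \<open>Separability\<close>

lemma separable_imp_countable_basis:
  assumes "\<And>e::real. e > 0 \<Longrightarrow> \<exists>C. countable C \<and> (\<forall>x::'a::metric_space. \<exists>c\<in>C. dist x c < e)"
  shows "\<exists>B :: 'a set set. countable B \<and> open = generate_topology B"
proof -
  have "\<forall>n. \<exists>C. countable C \<and> (\<forall>x::'a. \<exists>c\<in>C. dist x c < 1 / Suc n)" using assms by simp
  then obtain C where C: "\<And>n. countable (C n)" "\<And>n x. \<exists>c\<in>C n. dist (x::'a) c < 1 / Suc n" by metis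
  define B where "B = (\<Union>n. (\<lambda>c. ball c (1 / Suc n)) ` C n)"
  have "topological_basis B"
  proof (rule topological_basisI)
    fix O' and x :: 'a assume "open O'" "x \<in> O'"
    then obtain e where e: "e > 0" "ball x e \<subseteq> O'" unfolding open_contains_ball by auto
    obtain n where n: "1 / Suc n < e/2" using e(1) by (metis half_gt_zero nat_approx_posE)
    obtain c where c: "c \<in> C n" "dist x c < 1 / Suc n" using C(2) by blast
    have "ball c (1 / Suc n) \<subseteq> O'"
    proof
      fix y assume "y \<in> ball c (1 / Suc n)"
      then have "dist x y < e" using c(2) n dist_triangle[of x y c] by simp
      then show "y \<in> O'" using e(2) by auto
    qed
    then show "\<exists>B'\<in>B. x \<in> B' \<and> B' \<subseteq> O'"
      using c by (intro bexI[of _ "ball c (1 / Suc n)"]) (auto simp: B_def dist_commute)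
  qed (auto simp: B_def)
  moreover have "countable B" unfolding B_def using C(1) by auto
  ultimately show ?thesis using topological_basis_imp_subbasis by blast
qed

instance rsphere :: second_countable_topology
proof
  show "\<exists>B :: rsphere set set. countable B \<and> open = generate_topology B"
  proof (rule separable_imp_countable_basis)
    fix e :: real assume "e > 0"
    then obtain k where k: "finite k" "(UNIV :: rsphere set) \<subseteq> (\<Union>x\<in>k. ball x e)"
      using compact_rsphere unfolding compact_eq_totally_bounded by blast
    have "\<exists>c\<in>k. dist x c < e" for x
    proof -
      have "x \<in> (\<Union>x\<in>k. ball x e)" using k(2) by blast
      then show ?thesis by (auto simp: dist_commute)
    qed
    then show "\<exists>C. countable C \<and> (\<forall>x::rsphere. \<exists>c\<in>C. dist x c < e)"
      using countable_finite[OF k(1)] by (intro exI[of _ k]) simp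
  qed
qed

text \<open>This identifies the product sigma-algebra on paths with the Borel one and gives families
  of null open sets countable subfamilies with the same union. For fixed \<open>e\<close>, uniform
  continuity distributes all rational maps over the classes \<open>FF n\<close>, each of which has a
  finite net.\<close>

instance rat_map :: second_countable_topology
proof
  show "\<exists>B :: rat_map set set. countable B \<and> open = generate_topology B"
  proof (rule separable_imp_countable_basis)
    fix e :: real assume e: "e > 0"
    then have e8: "e/8 > 0" by simp
    define FF where "FF n = {f \<in> range apply_rat. \<forall>x y. dist y x < 1 / Suc n \<longrightarrow> dist (f y) (f x) < e/8}" for n
    obtain N where N: "finite N" "(UNIV :: rsphere set) \<subseteq> (\<Union>x\<in>N. ball x (e/8))"
      using compact_rsphere e8 unfolding compact_eq_totally_bounded by blast
    have "\<exists>F0\<subseteq>FF n. finite F0 \<and> (\<forall>f\<in>FF n. \<exists>g\<in>F0. \<forall>x\<in>UNIV. dist (f x) (g x) < 4 * (e/8))" for n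
    proof (rule equicontinuous_finite_net[OF compact_rsphere _ N(1)])
      fix x :: rsphere
      show "\<exists>U. open U \<and> x \<in> U \<and> (\<forall>f\<in>FF n. \<forall>y\<in>U. dist (f y) (f x) < e/8)"
        by (intro exI[of _ "ball x (1 / Suc n)"]) (auto simp: FF_def dist_commute)
    next
      fix f and x :: rsphere
      obtain y where "y \<in> N" "f x \<in> ball y (e/8)" using N(2) by blast
      then show "\<exists>y\<in>N. dist (f x) y < e/8" by (intro bexI[of _ y]) (auto simp: dist_commute)
    qed
    then obtain F0 where F0: "\<And>n. F0 n \<subseteq> FF n" "\<And>n. finite (F0 n)"
      "\<forall>n. \<forall>f\<in>FF n. \<exists>g\<in>F0 n. \<forall>x\<in>UNIV. dist (f x) (g x) < 4 * (e/8)" by metis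
    define C where "C = (\<Union>n. Abs_rat_map ` F0 n)"
    have "\<exists>c\<in>C. dist h c < e" for h
    proof -
      have "uniformly_continuous_on UNIV (apply_rat h)"
        by (rule compact_uniformly_continuous[OF continuous_on_apply_rat compact_rsphere])
      then obtain d where d: "d > 0" "\<forall>x\<in>UNIV. \<forall>x'\<in>UNIV. dist x' x < d \<longrightarrow> dist (apply_rat h x') (apply_rat h x) < e/8"
        unfolding uniformly_continuous_on_def using e8 by meson
      obtain n where "1 / Suc n < d" using d(1) nat_approx_posE by blast
      then have "apply_rat h \<in> FF n" unfolding FF_def using d(2) by auto
      then obtain g where g: "g \<in> F0 n" "\<forall>x\<in>UNIV. dist (apply_rat h x) (g x) < 4 * (e/8)" using F0(3) by blast
      obtain k where k: "g = apply_rat k" using g(1) F0(1)[of n] unfolding FF_def by blast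
      have "k \<in> C" using g(1) k unfolding C_def by (auto simp: image_iff intro!: exI[of _ n] bexI[of _ g] simp: apply_rat_inverse)
      moreover have "dist h k \<le> e/2" unfolding dist_rat_map_def
        using g(2) k by (intro cSUP_least) (auto intro: less_imp_le)
      ultimately show ?thesis using e by (intro bexI[of _ k]) auto
    qed
    moreover have "countable C" unfolding C_def using F0(2) by (auto intro: countable_finite)
    ultimately show "\<exists>C. countable C \<and> (\<forall>x::rat_map. \<exists>c\<in>C. dist x c < e)" by blast
  qed
qed

section \<open>Random compositions\<close>

text \<open>Evaluation is jointly continuous because rational maps carry the sup metric: changing
  the map costs at most its distance, uniformly in the point.\<close>

lemma continuous_on_apply_rat_compose:
  assumes "continuous_on S f" "continuous_on S h"
  shows "continuous_on S (\<lambda>s. apply_rat (f s) (h s))"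
  unfolding continuous_on_def
proof
  fix s assume s: "s \<in> S"
  have f: "(f \<longlongrightarrow> f s) (at s within S)" and h: "(h \<longlongrightarrow> h s) (at s within S)"
    using assms s by (auto simp: continuous_on_def)
  have "((\<lambda>t. dist (apply_rat (f s) (h t)) (apply_rat (f s) (h s))) \<longlongrightarrow> 0) (at s within S)"
    using tendsto_dist_iff[THEN iffD1, OF continuous_on_tendsto_compose[OF continuous_on_apply_rat[of UNIV "f s"] h]] by simp
  then have "((\<lambda>t. dist (f t) (f s) + dist (apply_rat (f s) (h t)) (apply_rat (f s) (h s))) \<longlongrightarrow> 0 + 0) (at s within S)"
    using tendsto_dist_iff[THEN iffD1, OF f] by (intro tendsto_add)
  then have *: "((\<lambda>t. dist (f t) (f s) + dist (apply_rat (f s) (h t)) (apply_rat (f s) (h s))) \<longlongrightarrow> 0) (at s within S)" by simp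
  have "((\<lambda>t. dist (apply_rat (f t) (h t)) (apply_rat (f s) (h s))) \<longlongrightarrow> 0) (at s within S)"
  proof (rule tendsto_sandwich[OF _ _ tendsto_const *])
    show "\<forall>\<^sub>F t in at s within S. dist (apply_rat (f t) (h t)) (apply_rat (f s) (h s))
        \<le> dist (f t) (f s) + dist (apply_rat (f s) (h t)) (apply_rat (f s) (h s))"
    proof (rule always_eventually, rule allI)
      fix t
      show "dist (apply_rat (f t) (h t)) (apply_rat (f s) (h s))
        \<le> dist (f t) (f s) + dist (apply_rat (f s) (h t)) (apply_rat (f s) (h s))"
        using dist_triangle[of "apply_rat (f t) (h t)" "apply_rat (f s) (h s)" "apply_rat (f s) (h t)"]
          dist_apply_rat_le[of "f t" "h t" "f s"] by linarith
    qed
  qed simp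
  then show "((\<lambda>s. apply_rat (f s) (h s)) \<longlongrightarrow> apply_rat (f s) (h s)) (at s within S)"
    by (rule tendsto_dist_iff[THEN iffD2])
qed

lemma continuous_random_comp_pair: "continuous_on UNIV (\<lambda>p. random_comp (fst p) n (snd p))"
proof (induction n)
  case (Suc n)
  have "continuous_on UNIV (\<lambda>p :: (nat \<Rightarrow> rat_map) \<times> rsphere. fst p n)"
    by (rule continuous_on_compose2[OF continuous_on_eval[of UNIV n]]) (auto intro: continuous_intros)
  then show ?case using continuous_on_apply_rat_compose[OF _ Suc] by simp
qed (simp add: continuous_on_snd)

lemma continuous_random_comp: "continuous_on S (random_comp \<gamma> n)"
proof -
  have "continuous_on S (\<lambda>z. (\<gamma>, z))" by (intro continuous_intros)
  from continuous_on_compose2[OF continuous_random_comp_pair this] show ?thesis by simp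
qed

lemma continuous_random_comp_path: "continuous_on S (\<lambda>\<gamma>. random_comp \<gamma> n z)"
proof -
  have "continuous_on S (\<lambda>\<gamma>. (\<gamma>, z))" by (intro continuous_intros)
  from continuous_on_compose2[OF continuous_random_comp_pair this] show ?thesis by simp
qed

text \<open>The tube lemma for joint continuity in path and point. Through it the hitting events
  become open, hence measurable.\<close>

lemma open_random_comp:
  assumes C: "compact C" and O': "open O'"
  shows "open {\<gamma>. random_comp \<gamma> n ` C \<subseteq> O'}"
proof (subst open_subopen, intro ballI)
  fix \<gamma> assume \<gamma>: "\<gamma> \<in> {\<gamma>. random_comp \<gamma> n ` C \<subseteq> O'}"
  define W where "W = (\<lambda>p. random_comp (fst p) n (snd p)) -` O'"
  have W: "open W" unfolding W_def by (rule open_vimage[OF O' continuous_random_comp_pair])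
  have "{\<gamma>} \<times> C \<subseteq> W"
  proof
    fix p assume "p \<in> {\<gamma>} \<times> C"
    then obtain c where "c \<in> C" "p = (\<gamma>, c)" by blast
    then show "p \<in> W" using \<gamma> by (simp add: W_def image_subset_iff)
  qed
  from Elementary_Topology.tube_lemma[OF C W this]
  obtain X0 where X0: "\<gamma> \<in> X0 \<and> open X0 \<and> X0 \<times> C \<subseteq> W" by (rule exE)
  have "random_comp \<gamma>' n c \<in> O'" if "\<gamma>' \<in> X0" "c \<in> C" for \<gamma>' c
  proof -
    have "(\<gamma>', c) \<in> W" using X0 that by blast
    then show ?thesis by (simp add: W_def)
  qed
  then have "X0 \<subseteq> {\<gamma>. random_comp \<gamma> n ` C \<subseteq> O'}"
    by - (rule subsetI, rule CollectI, rule image_subsetI)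
  then show "\<exists>T. open T \<and> \<gamma> \<in> T \<and> T \<subseteq> {\<gamma>. random_comp \<gamma> n ` C \<subseteq> O'}"
    using X0 by (intro exI[of _ X0]) simp
qed

lemma random_comp_add: "random_comp \<gamma> (m + n) = random_comp (\<lambda>k. \<gamma> (m + k)) n \<circ> random_comp \<gamma> m"
  by (induction n) (simp_all add: comp_assoc)

lemma random_comp_cong: "(\<And>k. k < n \<Longrightarrow> \<gamma> k = \<gamma>' k) \<Longrightarrow> random_comp \<gamma> n = random_comp \<gamma>' n"
  by (induction n) simp_all

lemma random_comp_comb_seq_le: "k \<le> n \<Longrightarrow> random_comp (comb_seq n \<gamma> \<gamma>') k = random_comp \<gamma> k"
  by (rule random_comp_cong) (simp add: comb_seq_def)

text \<open>\<open>comb_seq n\<close> follows one path for \<open>n\<close> steps and then starts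
  the other from its beginning; the Markov property at time \<open>n\<close> is used in this
  form.\<close>

lemma random_comp_comb_seq: "random_comp (comb_seq n \<gamma> \<gamma>') (n + k) = random_comp \<gamma>' k \<circ> random_comp \<gamma> n"
proof -
  have "(\<lambda>k. comb_seq n \<gamma> \<gamma>' (n + k)) = \<gamma>'" by (simp add: comb_seq_def fun_eq_iff)
  then show ?thesis by (simp add: random_comp_add random_comp_comb_seq_le)
qed

lemma random_comp_case_nat: "random_comp (case_nat g \<gamma>) (Suc n) = random_comp \<gamma> n \<circ> apply_rat g"
  using random_comp_add[of "case_nat g \<gamma>" "Suc 0" n] by simp

locale random_rational =
  fixes \<tau> :: "rat_map measure"
  assumes borel_probs: "\<tau> \<in> borel_probs"
begin

abbreviation "\<Gamma> \<equiv> topological_support \<tau>"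
abbreviation "P \<equiv> path_measure \<tau>"
abbreviation "G \<equiv> semigroup_of \<tau>"

sublocale prob_space \<tau> using borel_probs by (simp add: borel_probs_def)

sublocale sequence_space \<tau>
  by (intro sequence_space.intro product_prob_space.intro product_sigma_finite.intro product_prob_space_axioms.intro)
     (auto intro: prob_space_axioms sigma_finite_measure_axioms)

lemma sets_tau: "sets \<tau> = sets borel" using borel_probs by (simp add: borel_probs_def)

lemma space_tau: "space \<tau> = UNIV" using sets_eq_imp_space_eq[OF sets_tau] by simp

lemma sets_P: "sets P = sets borel"
  unfolding path_measure_def using sets_PiM_equal_borel[where 'a = nat and 'b = rat_map]
    sets_PiM_cong[of UNIV UNIV "\<lambda>_::nat. \<tau>" "\<lambda>_. borel"] sets_tau by simp

lemma space_P: "space P = UNIV" using sets_eq_imp_space_eq[OF sets_P] by simp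

sublocale path: prob_space P unfolding path_measure_def by (rule P.prob_space_axioms)

text \<open>The complement of the support is a union of null open sets, and by Lindelof countably
  many of them suffice.\<close>

lemma AE_support: "AE g in \<tau>. g \<in> \<Gamma>"
proof -
  define FF where "FF = {U :: rat_map set. open U \<and> emeasure \<tau> U = 0}"
  have eq: "- \<Gamma> = \<Union>FF" unfolding FF_def topological_support_def by (auto simp: not_less zero_less_iff_neq_zero)
  obtain F' where F': "F' \<subseteq> FF" "countable F'" "\<Union>F' = \<Union>FF"
    using Lindelof[of FF] unfolding FF_def by auto
  have "(\<Union>U\<in>F'. U) \<in> null_sets \<tau>"
    by (rule null_sets_UN'[OF F'(2)]) (use F'(1) in \<open>auto simp: FF_def null_sets_def sets_tau\<close>)
  then have "AE g in \<tau>. g \<notin> - \<Gamma>" using F'(3) eq by (intro AE_not_in) simp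
  then show ?thesis by simp
qed

lemma AE_paths: "AE \<gamma> in P. \<forall>n. \<gamma> n \<in> \<Gamma>"
proof (subst AE_all_countable, rule allI)
  fix n
  have "AE g in distr P \<tau> (\<lambda>\<gamma>. \<gamma> n). g \<in> \<Gamma>"
    unfolding path_measure_def by (subst PiM_component) (simp_all add: AE_support)
  moreover have "(\<lambda>\<gamma>. \<gamma> n) \<in> measurable P \<tau>" unfolding path_measure_def by simp
  ultimately show "AE \<gamma> in P. \<gamma> n \<in> \<Gamma>" by (rule AE_distrD[rotated])
qed

text \<open>A basic box around \<open>\<gamma>\<close> inside \<open>A\<close> restricts only
  finitely many factors, each to a neighbourhood of a point of the support.\<close>

lemma positive_open:
  assumes A: "open A" and \<gamma>: "\<gamma> \<in> A" "\<And>n. \<gamma> n \<in> \<Gamma>"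
  shows "measure P A > 0"
proof -
  have "openin (product_topology (\<lambda>i::nat. euclidean :: rat_map topology) UNIV) A"
    using A by (simp add: open_fun_def)
  from product_topology_open_contains_basis[OF this \<gamma>(1)]
  obtain X where X: "\<gamma> \<in> (\<Pi>\<^sub>E i\<in>UNIV. X i)" "\<And>i. open (X i)" "finite {i. X i \<noteq> UNIV}" "(\<Pi>\<^sub>E i\<in>UNIV. X i) \<subseteq> A"
    by (auto simp: open_openin[symmetric])
  define J where "J = {i. X i \<noteq> UNIV}"
  have eq: "prod_emb UNIV (\<lambda>_. \<tau>) J (Pi\<^sub>E J X) = (\<Pi>\<^sub>E i\<in>UNIV. X i)"
    by (auto simp: prod_emb_def J_def space_tau PiE_iff Pi_iff) (metis UNIV_I)+
  have "emeasure P (\<Pi>\<^sub>E i\<in>UNIV. X i) = (\<Prod>i\<in>J. emeasure \<tau> (X i))"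
    unfolding path_measure_def eq[symmetric]
    by (rule emeasure_PiM_emb) (use X in \<open>auto simp: J_def sets_tau\<close>)
  moreover have "emeasure \<tau> (X i) > 0" for i
    using \<gamma>(2)[of i] X(1,2) unfolding topological_support_def by (auto simp: PiE_iff)
  then have "(\<Prod>i\<in>J. emeasure \<tau> (X i)) \<noteq> 0" using X(3) by (simp add: J_def prod_zero_iff zero_less_iff_neq_zero)
  moreover have "emeasure P (\<Pi>\<^sub>E i\<in>UNIV. X i) \<le> emeasure P A"
    by (rule emeasure_mono[OF X(4)]) (simp add: sets_P A)
  ultimately have "emeasure P A \<noteq> 0" by auto
  then show ?thesis by (simp add: path.emeasure_eq_measure zero_less_measure_iff)
qed

lemma comp_semigroup: "g \<in> insert id G \<Longrightarrow> h \<in> insert id G \<Longrightarrow> g \<circ> h \<in> insert id G"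
  unfolding semigroup_of_def by (elim insertE) (simp_all add: gen_semigroup.comp)

lemma random_comp_in_semigroup:
  assumes "\<And>n. \<gamma> n \<in> \<Gamma>" shows "random_comp \<gamma> n \<in> insert id G"
proof (induction n)
  case (Suc n)
  have "apply_rat (\<gamma> n) \<in> G" unfolding semigroup_of_def using assms by (intro gen_semigroup.generator) auto
  then show ?case unfolding random_comp.simps by (intro comp_semigroup Suc) simp
qed simp

lemma semigroup_random_comp:
  assumes "g \<in> G" shows "\<exists>\<gamma> n. (\<forall>i. \<gamma> i \<in> \<Gamma>) \<and> g = random_comp \<gamma> n"
  using assms unfolding semigroup_of_def
proof (induction rule: gen_semigroup.induct)
  case (generator g)
  then obtain a where "a \<in> \<Gamma>" "g = apply_rat a" by blast
  then show ?case by (intro exI[of _ "\<lambda>_. a"] exI[of _ "Suc 0"]) simp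
next
  case (comp g h)
  then obtain \<gamma> n \<gamma>' m where *: "\<forall>i. \<gamma> i \<in> \<Gamma>" "g = random_comp \<gamma> n" "\<forall>i. \<gamma>' i \<in> \<Gamma>" "h = random_comp \<gamma>' m" by blast
  show ?case
  proof (intro exI[of _ "comb_seq m \<gamma>' \<gamma>"] exI[of _ "m + n"] conjI)
    show "\<forall>i. comb_seq m \<gamma>' \<gamma> i \<in> \<Gamma>" using * by (simp add: comb_seq_def)
    show "g \<circ> h = random_comp (comb_seq m \<gamma>' \<gamma>) (m + n)" by (simp only: random_comp_comb_seq *)
  qed
qed

lemma continuous_semigroup: "g \<in> G \<Longrightarrow> continuous_on X g"
  using semigroup_random_comp continuous_random_comp by blast

text \<open>Splicing an independent path after time \<open>n\<close> reproduces \<open>P\<close>,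
  and the shift by \<open>n\<close> recovers the spliced path; so \<open>P\<close> is shift
  invariant.\<close>

lemma AE_shift:
  assumes "AE \<gamma> in P. Q \<gamma>" shows "AE \<gamma> in P. Q (\<lambda>k. \<gamma> (n + k))"
proof -
  have m: "(\<lambda>\<gamma> k. \<gamma> (n + k)) \<in> measurable P P"
    unfolding path_measure_def by (rule measurable_PiM_single') (auto simp: space_PiM)
  have "distr P P (\<lambda>\<gamma> k. \<gamma> (n + k)) = P"
  proof -
    have mc: "(\<lambda>(\<gamma>, \<gamma>'). comb_seq n \<gamma> \<gamma>') \<in> measurable (P \<Otimes>\<^sub>M P) P"
      unfolding path_measure_def by (rule measurable_comb_seq)
    have "distr P P (\<lambda>\<gamma> k. \<gamma> (n + k)) = distr (distr (P \<Otimes>\<^sub>M P) P (\<lambda>(\<gamma>, \<gamma>'). comb_seq n \<gamma> \<gamma>')) P (\<lambda>\<gamma> k. \<gamma> (n + k))"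
      unfolding path_measure_def PiM_comb_seq ..
    also have "\<dots> = distr (P \<Otimes>\<^sub>M P) P snd"
      by (subst distr_distr[OF m mc]) (rule distr_cong; auto simp: comb_seq_def)
    also have "\<dots> = P"
    proof (rule measure_eqI)
      fix A assume A: "A \<in> sets (distr (P \<Otimes>\<^sub>M P) P snd)"
      have "snd -` A \<inter> space (P \<Otimes>\<^sub>M P) = UNIV \<times> A" by (auto simp: space_pair_measure space_P)
      then show "emeasure (distr (P \<Otimes>\<^sub>M P) P snd) A = emeasure P A"
        using A path.emeasure_pair_measure_Times[of UNIV P A] path.emeasure_space_1
        by (simp add: emeasure_distr space_P sets_P)
    qed simp
    finally show ?thesis .
  qed
  then have "AE \<gamma> in distr P P (\<lambda>\<gamma> k. \<gamma> (n + k)). Q \<gamma>" using assms by (simp only:)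
  then show ?thesis by (rule AE_distrD[OF m])
qed

text \<open>If the target is not reached by time \<open>n\<close>, then from the state at time \<open>n\<close> it is still reached
  with probability at least \<open>c\<close>; hence the probability \<open>q\<close> of never reaching it satisfies \<open>q \<le> (1 - c) q\<close>.\<close>

lemma hitting_zero_one:
  fixes hit :: "(rsphere \<Rightarrow> rsphere) \<Rightarrow> bool"
  assumes op: "\<And>h n. h \<in> insert id G \<Longrightarrow> open {\<gamma>. hit (random_comp \<gamma> n \<circ> h)}"
    and c: "c > 0" "\<And>h. h \<in> insert id G \<Longrightarrow> c \<le> measure P {\<gamma>. \<exists>n. hit (random_comp \<gamma> n \<circ> h)}"
    and h: "h \<in> insert id G"
  shows "AE \<gamma> in P. \<exists>n. hit (random_comp \<gamma> n \<circ> h)"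
proof -
  define N where "N k = {\<gamma>. \<not> hit (random_comp \<gamma> k \<circ> h)}" for k
  \<comment> \<open>The events of missing the target up to time \<open>n\<close> decrease to
    \<open>D\<close>, the event of never hitting it.\<close>
  define B where "B n = (\<Inter>k\<in>{..n}. N k)" for n
  define D where "D = (\<Inter>n. B n)"
  have sN: "N k \<in> sets P" for k
  proof -
    have "- N k = {\<gamma>. hit (random_comp \<gamma> k \<circ> h)}" by (auto simp: N_def)
    then have "open (- N k)" using op[OF h] by simp
    then show ?thesis by (simp add: sets_P closed_def)
  qed
  have sB: "B n \<in> sets P" for n unfolding B_def using sN by auto
  have sD: "D \<in> sets P" unfolding D_def using sB by auto
  have Deq: "D = {\<gamma>. \<forall>n. \<not> hit (random_comp \<gamma> n \<circ> h)}" unfolding D_def B_def N_def by auto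
  have mc: "(\<lambda>(\<gamma>, \<gamma>'). comb_seq n \<gamma> \<gamma>') \<in> measurable (P \<Otimes>\<^sub>M P) P" for n
    unfolding path_measure_def by (rule measurable_comb_seq)
  have step: "emeasure P D \<le> ennreal (1 - c) * emeasure P (B n)" for n
  proof -
    \<comment> \<open>The path is split at time \<open>n\<close> into independent past and future,
      and Fubini conditions on the past.\<close>
    define D' where "D' = (\<lambda>(\<gamma>, \<gamma>'). comb_seq n \<gamma> \<gamma>') -` D \<inter> space (P \<Otimes>\<^sub>M P)"
    have sD': "D' \<in> sets (P \<Otimes>\<^sub>M P)" unfolding D'_def by (rule measurable_sets[OF mc sD])
    have "emeasure P D = emeasure (distr (P \<Otimes>\<^sub>M P) P (\<lambda>(\<gamma>, \<gamma>'). comb_seq n \<gamma> \<gamma>')) D"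
      unfolding path_measure_def PiM_comb_seq ..
    also have "\<dots> = emeasure (P \<Otimes>\<^sub>M P) D'" unfolding D'_def by (rule emeasure_distr[OF mc sD])
    also have "\<dots> = (\<integral>\<^sup>+ \<gamma>. emeasure P (Pair \<gamma> -` D') \<partial>P)" by (rule path.emeasure_pair_measure_alt[OF sD'])
    also have "\<dots> \<le> (\<integral>\<^sup>+ \<gamma>. ennreal (1 - c) * indicator (B n) \<gamma> \<partial>P)"
    proof (rule nn_integral_mono_AE, use AE_paths in eventually_elim)
      fix \<gamma> :: "nat \<Rightarrow> rat_map" assume \<gamma>: "\<forall>n. \<gamma> n \<in> \<Gamma>"
      define h' where "h' = random_comp \<gamma> n \<circ> h"
      have h': "h' \<in> insert id G" unfolding h'_def using \<gamma> h by (intro comp_semigroup random_comp_in_semigroup) auto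
      define A where "A = {\<gamma>'. \<exists>k. hit (random_comp \<gamma>' k \<circ> h')}"
      have "A = (\<Union>k. {\<gamma>'. hit (random_comp \<gamma>' k \<circ> h')})" by (auto simp: A_def)
      then have sA: "A \<in> sets P" using op[OF h'] by (auto simp: sets_P)
      have "Pair \<gamma> -` D' \<subseteq> - A"
      proof
        fix \<gamma>' assume "\<gamma>' \<in> Pair \<gamma> -` D'"
        then have "\<not> hit (random_comp (comb_seq n \<gamma> \<gamma>') (n + k) \<circ> h)" for k by (auto simp: D'_def Deq)
        then show "\<gamma>' \<in> - A" by (auto simp: A_def random_comp_comb_seq h'_def comp_assoc)
      qed
      moreover have "- A \<in> sets P" using sets.compl_sets[OF sA] by (simp add: space_P Compl_eq_Diff_UNIV)
      ultimately have "emeasure P (Pair \<gamma> -` D') \<le> emeasure P (- A)" by (intro emeasure_mono) auto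
      also have "\<dots> = ennreal (1 - measure P A)"
        using path.prob_compl[OF sA] by (simp add: path.emeasure_eq_measure space_P Compl_eq_Diff_UNIV)
      also have "\<dots> \<le> ennreal (1 - c)" using c(2)[OF h'] by (intro ennreal_leI) (simp add: A_def)
      finally have le: "emeasure P (Pair \<gamma> -` D') \<le> ennreal (1 - c)" .
      \<comment> \<open>A past that has already hit the target has no continuation in
        \<open>D\<close>; any other past leaves at most the failure probability
        \<open>1 - c\<close>.\<close>
      show "emeasure P (Pair \<gamma> -` D') \<le> ennreal (1 - c) * indicator (B n) \<gamma>"
      proof (cases "\<gamma> \<in> B n")
        case False
        then obtain k where k: "k \<le> n" "hit (random_comp \<gamma> k \<circ> h)" by (auto simp: B_def N_def)
        then have "hit (random_comp (comb_seq n \<gamma> \<gamma>') k \<circ> h)" for \<gamma>' by (simp add: random_comp_comb_seq_le)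
        then have "Pair \<gamma> -` D' = {}" by (auto simp: D'_def Deq)
        then show ?thesis by simp
      qed (use le in simp)
    qed
    also have "\<dots> = ennreal (1 - c) * emeasure P (B n)" using sB by (simp add: nn_integral_cmult_indicator)
    finally show ?thesis .
  qed
  have c1: "c \<le> 1" using c(2)[OF h] path.prob_le_1 order_trans by blast
  have "measure P D \<le> (1 - c) * measure P (B n)" for n
    using step[of n] c1 by (simp add: path.emeasure_eq_measure ennreal_mult[symmetric])
  moreover have "(\<lambda>n. (1 - c) * measure P (B n)) \<longlonglongrightarrow> (1 - c) * measure P D"
    unfolding D_def by (intro tendsto_mult tendsto_const path.finite_Lim_measure_decseq)
      (use sB in \<open>auto simp: decseq_def B_def\<close>)
  ultimately have "measure P D \<le> (1 - c) * measure P D" by (intro LIMSEQ_le_const) auto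
  then have "c * measure P D \<le> 0" by (simp add: algebra_simps)
  then have "measure P D = 0" using c(1) measure_nonneg[of P D] by (simp add: mult_le_0_iff)
  then have "D \<in> null_sets P" using sD by (simp add: null_sets_def path.emeasure_eq_measure)
  then have "AE \<gamma> in P. \<gamma> \<notin> D" by (rule AE_not_in)
  then show ?thesis by (simp add: Deq)
qed

text \<open>The constant for the zero-one argument must be uniform over all states \<open>h\<close>.
  Near a limit \<open>p\<close>, one neighbourhood of paths brings the image of \<open>V\<close>
  into a target for all \<open>h\<close> close to \<open>p\<close>; compactness of the closure of
  \<open>insert id G\<close> leaves finitely many constants. Uniform closeness on \<open>V\<close>
  is a hypothesis so that single points are covered as well as compact subsets of the Fatou
  set.\<close>

lemma hitting:
  assumes V: "compact V" and contV: "\<And>p. p \<in> closure (insert id G) \<Longrightarrow> continuous_on V p"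
    and close: "\<And>p e. p \<in> closure (insert id G) \<Longrightarrow> e > 0 \<Longrightarrow>
        \<forall>\<^sub>F h in inf (nhds p) (principal (insert id G)). \<forall>x\<in>V. dist (h x) (p x) < e"
    and TT: "\<And>O'. O' \<in> TT \<Longrightarrow> open O'"
    and reach: "\<And>p. p \<in> closure (insert id G) \<Longrightarrow> \<exists>g\<in>G. \<exists>O'\<in>TT. g ` p ` V \<subseteq> O'"
    and h: "h \<in> insert id G"
  shows "AE \<gamma> in P. \<exists>n. \<exists>O'\<in>TT. random_comp \<gamma> n ` h ` V \<subseteq> O'"
proof -
  define hit where "hit f \<longleftrightarrow> (\<exists>O'\<in>TT. f ` V \<subseteq> O')" for f :: "rsphere \<Rightarrow> rsphere"
  have contG: "continuous_on S h" if "h \<in> insert id G" for h S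
    using that continuous_semigroup by (auto simp: id_def)
  have cE: "compact (closure (insert id G))"
    using compact_Int_closed[OF compact_UNIV_fun[OF compact_rsphere] closed_closure] by simp
  have local: "\<exists>S c. open S \<and> p \<in> S \<and> c > 0 \<and> (\<forall>h\<in>S \<inter> insert id G. c \<le> measure P {\<gamma>. \<exists>n. hit (random_comp \<gamma> n \<circ> h)})"
    if p: "p \<in> closure (insert id G)" for p
  proof -
    obtain g O' where g: "g \<in> G" "O' \<in> TT" "g ` p ` V \<subseteq> O'" using reach[OF p] by blast
    obtain \<gamma> n where \<gamma>: "\<forall>i. \<gamma> i \<in> \<Gamma>" "g = random_comp \<gamma> n" using semigroup_random_comp[OF g(1)] by blast
    have cp: "compact (p ` V)" using contV[OF p] V by (rule compact_continuous_image)
    have "open (g -` O')" by (rule open_vimage[OF TT[OF g(2)] continuous_semigroup[OF g(1)]])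
    moreover have "p ` V \<subseteq> g -` O'" using g(3) by auto
    ultimately obtain e where e: "e > 0" "(\<Union>x\<in>p ` V. ball x e) \<subseteq> g -` O'"
      by (rule compact_subset_open_imp_ball_epsilon_subset[OF cp])
    \<comment> \<open>A compact neighbourhood of the image of \<open>V\<close> under
      \<open>p\<close> that \<open>g\<close> still sends into \<open>O'\<close>; it catches the
      image of \<open>V\<close> under every \<open>h\<close> near \<open>p\<close>.\<close>
    define C where "C = closure (\<Union>x\<in>p ` V. ball x (e/2))"
    have C: "compact C" using compact_Int_closed[OF compact_rsphere, of C] by (simp add: C_def)
    have CO: "g ` C \<subseteq> O'"
    proof
      fix z assume "z \<in> g ` C"
      then obtain y where y: "y \<in> C" "z = g y" by blast
      have "e/2 > 0" using e(1) by simp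
      then obtain y' where "y' \<in> (\<Union>x\<in>p ` V. ball x (e/2))" "dist y' y < e/2"
        using y(1) unfolding C_def closure_approachable by blast
      then obtain x where "x \<in> p ` V" "dist x y' < e/2" "dist y' y < e/2" by auto
      then have "x \<in> p ` V" "dist x y < e" using dist_triangle[of x y y'] by auto
      then have "y \<in> (\<Union>x\<in>p ` V. ball x e)" by auto
      then have "y \<in> g -` O'" using e(2) by blast
      then show "z \<in> O'" using y by simp
    qed
    have e2: "e/2 > 0" using e(1) by simp
    have "\<forall>\<^sub>F h in inf (nhds p) (principal (insert id G)). \<forall>x\<in>V. dist (h x) (p x) < e/2"
      by (rule close[OF p e2])
    then obtain S where S: "open S" "p \<in> S" "\<forall>h\<in>S. h \<in> insert id G \<longrightarrow> (\<forall>x\<in>V. dist (h x) (p x) < e/2)"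
      unfolding eventually_inf_principal eventually_nhds by auto
    define c where "c = measure P {\<gamma>. random_comp \<gamma> n ` C \<subseteq> O'}"
    have opn: "open {\<gamma>. random_comp \<gamma> n ` C \<subseteq> O'}" by (rule open_random_comp[OF C TT[OF g(2)]])
    have c: "c > 0" unfolding c_def using opn by (rule positive_open[of _ \<gamma>]) (use CO \<gamma> in auto)
    have "c \<le> measure P {\<gamma>. \<exists>n. hit (random_comp \<gamma> n \<circ> h)}" if h: "h \<in> S \<inter> insert id G" for h
      unfolding c_def
    proof (rule path.finite_measure_mono)
      have hC: "h ` V \<subseteq> C"
      proof
        fix z assume "z \<in> h ` V"
        then obtain x where x: "x \<in> V" "z = h x" by blast
        then have "dist (p x) z < e/2" using S(3) h by (auto simp: dist_commute)
        then have "z \<in> (\<Union>x\<in>p ` V. ball x (e/2))" using x by auto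
        then show "z \<in> C" unfolding C_def by (rule subsetD[OF closure_subset])
      qed
      show "{\<gamma>. random_comp \<gamma> n ` C \<subseteq> O'} \<subseteq> {\<gamma>. \<exists>n. hit (random_comp \<gamma> n \<circ> h)}"
      proof
        fix \<gamma>' assume "\<gamma>' \<in> {\<gamma>. random_comp \<gamma> n ` C \<subseteq> O'}"
        then have "(random_comp \<gamma>' n \<circ> h) ` V \<subseteq> O'" using hC by (auto simp: image_subset_iff subset_iff)
        then show "\<gamma>' \<in> {\<gamma>. \<exists>n. hit (random_comp \<gamma> n \<circ> h)}" using g(2) unfolding hit_def by blast
      qed
      have "{\<gamma>. \<exists>n. hit (random_comp \<gamma> n \<circ> h)} = (\<Union>n. \<Union>O'\<in>TT. {\<gamma>. random_comp \<gamma> n ` (h ` V) \<subseteq> O'})"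
        unfolding hit_def by (auto simp: image_comp)
      moreover have "open \<dots>"
        using compact_continuous_image[OF contG V, of h] h by (intro open_UN ballI open_random_comp TT) auto
      ultimately show "{\<gamma>. \<exists>n. hit (random_comp \<gamma> n \<circ> h)} \<in> sets P" by (simp add: sets_P)
    qed
    then show ?thesis using S c by blast
  qed
  then obtain S c where Sc: "\<And>p. p \<in> closure (insert id G) \<Longrightarrow> open (S p) \<and> p \<in> S p \<and> c p > 0 \<and>
       (\<forall>h\<in>S p \<inter> insert id G. c p \<le> measure P {\<gamma>. \<exists>n. hit (random_comp \<gamma> n \<circ> h)})" by metis
  have "closure (insert id G) \<subseteq> \<Union>(S ` closure (insert id G))" using Sc by blast
  with compactE_image[OF cE, of "closure (insert id G)" S] Sc
  obtain I where I: "I \<subseteq> closure (insert id G)" "finite I" "closure (insert id G) \<subseteq> \<Union>(S ` I)" by blast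
  have Ine: "I \<noteq> {}" using I(3) closure_subset[of "insert id G"] by auto
  define c0 where "c0 = Min (c ` I)"
  have c0: "c0 > 0" unfolding c0_def using I Ine Sc by (subst Min_gr_iff) auto
  have "AE \<gamma> in P. \<exists>n. hit (random_comp \<gamma> n \<circ> h)"
  proof (rule hitting_zero_one[OF _ c0 _ h])
    fix h n assume "h \<in> insert id G"
    have "{\<gamma>. hit (random_comp \<gamma> n \<circ> h)} = (\<Union>O'\<in>TT. {\<gamma>. random_comp \<gamma> n ` (h ` V) \<subseteq> O'})"
      unfolding hit_def by (auto simp: image_comp)
    moreover have "open \<dots>"
      using compact_continuous_image[OF contG V, of h] \<open>h \<in> insert id G\<close> by (intro open_UN ballI open_random_comp TT) auto
    ultimately show "open {\<gamma>. hit (random_comp \<gamma> n \<circ> h)}" by simp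
  next
    fix h assume h: "h \<in> insert id G"
    then obtain p where p: "p \<in> I" "h \<in> S p" using I(3) closure_subset[of "insert id G"] by blast
    have "c0 \<le> c p" unfolding c0_def using p I(2) by (intro Min_le) auto
    also have "\<dots> \<le> measure P {\<gamma>. \<exists>n. hit (random_comp \<gamma> n \<circ> h)}" using Sc[of p] p I(1) h by auto
    finally show "c0 \<le> measure P {\<gamma>. \<exists>n. hit (random_comp \<gamma> n \<circ> h)}" .
  qed
  then show ?thesis by (rule AE_mp) (auto simp: hit_def image_comp)
qed

lemma hitting_equicontinuous:
  assumes V: "compact V" and eq: "\<And>x. x \<in> V \<Longrightarrow> equi_at (insert id G) x" and TT: "\<And>O'. O' \<in> TT \<Longrightarrow> open O'"
    and reach: "\<And>p. p \<in> closure (insert id G) \<Longrightarrow> \<exists>g\<in>G. \<exists>O'\<in>TT. g ` p ` V \<subseteq> O'"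
    and h: "h \<in> insert id G"
  shows "AE \<gamma> in P. \<exists>n. \<exists>O'\<in>TT. random_comp \<gamma> n ` h ` V \<subseteq> O'"
proof (rule hitting[OF V _ _ TT reach h])
  show "continuous_on V p" if p: "p \<in> closure (insert id G)" for p
    using equi_at_imp_isCont[OF equi_at_closure[OF eq] p] by (intro continuous_at_imp_continuous_on) auto
qed (rule eventually_uniformly_close[OF _ V eq])

text \<open>On a single point pointwise closeness is already uniform, so the argument reaches every
  \<open>z\<close>, on the Julia set too.\<close>

lemma hitting_point:
  assumes TT: "\<And>O'. O' \<in> TT \<Longrightarrow> open O'" and reach: "\<And>x. \<exists>g\<in>G. \<exists>O'\<in>TT. g x \<in> O'"
  shows "AE \<gamma> in P. \<exists>n. \<exists>O'\<in>TT. random_comp \<gamma> n z \<in> O'"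
proof -
  have "AE \<gamma> in P. \<exists>n. \<exists>O'\<in>TT. random_comp \<gamma> n ` id ` {z} \<subseteq> O'"
  proof (rule hitting[OF _ _ _ TT])
    show "\<exists>g\<in>G. \<exists>O'\<in>TT. g ` p ` {z} \<subseteq> O'" for p using reach[of "p z"] by simp
    show "\<forall>\<^sub>F h in inf (nhds p) (principal (insert id G)). \<forall>x\<in>{z}. dist (h x) (p x) < e" if "e > 0" for p :: "rsphere \<Rightarrow> rsphere" and e
      using eventually_nhds_eval[OF that, of z p] unfolding eventually_inf_principal by (auto elim: eventually_mono)
  qed auto
  then show ?thesis by simp
qed

end

section \<open>Contraction along random orbits\<close>

definition disc :: "bool \<times> complex \<times> real \<Rightarrow> rsphere set" where
  "disc = (\<lambda>(b, w, r). chart b ` ball w r)"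

definition closed_disc :: "bool \<times> complex \<times> real \<Rightarrow> rsphere set" where
  "closed_disc = (\<lambda>(b, w, r). chart b ` cball w r)"

lemma open_disc: "open (disc v)"
  by (auto simp: disc_def split: prod.split intro: open_chart_image)

lemma compact_closed_disc: "compact (closed_disc v)"
  by (auto simp: closed_disc_def split: prod.split intro: compact_continuous_image continuous_on_chart)

lemma disc_subset: "disc v \<subseteq> closed_disc v"
  by (auto simp: disc_def closed_disc_def split: prod.split)

locale cooperation = random_rational +
  assumes kernel_empty: "kernel_julia_set (semigroup_of \<tau>) = {}"
    and julia_nonempty: "julia_set (semigroup_of \<tau>) \<noteq> {}"
begin

lemma sholo_semigroup: "g \<in> G \<Longrightarrow> sholo (\<lambda>w. g (chart b w)) UNIV"
  unfolding semigroup_of_def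
proof (induction arbitrary: b rule: gen_semigroup.induct)
  case (generator g)
  then show ?case using sholo_apply_rat by auto
next
  case (comp g h)
  show ?case unfolding comp_def by (rule sholo_compose[OF comp.IH(2) comp.IH(1)])
qed

sublocale holomorphic_semigroup "semigroup_of \<tau>"
proof
  show "g \<circ> h \<in> G" if "g \<in> G" "h \<in> G" for g h
    using that unfolding semigroup_of_def by (rule gen_semigroup.comp)
qed (use kernel_empty julia_nonempty continuous_semigroup sholo_semigroup in auto)

text \<open>The doubled radius provides the room around the closed disc that
  \<open>contraction\<close> demands.\<close>

definition fatou_disc :: "bool \<times> complex \<times> real \<Rightarrow> bool" where
  "fatou_disc = (\<lambda>(b, w, r). r > 0 \<and> chart b ` ball w (2 * r) \<subseteq> F)"

lemma fatou_disc_subset: "fatou_disc v \<Longrightarrow> closed_disc v \<subseteq> F"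
proof -
  obtain b w r where v: "v = (b, w, r)" by (cases v)
  assume "fatou_disc v"
  then have "r > 0" "chart b ` ball w (2 * r) \<subseteq> F" by (auto simp: fatou_disc_def v)
  moreover from this(1) have "cball w r \<subseteq> ball w (2 * r)" by auto
  ultimately show ?thesis by (auto simp: closed_disc_def v)
qed

lemma fatou_disc_exists:
  assumes "z \<in> F" obtains v where "fatou_disc v" "z \<in> disc v"
proof -
  obtain b w r where "r > 0" "z = chart b w" "chart b ` ball w r \<subseteq> F"
    by (rule disc_in_open[OF open_fatou assms])
  then show ?thesis by (intro that[of "(b, w, r / 2)"]) (auto simp: fatou_disc_def disc_def)
qed

lemma finite_disc_cover:
  "\<exists>VV. finite VV \<and> (\<forall>v\<in>VV. fatou_disc v) \<and> (\<forall>x. \<exists>g\<in>G. \<exists>v\<in>VV. g x \<in> disc v)"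
proof -
  have "\<exists>g v. g \<in> G \<and> fatou_disc v \<and> g x \<in> disc v" for x
  proof -
    obtain g where g: "g \<in> G" "g x \<in> F" by (rule to_fatou)
    obtain v where "fatou_disc v" "g x \<in> disc v" by (rule fatou_disc_exists[OF g(2)])
    then show ?thesis using g(1) by blast
  qed
  then obtain g v where gv: "\<And>x. g x \<in> G" "\<And>x. fatou_disc (v x)" "\<And>x. g x x \<in> disc (v x)" by metis
  have "open (g x -` disc (v x))" for x by (rule open_vimage[OF open_disc cont[OF gv(1)]])
  moreover have "UNIV \<subseteq> (\<Union>x. g x -` disc (v x))" using gv(3) by auto
  ultimately obtain C where C: "finite C" "UNIV \<subseteq> (\<Union>x\<in>C. g x -` disc (v x))"
    using compactE_image[OF compact_rsphere, of UNIV "\<lambda>x. g x -` disc (v x)"] by metis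
  have "\<exists>h\<in>G. \<exists>u\<in>v ` C. h x \<in> disc u" for x
  proof -
    have "x \<in> (\<Union>x\<in>C. g x -` disc (v x))" using C(2) by blast
    then obtain c where "c \<in> C" "g c x \<in> disc (v c)" by auto
    then show ?thesis using gv(1)[of c] by (intro bexI[of _ "g c"] bexI[of _ "v c"]) auto
  qed
  then show ?thesis using C(1) gv(2) by (intro exI[of _ "v ` C"]) auto
qed

definition VV :: "(bool \<times> complex \<times> real) set" where
  "VV = (SOME VV. finite VV \<and> (\<forall>v\<in>VV. fatou_disc v) \<and> (\<forall>x. \<exists>g\<in>G. \<exists>v\<in>VV. g x \<in> disc v))"

lemma VV: "finite VV" "v \<in> VV \<Longrightarrow> fatou_disc v" "\<exists>g\<in>G. \<exists>v\<in>VV. g x \<in> disc v"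
  using someI_ex[OF finite_disc_cover] unfolding VV_def by blast+

definition core :: "rsphere set" where "core = (\<Union>v\<in>VV. disc v)"

lemma core_reach: "\<exists>g\<in>G. g x \<in> core"
  using VV(3)[of x] unfolding core_def by blast

text \<open>A Lebesgue number for the compact union of the closed discs makes \<open>d\<close>
  independent of the centre. The balls may leave \<open>core\<close>; only their centres lie in
  it.\<close>

lemma core_equicontinuous:
  assumes "e > 0"
  shows "\<exists>d>0. \<forall>y\<in>core. \<forall>g\<in>insert id G. \<forall>x\<in>ball y d. dist (g x) (g y) < e"
proof -
  define K where "K = (\<Union>v\<in>VV. closed_disc v)"
  have K: "compact K" unfolding K_def using VV(1) by (intro compact_UN compact_closed_disc)
  have KF: "K \<subseteq> F" unfolding K_def using VV(2) fatou_disc_subset by blast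
  have e2: "e/2 > 0" using assms by simp
  have "\<exists>U. open U \<and> y \<in> U \<and> (\<forall>f\<in>insert id G. \<forall>x\<in>U. dist (f x) (f y) < e/2)" if "y \<in> K" for y
    using equi_id[of y] that KF e2 unfolding equi_at_def by blast
  then obtain U where U: "\<And>y. y \<in> K \<Longrightarrow> open (U y)" "\<And>y. y \<in> K \<Longrightarrow> y \<in> U y"
     "\<forall>y\<in>K. \<forall>f\<in>insert id G. \<forall>x\<in>U y. dist (f x) (f y) < e/2" by metis
  have "K \<subseteq> \<Union>(U ` K)" using U(2) by auto
  then obtain d where d: "d > 0" "\<And>x. x \<in> K \<Longrightarrow> \<exists>G\<in>U ` K. ball x d \<subseteq> G"
    by (rule Heine_Borel_lemma[OF K]) (use U(1) in auto)
  have "dist (g x) (g y) < e" if y: "y \<in> core" and g: "g \<in> insert id G" and x: "x \<in> ball y d" for x y g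
  proof -
    have "y \<in> K" using y disc_subset unfolding core_def K_def by blast
    then obtain y' where y': "y' \<in> K" "ball y d \<subseteq> U y'" using d(2) by blast
    moreover have "y \<in> ball y d" using d(1) by simp
    ultimately have "x \<in> U y'" "y \<in> U y'" using x by auto
    then have "dist (g x) (g y') < e/2" "dist (g y) (g y') < e/2" using U(3) y'(1) g by auto
    then show ?thesis using dist_triangle2[of "g x" "g y" "g y'"] by simp
  qed
  then show ?thesis using d(1) by blast
qed

text \<open>Whatever follows time \<open>n\<close> is the identity or an element of the semigroup,
  so equicontinuity at \<open>y\<close> traps both orbits for ever; the factor 2 comes from
  comparing each with the image of \<open>y\<close>.\<close>

lemma stays_close:
  assumes \<gamma>: "\<forall>i. \<gamma> i \<in> \<Gamma>" and y: "y \<in> core" and d: "\<forall>g\<in>insert id G. \<forall>x\<in>ball y d. dist (g x) (g y) < e"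
    and "random_comp \<gamma> n a \<in> ball y d" "random_comp \<gamma> n b \<in> ball y d" and m: "m \<ge> n"
  shows "dist (random_comp \<gamma> m a) (random_comp \<gamma> m b) < 2 * e"
proof -
  define h where "h = random_comp (\<lambda>k. \<gamma> (n + k)) (m - n)"
  have h: "h \<in> insert id G" unfolding h_def using \<gamma> by (intro random_comp_in_semigroup) simp
  have eq: "random_comp \<gamma> m = h \<circ> random_comp \<gamma> n" using random_comp_add[of \<gamma> n "m - n"] m by (simp add: h_def)
  have "dist (h (random_comp \<gamma> n a)) (h y) < e" "dist (h (random_comp \<gamma> n b)) (h y) < e" using d h assms(4,5) by auto
  then show ?thesis unfolding eq using dist_triangle2[of "h (random_comp \<gamma> n a)" "h (random_comp \<gamma> n b)" "h y"] by simp
qed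

text \<open>By \<open>contraction\<close>, every limit can be followed by a map that shrinks the
  disc into a small ball centred in \<open>core\<close>; so this happens almost surely along the
  path, and \<open>stays_close\<close> takes over from then on. Countably many values of
  \<open>e\<close> give one null set.\<close>

lemma disc_contraction:
  assumes v: "fatou_disc v" and h: "h \<in> insert id G"
  shows "AE \<gamma> in P. \<forall>e>0. \<exists>N. \<forall>n\<ge>N. \<forall>x\<in>closed_disc v. \<forall>y\<in>closed_disc v.
    dist (random_comp \<gamma> n (h x)) (random_comp \<gamma> n (h y)) < e"
proof -
  obtain b w r where bwr: "v = (b, w, r)" by (cases v)
  have r: "r > 0" "r < 2 * r" "chart b ` ball w (2 * r) \<subseteq> F" using v by (auto simp: fatou_disc_def bwr)
  have V: "closed_disc v = chart b ` cball w r" by (simp add: closed_disc_def bwr)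
  have "AE \<gamma> in P. \<exists>N. \<forall>n\<ge>N. \<forall>x\<in>closed_disc v. \<forall>y\<in>closed_disc v.
    dist (random_comp \<gamma> n (h x)) (random_comp \<gamma> n (h y)) < e" if e: "e > 0" for e
  proof -
    have e2: "e/2 > 0" using e by simp
    obtain d where d: "d > 0" "\<forall>y\<in>core. \<forall>g\<in>insert id G. \<forall>x\<in>ball y d. dist (g x) (g y) < e/2"
      using core_equicontinuous[OF e2] by blast
    have "AE \<gamma> in P. \<exists>n. \<exists>O'\<in>(\<lambda>y. ball y d) ` core. random_comp \<gamma> n ` h ` closed_disc v \<subseteq> O'"
    proof (rule hitting_equicontinuous[OF compact_closed_disc _ _ _ h])
      show "equi_at (insert id G) x" if "x \<in> closed_disc v" for x
        using that fatou_disc_subset[OF v] by (intro equi_id) blast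
      show "\<exists>g\<in>G. \<exists>O'\<in>(\<lambda>y. ball y d) ` core. g ` p ` closed_disc v \<subseteq> O'" if p: "p \<in> E" for p
      proof -
        obtain g y where "g \<in> G" "y \<in> core" "g ` p ` chart b ` cball w r \<subseteq> ball y d"
          by (rule contraction[OF p r(3,2) core_reach d(1)])
        then show ?thesis unfolding V by blast
      qed
    qed auto
    then show ?thesis using AE_paths
    proof eventually_elim
      case (elim \<gamma>)
      then obtain n y where n: "y \<in> core" "random_comp \<gamma> n ` h ` closed_disc v \<subseteq> ball y d" by blast
      have "dist (random_comp \<gamma> m (h a)) (random_comp \<gamma> m (h c)) < 2 * (e/2)"
        if "m \<ge> n" "a \<in> closed_disc v" "c \<in> closed_disc v" for m a c
        by (rule stays_close[OF elim(2) n(1) _ _ _ that(1), of d]) (use d(2) n that in blast)+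
      then show ?case by (intro exI[of _ n]) simp
    qed
  qed
  then have "AE \<gamma> in P. \<forall>j::nat. \<exists>N. \<forall>n\<ge>N. \<forall>x\<in>closed_disc v. \<forall>y\<in>closed_disc v.
    dist (random_comp \<gamma> n (h x)) (random_comp \<gamma> n (h y)) < 1 / Suc j"
    by (simp add: AE_all_countable)
  then show ?thesis
  proof eventually_elim
    case (elim \<gamma>)
    show ?case
    proof (intro allI impI)
      fix e :: real assume "e > 0"
      then obtain j where j: "1 / Suc j < e" using nat_approx_posE by blast
      obtain N where N: "\<forall>n\<ge>N. \<forall>x\<in>closed_disc v. \<forall>y\<in>closed_disc v.
         dist (random_comp \<gamma> n (h x)) (random_comp \<gamma> n (h y)) < 1 / Suc j" using elim by blast
      show "\<exists>N. \<forall>n\<ge>N. \<forall>x\<in>closed_disc v. \<forall>y\<in>closed_disc v. dist (random_comp \<gamma> n (h x)) (random_comp \<gamma> n (h y)) < e"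
        using N j by (intro exI[of _ N]) (meson less_trans)
    qed
  qed
qed

text \<open>All shifts \<open>m\<close> are included because an orbit enters a disc of
  \<open>VV\<close> at a random time and contraction has to start from there. With countably many
  \<open>m\<close> and finitely many discs the property stays almost sure.\<close>

definition contracts :: "(nat \<Rightarrow> rat_map) \<Rightarrow> bool" where
  "contracts \<gamma> \<longleftrightarrow> (\<forall>m. \<forall>v\<in>VV. \<forall>e>0. \<exists>N. \<forall>n\<ge>N. \<forall>x\<in>closed_disc v. \<forall>y\<in>closed_disc v.
    dist (random_comp (\<lambda>k. \<gamma> (m + k)) n x) (random_comp (\<lambda>k. \<gamma> (m + k)) n y) < e)"

lemma AE_contracts: "AE \<gamma> in P. contracts \<gamma>"
proof -
  have "AE \<gamma> in P. \<forall>e>0. \<exists>N. \<forall>n\<ge>N. \<forall>x\<in>closed_disc v. \<forall>y\<in>closed_disc v.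
    dist (random_comp (\<lambda>k. \<gamma> (m + k)) n x) (random_comp (\<lambda>k. \<gamma> (m + k)) n y) < e" if "v \<in> VV" for v m
    using AE_shift[OF disc_contraction[OF VV(2)[OF that], of id], of m] by simp
  then show ?thesis unfolding contracts_def
    by (simp add: AE_all_countable AE_ball_countable[OF countable_finite[OF VV(1)]])
qed

lemma contractsD:
  assumes "contracts \<gamma>" "v \<in> VV" "e > 0"
  obtains N where "N \<ge> m" "\<forall>n\<ge>N. \<forall>x y. random_comp \<gamma> m x \<in> closed_disc v \<longrightarrow> random_comp \<gamma> m y \<in> closed_disc v \<longrightarrow>
    dist (random_comp \<gamma> n x) (random_comp \<gamma> n y) < e"
proof -
  obtain N where N: "\<forall>n\<ge>N. \<forall>x\<in>closed_disc v. \<forall>y\<in>closed_disc v.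
    dist (random_comp (\<lambda>k. \<gamma> (m + k)) n x) (random_comp (\<lambda>k. \<gamma> (m + k)) n y) < e"
    using assms unfolding contracts_def by blast
  have "dist (random_comp \<gamma> n x) (random_comp \<gamma> n y) < e"
    if n: "n \<ge> m + N" and xy: "random_comp \<gamma> m x \<in> closed_disc v" "random_comp \<gamma> m y \<in> closed_disc v" for n x y
  proof -
    have "n - m \<ge> N" using n by simp
    then show ?thesis using N xy random_comp_add[of \<gamma> m "n - m"] n by simp
  qed
  then show ?thesis by (intro that[of "m + N"]) auto
qed

lemma AE_exists:
  assumes "AE \<gamma> in P. Q \<gamma>" shows "\<exists>\<gamma>. Q \<gamma>"
proof (rule ccontr)
  assume "\<nexists>\<gamma>. Q \<gamma>"
  then have "AE \<gamma> in P. False" using assms by simp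
  then show False using path.emeasure_space_1 by (simp add: AE_False)
qed

lemma AE_borel:
  assumes "AE \<gamma> in P. Q \<gamma>"
  shows "\<exists>A. A \<in> sets borel \<and> emeasure P A = 1 \<and> (\<forall>\<gamma>\<in>A. Q \<gamma>)"
proof -
  obtain N where N: "{\<gamma> \<in> space P. \<not> Q \<gamma>} \<subseteq> N" "emeasure P N = 0" "N \<in> sets P" using AE_E[OF assms] by blast
  have "emeasure P (space P - N) = 1"
    using emeasure_Diff[of P N "space P"] N(2,3) path.emeasure_space_1 sets.sets_into_space[OF N(3)] by simp
  moreover have "space P - N \<in> sets borel" using sets.compl_sets[OF N(3)] by (simp add: sets_P)
  ultimately show ?thesis using N(1) by (intro exI[of _ "space P - N"]) (auto simp: space_P)
qed

text \<open>The orbit of \<open>z\<close> enters a disc of \<open>VV\<close> at some time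
  \<open>m\<close>; by continuity a ball around \<open>z\<close> enters with it, and
  \<open>contracts\<close> is used at shift \<open>m\<close>.\<close>

lemma random_ball_contraction:
  "\<exists>A. A \<in> sets borel \<and> emeasure P A = 1 \<and>
    (\<forall>\<gamma>\<in>A. \<exists>\<delta>>0. (\<lambda>n. diameter (random_comp \<gamma> n ` ball z \<delta>)) \<longlonglongrightarrow> 0)"
proof (rule AE_borel)
  have "AE \<gamma> in P. \<exists>n. \<exists>O'\<in>disc ` VV. random_comp \<gamma> n z \<in> O'"
    by (rule hitting_point) (use VV(3) open_disc in auto)
  then show "AE \<gamma> in P. \<exists>\<delta>>0. (\<lambda>n. diameter (random_comp \<gamma> n ` ball z \<delta>)) \<longlonglongrightarrow> 0"
    using AE_contracts
  proof eventually_elim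
    case (elim \<gamma>)
    then obtain m v where v: "v \<in> VV" "random_comp \<gamma> m z \<in> disc v" by blast
    have "open (random_comp \<gamma> m -` disc v)" by (rule open_vimage[OF open_disc continuous_random_comp])
    moreover have "z \<in> random_comp \<gamma> m -` disc v" using v(2) by simp
    ultimately have "\<exists>\<delta>>0. ball z \<delta> \<subseteq> random_comp \<gamma> m -` disc v" unfolding open_contains_ball by blast
    then obtain \<delta> where \<delta>: "\<delta> > 0" "ball z \<delta> \<subseteq> random_comp \<gamma> m -` disc v" by blast
    have in_disc: "random_comp \<gamma> m x \<in> closed_disc v" if "x \<in> ball z \<delta>" for x
      using that \<delta>(2) disc_subset by blast
    have "(\<lambda>n. diameter (random_comp \<gamma> n ` ball z \<delta>)) \<longlonglongrightarrow> 0" unfolding lim_sequentially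
    proof (intro allI impI)
      fix e :: real assume "e > 0"
      then have e2: "e/2 > 0" by simp
      obtain N where N: "\<forall>n\<ge>N. \<forall>x y. random_comp \<gamma> m x \<in> closed_disc v \<longrightarrow> random_comp \<gamma> m y \<in> closed_disc v \<longrightarrow>
          dist (random_comp \<gamma> n x) (random_comp \<gamma> n y) < e/2"
        by (rule contractsD[OF elim(2) v(1) e2])
      have "dist (diameter (random_comp \<gamma> n ` ball z \<delta>)) 0 < e" if n: "n \<ge> N" for n
      proof -
        have "z \<in> ball z \<delta>" using \<delta>(1) by simp
        then have ne: "random_comp \<gamma> n ` ball z \<delta> \<times> random_comp \<gamma> n ` ball z \<delta> \<noteq> {}" by blast
        have "diameter (random_comp \<gamma> n ` ball z \<delta>) \<le> e/2"
        proof -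
          have "(SUP (x, y)\<in>random_comp \<gamma> n ` ball z \<delta> \<times> random_comp \<gamma> n ` ball z \<delta>. dist x y) \<le> e/2"
          proof (rule cSUP_least[OF ne])
            fix p assume "p \<in> random_comp \<gamma> n ` ball z \<delta> \<times> random_comp \<gamma> n ` ball z \<delta>"
            then obtain a b where ab: "a \<in> ball z \<delta>" "b \<in> ball z \<delta>" "p = (random_comp \<gamma> n a, random_comp \<gamma> n b)" by blast
            have "dist (random_comp \<gamma> n a) (random_comp \<gamma> n b) < e/2"
              using N n in_disc[OF ab(1)] in_disc[OF ab(2)] by blast
            then show "(case p of (x, y) \<Rightarrow> dist x y) \<le> e/2" by (simp add: ab(3))
          qed
          moreover have "random_comp \<gamma> n ` ball z \<delta> \<noteq> {}" using \<delta>(1) by simp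
          ultimately show ?thesis by (simp only: diameter_def if_False)
        qed
        moreover have "0 \<le> diameter (random_comp \<gamma> n ` ball z \<delta>)" by (rule diameter_ge_0) simp
        ultimately show ?thesis using e2 by simp
      qed
      then show "\<exists>N. \<forall>n\<ge>N. dist (diameter (random_comp \<gamma> n ` ball z \<delta>)) 0 < e" by blast
    qed
    then show ?case using \<delta>(1) by blast
  qed
qed

section \<open>Minimal sets\<close>

lemma semigroup_invariant_UNIV: "forward_invariant_compact G UNIV"
  unfolding forward_invariant_compact_def using compact_rsphere by auto

lemma minimal_invariant:
  assumes "L \<in> minimal_sets G" "h \<in> insert id G" "x \<in> L" shows "h x \<in> L"
proof (cases "h = id")
  case False
  then have "h ` L \<subseteq> L" using assms(1,2) unfolding minimal_sets_def forward_invariant_compact_def by blast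
  then show ?thesis using assms(3) by blast
qed (use assms(3) in simp)

lemma minimal_sets_nonempty: "minimal_sets G \<noteq> {}"
proof -
  obtain L where "L \<in> minimal_sets G"
    by (rule minimal_set_exists[OF semigroup_invariant_UNIV]) (rule compact_imp_closed)
  then show ?thesis by blast
qed

lemma minimal_meets_disc:
  assumes "L \<in> minimal_sets G" shows "\<exists>v\<in>VV. L \<inter> disc v \<noteq> {}"
proof -
  have "L \<noteq> {}" using assms unfolding minimal_sets_def forward_invariant_compact_def by simp
  then obtain x where x: "x \<in> L" by blast
  obtain g v where "g \<in> G" "v \<in> VV" "g x \<in> disc v" using VV(3)[of x] by blast
  then show ?thesis using minimal_invariant[OF assms _ x, of g] by blast
qed

text \<open>Points of \<open>L\<close> and \<open>L'\<close> in one disc come arbitrarily close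
  along a common path without leaving their sets, so the compact sets meet. Their intersection is
  invariant, and minimality of both identifies them.\<close>

lemma minimal_sets_same_disc:
  assumes L: "L \<in> minimal_sets G" and L': "L' \<in> minimal_sets G"
    and v: "v \<in> VV" "L \<inter> disc v \<noteq> {}" "L' \<inter> disc v \<noteq> {}"
  shows "L = L'"
proof -
  obtain x y where xy: "x \<in> L" "x \<in> disc v" "y \<in> L'" "y \<in> disc v" using v by blast
  have cpt: "compact L" "compact L'" using L L' unfolding minimal_sets_def forward_invariant_compact_def by auto
  have "L \<inter> L' \<noteq> {}"
  proof
    assume "L \<inter> L' = {}"
    then have sub: "L \<subseteq> - L'" by blast
    have "open (- L')" using compact_imp_closed[OF cpt(2)] by (rule open_Compl)
    then obtain d where d: "d > 0" "(\<Union>x\<in>L. ball x d) \<subseteq> - L'"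
      by (rule compact_subset_open_imp_ball_epsilon_subset[OF cpt(1) _ sub])
    have "AE \<gamma> in P. contracts \<gamma> \<and> (\<forall>n. \<gamma> n \<in> \<Gamma>)" using AE_contracts AE_paths by eventually_elim simp
    then obtain \<gamma> where \<gamma>: "contracts \<gamma>" "\<forall>n. \<gamma> n \<in> \<Gamma>" using AE_exists by blast
    obtain N where N: "\<forall>n\<ge>N. \<forall>x y. random_comp \<gamma> 0 x \<in> closed_disc v \<longrightarrow> random_comp \<gamma> 0 y \<in> closed_disc v \<longrightarrow>
        dist (random_comp \<gamma> n x) (random_comp \<gamma> n y) < d"
      by (rule contractsD[OF \<gamma>(1) v(1) d(1)])
    have "dist (random_comp \<gamma> N x) (random_comp \<gamma> N y) < d" using N xy disc_subset[of v] by auto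
    moreover have "random_comp \<gamma> N \<in> insert id G" using \<gamma>(2) by (intro random_comp_in_semigroup) simp
    then have "random_comp \<gamma> N x \<in> L" "random_comp \<gamma> N y \<in> L'"
      using minimal_invariant[OF L _ xy(1)] minimal_invariant[OF L' _ xy(3)] by blast+
    ultimately show False using d(2) by (auto simp: subset_iff)
  qed
  moreover have "compact (L \<inter> L')" using cpt by (simp add: compact_Int)
  moreover have "g ` (L \<inter> L') \<subseteq> L \<inter> L'" if "g \<in> G" for g
    using minimal_invariant[OF L, of g] minimal_invariant[OF L', of g] that by auto
  ultimately have "forward_invariant_compact G (L \<inter> L')" by (simp add: forward_invariant_compact_def)
  moreover have "\<forall>C. forward_invariant_compact G C \<longrightarrow> C \<subseteq> L \<longrightarrow> C = L"
    "\<forall>C. forward_invariant_compact G C \<longrightarrow> C \<subseteq> L' \<longrightarrow> C = L'"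
    using L L' by (simp_all add: minimal_sets_def)
  ultimately have "L \<inter> L' = L" "L \<inter> L' = L'" by (meson inf_le1 inf_le2)+
  then show ?thesis by simp
qed

lemma finite_minimal_sets: "finite (minimal_sets G)"
proof -
  obtain v where v: "\<And>L. L \<in> minimal_sets G \<Longrightarrow> v L \<in> VV \<and> L \<inter> disc (v L) \<noteq> {}"
    using minimal_meets_disc by metis
  have "inj_on v (minimal_sets G)"
  proof (rule inj_onI)
    fix L L' assume L: "L \<in> minimal_sets G" "L' \<in> minimal_sets G" "v L = v L'"
    show "L = L'" by (rule minimal_sets_same_disc[OF L(1,2), of "v L"]) (use v[OF L(1)] v[OF L(2)] L(3) in auto)
  qed
  moreover have "v ` minimal_sets G \<subseteq> VV" using v by blast
  ultimately show ?thesis using VV(1) by (meson finite_imageD finite_subset)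
qed

text \<open>The orbit closure of \<open>x\<close> contains a minimal set, which meets some open disc
  of \<open>VV\<close>; hence a point of the orbit itself lies in that disc.\<close>

lemma reach_minimal_disc: "\<exists>g\<in>G. \<exists>v\<in>VV. g x \<in> disc v \<and> (\<exists>L\<in>minimal_sets G. L \<inter> disc v \<noteq> {})"
proof -
  define C where "C = closure ((\<lambda>g. g x) ` G)"
  have "h ` C \<subseteq> C" if h: "h \<in> G" for h
    unfolding C_def
  proof (rule image_closure_subset)
    show "continuous_on (closure ((\<lambda>g. g x) ` G)) h" by (rule continuous_semigroup[OF h])
    have "h (g x) \<in> (\<lambda>g. g x) ` G" if "g \<in> G" for g
      using comp_closed[OF h that] by (intro image_eqI[of _ _ "h \<circ> g"]) auto
    then show "h ` (\<lambda>g. g x) ` G \<subseteq> closure ((\<lambda>g. g x) ` G)"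
      by (auto intro!: closure_subset[THEN subsetD])
  qed simp
  moreover have "C \<noteq> {}" using VV(3)[of x] by (auto simp: C_def)
  moreover have "compact C" using compact_Int_closed[OF compact_rsphere, of C] by (simp add: C_def)
  ultimately have "forward_invariant_compact G C" by (simp add: forward_invariant_compact_def)
  then obtain L where L: "L \<in> minimal_sets G" "L \<subseteq> C" by (rule minimal_set_exists) (rule compact_imp_closed)
  obtain v y where v: "v \<in> VV" "y \<in> L" "y \<in> disc v" using minimal_meets_disc[OF L(1)] by blast
  have "y \<in> closure ((\<lambda>g. g x) ` G)" using v(2) L(2) by (auto simp: C_def)
  then have "disc v \<inter> (\<lambda>g. g x) ` G \<noteq> {}"
    using open_disc[of v] v(3) closure_iff_nhds_not_empty[of y "(\<lambda>g. g x) ` G"] by blast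
  then show ?thesis using v L(1) by blast
qed

text \<open>The disc entered by the orbit also contains a point \<open>s\<close> of a minimal set.
  The orbit of \<open>s\<close> stays in that set, and contraction draws the orbit of
  \<open>z\<close> towards it.\<close>

lemma random_orbit_attracted:
  "\<exists>C. C \<in> sets borel \<and> emeasure P C = 1 \<and>
    (\<forall>\<gamma>\<in>C. (\<lambda>n. infdist (random_comp \<gamma> n z) (\<Union>(minimal_sets G))) \<longlonglongrightarrow> 0)"
proof (rule AE_borel)
  have "AE \<gamma> in P. \<exists>n. \<exists>O'\<in>disc ` {v \<in> VV. \<exists>L\<in>minimal_sets G. L \<inter> disc v \<noteq> {}}. random_comp \<gamma> n z \<in> O'"
  proof (rule hitting_point)
    fix x
    show "\<exists>g\<in>G. \<exists>O'\<in>disc ` {v \<in> VV. \<exists>L\<in>minimal_sets G. L \<inter> disc v \<noteq> {}}. g x \<in> O'"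
      using reach_minimal_disc[of x] by blast
  qed (use open_disc in auto)
  then show "AE \<gamma> in P. (\<lambda>n. infdist (random_comp \<gamma> n z) (\<Union>(minimal_sets G))) \<longlonglongrightarrow> 0"
    using AE_contracts AE_paths
  proof eventually_elim
    case (elim \<gamma>)
    then obtain m v L where v: "v \<in> VV" "random_comp \<gamma> m z \<in> disc v" "L \<in> minimal_sets G" "L \<inter> disc v \<noteq> {}" by blast
    then obtain s where s: "s \<in> L" "s \<in> disc v" by blast
    show ?case unfolding lim_sequentially
    proof (intro allI impI)
      fix e :: real assume e: "e > 0"
      obtain N where N: "\<forall>n\<ge>N. \<forall>x\<in>closed_disc v. \<forall>y\<in>closed_disc v.
          dist (random_comp (\<lambda>k. \<gamma> (m + k)) n x) (random_comp (\<lambda>k. \<gamma> (m + k)) n y) < e"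
        using elim(2) v(1) e unfolding contracts_def by blast
      have "dist (infdist (random_comp \<gamma> n z) (\<Union>(minimal_sets G))) 0 < e" if n: "n \<ge> m + N" for n
      proof -
        define h where "h = random_comp (\<lambda>k. \<gamma> (m + k)) (n - m)"
        have h: "h \<in> insert id G" unfolding h_def using elim(3) by (intro random_comp_in_semigroup) simp
        have "n - m \<ge> N" "random_comp \<gamma> m z \<in> closed_disc v" "s \<in> closed_disc v"
          using n v(2) s(2) disc_subset[of v] by auto
        then have "dist (h (random_comp \<gamma> m z)) (h s) < e" using N unfolding h_def by blast
        moreover have "random_comp \<gamma> n z = h (random_comp \<gamma> m z)"
          using random_comp_add[of \<gamma> m "n - m"] n by (simp add: h_def)
        moreover have "h s \<in> \<Union>(minimal_sets G)" using minimal_invariant[OF v(3) h s(1)] v(3) by blast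
        ultimately have "infdist (random_comp \<gamma> n z) (\<Union>(minimal_sets G)) < e"
          using infdist_le[of "h s" "\<Union>(minimal_sets G)" "random_comp \<gamma> n z"] by simp
        then show ?thesis by (simp add: infdist_nonneg)
      qed
      then show "\<exists>N. \<forall>n\<ge>N. dist (infdist (random_comp \<gamma> n z) (\<Union>(minimal_sets G))) 0 < e" by blast
    qed
  qed
qed

end

section \<open>The transition operator\<close>

text \<open>Evaluation on \<open>Z\<close> is injective on \<open>V\<close>. Each point removed
  costs one spanning vector \<open>u\<close>, and subtracting a multiple of \<open>u\<close> leads
  into the subspace of functions vanishing at that point.\<close>

lemma finite_evaluation_span:
  assumes "finite Z" "cfun.subspace V" "\<And>\<psi>. \<psi> \<in> V \<Longrightarrow> \<forall>z\<in>Z. apply_bcontfun \<psi> z = 0 \<Longrightarrow> \<psi> = 0"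
  shows "\<exists>B. finite B \<and> V = cfun.span B"
  using assms
proof (induction Z arbitrary: V rule: finite_induct)
  case empty
  then have "V = {0}" using cfun.subspace_0[OF empty(1)] by auto
  then show ?case by (intro exI[of _ "{}"]) simp
next
  case (insert z Z)
  show ?case
  proof (cases "\<forall>\<psi>\<in>V. apply_bcontfun \<psi> z = 0")
    case True
    show ?thesis by (rule insert.IH[OF insert.prems(1)]) (use True insert.prems(2) in auto)
  next
    case False
    then obtain u where u: "u \<in> V" "apply_bcontfun u z \<noteq> 0" by blast
    define V' where "V' = {\<psi> \<in> V. apply_bcontfun \<psi> z = 0}"
    have "cfun.subspace V'"
      using insert.prems(1) unfolding cfun.subspace_def V'_def by auto
    then obtain B where B: "finite B" "V' = cfun.span B"
      using insert.IH[of V'] insert.prems(2) unfolding V'_def by auto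
    have "V = cfun.span (insert u B)"
    proof
      show "cfun.span (insert u B) \<subseteq> V"
        using u(1) insert.prems(1) B(2) cfun.span_superset[of B] unfolding V'_def by (intro cfun.span_minimal) auto
      show "V \<subseteq> cfun.span (insert u B)"
      proof
        fix \<psi> assume \<psi>: "\<psi> \<in> V"
        define c where "c = apply_bcontfun \<psi> z / apply_bcontfun u z"
        have "\<psi> - cscale c u \<in> V'" unfolding V'_def
          using \<psi> u insert.prems(1) by (auto simp: c_def intro: cfun.subspace_diff cfun.subspace_scale)
        then have "\<psi> - cscale c u \<in> cfun.span (insert u B)" using B(2) cfun.span_mono[of B "insert u B"] by auto
        then have "(\<psi> - cscale c u) + cscale c u \<in> cfun.span (insert u B)"
          by (intro cfun.span_add cfun.span_scale[OF cfun.span_base]) simp_all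
        then show "\<psi> \<in> cfun.span (insert u B)" by simp
      qed
    qed
    then show ?thesis using B(1) by (intro exI[of _ "insert u B"]) simp
  qed
qed

text \<open>The converse half of Ascoli: finitely many functions approximate all of
  \<open>Q\<close>, and each is uniformly continuous on the compact domain.\<close>

lemma compact_uniformly_equicontinuous:
  fixes Q :: "('a::metric_space \<Rightarrow>\<^sub>C complex) set"
  assumes K: "compact (UNIV :: 'a set)" and Q: "compact Q" and e: "e > 0"
  shows "\<exists>d>0. \<forall>\<xi>\<in>Q. \<forall>x y. dist x y < d \<longrightarrow> dist (apply_bcontfun \<xi> x) (apply_bcontfun \<xi> y) < e"
proof -
  have e3: "e/3 > 0" using e by simp
  obtain C where C: "finite C" "Q \<subseteq> (\<Union>x\<in>C. ball x (e/3))"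
    using Q e3 unfolding compact_eq_totally_bounded by blast
  have "\<exists>d>0. \<forall>x y. dist x y < d \<longrightarrow> dist (apply_bcontfun c x) (apply_bcontfun c y) < e/3" for c :: "'a \<Rightarrow>\<^sub>C complex"
  proof -
    have "uniformly_continuous_on UNIV (apply_bcontfun c)"
      by (rule compact_uniformly_continuous[OF _ K]) simp
    then show ?thesis using e3 unfolding uniformly_continuous_on_def by (metis UNIV_I dist_commute)
  qed
  then obtain d where d: "\<And>c :: 'a \<Rightarrow>\<^sub>C complex. d c > 0"
    "\<forall>c. \<forall>x y. dist x y < d c \<longrightarrow> dist (apply_bcontfun c x) (apply_bcontfun c y) < e/3" by metis
  define D where "D = Min (insert 1 (d ` C))"
  have D: "D > 0" unfolding D_def using C(1) d(1) by (subst Min_gr_iff) auto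
  have "dist (apply_bcontfun \<xi> x) (apply_bcontfun \<xi> y) < e" if \<xi>: "\<xi> \<in> Q" and xy: "dist x y < D" for \<xi> x y
  proof -
    obtain c where c: "c \<in> C" "dist c \<xi> < e/3" using C(2) \<xi> by auto
    have "D \<le> d c" unfolding D_def using C(1) c(1) by (intro Min_le) auto
    then have "dist (apply_bcontfun c x) (apply_bcontfun c y) < e/3" using d(2) xy by auto
    moreover have "dist (apply_bcontfun c x) (apply_bcontfun \<xi> x) < e/3" "dist (apply_bcontfun c y) (apply_bcontfun \<xi> y) < e/3"
      using dist_fun_lt_imp_dist_val_lt[OF c(2)] by auto
    ultimately show ?thesis by metric
  qed
  then show ?thesis using D by blast
qed

context cooperation
begin

abbreviation "T \<equiv> transition_op \<tau>"

section \<open>Iterates of the transition operator as averages over random paths\<close>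

lemma measurable_path: "(\<lambda>\<gamma>. apply_bcontfun \<phi> (random_comp \<gamma> n z)) \<in> borel_measurable P"
proof -
  have "continuous_on UNIV (\<lambda>\<gamma>. apply_bcontfun \<phi> (random_comp \<gamma> n z))"
    by (rule continuous_on_compose2[OF _ continuous_random_comp_path]) auto
  from borel_measurable_continuous_onI[OF this] show ?thesis by (simp add: sets_P cong: measurable_cong_sets)
qed

lemma integrable_path:
  fixes \<phi> :: "rsphere \<Rightarrow>\<^sub>C complex"
  shows "integrable P (\<lambda>\<gamma>. apply_bcontfun \<phi> (random_comp \<gamma> n z))"
  by (rule path.integrable_const_bound[where B = "norm \<phi>"]) (auto intro: measurable_path norm_bounded)

text \<open>Induction splits off the first map: \<open>PiM_iter\<close> presents the path measure as
  an independent first step followed by a fresh path.\<close>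

lemma T_power:
  fixes \<phi> :: "rsphere \<Rightarrow>\<^sub>C complex"
  shows "apply_bcontfun ((T ^^ n) \<phi>) z = (\<integral>\<gamma>. apply_bcontfun \<phi> (random_comp \<gamma> n z) \<partial>P)"
proof (induction n arbitrary: z)
  case 0
  show ?case using path.prob_space by simp
next
  case (Suc n)
  interpret pair: pair_prob_space \<tau> P ..
  have mc: "(\<lambda>(s, \<omega>). case_nat s \<omega>) \<in> measurable (\<tau> \<Otimes>\<^sub>M P) P"
    unfolding path_measure_def by measurable
  let ?f = "\<lambda>\<gamma>. apply_bcontfun \<phi> (random_comp \<gamma> (Suc n) z)"
  have eq: "?f ((\<lambda>(s, \<omega>). case_nat s \<omega>) p) = apply_bcontfun \<phi> (random_comp (snd p) n (apply_rat (fst p) z))" for p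
    by (cases p) (simp only: prod.case random_comp_case_nat comp_apply fst_conv snd_conv)
  have m: "(\<lambda>p. apply_bcontfun \<phi> (random_comp (snd p) n (apply_rat (fst p) z))) \<in> borel_measurable (\<tau> \<Otimes>\<^sub>M P)"
    using measurable_compose[OF mc measurable_path[of \<phi> "Suc n" z]] unfolding eq .
  have i: "integrable (\<tau> \<Otimes>\<^sub>M P) (\<lambda>p. apply_bcontfun \<phi> (random_comp (snd p) n (apply_rat (fst p) z)))"
    by (rule pair.P.integrable_const_bound[where B = "norm \<phi>"]) (auto intro: m norm_bounded)
  have "integral\<^sup>L P ?f = integral\<^sup>L (distr (\<tau> \<Otimes>\<^sub>M P) P (\<lambda>(s, \<omega>). case_nat s \<omega>)) ?f"
    unfolding path_measure_def PiM_iter ..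
  also have "\<dots> = (\<integral>p. ?f ((\<lambda>(s, \<omega>). case_nat s \<omega>) p) \<partial>(\<tau> \<Otimes>\<^sub>M P))"
    by (rule integral_distr[OF mc measurable_path])
  also have "\<dots> = (\<integral>s. \<integral>\<omega>. apply_bcontfun \<phi> (random_comp \<omega> n (apply_rat s z)) \<partial>P \<partial>\<tau>)"
    unfolding eq using pair.integral_fst'[OF i] by simp
  also have "\<dots> = (\<integral>s. apply_bcontfun ((T ^^ n) \<phi>) (apply_rat s z) \<partial>\<tau>)" by (simp add: Suc)
  also have "\<dots> = apply_bcontfun ((T ^^ Suc n) \<phi>) z" by (simp add: apply_transition_op[OF borel_probs])
  finally show ?case by simp
qed

lemma integral_split_bound:
  fixes f :: "(nat \<Rightarrow> rat_map) \<Rightarrow> complex"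
  assumes f: "f \<in> borel_measurable P" and A: "A \<in> sets P"
    and a: "AE \<gamma> in P. \<gamma> \<in> A \<longrightarrow> norm (f \<gamma>) \<le> a" "0 \<le> a" and b: "\<And>\<gamma>. norm (f \<gamma>) \<le> b"
  shows "norm (integral\<^sup>L P f) \<le> a + b * (1 - measure P A)"
proof -
  have b0: "0 \<le> b" using b norm_ge_zero order_trans by blast
  have cA: "- A \<in> sets P" using sets.compl_sets[OF A] by (simp add: space_P Compl_eq_Diff_UNIV)
  have iA: "integrable P (indicat_real (- A))" using cA by (intro integrable_real_indicator) (simp_all add: less_top[symmetric])
  have "norm (integral\<^sup>L P f) \<le> (\<integral>\<gamma>. norm (f \<gamma>) \<partial>P)" by (rule integral_norm_bound)
  also have "\<dots> \<le> (\<integral>\<gamma>. a + b * indicator (- A) \<gamma> \<partial>P)"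
  proof (rule integral_mono_AE)
    show "integrable P (\<lambda>\<gamma>. norm (f \<gamma>))"
      by (rule integrable_norm, rule path.integrable_const_bound[where B = b]) (use f b in auto)
    show "integrable P (\<lambda>\<gamma>. a + b * indicator (- A) \<gamma>)" using iA by simp
    show "AE \<gamma> in P. norm (f \<gamma>) \<le> a + b * indicator (- A) \<gamma>"
      using a(1)
    proof eventually_elim
      case (elim \<gamma>)
      then show ?case using b[of \<gamma>] a(2) b0 by (cases "\<gamma> \<in> A") auto
    qed
  qed
  also have "\<dots> = a + b * measure P (- A)" using iA cA path.prob_space by (simp add: space_P)
  also have "measure P (- A) = 1 - measure P A"
    using path.prob_compl[OF A] by (simp add: space_P Compl_eq_Diff_UNIV)
  finally show ?thesis .
qed

text \<open>Almost sure hitting bounds neither the time nor the size of the neighbourhood carried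
  along. Up to probability \<open>e\<close> both become uniform: in \<open>A k\<close> the index
  \<open>k\<close> governs time and radius, and these events increase to a set of full measure.
  Closed balls are compact, which makes the \<open>A k\<close> open and measurable.\<close>

lemma hitting_neighbourhood:
  assumes TT: "\<And>O'. O' \<in> TT \<Longrightarrow> open O'" and hit: "AE \<gamma> in P. \<exists>n. \<exists>O'\<in>TT. random_comp \<gamma> n z \<in> O'" and e: "e > 0"
  obtains r k A where "r > 0" "A \<in> sets P" "1 - e < measure P A"
    "\<forall>\<gamma>\<in>A. \<exists>n\<le>k. \<exists>O'\<in>TT. random_comp \<gamma> n ` ball z r \<subseteq> O'"
proof -
  define A where "A k = {\<gamma>. \<exists>n\<le>k. \<exists>O'\<in>TT. random_comp \<gamma> n ` cball z (1 / Suc k) \<subseteq> O'}" for k :: nat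
  have cc: "compact (cball z r)" for r using compact_Int_closed[OF compact_rsphere closed_cball] by simp
  have "A k = (\<Union>n\<in>{..k}. \<Union>O'\<in>TT. {\<gamma>. random_comp \<gamma> n ` cball z (1 / Suc k) \<subseteq> O'})" for k
    unfolding A_def by auto
  moreover have "open (\<Union>n\<in>{..k}. \<Union>O'\<in>TT. {\<gamma>. random_comp \<gamma> n ` cball z (1 / Suc k) \<subseteq> O'})" for k
    by (intro open_UN ballI open_random_comp cc TT)
  ultimately have sA: "A k \<in> sets P" for k by (simp add: sets_P)
  have inc: "incseq A"
  proof (rule incseq_SucI, rule subsetI)
    fix k \<gamma> assume "\<gamma> \<in> A k"
    then obtain n O' where n: "n \<le> k" "O' \<in> TT" "random_comp \<gamma> n ` cball z (1 / Suc k) \<subseteq> O'" unfolding A_def by blast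
    have "1 / real (Suc (Suc k)) \<le> 1 / real (Suc k)" by (intro divide_left_mono) auto
    then have "cball z (1 / Suc (Suc k)) \<subseteq> cball z (1 / Suc k)" by (rule subset_cball)
    then have "random_comp \<gamma> n ` cball z (1 / Suc (Suc k)) \<subseteq> O'" by (rule order_trans[OF image_mono n(3)])
    then have "\<exists>n\<le>Suc k. \<exists>O'\<in>TT. random_comp \<gamma> n ` cball z (1 / Suc (Suc k)) \<subseteq> O'"
      using n(1,2) by (intro exI[of _ n] conjI bexI[of _ O']) simp_all
    then show "\<gamma> \<in> A (Suc k)" unfolding A_def mem_Collect_eq .
  qed
  have "AE \<gamma> in P. \<gamma> \<in> (\<Union>k. A k)"
    using hit
  proof eventually_elim
    case (elim \<gamma>)
    then obtain n O' where n: "O' \<in> TT" "random_comp \<gamma> n z \<in> O'" by blast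
    have "open (random_comp \<gamma> n -` O')" by (rule open_vimage[OF TT[OF n(1)] continuous_random_comp])
    moreover have "z \<in> random_comp \<gamma> n -` O'" using n(2) by simp
    ultimately have "\<exists>d>0. ball z d \<subseteq> random_comp \<gamma> n -` O'" unfolding open_contains_ball by blast
    then obtain d where d: "d > 0" "ball z d \<subseteq> random_comp \<gamma> n -` O'" by blast
    obtain j where j: "1 / Suc j < d" using d(1) nat_approx_posE by blast
    define k where "k = max j n"
    have "1 / real (Suc k) \<le> 1 / real (Suc j)" by (intro divide_left_mono) (auto simp: k_def)
    then have "cball z (1 / Suc k) \<subseteq> ball z d" using j by (auto simp: subset_iff)
    then have "random_comp \<gamma> n ` cball z (1 / Suc k) \<subseteq> O'" using d(2) by (auto simp: subset_iff)
    then have "\<exists>n\<le>k. \<exists>O'\<in>TT. random_comp \<gamma> n ` cball z (1 / Suc k) \<subseteq> O'"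
      using n(1) by (intro exI[of _ n] conjI bexI[of _ O']) (simp_all add: k_def)
    then have "\<gamma> \<in> A k" unfolding A_def mem_Collect_eq .
    then show ?case by blast
  qed
  then have "measure P (\<Union>k. A k) = 1" using path.AE_in_set_eq_1[of "\<Union>k. A k"] sA by auto
  moreover have "(\<lambda>k. measure P (A k)) \<longlonglongrightarrow> measure P (\<Union>k. A k)"
    by (rule path.finite_Lim_measure_incseq[OF _ inc]) (use sA in auto)
  ultimately have "\<forall>\<^sub>F k in sequentially. 1 - e < measure P (A k)"
    using e by (intro order_tendstoD(1)) auto
  then obtain k where k: "1 - e < measure P (A k)" using eventually_happens'[OF sequentially_bot] by blast
  have "ball z (1 / Suc k) \<subseteq> cball z (1 / Suc k)" by auto
  then have im: "random_comp \<gamma> n ` cball z (1 / Suc k) \<subseteq> O' \<Longrightarrow> random_comp \<gamma> n ` ball z (1 / Suc k) \<subseteq> O'" for \<gamma> n O'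
    by (rule order_trans[OF image_mono])
  have "\<exists>n\<le>k. \<exists>O'\<in>TT. random_comp \<gamma> n ` ball z (1 / Suc k) \<subseteq> O'" if "\<gamma> \<in> A k" for \<gamma>
  proof -
    obtain n O' where "n \<le> k" "O' \<in> TT" "random_comp \<gamma> n ` cball z (1 / Suc k) \<subseteq> O'" using \<open>\<gamma> \<in> A k\<close> unfolding A_def by blast
    then show ?thesis by (intro exI[of _ n] conjI bexI[of _ O'] im)
  qed
  then show ?thesis using that[of "1 / Suc k" "A k" k] sA k by simp
qed

lemma norm_integral_path_diff:
  fixes \<phi> :: "rsphere \<Rightarrow>\<^sub>C complex"
  assumes A: "A \<in> sets P" and a: "0 \<le> a"
    and AE: "AE \<gamma> in P. \<gamma> \<in> A \<longrightarrow> dist (apply_bcontfun \<phi> (random_comp \<gamma> n x)) (apply_bcontfun \<phi> (random_comp \<gamma> n y)) \<le> a"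
  shows "dist (apply_bcontfun ((T ^^ n) \<phi>) x) (apply_bcontfun ((T ^^ n) \<phi>) y) \<le> a + 2 * norm \<phi> * (1 - measure P A)"
proof -
  have "dist (apply_bcontfun ((T ^^ n) \<phi>) x) (apply_bcontfun ((T ^^ n) \<phi>) y) =
     norm (\<integral>\<gamma>. apply_bcontfun \<phi> (random_comp \<gamma> n x) - apply_bcontfun \<phi> (random_comp \<gamma> n y) \<partial>P)"
    unfolding T_power dist_norm by (subst Bochner_Integration.integral_diff[OF integrable_path integrable_path]) simp
  also have "\<dots> \<le> a + 2 * norm \<phi> * (1 - measure P A)"
  proof (rule integral_split_bound[OF _ A _ a])
    show "(\<lambda>\<gamma>. apply_bcontfun \<phi> (random_comp \<gamma> n x) - apply_bcontfun \<phi> (random_comp \<gamma> n y)) \<in> borel_measurable P"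
      by (intro borel_measurable_diff measurable_path)
    show "norm (apply_bcontfun \<phi> (random_comp \<gamma> n x) - apply_bcontfun \<phi> (random_comp \<gamma> n y)) \<le> 2 * norm \<phi>" for \<gamma>
      using norm_triangle_ineq4[of "apply_bcontfun \<phi> (random_comp \<gamma> n x)" "apply_bcontfun \<phi> (random_comp \<gamma> n y)"]
        norm_bounded[of \<phi> "random_comp \<gamma> n x"] norm_bounded[of \<phi> "random_comp \<gamma> n y"] by linarith
  qed (use AE in \<open>simp add: dist_norm\<close>)
  finally show ?thesis .
qed

text \<open>With high probability a whole ball around \<open>z\<close> reaches a small ball centred
  in \<open>core\<close> by time \<open>k\<close> and stays together afterwards; the remaining paths
  contribute at most twice the norm times their probability. The finitely many earlier iterates are
  continuous one by one.\<close>

lemma iterates_equicontinuous: "equi_at (range (\<lambda>n. apply_bcontfun ((T ^^ n) \<phi>))) z"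
  unfolding equi_at_def
proof (intro allI impI)
  fix e :: real assume e: "e > 0"
  then have e4: "e/4 > 0" by simp
  obtain \<eta> where \<eta>: "\<eta> > 0" "\<forall>\<xi>\<in>{\<phi>}. \<forall>x y. dist x y < \<eta> \<longrightarrow> dist (apply_bcontfun \<xi> x) (apply_bcontfun \<xi> y) < e/4"
    using compact_uniformly_equicontinuous[OF compact_rsphere compact_sing e4, of \<phi>] by blast
  then have \<eta>2: "\<eta>/2 > 0" by simp
  obtain d where d: "d > 0" "\<forall>y\<in>core. \<forall>g\<in>insert id G. \<forall>x\<in>ball y d. dist (g x) (g y) < \<eta>/2"
    using core_equicontinuous[OF \<eta>2] by blast
  have "AE \<gamma> in P. \<exists>n. \<exists>O'\<in>(\<lambda>y. ball y d) ` core. random_comp \<gamma> n z \<in> O'"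
  proof (rule hitting_point)
    fix x
    obtain g where "g \<in> G" "g x \<in> core" using core_reach by blast
    then show "\<exists>g\<in>G. \<exists>O'\<in>(\<lambda>y. ball y d) ` core. g x \<in> O'"
      using d(1) by (intro bexI[of _ g] bexI[of _ "ball (g x) d"]) auto
  qed auto
  note hit = this
  \<comment> \<open>Exceptional paths contribute at most
    \<open>2 * norm \<phi> * \<epsilon>\<close>, which is at most \<open>e/2\<close>; the summand 1
    avoids a division by zero.\<close>
  define \<epsilon> where "\<epsilon> = e / (4 * (norm \<phi> + 1))"
  have \<epsilon>: "\<epsilon> > 0" using e by (simp add: \<epsilon>_def add_nonneg_pos)
  obtain r k A where A: "r > 0" "A \<in> sets P" "1 - \<epsilon> < measure P A"
    "\<forall>\<gamma>\<in>A. \<exists>n\<le>k. \<exists>O'\<in>(\<lambda>y. ball y d) ` core. random_comp \<gamma> n ` ball z r \<subseteq> O'"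
    by (rule hitting_neighbourhood[OF _ hit \<epsilon>]) auto
  have big: "dist (apply_bcontfun ((T ^^ n) \<phi>) y) (apply_bcontfun ((T ^^ n) \<phi>) z) < e" if n: "n \<ge> k" and y: "y \<in> ball z r" for n y
  proof -
    have "AE \<gamma> in P. \<gamma> \<in> A \<longrightarrow> dist (apply_bcontfun \<phi> (random_comp \<gamma> n y)) (apply_bcontfun \<phi> (random_comp \<gamma> n z)) \<le> e/4"
      using AE_paths
    proof eventually_elim
      case (elim \<gamma>)
      show ?case
      proof
        assume "\<gamma> \<in> A"
        then obtain m c where m: "m \<le> k" "c \<in> core" "random_comp \<gamma> m ` ball z r \<subseteq> ball c d" using A(4) by blast
        have "z \<in> ball z r" using A(1) by simp
        then have "random_comp \<gamma> m y \<in> ball c d" "random_comp \<gamma> m z \<in> ball c d" using m(3) y by blast+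
        from stays_close[OF elim m(2) bspec[OF d(2) m(2)] this order_trans[OF m(1) n]]
        have "dist (random_comp \<gamma> n y) (random_comp \<gamma> n z) < \<eta>" by simp
        then show "dist (apply_bcontfun \<phi> (random_comp \<gamma> n y)) (apply_bcontfun \<phi> (random_comp \<gamma> n z)) \<le> e/4"
          using \<eta>(2) by (auto intro: less_imp_le)
      qed
    qed
    from norm_integral_path_diff[OF A(2) _ this]
    have "dist (apply_bcontfun ((T ^^ n) \<phi>) y) (apply_bcontfun ((T ^^ n) \<phi>) z) \<le> e/4 + 2 * norm \<phi> * (1 - measure P A)"
      using e4 by simp
    moreover have "2 * norm \<phi> * (1 - measure P A) \<le> 2 * norm \<phi> * \<epsilon>" using A(3) by (intro mult_left_mono) auto
    moreover have "2 * norm \<phi> * \<epsilon> \<le> 2 * (norm \<phi> + 1) * \<epsilon>" using \<epsilon> by (intro mult_right_mono) auto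
    moreover have "2 * (norm \<phi> + 1) * \<epsilon> = e/2"
    proof -
      have "norm \<phi> + 1 \<noteq> 0" using norm_ge_zero[of \<phi>] by linarith
      then show ?thesis by (simp add: \<epsilon>_def field_simps)
    qed
    ultimately show ?thesis using e by linarith
  qed
  define W where "W = (\<Inter>n\<in>{..<k}. apply_bcontfun ((T ^^ n) \<phi>) -` ball (apply_bcontfun ((T ^^ n) \<phi>) z) e)"
  have "open W" unfolding W_def by (intro open_INT ballI open_vimage) auto
  moreover have "z \<in> W" using e by (simp add: W_def)
  moreover have "dist (apply_bcontfun ((T ^^ n) \<phi>) y) (apply_bcontfun ((T ^^ n) \<phi>) z) < e" if "y \<in> W \<inter> ball z r" for n y
  proof (cases "n < k")
    case True
    then show ?thesis using that by (auto simp: W_def dist_commute)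
  qed (use that big in simp)
  ultimately show "\<exists>U. open U \<and> z \<in> U \<and> (\<forall>f\<in>range (\<lambda>n. apply_bcontfun ((T ^^ n) \<phi>)). \<forall>y\<in>U. dist (f y) (f z) < e)"
    using A(1) by (intro exI[of _ "W \<inter> ball z r"]) auto
qed

lemma integrable_step:
  fixes \<phi> :: "rsphere \<Rightarrow>\<^sub>C complex" shows "integrable \<tau> (\<lambda>g. apply_bcontfun \<phi> (apply_rat g z))"
proof (rule finite_measure.integrable_const_bound[where B = "norm \<phi>"])
  show "finite_measure \<tau>" using borel_probs by (simp add: borel_probs_def prob_space.finite_measure)
  have "apply_bcontfun \<phi> \<in> borel_measurable borel" by (intro borel_measurable_continuous_onI) simp
  from measurable_compose[OF measurable_eval_rat[OF borel_probs] this]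
  show "(\<lambda>g. apply_bcontfun \<phi> (apply_rat g z)) \<in> borel_measurable \<tau>" .
qed (auto intro: norm_bounded)

lemma T_contraction': "norm (T \<phi>) \<le> norm \<phi>"
proof (rule norm_bound)
  fix z
  have "norm (apply_bcontfun (T \<phi>) z) \<le> (\<integral>g. norm (apply_bcontfun \<phi> (apply_rat g z)) \<partial>\<tau>)"
    unfolding apply_transition_op[OF borel_probs] by (rule integral_norm_bound)
  also have "\<dots> \<le> (\<integral>g. norm \<phi> \<partial>\<tau>)"
    using borel_probs by (intro integral_mono integrable_norm integrable_step)
      (auto intro: norm_bounded prob_space.finite_measure finite_measure.integrable_const simp: borel_probs_def)
  finally show "norm (apply_bcontfun (T \<phi>) z) \<le> norm \<phi>"
    using prob_space.prob_space[of \<tau>] borel_probs by (simp add: borel_probs_def)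
qed

sublocale almost_periodic "transition_op \<tau>"
proof
  show add: "T (\<phi> + \<psi>) = T \<phi> + T \<psi>" for \<phi> \<psi>
    by (rule bcontfun_eqI) (simp add: apply_transition_op[OF borel_probs] Bochner_Integration.integral_add[OF integrable_step integrable_step])
  show "T (cscale c \<phi>) = cscale c (T \<phi>)" for c \<phi>
    by (rule bcontfun_eqI) (simp add: apply_transition_op[OF borel_probs])
  show "norm (T \<phi>) \<le> norm \<phi>" for \<phi> by (rule T_contraction')
  show "\<exists>Q. compact Q \<and> (\<forall>n. (T ^^ n) \<phi> \<in> Q)" for \<phi>
  proof (intro exI[of _ "closure (range (\<lambda>n. (T ^^ n) \<phi>))"] conjI allI)
    show "compact (closure (range (\<lambda>n. (T ^^ n) \<phi>)))"
    proof (rule compact_closure_bcontfun[OF compact_rsphere])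
      show "equi_at (apply_bcontfun ` range (\<lambda>n. (T ^^ n) \<phi>)) x" for x
        using iterates_equicontinuous[of \<phi> x] by (simp add: image_image)
      fix \<psi> assume "\<psi> \<in> range (\<lambda>n. (T ^^ n) \<phi>)"
      moreover have "norm ((T ^^ n) \<phi>) \<le> norm \<phi>" for n
        by (induction n) (auto intro: order_trans[OF T_contraction'])
      ultimately show "norm \<psi> \<le> norm \<phi>" by blast
    qed
    show "(T ^^ n) \<phi> \<in> closure (range (\<lambda>n. (T ^^ n) \<phi>))" for n
      by (rule subsetD[OF closure_subset]) simp
  qed
qed

text \<open>\<open>\<psi>\<close> is the \<open>n\<close>-th iterate of \<open>s n\<close>, and all
  \<open>s n\<close> lie in a compact, hence uniformly equicontinuous set. Along almost every path
  the orbits of \<open>h x\<close> and \<open>h y\<close> merge, so by dominated convergence the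
  difference of the values of \<open>\<psi>\<close>, which does not depend on \<open>n\<close>, is
  0.\<close>

lemma reversible_constant:
  assumes \<psi>: "\<psi> \<in> reversible" and v: "fatou_disc v" and h: "h \<in> insert id G"
    and xy: "x \<in> closed_disc v" "y \<in> closed_disc v"
  shows "apply_bcontfun \<psi> (h x) = apply_bcontfun \<psi> (h y)"
proof -
  obtain Q s where Q: "compact Q" "s 0 = \<psi>" "\<forall>n. s n \<in> Q" "\<forall>n. T (s (Suc n)) = s n"
    using \<psi> by (rule reversibleE)
  have Ts: "(T ^^ n) (s n) = \<psi>" for n using back_steps[of s n 0] Q by simp
  obtain B where B: "\<forall>\<xi>\<in>Q. norm \<xi> \<le> B" using compact_imp_bounded[OF Q(1)] unfolding bounded_iff by blast
  define f where "f n \<gamma> = apply_bcontfun (s n) (random_comp \<gamma> n (h x)) - apply_bcontfun (s n) (random_comp \<gamma> n (h y))" for n \<gamma>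
  have "(\<lambda>n. \<integral>\<gamma>. f n \<gamma> \<partial>P) \<longlonglongrightarrow> (\<integral>\<gamma>. 0 \<partial>P)"
  proof (rule integral_dominated_convergence[where w = "\<lambda>_. 2 * B"])
    show "f n \<in> borel_measurable P" for n unfolding f_def by (intro borel_measurable_diff measurable_path)
    show "AE \<gamma> in P. (\<lambda>n. f n \<gamma>) \<longlonglongrightarrow> 0"
      using disc_contraction[OF v h]
    proof eventually_elim
      case (elim \<gamma>)
      show ?case unfolding LIMSEQ_iff
      proof (intro allI impI)
        fix e :: real assume "e > 0"
        from compact_uniformly_equicontinuous[OF compact_rsphere Q(1) this]
        obtain d where d: "d > 0" "\<forall>\<xi>\<in>Q. \<forall>x y. dist x y < d \<longrightarrow> dist (apply_bcontfun \<xi> x) (apply_bcontfun \<xi> y) < e" by blast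
        obtain N where N: "\<forall>n\<ge>N. \<forall>x\<in>closed_disc v. \<forall>y\<in>closed_disc v. dist (random_comp \<gamma> n (h x)) (random_comp \<gamma> n (h y)) < d"
          using elim d(1) by blast
        have "norm (f n \<gamma> - 0) < e" if "n \<ge> N" for n
        proof -
          have "dist (random_comp \<gamma> n (h x)) (random_comp \<gamma> n (h y)) < d" using N that xy by blast
          then have "dist (apply_bcontfun (s n) (random_comp \<gamma> n (h x))) (apply_bcontfun (s n) (random_comp \<gamma> n (h y))) < e"
            using d(2) Q(3) by blast
          then show ?thesis by (simp add: f_def dist_norm)
        qed
        then show "\<exists>N. \<forall>n\<ge>N. norm (f n \<gamma> - 0) < e" by blast
      qed
    qed
    show "AE \<gamma> in P. norm (f n \<gamma>) \<le> 2 * B" for n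
    proof (rule AE_I2)
      fix \<gamma>
      have "norm (s n) \<le> B" using B Q(3) by blast
      then show "norm (f n \<gamma>) \<le> 2 * B" unfolding f_def
        using norm_triangle_ineq4[of "apply_bcontfun (s n) (random_comp \<gamma> n (h x))" "apply_bcontfun (s n) (random_comp \<gamma> n (h y))"]
          norm_bounded[of "s n" "random_comp \<gamma> n (h x)"] norm_bounded[of "s n" "random_comp \<gamma> n (h y)"] by linarith
    qed
  qed simp_all
  moreover have "(\<integral>\<gamma>. f n \<gamma> \<partial>P) = apply_bcontfun \<psi> (h x) - apply_bcontfun \<psi> (h y)" for n
    using T_power[of n "s n" "h x"] T_power[of n "s n" "h y"] unfolding f_def
    by (subst Bochner_Integration.integral_diff[OF integrable_path integrable_path]) (simp add: Ts)
  ultimately show ?thesis by (simp add: LIMSEQ_const_iff)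
qed

text \<open>By time \<open>k\<close> all but a quarter of the paths have brought the ball into a
  disc, after which \<open>reversible_constant\<close> for \<open>s k\<close> makes the difference
  vanish. The others contribute at most \<open>2 * norm (s k) / 4\<close>, and \<open>s k\<close>
  has the norm of \<open>\<psi>\<close> by isometry. So \<open>r\<close> does not depend on
  \<open>\<psi>\<close>.\<close>

lemma reversible_oscillation:
  "\<exists>r>0. \<forall>\<psi>\<in>reversible. \<forall>y\<in>ball z r. dist (apply_bcontfun \<psi> y) (apply_bcontfun \<psi> z) \<le> norm \<psi> / 2"
proof -
  have hit: "AE \<gamma> in P. \<exists>n. \<exists>O'\<in>disc ` VV. random_comp \<gamma> n z \<in> O'"
    by (rule hitting_point) (use VV(3) open_disc in auto)
  obtain r k A where A: "r > 0" "A \<in> sets P" "1 - 1/4 < measure P A"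
    "\<forall>\<gamma>\<in>A. \<exists>n\<le>k. \<exists>O'\<in>disc ` VV. random_comp \<gamma> n ` ball z r \<subseteq> O'"
  proof (rule hitting_neighbourhood[OF _ hit])
    show "open O'" if "O' \<in> disc ` VV" for O' using that open_disc by blast
    show "(1/4 :: real) > 0" by simp
  qed blast
  have "dist (apply_bcontfun \<psi> y) (apply_bcontfun \<psi> z) \<le> norm \<psi> / 2" if \<psi>: "\<psi> \<in> reversible" and y: "y \<in> ball z r" for \<psi> y
  proof -
    obtain Q s where Q: "compact Q" "s 0 = \<psi>" "\<forall>n. s n \<in> Q" "\<forall>n. T (s (Suc n)) = s n"
      using \<psi> by (rule reversibleE)
    have Ts: "(T ^^ k) (s k) = \<psi>" using back_steps[of s k 0] Q by simp
    have sk: "s k \<in> reversible" by (rule reversible_shift[OF Q(1)]) (use Q in auto)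
    have "norm (s k) = norm \<psi>" using reversible_isometry[OF sk, of k] Ts by simp
    have "AE \<gamma> in P. \<gamma> \<in> A \<longrightarrow>
        dist (apply_bcontfun (s k) (random_comp \<gamma> k y)) (apply_bcontfun (s k) (random_comp \<gamma> k z)) \<le> 0"
      using AE_paths
    proof eventually_elim
      case (elim \<gamma>)
      show ?case
      proof
        assume "\<gamma> \<in> A"
        then obtain m v where m: "m \<le> k" "v \<in> VV" "random_comp \<gamma> m ` ball z r \<subseteq> disc v" using A(4) by blast
        have "z \<in> ball z r" using A(1) by simp
        then have in_disc: "random_comp \<gamma> m y \<in> closed_disc v" "random_comp \<gamma> m z \<in> closed_disc v"
          using m(3) y disc_subset[of v] by blast+
        define h where "h = random_comp (\<lambda>i. \<gamma> (m + i)) (k - m)"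
        have h: "h \<in> insert id G" unfolding h_def using elim by (intro random_comp_in_semigroup) simp
        have "random_comp \<gamma> k = h \<circ> random_comp \<gamma> m" using random_comp_add[of \<gamma> m "k - m"] m(1) by (simp add: h_def)
        then show "dist (apply_bcontfun (s k) (random_comp \<gamma> k y)) (apply_bcontfun (s k) (random_comp \<gamma> k z)) \<le> 0"
          using reversible_constant[OF sk VV(2)[OF m(2)] h in_disc] by simp
      qed
    qed
    from norm_integral_path_diff[OF A(2) _ this]
    have "dist (apply_bcontfun \<psi> y) (apply_bcontfun \<psi> z) \<le> 2 * norm (s k) * (1 - measure P A)" by (simp add: Ts)
    also have "\<dots> \<le> 2 * norm (s k) * (1/4)" using A(3) by (intro mult_left_mono) auto
    finally show ?thesis using \<open>norm (s k) = norm \<psi>\<close> by simp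
  qed
  then show ?thesis using A(1) by blast
qed

lemma reversible_finite_dimensional: "\<exists>B. finite B \<and> reversible = cfun.span B"
proof -
  obtain r where r: "\<And>z. r z > 0"
    "\<forall>z. \<forall>\<psi>\<in>reversible. \<forall>y\<in>ball z (r z). dist (apply_bcontfun \<psi> y) (apply_bcontfun \<psi> z) \<le> norm \<psi> / 2"
    using reversible_oscillation by metis
  have "UNIV \<subseteq> (\<Union>z. ball z (r z))" using r(1) by (auto intro!: exI[of _ "_"] centre_in_ball[THEN iffD2])
  then obtain Z where Z: "finite Z" "UNIV \<subseteq> (\<Union>z\<in>Z. ball z (r z))"
    using compactE_image[OF compact_rsphere, of UNIV "\<lambda>z. ball z (r z)"] by (metis open_ball)
  show ?thesis
  proof (rule finite_evaluation_span[OF Z(1) reversible_subspace])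
    fix \<psi> assume \<psi>: "\<psi> \<in> reversible" "\<forall>z\<in>Z. apply_bcontfun \<psi> z = 0"
    \<comment> \<open>Every point lies in a ball whose centre is a zero of \<open>\<psi>\<close>, so
      the oscillation bound becomes a bound on the norm and forces it to be 0.\<close>
    have "norm \<psi> \<le> norm \<psi> / 2"
    proof (rule norm_bound)
      fix y
      have "y \<in> (\<Union>z\<in>Z. ball z (r z))" using Z(2) by blast
      then obtain z where "z \<in> Z" "y \<in> ball z (r z)" by blast
      then show "norm (apply_bcontfun \<psi> y) \<le> norm \<psi> / 2" using r(2) \<psi> by fastforce
    qed
    then show "\<psi> = 0" by simp
  qed
qed

lemma unitary_eigenvectors_eq: "unitary_eigenvectors \<tau> = eigenvectors"
  by (simp add: unitary_eigenvectors_def eigenvectors_def)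

lemma unitary_space_eq: "unitary_space \<tau> = reversible"
  using reversible_finite_dimensional reversible_eq_span
  by (auto simp: unitary_space_def unitary_eigenvectors_eq)

lemma vanishing_space_eq: "vanishing_space \<tau> = vanishing"
  by (simp add: vanishing_space_def vanishing_def)

lemma decomposition: "\<exists>u\<in>reversible. \<exists>v\<in>vanishing. \<phi> = u + v"
proof -
  obtain u where "u \<in> reversible" "(\<lambda>n. (T ^^ n) (\<phi> - u)) \<longlonglongrightarrow> 0" by (rule reversible_part)
  then show ?thesis by (intro bexI[of _ u] bexI[of _ "\<phi> - u"]) (auto simp: vanishing_def)
qed

lemma reversible_locally_constant:
  assumes "\<phi> \<in> reversible" "z \<in> F"
  shows "\<exists>V. open V \<and> z \<in> V \<and> apply_bcontfun \<phi> constant_on V"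
proof -
  obtain v where v: "fatou_disc v" "z \<in> disc v" by (rule fatou_disc_exists[OF assms(2)])
  have "apply_bcontfun \<phi> x = apply_bcontfun \<phi> z" if "x \<in> disc v" for x
    using reversible_constant[OF assms(1) v(1), of id x z] that v(2) disc_subset[of v] by auto
  then show ?thesis using v(2) open_disc[of v] unfolding constant_on_def by blast
qed

end

section \<open>Weak convergence and the dual operator\<close>

lemma integrable_continuous_rsphere:
  fixes f :: "rsphere \<Rightarrow> 'b :: {banach, second_countable_topology}"
  assumes "\<mu> \<in> borel_probs" "continuous_on UNIV f" shows "integrable \<mu> f"
  using integrable_bcontfun[OF assms(1), of "Bcontfun f"] assms(2) by (simp add: Bcontfun_inverse bcontfun_rsphere_iff)

text \<open>Limits of integrals form a positive normalised functional on real continuous functions,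
  which the Riesz theorem represents; complex test functions follow from real and imaginary
  parts.\<close>

lemma weak_limit_exists:
  assumes \<mu>: "\<And>k. \<mu> k \<in> borel_probs"
    and conv: "\<And>\<phi> :: rsphere \<Rightarrow>\<^sub>C complex. convergent (\<lambda>k. \<integral>x. apply_bcontfun \<phi> x \<partial>\<mu> k)"
  shows "\<exists>\<nu>\<in>borel_probs. \<forall>\<phi> :: rsphere \<Rightarrow>\<^sub>C complex. (\<lambda>k. \<integral>x. apply_bcontfun \<phi> x \<partial>\<mu> k) \<longlonglongrightarrow> (\<integral>x. apply_bcontfun \<phi> x \<partial>\<nu>)"
proof -
  define L where "L f = lim (\<lambda>k. \<integral>x. f x \<partial>\<mu> k)" for f :: "rsphere \<Rightarrow> real"
  note int = integrable_continuous_rsphere[OF \<mu>]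
  have L: "(\<lambda>k. \<integral>x. f x \<partial>\<mu> k) \<longlonglongrightarrow> L f" if f: "continuous_on UNIV f" for f
  proof -
    define \<phi> where "\<phi> = Bcontfun (\<lambda>x. complex_of_real (f x))"
    have \<phi>: "apply_bcontfun \<phi> = (\<lambda>x. complex_of_real (f x))"
      unfolding \<phi>_def by (rule Bcontfun_inverse) (simp add: bcontfun_rsphere_iff continuous_on_of_real f)
    obtain l where "(\<lambda>k. \<integral>x. apply_bcontfun \<phi> x \<partial>\<mu> k) \<longlonglongrightarrow> l" using conv unfolding convergent_def by blast
    then have "(\<lambda>k. Re (\<integral>x. apply_bcontfun \<phi> x \<partial>\<mu> k)) \<longlonglongrightarrow> Re l" by (rule tendsto_Re)
    then have "convergent (\<lambda>k. \<integral>x. f x \<partial>\<mu> k)" unfolding convergent_def \<phi> by auto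
    then show ?thesis unfolding L_def by (rule convergent_LIMSEQ_iff[THEN iffD1])
  qed
  interpret positive_functional L
  proof
    show "compact (UNIV :: rsphere set)" by (rule compact_rsphere)
    show "L (\<lambda>x. f x + g x) = L f + L g" if f: "continuous_on UNIV f" and g: "continuous_on UNIV g" for f g
    proof (rule LIMSEQ_unique[OF L])
      show "continuous_on UNIV (\<lambda>x. f x + g x)" by (intro continuous_intros f g)
      show "(\<lambda>k. \<integral>x. f x + g x \<partial>\<mu> k) \<longlonglongrightarrow> L f + L g"
        using tendsto_add[OF L[OF f] L[OF g]] by (simp add: Bochner_Integration.integral_add[OF int[OF f] int[OF g]])
    qed
    show "L (\<lambda>x. c * f x) = c * L f" if f: "continuous_on UNIV f" for f c
    proof (rule LIMSEQ_unique[OF L])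
      show "continuous_on UNIV (\<lambda>x. c * f x)" by (intro continuous_intros f)
      show "(\<lambda>k. \<integral>x. c * f x \<partial>\<mu> k) \<longlonglongrightarrow> c * L f"
        using tendsto_mult_left[OF L[OF f], of c] by simp
    qed
    show "0 \<le> L f" if f: "continuous_on UNIV f" "\<And>x. 0 \<le> f x" for f
      by (rule LIMSEQ_le_const[OF L[OF f(1)]]) (use f(2) in \<open>auto intro!: Bochner_Integration.integral_nonneg\<close>)
    show "L (\<lambda>_. 1) = 1"
    proof (rule LIMSEQ_unique[OF L])
      have "(\<integral>x. 1 \<partial>\<mu> k) = (1::real)" for k
        using \<mu>[of k] prob_space.prob_space[of "\<mu> k"] by (simp add: borel_probs_def)
      then show "(\<lambda>k. \<integral>x. 1 \<partial>\<mu> k) \<longlonglongrightarrow> (1::real)" by simp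
    qed simp
  qed
  show ?thesis
  proof (rule bexI[OF _ rep_prob], intro allI)
    fix \<phi> :: "rsphere \<Rightarrow>\<^sub>C complex"
    have c: "continuous_on UNIV (\<lambda>x. Re (apply_bcontfun \<phi> x))" "continuous_on UNIV (\<lambda>x. Im (apply_bcontfun \<phi> x))"
      by (intro continuous_intros; simp)+
    have Re: "Re (\<integral>x. apply_bcontfun \<phi> x \<partial>\<nu>) = (\<integral>x. Re (apply_bcontfun \<phi> x) \<partial>\<nu>)"
      and Im: "Im (\<integral>x. apply_bcontfun \<phi> x \<partial>\<nu>) = (\<integral>x. Im (apply_bcontfun \<phi> x) \<partial>\<nu>)" if "\<nu> \<in> borel_probs" for \<nu>
      using integrable_bcontfun[OF that, of \<phi>] by simp_all
    show "(\<lambda>k. \<integral>x. apply_bcontfun \<phi> x \<partial>\<mu> k) \<longlonglongrightarrow> (\<integral>x. apply_bcontfun \<phi> x \<partial>rep)"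
      using L[OF c(1)] L[OF c(2)] unfolding tendsto_complex_iff Re[OF \<mu>] Im[OF \<mu>] Re[OF rep_prob] Im[OF rep_prob]
        integral_rep[OF c(1)] integral_rep[OF c(2)] by blast
  qed
qed

lemma limitin_weak_topology:
  assumes \<mu>: "\<And>k. \<mu> k \<in> borel_probs" and \<nu>: "\<nu> \<in> borel_probs"
    and lim: "\<And>\<phi> :: rsphere \<Rightarrow>\<^sub>C complex. (\<lambda>k. \<integral>x. apply_bcontfun \<phi> x \<partial>\<mu> k) \<longlonglongrightarrow> (\<integral>x. apply_bcontfun \<phi> x \<partial>\<nu>)"
  shows "limitin weak_topology \<mu> \<nu> sequentially"
  unfolding limitin_def
proof (intro conjI allI impI)
  show "\<nu> \<in> topspace weak_topology" using \<nu> by simp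
  have real: "(\<lambda>k. \<integral>x. apply_bcontfun \<phi> x \<partial>\<mu> k) \<longlonglongrightarrow> (\<integral>x. apply_bcontfun \<phi> x \<partial>\<nu>)" for \<phi> :: "rsphere \<Rightarrow>\<^sub>C real"
  proof -
    define \<psi> where "\<psi> = Bcontfun (\<lambda>x. complex_of_real (apply_bcontfun \<phi> x))"
    have "apply_bcontfun \<psi> = (\<lambda>x. complex_of_real (apply_bcontfun \<phi> x))"
      unfolding \<psi>_def by (rule Bcontfun_inverse) (auto simp: bcontfun_rsphere_iff intro!: continuous_on_of_real)
    then show ?thesis using tendsto_Re[OF lim[of \<psi>]] by simp
  qed
  fix U assume U: "openin weak_topology U \<and> \<nu> \<in> U"
  then have "generate_topology_on {{\<mu> \<in> borel_probs. (\<integral>x. apply_bcontfun \<phi> x \<partial>\<mu>) \<in> V} | (\<phi> :: rsphere \<Rightarrow>\<^sub>C real) V. open V} U"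
    unfolding weak_topology_def by (intro openin_topology_generated_by) blast
  then have "\<nu> \<in> U \<longrightarrow> (\<forall>\<^sub>F k in sequentially. \<mu> k \<in> U)"
  proof (induction rule: generate_topology_on.induct)
    case (Int a b)
    then show ?case by (auto intro: eventually_conj)
  next
    case (UN K)
    show ?case
    proof
      assume "\<nu> \<in> \<Union>K"
      then obtain k where k: "k \<in> K" "\<nu> \<in> k" by blast
      then show "\<forall>\<^sub>F i in sequentially. \<mu> i \<in> \<Union>K" using UN[OF k(1)] by (auto elim: eventually_mono)
    qed
  next
    case (Basis s)
    then obtain \<phi> :: "rsphere \<Rightarrow>\<^sub>C real" and V where s: "s = {\<mu> \<in> borel_probs. (\<integral>x. apply_bcontfun \<phi> x \<partial>\<mu>) \<in> V}" "open V" by blast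
    show ?case using topological_tendstoD[OF real s(2), of \<phi>] \<mu> by (simp add: s(1))
  qed simp
  then show "\<forall>\<^sub>F k in sequentially. \<mu> k \<in> U" using U by blast
qed

lemma continuous_map_integral:
  fixes \<phi> :: "'a::topological_space \<Rightarrow>\<^sub>C real"
  shows "continuous_map weak_topology euclideanreal (\<lambda>\<mu>. \<integral>x. apply_bcontfun \<phi> x \<partial>\<mu>)"
  unfolding continuous_map_def
proof (intro conjI allI impI)
  fix U :: "real set" assume "openin euclideanreal U"
  then have "open U" by simp
  then show "openin weak_topology {\<mu> \<in> topspace weak_topology. (\<integral>x. apply_bcontfun \<phi> x \<partial>\<mu>) \<in> U}"
    unfolding topspace_weak_topology unfolding weak_topology_def by (intro topology_generated_by_Basis) blast
qed simp

text \<open>Weakly open sets arise from sub-basic ones by finite intersections and unions, so it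
  suffices that every single integral depends continuously on the coordinates.\<close>

lemma real_coords_weak_topology:
  fixes A :: "'a::topological_space measure set"
  assumes A: "A \<subseteq> borel_probs" and cont: "\<And>i. i \<in> I \<Longrightarrow> continuous_map weak_topology euclideanreal (f i)"
    and determined: "\<And>(\<phi> :: 'a \<Rightarrow>\<^sub>C real) a e. a \<in> A \<Longrightarrow> e > 0 \<Longrightarrow>
      \<exists>d>0. \<forall>\<mu>\<in>A. (\<forall>i\<in>I. \<bar>f i \<mu> - f i a\<bar> < d) \<longrightarrow> dist (\<integral>x. apply_bcontfun \<phi> x \<partial>\<mu>) (\<integral>x. apply_bcontfun \<phi> x \<partial>a) < e"
  shows "real_coords (subtopology weak_topology A) I f"
  unfolding real_coords_def
proof (intro conjI ballI allI impI)
  show "continuous_map (subtopology weak_topology A) euclideanreal (f i)" if "i \<in> I" for i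
    using cont[OF that] by (rule continuous_map_from_subtopology)
  fix V a assume V: "openin (subtopology weak_topology A) V" and aV: "a \<in> V"
  then obtain U where U: "openin weak_topology U" "V = U \<inter> A" unfolding openin_subtopology by blast
  have a: "a \<in> A" using aV U(2) by blast
  from U(1) have "generate_topology_on {{\<mu> \<in> borel_probs. (\<integral>x. apply_bcontfun \<phi> x \<partial>\<mu>) \<in> V} | (\<phi> :: 'a \<Rightarrow>\<^sub>C real) V. open V} U"
    unfolding weak_topology_def by (rule openin_topology_generated_by)
  then have "a \<in> U \<longrightarrow> (\<exists>e>0. \<forall>\<mu>\<in>A. (\<forall>i\<in>I. \<bar>f i \<mu> - f i a\<bar> < e) \<longrightarrow> \<mu> \<in> U)"
  proof (induction rule: generate_topology_on.induct)
    case (Int S S')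
    show ?case
    proof
      assume "a \<in> S \<inter> S'"
      then obtain e e' where e: "e > 0" "\<forall>\<mu>\<in>A. (\<forall>i\<in>I. \<bar>f i \<mu> - f i a\<bar> < e) \<longrightarrow> \<mu> \<in> S"
        and e': "e' > 0" "\<forall>\<mu>\<in>A. (\<forall>i\<in>I. \<bar>f i \<mu> - f i a\<bar> < e') \<longrightarrow> \<mu> \<in> S'" using Int.IH by blast
      then show "\<exists>e>0. \<forall>\<mu>\<in>A. (\<forall>i\<in>I. \<bar>f i \<mu> - f i a\<bar> < e) \<longrightarrow> \<mu> \<in> S \<inter> S'"
        by (intro exI[of _ "min e e'"]) simp
    qed
  next
    case (UN K)
    show ?case
    proof
      assume "a \<in> \<Union>K"
      then obtain k where k: "k \<in> K" "a \<in> k" by blast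
      then obtain e where "e > 0" "\<forall>\<mu>\<in>A. (\<forall>i\<in>I. \<bar>f i \<mu> - f i a\<bar> < e) \<longrightarrow> \<mu> \<in> k" using UN.IH by blast
      then show "\<exists>e>0. \<forall>\<mu>\<in>A. (\<forall>i\<in>I. \<bar>f i \<mu> - f i a\<bar> < e) \<longrightarrow> \<mu> \<in> \<Union>K" using k(1) by blast
    qed
  next
    case (Basis s)
    then obtain \<phi> :: "'a \<Rightarrow>\<^sub>C real" and W where s: "s = {\<mu> \<in> borel_probs. (\<integral>x. apply_bcontfun \<phi> x \<partial>\<mu>) \<in> W}" "open W" by blast
    show ?case
    proof
      assume "a \<in> s"
      then have "(\<integral>x. apply_bcontfun \<phi> x \<partial>a) \<in> W" by (simp add: s(1))
      then obtain e where e: "e > 0" "\<forall>y. dist y (\<integral>x. apply_bcontfun \<phi> x \<partial>a) < e \<longrightarrow> y \<in> W"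
        using s(2) unfolding open_dist by blast
      obtain d where d: "d > 0" "\<forall>\<mu>\<in>A. (\<forall>i\<in>I. \<bar>f i \<mu> - f i a\<bar> < d) \<longrightarrow> dist (\<integral>x. apply_bcontfun \<phi> x \<partial>\<mu>) (\<integral>x. apply_bcontfun \<phi> x \<partial>a) < e"
        using determined[OF a e(1), of \<phi>] by blast
      then show "\<exists>e>0. \<forall>\<mu>\<in>A. (\<forall>i\<in>I. \<bar>f i \<mu> - f i a\<bar> < e) \<longrightarrow> \<mu> \<in> s"
        using A e(2) by (intro exI[of _ d]) (auto simp: s(1))
    qed
  qed simp
  then obtain e where "e > 0" "\<forall>\<mu>\<in>A. (\<forall>i\<in>I. \<bar>f i \<mu> - f i a\<bar> < e) \<longrightarrow> \<mu> \<in> U" using aV U(2) by blast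
  then show "\<exists>e>0. \<forall>\<mu>\<in>topspace (subtopology weak_topology A). (\<forall>i\<in>I. \<bar>f i \<mu> - f i a\<bar> < e) \<longrightarrow> \<mu> \<in> V"
    using U(2) by (intro exI[of _ e]) auto
qed

lemma simultaneous_subsequence:
  fixes a :: "'i \<Rightarrow> nat \<Rightarrow> complex"
  assumes "finite I" "\<And>i n. norm (a i n) \<le> b i"
  shows "\<exists>r :: nat \<Rightarrow> nat. strict_mono r \<and> (\<forall>i\<in>I. convergent (\<lambda>k. a i (r k)))"
  using assms(1)
proof (induction I rule: finite_induct)
  case empty
  show ?case by (rule exI[of _ "\<lambda>x. x"]) (simp add: strict_mono_def)
next
  case (insert j I)
  then obtain r :: "nat \<Rightarrow> nat" where r: "strict_mono r" "\<forall>i\<in>I. convergent (\<lambda>k. a i (r k))" by blast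
  have "bounded (range (\<lambda>k. a j (r k)))" using assms(2) unfolding bounded_iff by blast
  then obtain l q where q: "strict_mono (q :: nat \<Rightarrow> nat)" "((\<lambda>k. a j (r k)) \<circ> q) \<longlonglongrightarrow> l"
    using bounded_imp_convergent_subsequence by blast
  show ?case
  proof (intro exI[of _ "r \<circ> q"] conjI ballI)
    show "strict_mono (r \<circ> q)" using r(1) q(1) by (rule strict_mono_o)
    fix i assume "i \<in> insert j I"
    then show "convergent (\<lambda>k. a i ((r \<circ> q) k))"
    proof
      assume "i = j" then show ?thesis using q(2) unfolding convergent_def comp_def by blast
    next
      assume "i \<in> I"
      then show ?thesis using convergent_subseq_convergent[OF _ q(1)] r(2) by (fastforce simp: comp_def)
    qed
  qed
qed

definition integral_of :: "'a::topological_space measure \<Rightarrow> ('a \<Rightarrow>\<^sub>C complex) \<Rightarrow> complex" where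
  "integral_of \<mu> \<phi> = (\<integral>x. apply_bcontfun \<phi> x \<partial>\<mu>)"

lemma integral_of_add: "\<mu> \<in> borel_probs \<Longrightarrow> integral_of \<mu> (\<phi> + \<psi>) = integral_of \<mu> \<phi> + integral_of \<mu> \<psi>"
  by (simp add: integral_of_def Bochner_Integration.integral_add integrable_bcontfun)

lemma integral_of_diff: "\<mu> \<in> borel_probs \<Longrightarrow> integral_of \<mu> (\<phi> - \<psi>) = integral_of \<mu> \<phi> - integral_of \<mu> \<psi>"
  by (simp add: integral_of_def Bochner_Integration.integral_diff integrable_bcontfun)

lemma integral_of_cscale: "integral_of \<mu> (cscale c \<phi>) = c * integral_of \<mu> \<phi>"
  by (simp add: integral_of_def)

lemma integral_of_0: "integral_of \<mu> 0 = 0"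
  by (simp add: integral_of_def)

lemma norm_integral_of:
  assumes "\<mu> \<in> borel_probs" shows "norm (integral_of \<mu> \<phi>) \<le> norm \<phi>"
proof -
  interpret prob_space \<mu> using assms by (simp add: borel_probs_def)
  have "norm (integral_of \<mu> \<phi>) \<le> (\<integral>x. norm (apply_bcontfun \<phi> x) \<partial>\<mu>)"
    unfolding integral_of_def by (rule integral_norm_bound)
  also have "\<dots> \<le> (\<integral>x. norm \<phi> \<partial>\<mu>)"
    by (intro integral_mono integrable_norm integrable_bcontfun[OF assms]) (auto intro: norm_bounded)
  finally show ?thesis by (simp add: prob_space)
qed

lemma tendsto_integral_of:
  assumes \<mu>: "\<mu> \<in> borel_probs" and s: "(s \<longlongrightarrow> l) F" shows "((\<lambda>k. integral_of \<mu> (s k)) \<longlongrightarrow> integral_of \<mu> l) F"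
proof (rule tendsto_dist_iff[THEN iffD2], rule tendsto_sandwich[OF _ _ tendsto_const s[THEN tendsto_dist_iff[THEN iffD1]]])
  show "\<forall>\<^sub>F k in F. dist (integral_of \<mu> (s k)) (integral_of \<mu> l) \<le> dist (s k) l"
    using norm_integral_of[OF \<mu>] unfolding dist_norm by (simp add: integral_of_diff[OF \<mu>, symmetric])
qed simp

lemma integral_of_eqI:
  fixes \<mu> :: "'a::metric_space measure"
  shows "\<mu> \<in> borel_probs \<Longrightarrow> \<nu> \<in> borel_probs \<Longrightarrow> (\<And>\<phi>. integral_of \<mu> \<phi> = integral_of \<nu> \<phi>) \<Longrightarrow> \<mu> = \<nu>"
  unfolding integral_of_def by (rule borel_probs_eqI)

lemma integral_of_span:
  assumes \<mu>: "\<And>k. \<mu> k \<in> borel_probs" and conv: "\<And>s. s \<in> B \<Longrightarrow> convergent (\<lambda>k. integral_of (\<mu> k) s)" and u: "u \<in> cfun.span B"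
  shows "convergent (\<lambda>k. integral_of (\<mu> k) u)"
  using u
proof (induction rule: cfun.span_induct_alt)
  case base
  show ?case by (simp add: integral_of_0 convergent_const)
next
  case (step c x y)
  then show ?case using conv[OF step(1)]
    by (simp add: integral_of_add[OF \<mu>] integral_of_cscale convergent_add convergent_mult convergent_const)
qed

lemma integral_of_span_continuous:
  assumes A: "A \<subseteq> borel_probs" and a: "a \<in> A" and u: "u \<in> cfun.span B" and e: "e > 0"
  shows "\<exists>d>0. \<forall>\<mu>\<in>A. (\<forall>s\<in>B. norm (integral_of \<mu> s - integral_of a s) < d) \<longrightarrow> norm (integral_of \<mu> u - integral_of a u) < e"
  using u e
proof (induction arbitrary: e rule: cfun.span_induct_alt)
  case base
  then show ?case by (intro exI[of _ 1]) (simp add: integral_of_0)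
next
  case (step c x y)
  have "e/2 > 0" using step.prems by simp
  from step.IH[OF this] obtain d where d: "d > 0"
    "\<forall>\<mu>\<in>A. (\<forall>s\<in>B. norm (integral_of \<mu> s - integral_of a s) < d) \<longrightarrow> norm (integral_of \<mu> y - integral_of a y) < e/2" by blast
  define d' where "d' = min d (e / (2 * (norm c + 1)))"
  have c1: "norm c + 1 > 0" using norm_ge_zero[of c] by linarith
  have "d' > 0" unfolding d'_def using d(1) step.prems c1 by simp
  moreover have "norm (integral_of \<mu> (cscale c x + y) - integral_of a (cscale c x + y)) < e"
    if \<mu>: "\<mu> \<in> A" and close: "\<forall>s\<in>B. norm (integral_of \<mu> s - integral_of a s) < d'" for \<mu>
  proof -
    have "norm (integral_of \<mu> x - integral_of a x) \<le> e / (2 * (norm c + 1))"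
      using close step.hyps unfolding d'_def by (auto intro: less_imp_le)
    then have "norm c * norm (integral_of \<mu> x - integral_of a x) \<le> norm c * (e / (2 * (norm c + 1)))"
      by (rule mult_left_mono) simp
    also have "\<dots> \<le> e/2" using step.prems c1 by (simp add: divide_simps)
    finally have 1: "norm (c * (integral_of \<mu> x - integral_of a x)) \<le> e/2" by (simp add: norm_mult)
    have 2: "norm (integral_of \<mu> y - integral_of a y) < e/2" using d(2) \<mu> close unfolding d'_def by auto
    have "\<mu> \<in> borel_probs" "a \<in> borel_probs" using \<mu> a A by auto
    then have "integral_of \<mu> (cscale c x + y) - integral_of a (cscale c x + y) =
      c * (integral_of \<mu> x - integral_of a x) + (integral_of \<mu> y - integral_of a y)"
      by (simp add: integral_of_add integral_of_cscale algebra_simps)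
    note 3 = this
    show ?thesis unfolding 3 using 1 2 norm_triangle_ineq[of "c * (integral_of \<mu> x - integral_of a x)" "integral_of \<mu> y - integral_of a y"]
      by linarith
  qed
  ultimately show ?case by blast
qed

context cooperation
begin

section \<open>The dual operator and its attractor\<close>

lemma dual_op_power:
  assumes "\<mu> \<in> borel_probs"
  shows "(dual_op \<tau> ^^ n) \<mu> \<in> borel_probs" "integral_of ((dual_op \<tau> ^^ n) \<mu>) \<phi> = integral_of \<mu> ((T ^^ n) \<phi>)"
proof -
  have *: "(dual_op \<tau> ^^ n) \<mu> \<in> borel_probs \<and> (\<forall>\<phi>. integral_of ((dual_op \<tau> ^^ n) \<mu>) \<phi> = integral_of \<mu> ((T ^^ n) \<phi>))"
  proof (induction n)
    case (Suc n)
    then have b: "(dual_op \<tau> ^^ n) \<mu> \<in> borel_probs" by blast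
    have "integral_of (dual_op \<tau> ((dual_op \<tau> ^^ n) \<mu>)) \<phi> = integral_of \<mu> ((T ^^ n) (T \<phi>))" for \<phi>
      using Suc by (simp add: integral_of_def integral_dual_op[OF borel_probs b])
    then show ?case using dual_op_in_borel_probs[OF borel_probs b] by (simp add: funpow_swap1[of "transition_op \<tau>"])
  qed (simp add: assms)
  then show "(dual_op \<tau> ^^ n) \<mu> \<in> borel_probs" "integral_of ((dual_op \<tau> ^^ n) \<mu>) \<phi> = integral_of \<mu> ((T ^^ n) \<phi>)" by auto
qed

text \<open>Iterating the dual operator erases the pairing with vanishing functions, so weak limits
  along times tending to infinity lie here; and a measure in this set is determined by its pairing
  with reversible functions.\<close>

definition attractor :: "rsphere measure set" where
  "attractor = {\<mu> \<in> borel_probs. \<forall>v\<in>vanishing. integral_of \<mu> v = 0}"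

lemma attractor_borel_probs: "attractor \<subseteq> borel_probs" by (auto simp: attractor_def)

lemma vanishing_tendsto: "v \<in> vanishing \<Longrightarrow> filterlim m at_top sequentially \<Longrightarrow> (\<lambda>k. (T ^^ (m k)) v) \<longlonglongrightarrow> 0"
  unfolding vanishing_def by (auto intro: filterlim_compose)

text \<open>The vanishing part of a test function dies out at times tending to infinity and its
  reversible part converges by assumption, so all pairings converge and define a limit
  measure.\<close>

lemma orbit_weak_limit:
  assumes \<mu>: "\<mu> \<in> borel_probs" and m: "filterlim m at_top sequentially"
    and conv: "\<And>u. u \<in> reversible \<Longrightarrow> convergent (\<lambda>k. (T ^^ (m k)) u)"
  shows "\<exists>\<nu>\<in>attractor. \<forall>\<phi>. (\<lambda>k. integral_of ((dual_op \<tau> ^^ m k) \<mu>) \<phi>) \<longlonglongrightarrow> integral_of \<nu> \<phi>"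
proof -
  have "convergent (\<lambda>k. integral_of ((dual_op \<tau> ^^ m k) \<mu>) \<phi>)" for \<phi>
  proof -
    obtain u v where uv: "u \<in> reversible" "v \<in> vanishing" "\<phi> = u + v" using decomposition by blast
    obtain l where "(\<lambda>k. (T ^^ (m k)) u) \<longlonglongrightarrow> l" using conv[OF uv(1)] unfolding convergent_def by blast
    from tendsto_add[OF this vanishing_tendsto[OF uv(2) m]] have "(\<lambda>k. (T ^^ (m k)) \<phi>) \<longlonglongrightarrow> l"
      by (simp add: uv(3) Tn_add)
    from tendsto_integral_of[OF \<mu> this] show ?thesis unfolding dual_op_power(2)[OF \<mu>] convergent_def by blast
  qed
  from weak_limit_exists[OF dual_op_power(1)[OF \<mu>] this[unfolded integral_of_def]]
  obtain \<nu> where \<nu>: "\<nu> \<in> borel_probs" "\<forall>\<phi>. (\<lambda>k. integral_of ((dual_op \<tau> ^^ m k) \<mu>) \<phi>) \<longlonglongrightarrow> integral_of \<nu> \<phi>"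
    unfolding integral_of_def by blast
  have "integral_of \<nu> v = 0" if v: "v \<in> vanishing" for v
  proof (rule LIMSEQ_unique[OF \<nu>(2)[rule_format]])
    show "(\<lambda>k. integral_of ((dual_op \<tau> ^^ m k) \<mu>) v) \<longlonglongrightarrow> 0"
      using tendsto_integral_of[OF \<mu> vanishing_tendsto[OF v m]] by (simp add: dual_op_power(2)[OF \<mu>] integral_of_0)
  qed
  then show ?thesis using \<nu> by (auto simp: attractor_def)
qed

lemma recurrence_times:
  obtains m :: "nat \<Rightarrow> nat" where "\<And>k. m k \<ge> Suc k" "\<And>u. u \<in> reversible \<Longrightarrow> (\<lambda>k. (T ^^ (m k)) u) \<longlonglongrightarrow> u"
proof -
  obtain B where B: "finite B" "reversible = cfun.span B" using reversible_finite_dimensional by blast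
  have "cfun.span B \<subseteq> reversible" using B(2) by simp
  from simultaneous_recurrence[OF B(1) this] show ?thesis using that unfolding B(2) by blast
qed

text \<open>Any starting measure would do; the Dirac mass at infinity is taken, and its iterates
  converge along return times of the reversible part.\<close>

lemma attractor_nonempty: "attractor \<noteq> {}"
proof -
  obtain m :: "nat \<Rightarrow> nat" where m: "\<And>k. m k \<ge> Suc k" "\<And>u. u \<in> reversible \<Longrightarrow> (\<lambda>k. (T ^^ (m k)) u) \<longlonglongrightarrow> u"
    by (rule recurrence_times) blast
  have "filterlim m at_top sequentially"
    by (rule filterlim_at_top_mono[OF filterlim_Suc]) (simp add: m(1))
  moreover have "return borel Infty \<in> borel_probs" by (simp add: borel_probs_def prob_space_return)
  ultimately show ?thesis using orbit_weak_limit[of "return borel Infty" m] m(2) unfolding convergent_def by blast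
qed

text \<open>For surjectivity, a preimage of \<open>\<mu>\<close> is found as the limit of its
  iterates at times \<open>m k - 1\<close>, where \<open>m\<close> are return times of the
  reversible part; one further application gives back \<open>\<mu>\<close>.\<close>

lemma dual_op_attractor: "dual_op \<tau> ` attractor = attractor"
proof
  have T: "T v \<in> vanishing" if "v \<in> vanishing" for v
    using that unfolding vanishing_def by (auto simp: funpow_swap1[symmetric] dest: LIMSEQ_Suc)
  have int: "integral_of (dual_op \<tau> \<mu>) \<phi> = integral_of \<mu> (T \<phi>)" if "\<mu> \<in> borel_probs" for \<mu> \<phi>
    using dual_op_power(2)[OF that, of 1] by simp
  show "dual_op \<tau> ` attractor \<subseteq> attractor"
    using T by (auto simp: attractor_def int dual_op_in_borel_probs[OF borel_probs])
  show "attractor \<subseteq> dual_op \<tau> ` attractor"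
  proof
    fix \<mu> assume \<mu>A: "\<mu> \<in> attractor"
    then have \<mu>: "\<mu> \<in> borel_probs" by (simp add: attractor_def)
    obtain m :: "nat \<Rightarrow> nat" where m: "\<And>k. m k \<ge> Suc k" "\<And>u. u \<in> reversible \<Longrightarrow> (\<lambda>k. (T ^^ (m k)) u) \<longlonglongrightarrow> u"
      by (rule recurrence_times) blast
    have m1: "m k = Suc (m k - 1)" for k using m(1)[of k] by simp
    have ml: "filterlim m at_top sequentially" by (rule filterlim_at_top_mono[OF filterlim_Suc]) (simp add: m(1))
    have "filterlim (\<lambda>k. m k - 1) at_top sequentially"
    proof (rule filterlim_at_top_mono[OF filterlim_ident], rule always_eventually, rule allI)
      show "k \<le> m k - 1" for k using m(1)[of k] by simp
    qed
    moreover have "convergent (\<lambda>k. (T ^^ (m k - 1)) u)" if u: "u \<in> reversible" for u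
    proof -
      obtain Q s where Q: "compact Q" "s 0 = u" "\<forall>n. s n \<in> Q" "\<forall>n. T (s (Suc n)) = s n"
        using u by (rule reversibleE)
      have "s 1 \<in> reversible" by (rule reversible_shift[OF Q(1)]) (use Q in auto)
      \<comment> \<open>One step back along the backward orbit of \<open>u\<close> turns the times
        \<open>m k - 1\<close> into the return times \<open>m k\<close>.\<close>
      moreover have "(T ^^ (m k - 1)) u = (T ^^ (m k)) (s 1)" for k
        using Q by (subst (2) m1) (simp add: funpow_swap1)
      ultimately show ?thesis using m(2)[of "s 1"] unfolding convergent_def by auto
    qed
    ultimately obtain \<nu> where \<nu>: "\<nu> \<in> attractor" "\<forall>\<phi>. (\<lambda>k. integral_of ((dual_op \<tau> ^^ (m k - 1)) \<mu>) \<phi>) \<longlonglongrightarrow> integral_of \<nu> \<phi>"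
      using orbit_weak_limit[OF \<mu>] by blast
    have \<nu>b: "\<nu> \<in> borel_probs" using \<nu>(1) by (simp add: attractor_def)
    have "dual_op \<tau> \<nu> = \<mu>"
    proof (rule integral_of_eqI[OF dual_op_in_borel_probs[OF borel_probs \<nu>b] \<mu>])
      fix \<phi>
      obtain u v where uv: "u \<in> reversible" "v \<in> vanishing" "\<phi> = u + v" using decomposition by blast
      have "integral_of ((dual_op \<tau> ^^ (m k - 1)) \<mu>) (T \<phi>) = integral_of \<mu> ((T ^^ (m k)) \<phi>)" for k
        unfolding dual_op_power(2)[OF \<mu>] by (subst (2) m1) (simp add: funpow_swap1)
      then have "(\<lambda>k. integral_of \<mu> ((T ^^ (m k)) \<phi>)) \<longlonglongrightarrow> integral_of \<nu> (T \<phi>)" using \<nu>(2)[rule_format, of "T \<phi>"] by simp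
      moreover have "(\<lambda>k. (T ^^ (m k)) \<phi>) \<longlonglongrightarrow> u"
        using tendsto_add[OF m(2)[OF uv(1)] vanishing_tendsto[OF uv(2) ml]] by (simp add: uv(3) Tn_add)
      then have "(\<lambda>k. integral_of \<mu> ((T ^^ (m k)) \<phi>)) \<longlonglongrightarrow> integral_of \<mu> u" by (rule tendsto_integral_of[OF \<mu>])
      ultimately have "integral_of \<nu> (T \<phi>) = integral_of \<mu> u" by (rule LIMSEQ_unique)
      also have "\<dots> = integral_of \<mu> \<phi>"
        using \<mu>A uv(2) by (simp add: uv(3) integral_of_add[OF \<mu>] attractor_def)
      finally show "integral_of (dual_op \<tau> \<nu>) \<phi> = integral_of \<mu> \<phi>" by (simp add: int[OF \<nu>b])
    qed
    then show "\<mu> \<in> dual_op \<tau> ` attractor" using \<nu>(1) by blast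
  qed
qed

text \<open>On the attractor a test function and its reversible part have the same integral, so the
  integrals of a finite spanning set, split into real and imaginary parts, are coordinates. They are
  bounded, which yields convergent subsequences and hence compactness.\<close>

lemma attractor_coordinates:
  "compactin weak_topology attractor \<and> (\<exists>n. subtopology weak_topology attractor dim_le n)"
proof -
  obtain B where B: "finite B" "reversible = cfun.span B" using reversible_finite_dimensional by blast
  define I where "I = B \<times> (UNIV :: bool set)"
  define f where "f i \<mu> = (if snd i then Re (integral_of \<mu> (fst i)) else Im (integral_of \<mu> (fst i)))"
    for i :: "(rsphere \<Rightarrow>\<^sub>C complex) \<times> bool" and \<mu>
  have finI: "finite I" unfolding I_def using B(1) by simp
  have red: "\<exists>u\<in>cfun.span B. \<forall>\<mu>\<in>attractor. integral_of \<mu> \<phi> = integral_of \<mu> u" for \<phi>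
  proof -
    obtain u v where uv: "u \<in> reversible" "v \<in> vanishing" "\<phi> = u + v" using decomposition by blast
    then show ?thesis unfolding B(2)[symmetric] by (intro bexI[of _ u]) (auto simp: attractor_def integral_of_add)
  qed
  have rc: "real_coords (subtopology weak_topology attractor) I f"
  proof (rule real_coords_weak_topology[OF attractor_borel_probs])
    fix i assume "i \<in> I"
    define \<psi> where "\<psi> = Bcontfun (\<lambda>x. if snd i then Re (apply_bcontfun (fst i) x) else Im (apply_bcontfun (fst i) x))"
    have "apply_bcontfun \<psi> = (\<lambda>x. if snd i then Re (apply_bcontfun (fst i) x) else Im (apply_bcontfun (fst i) x))"
      unfolding \<psi>_def by (rule Bcontfun_inverse) (cases "snd i"; simp add: bcontfun_rsphere_iff continuous_on_Re continuous_on_Im)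
    then have "(\<integral>x. apply_bcontfun \<psi> x \<partial>\<mu>) = f i \<mu>" if "\<mu> \<in> borel_probs" for \<mu>
      using integrable_bcontfun[OF that, of "fst i"] by (simp add: f_def integral_of_def)
    then show "continuous_map weak_topology euclideanreal (f i)"
      by (intro continuous_map_eq[OF continuous_map_integral[of \<psi>]]) simp
  next
    fix \<phi> :: "rsphere \<Rightarrow>\<^sub>C real" and a and e :: real assume a: "a \<in> attractor" and e: "e > 0"
    define \<psi> where "\<psi> = Bcontfun (\<lambda>x. complex_of_real (apply_bcontfun \<phi> x))"
    have "apply_bcontfun \<psi> = (\<lambda>x. complex_of_real (apply_bcontfun \<phi> x))"
      unfolding \<psi>_def by (rule Bcontfun_inverse) (auto simp: bcontfun_rsphere_iff intro!: continuous_on_of_real)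
    then have \<psi>: "integral_of \<mu> \<psi> = complex_of_real (\<integral>x. apply_bcontfun \<phi> x \<partial>\<mu>)" for \<mu> by (simp add: integral_of_def)
    obtain u where u: "u \<in> cfun.span B" "\<forall>\<mu>\<in>attractor. integral_of \<mu> \<psi> = integral_of \<mu> u" using red by blast
    obtain d where d: "d > 0" "\<forall>\<mu>\<in>attractor. (\<forall>s\<in>B. norm (integral_of \<mu> s - integral_of a s) < d) \<longrightarrow> norm (integral_of \<mu> u - integral_of a u) < e"
      using integral_of_span_continuous[OF attractor_borel_probs a u(1) e] by blast
    \<comment> \<open>Real and imaginary parts are controlled separately, each up to
      \<open>d/2\<close>, since the modulus is at most the sum of theirs.\<close>
    have "dist (\<integral>x. apply_bcontfun \<phi> x \<partial>\<mu>) (\<integral>x. apply_bcontfun \<phi> x \<partial>a) < e"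
      if \<mu>: "\<mu> \<in> attractor" and close: "\<forall>i\<in>I. \<bar>f i \<mu> - f i a\<bar> < d/2" for \<mu>
    proof -
      have "norm (integral_of \<mu> s - integral_of a s) < d" if "s \<in> B" for s
      proof -
        have "(s, True) \<in> I" "(s, False) \<in> I" using that by (simp_all add: I_def)
        then have "\<bar>f (s, True) \<mu> - f (s, True) a\<bar> < d/2" "\<bar>f (s, False) \<mu> - f (s, False) a\<bar> < d/2" using close by blast+
        then show ?thesis using cmod_le[of "integral_of \<mu> s - integral_of a s"] by (simp add: f_def)
      qed
      then have "norm (integral_of \<mu> u - integral_of a u) < e" using d(2) \<mu> by blast
      then have "norm (complex_of_real ((\<integral>x. apply_bcontfun \<phi> x \<partial>\<mu>) - (\<integral>x. apply_bcontfun \<phi> x \<partial>a))) < e"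
        using u(2) \<mu> a by (simp add: \<psi>)
      then show ?thesis unfolding norm_of_real dist_real_def .
    qed
    then show "\<exists>d>0. \<forall>\<mu>\<in>attractor. (\<forall>i\<in>I. \<bar>f i \<mu> - f i a\<bar> < d) \<longrightarrow> dist (\<integral>x. apply_bcontfun \<phi> x \<partial>\<mu>) (\<integral>x. apply_bcontfun \<phi> x \<partial>a) < e"
      using d(1) by (intro exI[of _ "d/2"]) simp
  qed
  have ts: "topspace (subtopology weak_topology attractor) = attractor" using attractor_borel_probs by auto
  have "compact_space (subtopology weak_topology attractor)"
  proof (rule real_coords_compact[OF rc finI], unfold ts)
    fix \<mu> \<nu> assume A: "\<mu> \<in> attractor" "\<nu> \<in> attractor" and eq: "\<forall>i\<in>I. f i \<mu> = f i \<nu>"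
    then have b: "\<mu> \<in> borel_probs" "\<nu> \<in> borel_probs" using attractor_borel_probs by auto
    have s: "integral_of \<mu> s = integral_of \<nu> s" if "s \<in> B" for s
    proof (rule complex_eqI)
      have "(s, True) \<in> I" "(s, False) \<in> I" using that by (simp_all add: I_def)
      then have "f (s, True) \<mu> = f (s, True) \<nu>" "f (s, False) \<mu> = f (s, False) \<nu>" using eq by blast+
      then show "Re (integral_of \<mu> s) = Re (integral_of \<nu> s)" "Im (integral_of \<mu> s) = Im (integral_of \<nu> s)" by (simp_all add: f_def)
    qed
    have u: "integral_of \<mu> u = integral_of \<nu> u" if "u \<in> cfun.span B" for u
      using that by (induction rule: cfun.span_induct_alt) (simp_all add: integral_of_0 integral_of_add b integral_of_cscale s)
    show "\<mu> = \<nu>"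
    proof (rule integral_of_eqI[OF b])
      fix \<phi>
      obtain w where "w \<in> cfun.span B" "\<forall>\<mu>\<in>attractor. integral_of \<mu> \<phi> = integral_of \<mu> w" using red by blast
      then show "integral_of \<mu> \<phi> = integral_of \<nu> \<phi>" using u A by simp
    qed
  next
    fix \<sigma> :: "nat \<Rightarrow> rsphere measure" assume \<sigma>: "\<And>n. \<sigma> n \<in> attractor"
    then have b: "\<sigma> n \<in> borel_probs" for n using attractor_borel_probs by auto
    obtain r :: "nat \<Rightarrow> nat" where r: "strict_mono r" "\<forall>s\<in>B. convergent (\<lambda>k. integral_of (\<sigma> (r k)) s)"
      using simultaneous_subsequence[OF B(1), of "\<lambda>s n. integral_of (\<sigma> n) s" norm] norm_integral_of[OF b] by blast
    have "convergent (\<lambda>k. integral_of (\<sigma> (r k)) \<phi>)" for \<phi>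
    proof -
      obtain u where u: "u \<in> cfun.span B" "\<forall>\<mu>\<in>attractor. integral_of \<mu> \<phi> = integral_of \<mu> u" using red by blast
      have "convergent (\<lambda>k. integral_of (\<sigma> (r k)) u)" by (rule integral_of_span[OF b _ u(1)]) (use r(2) in blast)
      then show ?thesis using u(2) \<sigma> by simp
    qed
    from weak_limit_exists[OF b this[unfolded integral_of_def]]
    obtain \<nu> where \<nu>: "\<nu> \<in> borel_probs" "\<forall>\<phi>. (\<lambda>k. integral_of (\<sigma> (r k)) \<phi>) \<longlonglongrightarrow> integral_of \<nu> \<phi>"
      unfolding integral_of_def by blast
    have "integral_of \<nu> v = 0" if v: "v \<in> vanishing" for v
    proof (rule LIMSEQ_unique[OF \<nu>(2)[rule_format]])
      show "(\<lambda>k. integral_of (\<sigma> (r k)) v) \<longlonglongrightarrow> 0" using \<sigma> v by (simp add: attractor_def)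
    qed
    then have "\<nu> \<in> attractor" using \<nu>(1) by (simp add: attractor_def)
    moreover have "(\<lambda>k. f i (\<sigma> (r k))) \<longlonglongrightarrow> f i \<nu>" for i
      unfolding f_def using tendsto_Re[OF \<nu>(2)[rule_format, of "fst i"]] tendsto_Im[OF \<nu>(2)[rule_format, of "fst i"]] by simp
    ultimately show "\<exists>l\<in>attractor. \<exists>r :: nat \<Rightarrow> nat. strict_mono r \<and> (\<forall>i\<in>I. (\<lambda>k. f i (\<sigma> (r k))) \<longlonglongrightarrow> f i l)"
      using r(1) by blast
  qed
  then have "compactin weak_topology attractor" using attractor_borel_probs by (simp add: compactin_subspace)
  moreover have "subtopology weak_topology attractor dim_le int (card I)" by (rule real_coords_dim_le[OF finI rc])
  ultimately show ?thesis by blast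
qed

text \<open>Otherwise the distance stays above some \<open>e\<close> at infinitely many times
  \<open>r0\<close>. Along a subsequence of these the orbit converges weakly to a point of the
  attractor, and weak convergence is convergence for any metric \<open>\<rho>\<close> inducing the
  topology.\<close>

lemma attractor_attracts:
  assumes "Metric_space borel_probs \<rho>" and top: "Metric_space.mtopology borel_probs \<rho> = weak_topology" and \<mu>: "\<mu> \<in> borel_probs"
  shows "(\<lambda>n. INF \<alpha>\<in>attractor. \<rho> ((dual_op \<tau> ^^ n) \<mu>) \<alpha>) \<longlonglongrightarrow> 0"
proof (rule ccontr)
  interpret ms: Metric_space borel_probs \<rho> by fact
  define a where "a n = (INF \<alpha>\<in>attractor. \<rho> ((dual_op \<tau> ^^ n) \<mu>) \<alpha>)" for n
  have a0: "0 \<le> a n" for n unfolding a_def by (rule cINF_greatest[OF attractor_nonempty]) simp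
  have a_le: "a n \<le> \<rho> ((dual_op \<tau> ^^ n) \<mu>) \<alpha>" if "\<alpha> \<in> attractor" for n \<alpha>
    unfolding a_def by (rule cINF_lower[OF _ that]) (auto intro!: bdd_belowI2[of _ 0])
  assume "\<not> (\<lambda>n. INF \<alpha>\<in>attractor. \<rho> ((dual_op \<tau> ^^ n) \<mu>) \<alpha>) \<longlonglongrightarrow> 0"
  then have "\<not> a \<longlonglongrightarrow> 0" unfolding a_def .
  then obtain e where e: "e > 0" "\<forall>N. \<exists>n\<ge>N. \<not> norm (a n - 0) < e" unfolding LIMSEQ_iff by blast
  have "infinite {n. e \<le> a n}"
    unfolding infinite_nat_iff_unbounded_le using e(2) a0 by (simp add: not_less)
  then obtain r0 :: "nat \<Rightarrow> nat" where r0: "strict_mono r0" "\<forall>k. r0 k \<in> {n. e \<le> a n}"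
    using infinite_enumerate by blast
  obtain B where B: "finite B" "reversible = cfun.span B" using reversible_finite_dimensional by blast
  obtain r :: "nat \<Rightarrow> nat" where r: "strict_mono r" "\<forall>\<phi>\<in>B. convergent (\<lambda>k. (T ^^ (r0 (r k))) \<phi>)"
    using orbit_subsequences[OF B(1) r0(1)] by blast
  have m: "strict_mono (\<lambda>k. r0 (r k))" using r0(1) r(1) by (simp add: strict_mono_def)
  have "convergent (\<lambda>k. (T ^^ (r0 (r k))) u)" if "u \<in> reversible" for u
    by (rule convergent_span[where S = B]) (use r(2) that B(2) in auto)
  then obtain \<nu> where \<nu>: "\<nu> \<in> attractor" "\<forall>\<phi>. (\<lambda>k. integral_of ((dual_op \<tau> ^^ r0 (r k)) \<mu>) \<phi>) \<longlonglongrightarrow> integral_of \<nu> \<phi>"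
    using orbit_weak_limit[OF \<mu> filterlim_subseq[OF m]] by blast
  have "\<nu> \<in> borel_probs" using \<nu>(1) by (simp add: attractor_def)
  from limitin_weak_topology[OF dual_op_power(1)[OF \<mu>] this, of "\<lambda>k. r0 (r k)"] \<nu>(2)
  have "limitin ms.mtopology (\<lambda>k. (dual_op \<tau> ^^ r0 (r k)) \<mu>) \<nu> sequentially" unfolding top integral_of_def by blast
  then have "(\<lambda>k. \<rho> ((dual_op \<tau> ^^ r0 (r k)) \<mu>) \<nu>) \<longlonglongrightarrow> 0" by (simp add: ms.limitin_metric_dist_null)
  then have "e \<le> 0"
  proof (rule LIMSEQ_le_const, intro exI allI impI)
    fix k show "e \<le> \<rho> ((dual_op \<tau> ^^ r0 (r k)) \<mu>) \<nu>" using r0(2) a_le[OF \<nu>(1), of "r0 (r k)"] by (auto intro: order_trans)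
  qed
  then show False using e(1) by simp
qed

end

theorem theorem1p6:
  fixes \<tau> :: "rat_map measure"
  assumes "\<tau> \<in> compact_borel_probs"
    and "kernel_julia_set (semigroup_of \<tau>) = {}"
    and "julia_set (semigroup_of \<tau>) \<noteq> {}"
  shows
    "((cfun.subspace (unitary_space \<tau>) \<and> cfun.subspace (vanishing_space \<tau>) \<and>
       (\<forall>\<phi>. \<exists>u\<in>unitary_space \<tau>. \<exists>v\<in>vanishing_space \<tau>. \<phi> = u + v) \<and>
       unitary_space \<tau> \<inter> vanishing_space \<tau> = {0}) \<and>
      (\<exists>S. finite S \<and> unitary_space \<tau> = cfun.span S) \<and>
      closed (vanishing_space \<tau>) \<and>
      (\<exists>A. A \<noteq> {} \<and> dual_op \<tau> ` A = A \<and> compactin weak_topology A \<and>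
         (\<exists>n. subtopology weak_topology A dim_le n) \<and>
         (\<forall>\<rho>. Metric_space borel_probs \<rho> \<and> Metric_space.mtopology borel_probs \<rho> = weak_topology \<longrightarrow>
            (\<forall>\<mu>\<in>borel_probs. (\<lambda>n. INF \<alpha>\<in>A. \<rho> ((dual_op \<tau> ^^ n) \<mu>) \<alpha>) \<longlonglongrightarrow> 0))) \<and>
      (\<forall>\<phi>\<in>unitary_space \<tau>. \<forall>z\<in>fatou_set (semigroup_of \<tau>).
         \<exists>V. open V \<and> z \<in> V \<and> apply_bcontfun \<phi> constant_on V))
   \<and> (\<forall>z. \<exists>A. A \<in> sets borel \<and> emeasure (path_measure \<tau>) A = 1 \<and>
        (\<forall>\<gamma>\<in>A. \<exists>\<delta>>0. (\<lambda>n. diameter (random_comp \<gamma> n ` ball z \<delta>)) \<longlonglongrightarrow> 0))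
   \<and> (minimal_sets (semigroup_of \<tau>) \<noteq> {} \<and> finite (minimal_sets (semigroup_of \<tau>)))
   \<and> (\<forall>z. \<exists>C. C \<in> sets borel \<and> emeasure (path_measure \<tau>) C = 1 \<and>
        (\<forall>\<gamma>\<in>C. (\<lambda>n. infdist (random_comp \<gamma> n z) (\<Union>(minimal_sets (semigroup_of \<tau>)))) \<longlonglongrightarrow> 0))"
proof -
  interpret cooperation \<tau>
    by unfold_locales (use assms in \<open>auto simp: compact_borel_probs_def\<close>)
  have att: "\<exists>A. A \<noteq> {} \<and> dual_op \<tau> ` A = A \<and> compactin weak_topology A \<and>
         (\<exists>n. subtopology weak_topology A dim_le n) \<and>
         (\<forall>\<rho>. Metric_space borel_probs \<rho> \<and> Metric_space.mtopology borel_probs \<rho> = weak_topology \<longrightarrow>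
            (\<forall>\<mu>\<in>borel_probs. (\<lambda>n. INF \<alpha>\<in>A. \<rho> ((dual_op \<tau> ^^ n) \<mu>) \<alpha>) \<longlonglongrightarrow> 0))"
    using attractor_nonempty dual_op_attractor attractor_coordinates attractor_attracts
    by (intro exI[of _ attractor]) blast
  show ?thesis unfolding unitary_space_eq vanishing_space_eq
    by (intro conjI allI ballI reversible_subspace vanishing_subspace decomposition reversible_Int_vanishing
        reversible_finite_dimensional closed_vanishing att reversible_locally_constant
        random_ball_contraction minimal_sets_nonempty finite_minimal_sets random_orbit_attracted)
qed

end
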